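(* Let $(M, g)$ be a closed Riemannian manifold with $n = \dim M \geqslant 3$. Assume that the scalar curvature satisfies $S_g < 0$ somewhere on $M$ and that the first eigenvalue $\eta_1$ of the conformal Laplacian $\Box_g$ satisfies $\eta_1 < 0$. Then there exists some constant $\lambda < 0$ such that, for any constant $\beta \leqslant 0$, the equation $$-a\Delta_g u + (S_g + \beta) u = \lambda u^{p-1} \ \text{ in } M$$ has a real, positive, smooth solution $u$.
   Context: $S_g$ is the scalar curvature of $g$; $\Delta_g = -d^*d$ is the Laplace–Beltrami operator (negative sign convention); $a = \frac{4(n-1)}{n-2}$, $p = \frac{2n}{n-2}$. The conformal Laplacian is $\Box_g u := -a\Delta_g u + S_g u$. Its first eigenvalue is $\eta_1 = \inf_{\varphi \neq 0} \frac{\int_M (a|\nabla_g \varphi|^2 + S_g \varphi^2)\, d\mathrm{Vol}_g}{\int_M \varphi^2\, d\mathrm{Vol}_g}$. *)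

theory Defs
  imports "HOL-Analysis.Analysis"
begin

section \<open>Smooth functions on open subsets of Euclidean space\<close>

primrec Ck_on :: "nat \<Rightarrow> 'b::euclidean_space set \<Rightarrow> ('b \<Rightarrow> 'c::real_normed_vector) \<Rightarrow> bool" where
  "Ck_on 0 S f \<longleftrightarrow> continuous_on S f"
| "Ck_on (Suc k) S f \<longleftrightarrow>
     (\<forall>x\<in>S. f differentiable (at x)) \<and>
     (\<forall>v. Ck_on k S (\<lambda>x. frechet_derivative f (at x) v))"

definition smooth_on :: "'b::euclidean_space set \<Rightarrow> ('b \<Rightarrow> 'c::real_normed_vector) \<Rightarrow> bool" where
  "smooth_on S f \<longleftrightarrow> (\<forall>k. Ck_on k S f)"

section \<open>Smooth manifolds\<close>

text \<open>
  The manifold is \<open>M = topspace X\<close>; its dimension is \<open>CARD('n)\<close>.  A chart is a pair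
  \<open>(U, \<phi>)\<close>; only the values of \<open>\<phi>\<close> on \<open>U\<close> matter.
  The smooth structure is given by an atlas, not required to be maximal.
\<close>

type_synonym ('a, 'n) chart = "'a set \<times> ('a \<Rightarrow> real ^ 'n)"

abbreviation chart_dom :: "('a, 'n::finite) chart \<Rightarrow> 'a set" where
  "chart_dom c \<equiv> fst c"

abbreviation chart_map :: "('a, 'n::finite) chart \<Rightarrow> 'a \<Rightarrow> real ^ 'n" where
  "chart_map c \<equiv> snd c"

definition chart_inv :: "('a, 'n::finite) chart \<Rightarrow> real ^ 'n \<Rightarrow> 'a" where
  "chart_inv c = inv_into (chart_dom c) (chart_map c)"

definition smooth_atlas :: "'a topology \<Rightarrow> ('a, 'n::finite) chart set \<Rightarrow> bool" where
  "smooth_atlas X A \<longleftrightarrow>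
     (\<forall>c\<in>A. openin X (chart_dom c) \<and> open (chart_map c ` chart_dom c) \<and>
        homeomorphic_map (subtopology X (chart_dom c))
          (top_of_set (chart_map c ` chart_dom c)) (chart_map c)) \<and>
     (\<Union>c\<in>A. chart_dom c) = topspace X \<and>
     (\<forall>c\<in>A. \<forall>d\<in>A. smooth_on (chart_map c ` (chart_dom c \<inter> chart_dom d))
        (chart_map d \<circ> chart_inv c))"

text \<open>Second countability is automatic for a compact locally Euclidean space.\<close>

definition closed_manifold :: "'a topology \<Rightarrow> ('a, 'n::finite) chart set \<Rightarrow> bool" where
  "closed_manifold X A \<longleftrightarrow>
     compact_space X \<and> Hausdorff_space X \<and> connected_space X \<and> smooth_atlas X A"

text \<open>Functions are total on the ambient type; only their values on \<open>M\<close> matter here.\<close>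

definition smooth_functions :: "('a, 'n::finite) chart set \<Rightarrow> ('a \<Rightarrow> real) set" where
  "smooth_functions A =
     {f. \<forall>c\<in>A. smooth_on (chart_map c ` chart_dom c) (f \<circ> chart_inv c)}"

section \<open>Tangent vectors and Riemannian metrics\<close>

type_synonym 'a tangent = "('a \<Rightarrow> real) \<Rightarrow> real"

text \<open>
  Tangent vectors at \<open>p\<close> are the derivations at \<open>p\<close> of the algebra of smooth functions;
  they are set to \<open>0\<close> outside that algebra so that equality of derivations is HOL equality.
\<close>

definition tangent_space :: "('a, 'n::finite) chart set \<Rightarrow> 'a \<Rightarrow> 'a tangent set" where
  "tangent_space A p = {v.
     (\<forall>f. f \<notin> smooth_functions A \<longrightarrow> v f = 0) \<and>
     (\<forall>f\<in>smooth_functions A. \<forall>h\<in>smooth_functions A. \<forall>a b.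
        v (\<lambda>q. a * f q + b * h q) = a * v f + b * v h) \<and>
     (\<forall>f\<in>smooth_functions A. \<forall>h\<in>smooth_functions A.
        v (\<lambda>q. f q * h q) = f p * v h + h p * v f)}"

text \<open>\<open>partial c i f p\<close> is the \<open>i\<close>-th partial derivative at \<open>p\<close> of \<open>f\<close>
  read in the chart \<open>c\<close>.\<close>

definition partial :: "('a, 'n::finite) chart \<Rightarrow> 'n \<Rightarrow> ('a \<Rightarrow> real) \<Rightarrow> 'a \<Rightarrow> real" where
  "partial c i f p = frechet_derivative (f \<circ> chart_inv c) (at (chart_map c p)) (axis i 1)"

definition coord_vector ::
  "('a, 'n::finite) chart set \<Rightarrow> ('a, 'n) chart \<Rightarrow> 'n \<Rightarrow> 'a \<Rightarrow> 'a tangent" where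
  "coord_vector A c i p = (\<lambda>f. if f \<in> smooth_functions A then partial c i f p else 0)"

type_synonym 'a metric_tensor = "'a \<Rightarrow> 'a tangent \<Rightarrow> 'a tangent \<Rightarrow> real"

definition metric_matrix ::
  "('a, 'n::finite) chart set \<Rightarrow> 'a metric_tensor \<Rightarrow> ('a, 'n) chart \<Rightarrow> 'a \<Rightarrow> real ^ 'n ^ 'n" where
  "metric_matrix A g c p = (\<chi> i j. g p (coord_vector A c i p) (coord_vector A c j p))"

definition riemannian_metric ::
  "'a topology \<Rightarrow> ('a, 'n::finite) chart set \<Rightarrow> 'a metric_tensor \<Rightarrow> bool" where
  "riemannian_metric X A g \<longleftrightarrow>
     (\<forall>p\<in>topspace X.
        (\<forall>v\<in>tangent_space A p. \<forall>w\<in>tangent_space A p. g p v w = g p w v) \<and>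
        (\<forall>v\<in>tangent_space A p. \<forall>w\<in>tangent_space A p. \<forall>z\<in>tangent_space A p. \<forall>a b.
           g p (\<lambda>f. a * v f + b * w f) z = a * g p v z + b * g p w z) \<and>
        (\<forall>v\<in>tangent_space A p. v \<noteq> (\<lambda>_. 0) \<longrightarrow> g p v v > 0)) \<and>
     (\<forall>c\<in>A. \<forall>i j. smooth_on (chart_map c ` chart_dom c)
        (\<lambda>x. metric_matrix A g c (chart_inv c x) $ i $ j))"

definition inv_metric ::
  "('a, 'n::finite) chart set \<Rightarrow> 'a metric_tensor \<Rightarrow> ('a, 'n) chart \<Rightarrow> 'a \<Rightarrow> real ^ 'n ^ 'n" where
  "inv_metric A g c p = matrix_inv (metric_matrix A g c p)"

definition volume_density ::
  "('a, 'n::finite) chart set \<Rightarrow> 'a metric_tensor \<Rightarrow> ('a, 'n) chart \<Rightarrow> 'a \<Rightarrow> real" where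
  "volume_density A g c p = sqrt (det (metric_matrix A g c p))"

text \<open>
  The objects below are given by their classical coordinate expressions, which do not depend
  on the chart; \<open>chart_at\<close> fixes one chart around each point in order to evaluate them.
\<close>

definition chart_at :: "('a, 'n::finite) chart set \<Rightarrow> 'a \<Rightarrow> ('a, 'n) chart" where
  "chart_at A p = (SOME c. c \<in> A \<and> p \<in> chart_dom c)"

section \<open>Scalar curvature\<close>

text \<open>Christoffel symbols \<open>\<Gamma>\<^sup>k\<^sub>i\<^sub>j\<close> of the Levi-Civita connection.\<close>

definition christoffel ::
  "('a, 'n::finite) chart set \<Rightarrow> 'a metric_tensor \<Rightarrow> ('a, 'n) chart \<Rightarrow>
     'n \<Rightarrow> 'n \<Rightarrow> 'n \<Rightarrow> 'a \<Rightarrow> real" where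
  "christoffel A g c k i j p =
     (1 / 2) * (\<Sum>l\<in>UNIV. inv_metric A g c p $ k $ l *
        (partial c i (\<lambda>q. metric_matrix A g c q $ j $ l) p
         + partial c j (\<lambda>q. metric_matrix A g c q $ i $ l) p
         - partial c l (\<lambda>q. metric_matrix A g c q $ i $ j) p))"

text \<open>
  \<open>riemann A g c l k i j\<close> is the component \<open>R\<^sup>l\<^sub>k\<^sub>i\<^sub>j\<close> in
  \<open>R(\<partial>\<^sub>i, \<partial>\<^sub>j) \<partial>\<^sub>k = R\<^sup>l\<^sub>k\<^sub>i\<^sub>j \<partial>\<^sub>l\<close>,
  where \<open>R(V, W) = [\<nabla>\<^sub>V, \<nabla>\<^sub>W] - \<nabla>\<^bsub>[V,W]\<^esub>\<close>.  With this sign convention and the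
  contractions below, round spheres have positive scalar curvature.
\<close>

definition riemann ::
  "('a, 'n::finite) chart set \<Rightarrow> 'a metric_tensor \<Rightarrow> ('a, 'n) chart \<Rightarrow>
     'n \<Rightarrow> 'n \<Rightarrow> 'n \<Rightarrow> 'n \<Rightarrow> 'a \<Rightarrow> real" where
  "riemann A g c l k i j p =
     partial c i (christoffel A g c l j k) p - partial c j (christoffel A g c l i k) p
     + (\<Sum>m\<in>UNIV. christoffel A g c l i m p * christoffel A g c m j k p
                - christoffel A g c l j m p * christoffel A g c m i k p)"

definition ricci ::
  "('a, 'n::finite) chart set \<Rightarrow> 'a metric_tensor \<Rightarrow> ('a, 'n) chart \<Rightarrow>
     'n \<Rightarrow> 'n \<Rightarrow> 'a \<Rightarrow> real" where
  "ricci A g c j k p = (\<Sum>i\<in>UNIV. riemann A g c i k i j p)"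

definition scalar_curvature ::
  "('a, 'n::finite) chart set \<Rightarrow> 'a metric_tensor \<Rightarrow> 'a \<Rightarrow> real" where
  "scalar_curvature A g p =
     (let c = chart_at A p in
        \<Sum>j\<in>UNIV. \<Sum>k\<in>UNIV. inv_metric A g c p $ j $ k * ricci A g c j k p)"

section \<open>Gradient and Laplace--Beltrami operator\<close>

definition gradient ::
  "('a, 'n::finite) chart set \<Rightarrow> 'a metric_tensor \<Rightarrow> ('a \<Rightarrow> real) \<Rightarrow> 'a \<Rightarrow> 'a tangent" where
  "gradient A g u p =
     (let c = chart_at A p in
        (\<lambda>f. \<Sum>i\<in>UNIV. \<Sum>j\<in>UNIV.
               inv_metric A g c p $ i $ j * partial c j u p * coord_vector A c i p f))"

definition grad_norm_sq ::
  "('a, 'n::finite) chart set \<Rightarrow> 'a metric_tensor \<Rightarrow> ('a \<Rightarrow> real) \<Rightarrow> 'a \<Rightarrow> real" where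
  "grad_norm_sq A g u p = g p (gradient A g u p) (gradient A g u p)"

type_synonym 'a one_form = "'a \<Rightarrow> 'a tangent \<Rightarrow> real"

definition differential :: "('a \<Rightarrow> real) \<Rightarrow> 'a one_form" where
  "differential u p v = v u"

text \<open>
  The codifferential \<open>d\<^sup>*\<close> on one-forms, i.e. the formal \<open>L\<^sup>2\<close>-adjoint of \<open>d\<close>:
  \<open>d\<^sup>* \<omega> = - G\<^sup>-\<^sup>1 \<partial>\<^sub>i (G g\<^sup>i\<^sup>j \<omega>\<^sub>j)\<close> with
  \<open>G = sqrt (det g)\<close>.
\<close>

definition codifferential ::
  "('a, 'n::finite) chart set \<Rightarrow> 'a metric_tensor \<Rightarrow> 'a one_form \<Rightarrow> 'a \<Rightarrow> real" where
  "codifferential A g \<omega> p =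
     (let c = chart_at A p in
        - (1 / volume_density A g c p) *
          (\<Sum>i\<in>UNIV. partial c i
             (\<lambda>q. volume_density A g c q *
                (\<Sum>j\<in>UNIV. inv_metric A g c q $ i $ j * \<omega> q (coord_vector A c j q))) p))"

definition laplace_beltrami ::
  "('a, 'n::finite) chart set \<Rightarrow> 'a metric_tensor \<Rightarrow> ('a \<Rightarrow> real) \<Rightarrow> 'a \<Rightarrow> real" where
  "laplace_beltrami A g u p = - codifferential A g (differential u) p"

section \<open>Riemannian volume measure\<close>

text \<open>The Borel measure on \<open>M\<close> that is \<open>sqrt (det g) dx\<close> in every chart.\<close>

definition is_riemannian_volume ::
  "'a topology \<Rightarrow> ('a, 'n::finite) chart set \<Rightarrow> 'a metric_tensor \<Rightarrow> 'a measure \<Rightarrow> bool" where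
  "is_riemannian_volume X A g \<mu> \<longleftrightarrow>
     space \<mu> = topspace X \<and>
     sets \<mu> = sigma_sets (topspace X) {U. openin X U} \<and>
     (\<forall>c\<in>A. \<forall>B\<in>sets \<mu>. B \<subseteq> chart_dom c \<longrightarrow>
        emeasure \<mu> B =
          (\<integral>\<^sup>+x\<in>chart_map c ` B. ennreal (volume_density A g c (chart_inv c x)) \<partial>lborel))"

definition riemannian_volume ::
  "'a topology \<Rightarrow> ('a, 'n::finite) chart set \<Rightarrow> 'a metric_tensor \<Rightarrow> 'a measure" where
  "riemannian_volume X A g = (THE \<mu>. is_riemannian_volume X A g \<mu>)"

section \<open>Conformal Laplacian\<close>

definition yamabe_a :: "nat \<Rightarrow> real" where
  "yamabe_a n = 4 * (real n - 1) / (real n - 2)"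

definition yamabe_p :: "nat \<Rightarrow> real" where
  "yamabe_p n = 2 * real n / (real n - 2)"

text \<open>
  The first eigenvalue of the conformal Laplacian \<open>u \<mapsto> - a \<Delta> u + S u\<close> as the infimum of its
  Rayleigh quotient over smooth functions that do not vanish identically on \<open>M\<close>.
\<close>

definition conformal_eigenvalue ::
  "'a topology \<Rightarrow> ('a, 'n::finite) chart set \<Rightarrow> 'a metric_tensor \<Rightarrow> real" where
  "conformal_eigenvalue X A g =
     (INF \<phi> \<in> {\<phi> \<in> smooth_functions A. \<exists>p\<in>topspace X. \<phi> p \<noteq> 0}.
        (\<integral>p. yamabe_a CARD('n) * grad_norm_sq A g \<phi> p + scalar_curvature A g p * (\<phi> p)\<^sup>2
            \<partial>riemannian_volume X A g)
        / (\<integral>p. (\<phi> p)\<^sup>2 \<partial>riemannian_volume X A g))"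

end

(* The solution is found by monotone iteration, which needs the resolvent of the Laplacian on
smooth functions and maximum principles.

For large ka the resolvent (ka - Laplacian)^-1 is a Neumann series.  In a chart, a Gaussian with
the inverse metric as covariance, averaged over the scales s in (0,1] with weight
2 s (1 - s) exp (- ka s^2), inverts ka - Laplacian up to an operator of the same kind with small sup
norm.  Commutators of such operators with vector fields are again of this kind, so in every C^k
norm the remainder has the same small leading constant, and the resolvent gains a derivative.
Hence an iteration that converges uniformly converges in all C^k.

Let lam be half of a negative Rayleigh quotient, attained by a function f.  Large constants are
supersolutions.  First u^(p-1) is replaced by u (1 + u)^(p-2), which is smooth at 0, and the
iteration is run down to the subsolution 0.  The iterates are positive supersolutions; were their
limit 0, Picone's inequality for f would contradict the choice of lam.  So the limit is positive
by Hopf's strong maximum principle.  It is a subsolution of the original equation, and a second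
iteration between it and a constant yields u. *)

theory Submission
 imports Defs "HOL-Real_Asymp.Real_Asymp"
begin

text \<open>The negative eigenvalue enters through one trial function only. No minimizer of the
  Rayleigh quotient is constructed, so no eigenfunction is at hand as a subsolution; this is why the
  iteration is run down to 0 and its limit is shown to be nonzero afterwards. As \<beta> \<le> 0
  only lowers the quadratic form of that trial function, \<open>lam\<close> can be fixed before
  \<beta>. Halving the quotient leaves room for a factor 3/2, lost when (1 + u) powr q is compared
  with 1 near u = 0.

  The weight 2 s (1 - s) exp (- ka s^2) comes from the resolvent as the Laplace transform of the
  heat semigroup, with time s^2 and its differential 2 s ds: the Gaussian of scale s is the heat
  kernel at time s^2 for coefficients frozen at x. The factor 1 - s removes the boundary term at s =
  1; the one at s = 0 is a multiple of the function itself.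

  Laplacian and scalar curvature are evaluated in a chart selected separately at every point, and
  the volume is a definite description. Smoothness and integration by parts therefore rest on
  independence of the chart and on unique existence of the measure.\<close>

abbreviation usum :: "('i => 'c::comm_monoid_add) => 'c" (binder "SU " 10) where
 "usum f == sum f UNIV"

section \<open>Calculus of smooth functions\<close>

lemma Ck_on_imp_continuous_on: "Ck_on k S f ==> continuous_on S f"
proof (cases k)
 case (Suc m)
 assume "Ck_on k S f"
 hence "f differentiable (at x)" if "x \<in> S" for x using that Suc by simp
 thus ?thesis by (meson continuous_at_imp_continuous_on differentiable_imp_continuous_within)
qed simp

lemma Ck_on_SucD: "Ck_on (Suc k) S f ==> Ck_on k S f"
proof (induction k arbitrary: f)
 case 0
 thus ?case using Ck_on_imp_continuous_on[of "Suc 0"] by auto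
next
 case (Suc k)
 thus ?case by auto
qed

lemma Ck_on_subset: "T \<subseteq> S ==> Ck_on k S f ==> Ck_on k T f"
 by (induction k arbitrary: f) (auto intro: continuous_on_subset)

lemma Ck_on_cong:
 assumes "open S" "!!x. x \<in> S ==> f x = g x" "Ck_on k S f"
 shows "Ck_on k S g" using assms(2,3)
proof (induction k arbitrary: f g)
 case 0
 thus ?case using continuous_on_cong by fastforce
next
 case (Suc k)
 have 1: "(g has_derivative frechet_derivative f (at x)) (at x)" if "x \<in> S" for x
  using Suc.prems that frechet_derivative_works[of f "at x"]
  by (auto intro: has_derivative_transform_within_open[OF _ assms(1) that])
 hence 2: "frechet_derivative g (at x) = frechet_derivative f (at x)" if "x \<in> S" for x
  using frechet_derivative_at that by metis
 have "Ck_on k S (%x. frechet_derivative g (at x) v)" for v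
  using Suc.IH[of "%x. frechet_derivative f (at x) v" "%x. frechet_derivative g (at x) v"] Suc.prems 2 by auto
 with 1 show ?case by (auto simp: differentiable_def)
qed

lemma Ck_on_has_derivative:
 "Ck_on (Suc k) S f ==> x \<in> S ==> (f has_derivative frechet_derivative f (at x)) (at x)"
 by (simp add: frechet_derivative_works[symmetric])

lemma Ck_on_SucI:
 assumes "open S" "!!x. x \<in> S ==> (f has_derivative f' x) (at x)" "!!v. Ck_on k S (%x. f' x v)"
 shows "Ck_on (Suc k) S f"
proof -
 have "frechet_derivative f (at x) = f' x" if "x \<in> S" for x using assms(2)[OF that] frechet_derivative_at by metis
 hence "Ck_on k S (%x. frechet_derivative f (at x) v)" for v by (intro Ck_on_cong[OF assms(1) _ assms(3)[of v]]) auto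
 thus ?thesis using assms(2) by (auto simp: differentiable_def)
qed

lemma Ck_on_const [simp]: "Ck_on k S (%x. c)" by (induction k arbitrary: c) auto

lemma Ck_on_add:
 assumes "open S" "Ck_on k S f" "Ck_on k S g"
 shows "Ck_on k S (%x. f x + g x)" using assms(2,3)
proof (induction k arbitrary: f g)
 case 0
 thus ?case by (auto intro: continuous_intros)
next
 case (Suc k)
 show ?case
  by (rule Ck_on_SucI[OF assms(1) has_derivative_add[OF Ck_on_has_derivative[OF Suc.prems(1)] Ck_on_has_derivative[OF Suc.prems(2)]]])
   (use Suc in auto)
qed

lemma Ck_on_bilinear:
 assumes "bounded_bilinear bil" "open S" "Ck_on k S f" "Ck_on k S g"
 shows "Ck_on k S (%x. bil (f x) (g x))" using assms(3,4)
proof (induction k arbitrary: f g)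
 case 0
 thus ?case using bounded_bilinear.continuous_on[OF assms(1)] by auto
next
 case (Suc k)
 have "Ck_on k S f" "Ck_on k S g" using Suc.prems Ck_on_SucD by auto
 thus ?case
  by (intro Ck_on_SucI[OF assms(2) bounded_bilinear.FDERIV[OF assms(1) Ck_on_has_derivative[OF Suc.prems(1)] Ck_on_has_derivative[OF Suc.prems(2)]]]
   Ck_on_add assms(2) Suc.IH)
   (use Suc.prems in auto)
qed

lemma Ck_on_bounded_linear:
 assumes "bounded_linear l" "open S" "Ck_on k S f"
 shows "Ck_on k S (%x. l (f x))" using assms(3)
proof (induction k arbitrary: f)
 case 0
 thus ?case using bounded_linear.continuous_on[OF assms(1)] by auto
next
 case (Suc k)
 show ?case
  by (intro Ck_on_SucI[OF assms(2) bounded_linear.has_derivative[OF assms(1) Ck_on_has_derivative[OF Suc.prems(1)]]] Suc.IH)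
   (use Suc.prems in auto)
qed

lemma Ck_on_id: "open S ==> Ck_on k S (%x. x)"
proof (cases k)
 case (Suc m)
 assume "open S"
 thus ?thesis unfolding Suc by (intro Ck_on_SucI[where f' = "%x v. v"]) (auto simp: has_derivative_ident)
qed (auto intro: continuous_intros)

lemma Ck_on_sum:
 assumes "open S" "!!i. i \<in> I ==> Ck_on k S (f i)"
 shows "Ck_on k S (%x. SUM i:I. f i x)" using assms by (induction I rule: infinite_finite_induct) (auto intro!: Ck_on_add)

text \<open>The chain rule is expanded along the standard basis, so the derivative of the composite
  is a finite sum of products of a component of the derivative of \<open>f\<close> with a partial
  derivative of \<open>g\<close> after \<open>f\<close>. The induction hypothesis, general in
  \<open>g\<close>, handles the second factor.\<close>

lemma Ck_on_compose:
 fixes f :: "'b::euclidean_space => 'c::euclidean_space" and g :: "'c => 'd::real_normed_vector"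
 assumes "open S" "open T" "f ` S \<subseteq> T" "Ck_on k S f" "Ck_on k T g"
 shows "Ck_on k S (%x. g (f x))" using assms(4,5)
proof (induction k arbitrary: g)
 case 0
 thus ?case using continuous_on_compose2[of T g S f] assms(3) by auto
next
 case (Suc k)
 have d: "((%x. g (f x)) has_derivative
   (%v. SUM b:Basis. (frechet_derivative f (at x) v \<bullet> b) *\<^sub>R frechet_derivative g (at (f x)) b)) (at x)" if "x \<in> S" for x
 proof -
  have 1: "(f has_derivative frechet_derivative f (at x)) (at x)" using Ck_on_has_derivative[OF Suc.prems(1) that] .
  have 2: "(g has_derivative frechet_derivative g (at (f x))) (at (f x))"
   using Ck_on_has_derivative[OF Suc.prems(2)] that assms(3) by auto
  have lin: "linear (frechet_derivative g (at (f x)))" using 2 has_derivative_linear by auto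
  have "frechet_derivative g (at (f x)) w = (SUM b:Basis. (w \<bullet> b) *\<^sub>R frechet_derivative g (at (f x)) b)" for w
  proof -
   have "frechet_derivative g (at (f x)) w = frechet_derivative g (at (f x)) (SUM b:Basis. (w \<bullet> b) *\<^sub>R b)"
    by (simp add: euclidean_representation)
   also have "... = (SUM b:Basis. (w \<bullet> b) *\<^sub>R frechet_derivative g (at (f x)) b)"
    by (simp add: linear_sum[OF lin] linear_cmul[OF lin])
   finally show ?thesis .
  qed
  thus ?thesis by (intro has_derivative_eq_rhs[OF has_derivative_compose[OF 1 2]] ext)
 qed
 have fk: "Ck_on k S f" using Suc.prems Ck_on_SucD by auto
 show ?case
 proof (rule Ck_on_SucI[OF assms(1) d])
  show "Ck_on k S (%x. SUM b:Basis. (frechet_derivative f (at x) v \<bullet> b) *\<^sub>R frechet_derivative g (at (f x)) b)" for v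
  proof (intro Ck_on_sum Ck_on_bilinear[OF bounded_bilinear_scaleR] assms(1))
   fix b :: 'c
   show "Ck_on k S (%x. frechet_derivative f (at x) v \<bullet> b)"
    by (intro Ck_on_bounded_linear[OF bounded_linear_inner_left] assms(1)) (use Suc.prems in auto)
   show "Ck_on k S (%x. frechet_derivative g (at (f x)) b)" by (rule Suc.IH[OF fk]) (use Suc.prems in auto)
  qed
 qed
qed

text \<open>The derivatives in \<open>Ck_on\<close> are taken in the full space, not within
  \<open>S\<close>, so differentiability can be decided in any open neighbourhood of each
  point.\<close>

lemma Ck_on_local:
 assumes "!!x. x \<in> S ==> EX T. open T & x \<in> T & Ck_on k T f"
 shows "Ck_on k S f" using assms
proof (induction k arbitrary: f)
 case 0
 show ?case unfolding Ck_on.simps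
 proof (rule continuous_at_imp_continuous_on, safe)
  fix x assume "x \<in> S"
  thus "isCont f x" using 0 by (metis Ck_on.simps(1) continuous_on_eq_continuous_at)
 qed
next
 case (Suc k)
 have "f differentiable (at x)" if "x \<in> S" for x using Suc.prems[OF that] by auto
 moreover have "Ck_on k S (%x. frechet_derivative f (at x) v)" for v by (rule Suc.IH) (use Suc.prems in "fastforce")
 ultimately show ?case by auto
qed

section \<open>Closure properties of smooth functions, including exponentials, real powers and
  quotients\<close>

lemma smooth_cont: "smooth_on S f ==> continuous_on S f" by (metis smooth_on_def Ck_on.simps(1))

lemma smooth_on_subset: "smooth_on S f ==> T \<subseteq> S ==> smooth_on T f" by (auto simp: smooth_on_def intro: Ck_on_subset)

lemma smooth_on_cong: "smooth_on S f ==> open S ==> (!!x. x \<in> S ==> f x = g x) ==> smooth_on S g"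
 by (auto simp: smooth_on_def intro: Ck_on_cong)

lemma smooth_on_local:
 assumes "!!x. x \<in> S ==> EX T. open T & x \<in> T & smooth_on T f"
 shows "smooth_on S f" using assms unfolding smooth_on_def by (metis Ck_on_local)

lemma smooth_diff: "smooth_on S f ==> x \<in> S ==> f differentiable (at x)" unfolding smooth_on_def using Ck_on.simps(2) by blast

named_theorems smooth_intros

lemma smooth_on_frechet [smooth_intros]:
 "smooth_on S f ==> smooth_on S (%x. frechet_derivative f (at x) v)" unfolding smooth_on_def using Ck_on.simps(2) by blast

lemma smooth_on_const [smooth_intros]: "smooth_on S (%x. c)" by (simp add: smooth_on_def)

lemma smooth_on_id [smooth_intros]: "open S ==> smooth_on S (%x. x)" by (simp add: smooth_on_def Ck_on_id)

lemma smooth_on_add [smooth_intros]: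
 "open S ==> smooth_on S f ==> smooth_on S g ==> smooth_on S (%x. f x + g x)" by (simp add: smooth_on_def Ck_on_add)

lemma smooth_on_bounded_linear:
 "bounded_linear l ==> open S ==> smooth_on S f ==> smooth_on S (%x. l (f x))" by (simp add: smooth_on_def Ck_on_bounded_linear)

lemma smooth_on_bilinear:
 "bounded_bilinear b ==> open S ==> smooth_on S f ==> smooth_on S g ==> smooth_on S (%x. b (f x) (g x))"
 by (simp add: smooth_on_def Ck_on_bilinear)

lemma smooth_on_sum [smooth_intros]:
 "open S ==> (!!i. i \<in> I ==> smooth_on S (f i)) ==> smooth_on S (%x. SUM i:I. f i x)" by (simp add: smooth_on_def Ck_on_sum)

lemma smooth_on_compose:
 fixes f :: "'b::euclidean_space => 'c::euclidean_space"
 shows "open S ==> open T ==> f ` S \<subseteq> T ==> smooth_on S f ==> smooth_on T g ==> smooth_on S (%x. g (f x))"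
 by (simp add: smooth_on_def Ck_on_compose)

lemma smooth_on_minus [smooth_intros]:
 "open S ==> smooth_on S f ==> smooth_on S (%x. - f x)"
 by (rule smooth_on_bounded_linear[OF bounded_linear_minus[OF bounded_linear_ident]])

lemma smooth_on_diff [smooth_intros]:
 "open S ==> smooth_on S f ==> smooth_on S g ==> smooth_on S (%x. f x - g x)"
 using smooth_on_add[of S f "%x. - g x"] smooth_on_minus by auto

lemma smooth_on_mult [smooth_intros]:
 fixes f g :: "'b::euclidean_space => real"
 shows "open S ==> smooth_on S f ==> smooth_on S g ==> smooth_on S (%x. f x * g x)"
 by (rule smooth_on_bilinear[OF bounded_bilinear_mult])

lemma smooth_on_inner [smooth_intros]:
 "open S ==> smooth_on S f ==> smooth_on S g ==> smooth_on S (%x. f x \<bullet> g x)"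
 by (rule smooth_on_bilinear[OF bounded_bilinear_inner])

lemma smooth_on_component [smooth_intros]:
 "open S ==> smooth_on S f ==> smooth_on S (%x. f x $ i)" by (rule smooth_on_bounded_linear[OF bounded_linear_vec_nth])

lemma smooth_on_prod [smooth_intros]:
 fixes f :: "'i => 'b::euclidean_space => real"
 shows "open S ==> (!!i. i \<in> I ==> smooth_on S (f i)) ==> smooth_on S (%x. \<Prod>i\<in>I. f i x)"
 by (induction I rule: infinite_finite_induct) (auto intro!: smooth_intros)

lemma Ck_on_real_SucI:
 fixes f :: "real => real"
 assumes "open S" "!!x. x \<in> S ==> (f has_real_derivative f' x) (at x)" "Ck_on k S f'"
 shows "Ck_on (Suc k) S f"
proof (rule Ck_on_SucI[OF assms(1)])
 show "x \<in> S ==> (f has_derivative (%v. f' x * v)) (at x)" for x using assms(2) by (simp add: has_field_derivative_def)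
 show "Ck_on k S (%x. f' x * v)" for v by (rule Ck_on_bounded_linear[OF bounded_linear_mult_left assms(1,3)])
qed

lemma smooth_on_exp_real: "smooth_on (UNIV::real set) exp"
proof -
 have "Ck_on k (UNIV::real set) exp" for k
  by (induction k) (auto intro!: continuous_intros Ck_on_real_SucI[where f' = exp] DERIV_exp simp del: Ck_on.simps(2))
 thus ?thesis by (simp add: smooth_on_def)
qed

lemma smooth_on_powr_real: "smooth_on {0::real<..} (%x. x powr a)"
proof -
 have "Ck_on k {0::real<..} (%x. x powr a)" for k
 proof (induction k arbitrary: a)
  case (Suc k)
  show ?case
  proof (rule Ck_on_real_SucI[where f' = "%x. a * x powr (a - 1)"])
   show "Ck_on k {0<..} (%x::real. a * x powr (a - 1))" by (rule Ck_on_bounded_linear[OF bounded_linear_mult_right _ Suc.IH]) auto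
  qed (auto intro!: derivative_eq_intros)
 qed (auto intro!: continuous_intros)
 thus ?thesis by (simp add: smooth_on_def)
qed

lemma smooth_on_inverse_real: "smooth_on (- {0::real}) inverse"
proof -
 have "Ck_on k (- {0::real}) inverse" for k
 proof (induction k)
  case (Suc k)
  have "Ck_on k (- {0::real}) (%x. - (inverse x * inverse x))"
   by (rule Ck_on_bounded_linear[OF bounded_linear_minus[OF bounded_linear_ident] _
      Ck_on_bilinear[OF bounded_bilinear_mult _ Suc Suc]]) auto
  thus ?case by (intro Ck_on_real_SucI[where f' = "%x. - (inverse x * inverse x)"]) (auto intro!: derivative_eq_intros)
 qed (auto intro!: continuous_intros)
 thus ?thesis by (simp add: smooth_on_def)
qed

lemma smooth_on_exp [smooth_intros]:
 fixes f :: "'b::euclidean_space => real"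
 shows "open S ==> smooth_on S f ==> smooth_on S (%x. exp (f x))" using smooth_on_compose[OF _ _ _ _ smooth_on_exp_real] by auto

lemma smooth_on_powr [smooth_intros]:
 fixes f :: "'b::euclidean_space => real"
 shows "open S ==> smooth_on S f ==> (!!x. x \<in> S ==> f x > 0) ==> smooth_on S (%x. f x powr a)"
 by (rule smooth_on_compose[OF _ _ _ _ smooth_on_powr_real]) auto

lemma smooth_on_inverse [smooth_intros]:
 fixes f :: "'b::euclidean_space => real"
 shows "open S ==> smooth_on S f ==> (!!x. x \<in> S ==> f x ~= 0) ==> smooth_on S (%x. inverse (f x))"
 by (rule smooth_on_compose[OF _ _ _ _ smooth_on_inverse_real]) (auto simp: open_Compl)

lemma smooth_on_divide [smooth_intros]:
 fixes f :: "'b::euclidean_space => real"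
 shows "open S ==> smooth_on S f ==> smooth_on S g ==> (!!x. x \<in> S ==> g x ~= 0) ==> smooth_on S (%x. f x / g x)"
 unfolding divide_inverse by (intro smooth_intros)

lemma smooth_on_sqrt [smooth_intros]:
 fixes f :: "'b::euclidean_space => real"
 assumes "open S" "smooth_on S f" "!!x. x \<in> S ==> f x > 0"
 shows "smooth_on S (%x. sqrt (f x))"
proof (rule smooth_on_cong[OF smooth_on_powr[OF assms(1,2), of "1/2"] assms(1)])
 show "f x powr (1 / 2) = sqrt (f x)" if "x \<in> S" for x using assms(3)[OF that] powr_half_sqrt by auto
qed (use assms in auto)


section \<open>Directional derivatives and symmetry of second derivatives\<close>

definition dd :: "'b::real_normed_vector => ('b => 'c::real_normed_vector) => 'b => 'c" where
 "dd v f x = frechet_derivative f (at x) v"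

abbreviation dx :: "'n => (real ^ 'n::finite => 'c::real_normed_vector) => real ^ 'n => 'c" where
 "dx i == dd (axis i 1)"

lemma dd_eqI: "(f has_derivative f') (at x) ==> dd v f x = f' v" unfolding dd_def using frechet_derivative_at by metis

lemma dd_works: "f differentiable (at x) ==> (f has_derivative (%v. dd v f x)) (at x)"
 unfolding dd_def using frechet_derivative_works by auto

lemma smooth_on_dd [smooth_intros]: "smooth_on S f ==> smooth_on S (dd v f)" unfolding dd_def[abs_def] by (rule smooth_on_frechet)

lemma dd_const [simp]: "dd v (%x. c) x = 0" by (rule dd_eqI) (auto intro!: derivative_eq_intros)

lemma dd_cong_open:
 assumes "open S" "x \<in> S" "!!y. y \<in> S ==> f y = g y"
 shows "dd v f x = dd v g x"
proof -
 have "(f has_derivative D) (at x) \<longleftrightarrow> (g has_derivative D) (at x)" for D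
  using has_derivative_transform_within_open[OF _ assms(1,2)] assms(3) by metis
 thus ?thesis unfolding dd_def frechet_derivative_def by simp
qed

lemma dd_add:
 "f differentiable (at x) ==> g differentiable (at x) ==> dd v (%x. f x + g x) x = dd v f x + dd v g x"
 by (rule dd_eqI[OF has_derivative_add[OF dd_works dd_works]])

lemma dd_diff:
 "f differentiable (at x) ==> g differentiable (at x) ==> dd v (%x. f x - g x) x = dd v f x - dd v g x"
 by (rule dd_eqI[OF has_derivative_diff[OF dd_works dd_works]])

lemma dd_sum:
 "(!!i. i \<in> I ==> f i differentiable (at x)) ==> dd v (%x. SUM i:I. f i x) x = (SUM i:I. dd v (f i) x)"
 by (rule dd_eqI[OF has_derivative_sum[OF dd_works]])

lemma dd_mult:
 fixes f g :: "'b::real_normed_vector => real"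
 shows "f differentiable (at x) ==> g differentiable (at x) ==>
  dd v (%x. f x * g x) x = f x * dd v g x + dd v f x * g x" by (rule dd_eqI[OF has_derivative_mult[OF dd_works dd_works]])

lemma dd_cmult:
 fixes f :: "'b::real_normed_vector => real"
 shows "f differentiable (at x) ==> dd v (%x. c * f x) x = c * dd v f x"
 by (rule dd_eqI[OF has_derivative_mult_right[OF dd_works]])

lemma dd_real_compose:
 fixes f :: "'b::real_normed_vector => real" and h :: "real => real"
 assumes "f differentiable (at x)" "(h has_real_derivative h') (at (f x))"
 shows "dd v (%x. h (f x)) x = h' * dd v f x"
 using dd_eqI[OF has_derivative_compose[OF dd_works[OF assms(1)]], of h "%u. h' * u"] assms(2)
 by (simp add: has_field_derivative_def)

lemma dd_component:
 fixes f :: "'b::real_normed_vector => real ^ 'n"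
 shows "f differentiable (at x) ==> dd v (%x. f x $ i) x = dd v f x $ i"
 by (rule dd_eqI[OF bounded_linear.has_derivative[OF bounded_linear_vec_nth dd_works]])

lemma linear_dd: "f differentiable (at x) ==> linear (%v. dd v f x)" using has_derivative_linear[OF dd_works] .

lemma dd_axis:
 fixes f :: "real ^ 'n => 'c::real_normed_vector"
 assumes "f differentiable (at x)"
 shows "dd v f x = (SU i. v $ i *\<^sub>R dx i f x)"
proof -
 note lin = linear_dd[OF assms]
 have "dd v f x = dd (SU i. v $ i *\<^sub>R axis i 1) f x"
  by (rule arg_cong[of _ _ "%v. dd v f x"]) (simp add: vec_eq_iff axis_def if_distrib cong: if_cong)
 also have "... = (SU i. v $ i *\<^sub>R dx i f x)" by (simp add: linear_sum[OF lin] linear_cmul[OF lin])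
 finally show ?thesis .
qed

lemma dd_compose:
 fixes f :: "'b::real_normed_vector => real ^ 'n" and g :: "real ^ 'n => real"
 assumes "f differentiable (at x)" "g differentiable (at (f x))"
 shows "dd v (%x. g (f x)) x = (SU i. dd v (%x. f x $ i) x * dx i g (f x))"
proof -
 have "dd v (%x. g (f x)) x = dd (dd v f x) g (f x)"
  by (rule dd_eqI[OF has_derivative_compose[OF dd_works[OF assms(1)] dd_works[OF assms(2)]]])
 thus ?thesis by (simp add: dd_axis[OF assms(2), of "dd v f x"] dd_component[OF assms(1)])
qed

lemma dd_DERIV_line:
 fixes f :: "'b::real_normed_vector => real"
 assumes "f differentiable (at (x + t *\<^sub>R v))"
 shows "((%t. f (x + t *\<^sub>R v)) has_real_derivative dd v f (x + t *\<^sub>R v)) (at t)"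
proof -
 have "((%t. x + t *\<^sub>R v) has_derivative (%s. s *\<^sub>R v)) (at t)" by (auto intro!: derivative_eq_intros)
 from has_derivative_compose[OF this dd_works[OF assms]]
 have "((%t. f (x + t *\<^sub>R v)) has_derivative (%s. dd (s *\<^sub>R v) f (x + t *\<^sub>R v))) (at t)" .
 moreover have "dd (s *\<^sub>R v) f (x + t *\<^sub>R v) = dd v f (x + t *\<^sub>R v) * s" for s
  using linear_cmul[OF linear_dd[OF assms]] by simp
 ultimately show ?thesis by (simp add: has_field_derivative_def)
qed

text \<open>The mean value theorem is used along \<open>v\<close> and then along \<open>w\<close>.
  The left-hand side is symmetric in \<open>v\<close> and \<open>w\<close>, while the right-hand
  side fixes an order of differentiation; that asymmetry is what makes mixed derivatives
  commute.\<close>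

lemma second_difference:
 fixes f :: "'b::euclidean_space => real"
 assumes "ball x r \<subseteq> S" "smooth_on S f" "h > 0" "h * (norm v + norm w) < r"
 shows "EX y:ball x r. f (x + h *\<^sub>R v + h *\<^sub>R w) - f (x + h *\<^sub>R v) - f (x + h *\<^sub>R w) + f x = h\<^sup>2 * dd w (dd v f) y"
proof -
 have inb: "x + s *\<^sub>R v + t *\<^sub>R w \<in> ball x r" if "0 <= s" "s <= h" "0 <= t" "t <= h" for s t
 proof -
  have "norm (s *\<^sub>R v + t *\<^sub>R w) <= s * norm v + t * norm w"
   using norm_triangle_ineq[of "s *\<^sub>R v" "t *\<^sub>R w"] that by simp
  also have "... <= h * (norm v + norm w)" using that by (simp add: distrib_left add_mono mult_right_mono)
  finally have "norm (s *\<^sub>R v + t *\<^sub>R w) < r" using assms(4) by simp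
  moreover have "dist x (x + s *\<^sub>R v + t *\<^sub>R w) = norm (s *\<^sub>R v + t *\<^sub>R w)"
   by (metis add.assoc add_diff_cancel_left' dist_commute dist_norm)
  ultimately show ?thesis by simp
 qed
 have df: "f differentiable (at y)" "dd v f differentiable (at y)" if "y \<in> ball x r" for y
  using that assms(1,2) smooth_diff smooth_on_dd by blast+
 \<comment> \<open>The increment across \<open>w\<close> as a function of the position along
   \<open>v\<close>: its derivative is again an increment, ready for the second mean value
   theorem.\<close>
 define F where "F s = f (x + h *\<^sub>R w + s *\<^sub>R v) - f (x + s *\<^sub>R v)" for s
 have "(F has_real_derivative dd v f (x + h *\<^sub>R w + s *\<^sub>R v) - dd v f (x + s *\<^sub>R v)) (at s)" if "0 <= s" "s <= h" for s
  unfolding F_def using inb[OF that, of h] inb[OF that, of 0] assms(3)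
  by (intro DERIV_diff dd_DERIV_line df) (auto simp: algebra_simps)
 from MVT2[OF assms(3) this] obtain s where s: "0 < s" "s < h"
  "F h - F 0 = h * (dd v f (x + h *\<^sub>R w + s *\<^sub>R v) - dd v f (x + s *\<^sub>R v))" by auto
 have "((%t. dd v f (x + s *\<^sub>R v + t *\<^sub>R w)) has_real_derivative dd w (dd v f) (x + s *\<^sub>R v + t *\<^sub>R w)) (at t)" if "0 <= t" "t <= h" for t
  using inb[of s t] s that by (intro dd_DERIV_line df) auto
 from MVT2[OF assms(3) this] obtain t where t: "0 < t" "t < h"
  "dd v f (x + s *\<^sub>R v + h *\<^sub>R w) - dd v f (x + s *\<^sub>R v) = h * dd w (dd v f) (x + s *\<^sub>R v + t *\<^sub>R w)"
  by auto
 have "f (x + h *\<^sub>R v + h *\<^sub>R w) - f (x + h *\<^sub>R v) - f (x + h *\<^sub>R w) + f x = F h - F 0"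
  by (simp add: F_def algebra_simps)
 also have "... = h\<^sup>2 * dd w (dd v f) (x + s *\<^sub>R v + t *\<^sub>R w)"
  using s(3) t(3) by (simp add: power2_eq_square add.assoc add.left_commute[of "h *\<^sub>R w"] add.commute[of "h *\<^sub>R w"])
 finally show ?thesis using inb[of s t] s t by auto
qed

text \<open>If the two mixed derivatives differed by 2e at \<open>x\<close>, continuity would keep
  each within e of its value there on a small ball, but the second difference makes them coincide at
  two points of that ball.\<close>

lemma dd_symm:
 fixes f :: "'b::euclidean_space => real"
 assumes "open S" "smooth_on S f" "x \<in> S"
 shows "dd w (dd v f) x = dd v (dd w f) x"
proof (rule ccontr)
 assume ne: "dd w (dd v f) x ~= dd v (dd w f) x"
 define e where "e = \<bar>dd w (dd v f) x - dd v (dd w f) x\<bar> / 2"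
 have e: "e > 0" using ne by (simp add: e_def)
 have c: "continuous_on S (dd w (dd v f))" "continuous_on S (dd v (dd w f))"
  using assms by (auto intro!: smooth_cont smooth_intros)
 have "isCont (dd w (dd v f)) x" "isCont (dd v (dd w f)) x" using c assms by (auto simp: continuous_on_eq_continuous_at)
 hence "EX d>0. ALL y. dist y x < d --> dist (dd w (dd v f) y) (dd w (dd v f) x) < e"
  "EX d>0. ALL y. dist y x < d --> dist (dd v (dd w f) y) (dd v (dd w f) x) < e"
  using e by (simp_all add: continuous_at_eps_delta)
 then obtain d1 d2 where d: "d1 > 0" "!!y. dist y x < d1 ==> dist (dd w (dd v f) y) (dd w (dd v f) x) < e"
  "d2 > 0" "!!y. dist y x < d2 ==> dist (dd v (dd w f) y) (dd v (dd w f) x) < e" by blast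
 obtain d3 where d3: "d3 > 0" "ball x d3 \<subseteq> S" using assms openE by blast
 define r where "r = min d1 (min d2 d3)"
 have r: "r > 0" "ball x r \<subseteq> S" using d d3 by (auto simp: r_def)
 define h where "h = r / (2 * (norm v + norm w + 1))"
 have p: "norm v + norm w + 1 > 0" by (smt (verit) norm_ge_zero)
 have h: "h > 0" using r p by (auto simp: h_def)
 have "h * (norm v + norm w) <= h * (norm v + norm w + 1)" using h by simp
 also have "... = r / 2" using p unfolding h_def by (simp add: divide_simps)
 finally have h2: "h * (norm v + norm w) < r" "h * (norm w + norm v) < r" using r by (auto simp: add.commute)
 obtain y z where y: "y \<in> ball x r" "f (x + h *\<^sub>R v + h *\<^sub>R w) - f (x + h *\<^sub>R v) - f (x + h *\<^sub>R w) + f x = h\<^sup>2 * dd w (dd v f) y"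
  and z: "z \<in> ball x r" "f (x + h *\<^sub>R w + h *\<^sub>R v) - f (x + h *\<^sub>R w) - f (x + h *\<^sub>R v) + f x = h\<^sup>2 * dd v (dd w f) z"
  using second_difference[OF r(2) assms(2) h h2(1)] second_difference[OF r(2) assms(2) h h2(2)] by blast
 have "h\<^sup>2 * dd w (dd v f) y = h\<^sup>2 * dd v (dd w f) z" using y(2) z(2) by (simp add: algebra_simps)
 hence "dd w (dd v f) y = dd v (dd w f) z" using h by simp
 moreover have "\<bar>dd w (dd v f) y - dd w (dd v f) x\<bar> < e" "\<bar>dd v (dd w f) z - dd v (dd w f) x\<bar> < e"
  using d(2)[of y] d(4)[of z] y(1) z(1) by (auto simp: r_def dist_real_def dist_commute)
 ultimately show False using e by (auto simp: e_def abs_if split: if_splits)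
qed

subsection \<open>Cutoff functions\<close>

text \<open>The family over all \<open>m\<close> is closed under differentiation, so one induction
  covers all orders. Only the origin needs an estimate: for t > 0 the function is at most a multiple
  of t^2, so its difference quotient tends to 0.\<close>

lemma flat_Ck: "Ck_on k UNIV (%t::real. if t > 0 then exp (- 1 / t) / t ^ m else 0)"
proof -
 have bd: "exp (- 1 / t) / t ^ m <= real (m + 2) ^ (m + 2) * t\<^sup>2" if "t > 0" for t :: real and m
 proof -
  \<comment> \<open>From (1 + x/n)^n \<le> exp x with x = 1/t and n = m + 2; the two powers beyond
    \<open>m\<close> produce the factor t^2.\<close>
  have "(1 / t / real (m + 2)) ^ (m + 2) <= (1 + 1 / t / real (m + 2)) ^ (m + 2)" using that by (intro power_mono) auto
  also have "... <= exp (1 / t)"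
   using exp_ge_one_plus_x_over_n_power_n[of "m + 2" "1 / t"] that by (simp add: less_imp_le order.trans[of _ 0])
  finally have "exp (- 1 / t) <= 1 / (1 / t / real (m + 2)) ^ (m + 2)"
   using that by (simp add: exp_minus divide_simps mult_ac del: of_nat_add)
  also have "... = real (m + 2) ^ (m + 2) * t\<^sup>2 * t ^ m"
   using that unfolding power_divide power_mult_distrib power_add by (simp add: power_mult_distrib)
  finally show ?thesis using that by (simp add: divide_le_eq)
 qed
 have D: "((%t::real. if t > 0 then exp (- 1 / t) / t ^ m else 0) has_real_derivative
   ((if t > 0 then exp (- 1 / t) / t ^ (m + 2) else 0) - real m * (if t > 0 then exp (- 1 / t) / t ^ (m + 1) else 0))) (at t)" for t m
 proof -
  consider "t > 0" | "t < 0" | "t = 0" by linarith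
  thus ?thesis
  proof cases
   case 1
   have "((%t::real. exp (- 1 / t) / t ^ m) has_real_derivative
     exp (- 1 / t) / t ^ (m + 2) - real m * (exp (- 1 / t) / t ^ (m + 1))) (at t)" using 1 by (cases m; cases "m - 1")
      (auto intro!: derivative_eq_intros simp: field_simps power2_eq_square, metis One_nat_def power_eq_if)
   hence "((%t::real. if t > 0 then exp (- 1 / t) / t ^ m else 0) has_real_derivative
     exp (- 1 / t) / t ^ (m + 2) - real m * (exp (- 1 / t) / t ^ (m + 1))) (at t)"
    by (rule has_field_derivative_transform_within_open[of _ _ _ "{0<..}"]) (use 1 in auto)
   thus ?thesis using 1 by simp
  next
   case 2
   have "((%t::real. if t > 0 then exp (- 1 / t) / t ^ m else 0) has_real_derivative 0) (at t)"
    by (rule has_field_derivative_transform_within_open[of "%_. 0" _ _ "{..<0}"]) (use 2 in auto)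
   thus ?thesis using 2 by simp
  next
   case 3
   have "((%h::real. (if h > 0 then exp (- 1 / h) / h ^ m else 0) / h) \<longlongrightarrow> 0) (at 0)"
   proof (rule Lim_null_comparison)
    show "\<forall>\<^sub>F h in at 0. norm ((if h > 0 then exp (- 1 / h) / h ^ m else 0) / h) <= real (m + 2) ^ (m + 2) * \<bar>h\<bar>"
     using bd[of _ m] by (intro always_eventually) (auto simp: divide_le_eq power2_eq_square mult.assoc)
    show "((%h. real (m + 2) ^ (m + 2) * \<bar>h\<bar>) \<longlongrightarrow> 0) (at (0::real))"
     by (auto intro!: tendsto_eq_intros)
   qed
   thus ?thesis using 3 by (simp add: DERIV_def cong: if_cong)
  qed
 qed
 show ?thesis
 proof (induction k arbitrary: m)
  case 0
  show ?case using DERIV_continuous[OF D] unfolding Ck_on.simps by (intro continuous_at_imp_continuous_on ballI)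
 next
  case (Suc k)
  have "Ck_on k UNIV (%t::real. (if t > 0 then exp (- 1 / t) / t ^ (m + 2) else 0) + - (real m * (if t > 0 then exp (- 1 / t) / t ^ (m + 1) else 0)))"
   by (intro Ck_on_add Ck_on_bounded_linear[OF bounded_linear_minus[OF bounded_linear_mult_right]] Suc.IH open_UNIV)
  thus ?case by (intro Ck_on_real_SucI[OF _ D]) auto
 qed
qed

text \<open>Equal to 1 on the ball of radius \<open>r\<close> and to 0 outside the ball of radius 2
  r. Using the squared norm keeps it smooth at the centre.\<close>

definition cutoff :: "real ^ 'n => real => real ^ 'n => real" where
 "cutoff a r x = (let f = (%t::real. if t > 0 then exp (- 1 / t) else 0); t = (norm (x - a))\<^sup>2 / r\<^sup>2
   in f (2 - t) / (f (2 - t) + f (t - 1)))"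

lemma smooth_on_cutoff: "open S ==> smooth_on S (cutoff a r)"
proof -
 assume S: "open S"
 define f where "f = (%t::real. if t > 0 then exp (- 1 / t) else 0)"
 have f: "smooth_on UNIV f" using flat_Ck[of _ 0] by (simp add: smooth_on_def f_def cong: if_cong)
 have t: "smooth_on S (%x. (x - a) \<bullet> (x - a) / r\<^sup>2)" unfolding divide_inverse using S by (intro smooth_intros)
 have "smooth_on S (%x. f (2 - (x - a) \<bullet> (x - a) / r\<^sup>2))" "smooth_on S (%x. f ((x - a) \<bullet> (x - a) / r\<^sup>2 - 1))"
  by (rule smooth_on_compose[OF S _ _ _ f]; use S in "auto intro!: smooth_intros t")+
 moreover have "f (2 - t) + f (t - 1) ~= 0" for t using exp_gt_zero by (auto simp: f_def add_eq_0_iff) (smt (verit) exp_gt_zero)+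
 ultimately have "smooth_on S (%x. f (2 - (x - a) \<bullet> (x - a) / r\<^sup>2) / (f (2 - (x - a) \<bullet> (x - a) / r\<^sup>2) + f ((x - a) \<bullet> (x - a) / r\<^sup>2 - 1)))"
  using S by (intro smooth_intros)
 thus ?thesis by (simp add: cutoff_def[abs_def] Let_def f_def power2_norm_eq_inner)
qed

lemma cutoff_bounds: "0 <= cutoff a r x" "cutoff a r x <= 1"
 by (auto simp: cutoff_def Let_def divide_le_eq_1 add_pos_pos intro!: divide_nonneg_nonneg add_nonneg_nonneg)

lemma cutoff_eq_1: "r > 0 ==> norm (x - a) <= r ==> cutoff a r x = 1"
proof -
 assume "r > 0" "norm (x - a) <= r"
 hence "(norm (x - a))\<^sup>2 / r\<^sup>2 <= 1" by (simp add: power_mono)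
 thus ?thesis by (simp add: cutoff_def Let_def)
qed

lemma cutoff_eq_0: "r > 0 ==> norm (x - a) >= 2 * r ==> cutoff a r x = 0"
proof -
 assume r: "r > 0" "norm (x - a) >= 2 * r"
 hence "(2 * r)\<^sup>2 <= (norm (x - a))\<^sup>2" by (intro power_mono) auto
 hence "(norm (x - a))\<^sup>2 / r\<^sup>2 >= 2" using r by (simp add: le_divide_eq power2_eq_square) (smt (verit) zero_le_square)
 thus ?thesis by (simp add: cutoff_def Let_def)
qed

declare split_paired_All [simp del] split_paired_Ex [simp del]

section \<open>Integral operators with rapidly decaying kernels\<close>

definition csm :: "('b::euclidean_space => real) => bool" where
 "csm b \<longleftrightarrow> smooth_on UNIV b & (EX K. compact K & (ALL x. x \<notin> K --> b x = 0))"

lemma csm_smooth: "csm b ==> smooth_on S b" by (auto simp: csm_def intro: smooth_on_subset)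

lemma csm_differentiable: "csm b ==> b differentiable (at x)" using csm_smooth smooth_diff by blast

lemma csm_dd:
 assumes "csm b"
 shows "csm (dd v b)"
proof -
 obtain K where K: "compact K" "!!x. x \<notin> K ==> b x = 0" using assms by (auto simp: csm_def)
 have "dd v b x = 0" if "x \<notin> K" for x
  using dd_cong_open[of "- K" x b "%_. 0"] that K compact_imp_closed open_Compl by fastforce
 thus ?thesis using K assms by (auto simp: csm_def intro: smooth_on_dd)
qed

lemma csm_bounded:
 assumes "csm b"
 obtains C where "C > 0" "!!x. \<bar>b x\<bar> <= C"
proof -
 obtain K where K: "compact K" "!!x. x \<notin> K ==> b x = 0" using assms by (auto simp: csm_def)
 have "continuous_on K b" using smooth_cont csm_smooth[OF assms] by blast
 hence "bounded (b ` K)" using K compact_continuous_image compact_imp_bounded by blast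
 then obtain C where "C > 0" "ALL x:K. \<bar>b x\<bar> <= C" by (auto simp: bounded_pos)
 thus ?thesis using that[of C] K by (metis abs_zero less_imp_le)
qed

lemma csm_mult:
 assumes "smooth_on UNIV a" "csm b"
 shows "csm (%x. a x * b x)" using assms unfolding csm_def by (auto intro!: smooth_intros)

lemma csm_dd_bound:
 fixes b :: "real ^ 'n => real"
 assumes "csm b"
 obtains C where "C > 0" "!!x v. \<bar>dd v b x\<bar> <= C * norm v"
proof -
 have "ALL i::'n. EX C. ALL x. \<bar>dx i b x\<bar> <= C" by (rule allI, rule csm_bounded[OF csm_dd[OF assms]], blast)
 from choice[OF this] obtain C where C: "!!i x. \<bar>dx i b x\<bar> <= C i" by blast
 have C0: "C i >= 0" for i using C[of i 0] by linarith
 have "\<bar>dd v b x\<bar> <= ((SU i. C i) + 1) * norm v" for x v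
 proof -
  have "\<bar>dd v b x\<bar> <= (SU i. \<bar>v $ i * dx i b x\<bar>)"
   using sum_abs by (simp add: dd_axis[OF csm_differentiable[OF assms], of v])
  also have "... <= (SU i. norm v * C i)" by (intro sum_mono) (auto simp: abs_mult intro!: mult_mono C component_le_norm_cart)
  also have "... <= ((SU i. C i) + 1) * norm v" by (simp add: sum_distrib_left algebra_simps)
  finally show ?thesis .
 qed
 moreover have "(SU i. C i) + 1 > 0" using sum_nonneg[of UNIV C] C0 by (simp add: add_nonneg_pos)
 ultimately show ?thesis using that by blast
qed

lemma csm_lipschitz:
 fixes b :: "real ^ 'n => real"
 assumes "!!x v. \<bar>dd v b x\<bar> <= C * norm v" "csm b" "s > 0"
 shows "\<bar>b (x + s *\<^sub>R y) - b x\<bar> <= s * (C * norm y)"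
proof -
 have "((%t. b (x + t *\<^sub>R y)) has_real_derivative dd y b (x + t *\<^sub>R y)) (at t)" for t
  by (rule dd_DERIV_line[OF csm_differentiable[OF assms(2)]])
 from MVT2[OF assms(3) this] obtain z where "b (x + s *\<^sub>R y) - b x = s * dd y b (x + z *\<^sub>R y)" by auto
 thus ?thesis using assms(1,3) by (simp add: abs_mult)
qed

subsection \<open>Kernel classes\<close>

text \<open>A kernel is a function of a scale \<open>s \<in> (0,1]\<close> and a pair \<open>(x, y)\<close>; it acts by integrating
 \<open>k s (x, y) F (x + s y)\<close> over \<open>y\<close> and then over \<open>s\<close>.  The flag selects rapid decay in \<open>y\<close>
 (\<open>True\<close>) or polynomial growth in \<open>y\<close> (\<open>False\<close>), uniformly in \<open>s\<close> and \<open>x\<close>.\<close>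

type_synonym 'n kernel = "real => (real ^ 'n) \<times> (real ^ 'n) => real"

definition kbound :: "bool => 'n::finite kernel => bool" where
 "kbound r k \<longleftrightarrow>
  (if r then ALL N. EX C. ALL s:{0<..1}. ALL x y. \<bar>k s (x, y)\<bar> * (1 + norm y) ^ N <= C
   else EX N C. ALL s:{0<..1}. ALL x y. \<bar>k s (x, y)\<bar> <= C * (1 + norm y) ^ N)"

text \<open>Symbol classes: all derivatives in (x, y) up to order \<open>m\<close> obey the same
  kind of bound, uniformly in the scale. Nothing is differentiated in the scale; joint continuity
  supplies measurability in y and continuity in s of the later integrals.\<close>

primrec symb :: "bool => nat => 'n::finite kernel => bool" where
 "symb r 0 k \<longleftrightarrow> continuous_on ({0<..1} \<times> UNIV) (%(s, z). k s z) & kbound r k"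
| "symb r (Suc m) k \<longleftrightarrow> continuous_on ({0<..1} \<times> UNIV) (%(s, z). k s z) & kbound r k &
   (ALL s:{0<..1}. ALL z. k s differentiable (at z)) & (ALL v. symb r m (%s. dd v (k s)))"

definition kern :: "bool => 'n::finite kernel => bool" where
 "kern r k \<longleftrightarrow> (ALL m. symb r m k)"

lemma kbound_FalseI:
 "(!!s x y. s \<in> {0<..1} ==> \<bar>k s (x, y)\<bar> <= C * (1 + norm y) ^ N) ==> kbound False k"
 unfolding kbound_def by (simp only: if_False) blast

lemma symb_base: "symb r m k ==> continuous_on ({0<..1} \<times> UNIV) (%(s, z). k s z)" "symb r m k ==> kbound r k"
 by (cases m; simp)+

lemma symb_differentiable: "symb r (Suc m) k ==> s \<in> {0<..1} ==> k s differentiable (at z)" by simp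

lemma symb_SucD: "symb r (Suc m) k ==> symb r m k" by (induction m arbitrary: k) auto

lemma kbound_cong: "kbound r k ==> (!!s z. s \<in> {0<..1} ==> k s z = l s z) ==> kbound r l"
 unfolding kbound_def by (simp split: if_splits)

lemma symb_cong:
 "symb r m k ==> (!!s z. s \<in> {0<..1} ==> k s z = l s z) ==> symb r m l"
proof (induction m arbitrary: k l)
 case 0
 have "continuous_on ({0<..1} \<times> UNIV) (%(s, z). l s z)"
  by (rule continuous_on_eq[OF symb_base(1)[OF 0(1)]]) (use 0(2) in auto)
 moreover have "kbound r l" by (rule kbound_cong[OF symb_base(2)[OF 0(1)] 0(2)])
 ultimately show ?case by simp
next
 case (Suc m)
 have eq: "k s = l s" if "s \<in> {0<..1}" for s using Suc.prems(2)[OF that] by auto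
 have "continuous_on ({0<..1} \<times> UNIV) (%(s, z). l s z)"
  by (rule continuous_on_eq[OF symb_base(1)[OF Suc.prems(1)]]) (use eq in auto)
 moreover have "kbound r l" using Suc.prems symb_base(2) kbound_cong by blast
 moreover have "symb r m (%s. dd v (l s))" for v by (rule Suc.IH[of "%s. dd v (k s)"]) (use Suc.prems eq in auto)
 moreover have "l s differentiable (at z)" if "s \<in> {0<..1}" for s z
  using symb_differentiable[OF Suc.prems(1) that] unfolding eq[OF that] .
 ultimately show ?case by auto
qed

lemma symb_SucI:
 assumes "continuous_on ({0<..1} \<times> UNIV) (%(s, z). k s z)" "kbound r k"
  "!!s z. s \<in> {0<..1} ==> (k s has_derivative k' s z) (at z)"
  "!!v. symb r m (%s z. k' s z v)"
 shows "symb r (Suc m) k"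
proof -
 have "symb r m (%s. dd v (k s))" for v by (rule symb_cong[OF assms(4)[of v]]) (use dd_eqI[OF assms(3)] in metis)
 moreover have "k s differentiable (at z)" if "s \<in> {0<..1}" for s z
  unfolding differentiable_def using assms(3)[OF that] by blast
 ultimately show ?thesis using assms(1,2) by simp
qed

lemma kbound_add: "kbound r k ==> kbound r l ==> kbound r (%s z. k s z + l s z)"
proof (cases r)
 case True
 assume a: "kbound r k" "kbound r l"
 show ?thesis unfolding kbound_def if_P[OF True]
 proof
  fix N
  obtain C D where "ALL s:{0<..1}. ALL x y. \<bar>k s (x, y)\<bar> * (1 + norm y) ^ N <= C"
   "ALL s:{0<..1}. ALL x y. \<bar>l s (x, y)\<bar> * (1 + norm y) ^ N <= D" using a True unfolding kbound_def by meson
  moreover have "\<bar>a + b\<bar> * c <= C + D" if "\<bar>a\<bar> * c <= C" "\<bar>b\<bar> * c <= D" "c >= 0" for a b c :: real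
   using mult_right_mono[OF abs_triangle_ineq that(3), of a b] that by (simp add: distrib_right)
  ultimately have "ALL s:{0<..1}. ALL x y. \<bar>k s (x, y) + l s (x, y)\<bar> * (1 + norm y) ^ N <= C + D" by simp
  thus "EX C. ALL s:{0<..1}. ALL x y. \<bar>k s (x, y) + l s (x, y)\<bar> * (1 + norm y) ^ N <= C" by blast
 qed
next
 case False
 assume "kbound r k" "kbound r l"
 then obtain N C M D where
  a: "ALL s:{0<..1}. ALL x y. \<bar>k s (x, y)\<bar> <= C * (1 + norm y) ^ N"
  and b: "ALL s:{0<..1}. ALL x y. \<bar>l s (x, y)\<bar> <= D * (1 + norm y) ^ M" using False unfolding kbound_def by meson
 have "\<bar>k s (x, y) + l s (x, y)\<bar> <= (\<bar>C\<bar> + \<bar>D\<bar>) * (1 + norm y) ^ (N + M)" if s: "s \<in> {0<..1}" for s x y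
 proof -
  have "\<bar>k s (x, y)\<bar> <= C * (1 + norm y) ^ N" "\<bar>l s (x, y)\<bar> <= D * (1 + norm y) ^ M" using a b s by auto
  moreover have "C * (1 + norm y) ^ N <= \<bar>C\<bar> * (1 + norm y) ^ (N + M)"
   "D * (1 + norm y) ^ M <= \<bar>D\<bar> * (1 + norm y) ^ (N + M)" by (intro mult_mono power_increasing; simp)+
  ultimately show ?thesis by (simp add: distrib_right)
 qed
 from kbound_FalseI[of "%s z. k s z + l s z", OF this] show ?thesis using False by simp
qed

text \<open>A polynomially growing factor costs a fixed power of 1 + |y|, which a rapidly decaying
  factor can afford because its decay is available at every order.\<close>

lemma kbound_mult: "kbound False k ==> kbound r l ==> kbound r (%s z. k s z * l s z)"
proof -
 assume k: "kbound False k" and l: "kbound r l"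
 obtain N C where C: "ALL s:{0<..1}. ALL x y. \<bar>k s (x, y)\<bar> <= C * (1 + norm y) ^ N" using k unfolding kbound_def by auto
 show ?thesis
 proof (cases r)
  case True
  show ?thesis unfolding kbound_def if_P[OF True]
  proof
   fix M
   obtain D where D: "ALL s:{0<..1}. ALL x y. \<bar>l s (x, y)\<bar> * (1 + norm y) ^ (N + M) <= D"
    using l True unfolding kbound_def by meson
   have "\<bar>k s (x, y) * l s (x, y)\<bar> * (1 + norm y) ^ M <= \<bar>C\<bar> * D" if s: "s \<in> {0<..1}" for s x y
   proof -
    have "\<bar>k s (x, y) * l s (x, y)\<bar> * (1 + norm y) ^ M <= \<bar>C\<bar> * (1 + norm y) ^ N * \<bar>l s (x, y)\<bar> * (1 + norm y) ^ M"
     unfolding abs_mult using C s by (intro mult_right_mono) (auto intro: order.trans[OF _ mult_right_mono[OF abs_ge_self]])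
    also have "... = \<bar>C\<bar> * (\<bar>l s (x, y)\<bar> * (1 + norm y) ^ (N + M))" by (simp add: power_add)
    also have "... <= \<bar>C\<bar> * D" using D s by (intro mult_left_mono) auto
    finally show ?thesis .
   qed
   thus "EX C. ALL s:{0<..1}. ALL x y. \<bar>k s (x, y) * l s (x, y)\<bar> * (1 + norm y) ^ M <= C" by blast
  qed
 next
  case False
  obtain M D where D: "ALL s:{0<..1}. ALL x y. \<bar>l s (x, y)\<bar> <= D * (1 + norm y) ^ M"
   using l False unfolding kbound_def by auto
  have "\<bar>k s (x, y) * l s (x, y)\<bar> <= (C * D) * (1 + norm y) ^ (N + M)" if s: "s \<in> {0<..1}" for s x y
  proof -
   have "\<bar>k s (x, y)\<bar> * \<bar>l s (x, y)\<bar> <= (C * (1 + norm y) ^ N) * (D * (1 + norm y) ^ M)"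
    using C D s by (intro mult_mono) (auto intro: order.trans[OF abs_ge_zero, of "k s (x, y)"])
   thus ?thesis by (simp add: abs_mult power_add mult_ac)
  qed
  from kbound_FalseI[of "%s z. k s z * l s z", OF this] show ?thesis using False by simp
 qed
qed

lemma symb_add: "symb r m k ==> symb r m l ==> symb r m (%s z. k s z + l s z)"
proof (induction m arbitrary: k l)
 case 0
 thus ?case using kbound_add by (auto simp: case_prod_unfold intro: continuous_intros)
next
 case (Suc m)
 show ?case
 proof (rule symb_SucI)
  show "s \<in> {0<..1} ==> ((%z. k s z + l s z) has_derivative (%v. dd v (k s) z + dd v (l s) z)) (at z)" for s z
   by (intro has_derivative_add dd_works symb_differentiable[OF Suc.prems(1)] symb_differentiable[OF Suc.prems(2)])
 qed (use Suc kbound_add in "auto simp: case_prod_unfold intro: continuous_intros")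
qed

lemma symb_mult: "symb False m k ==> symb r m l ==> symb r m (%s z. k s z * l s z)"
proof (induction m arbitrary: k l)
 case 0
 thus ?case using kbound_mult by (auto simp: case_prod_unfold intro: continuous_intros)
next
 case (Suc m)
 show ?case
 proof (rule symb_SucI)
  show "s \<in> {0<..1} ==> ((%z. k s z * l s z) has_derivative (%v. k s z * dd v (l s) z + dd v (k s) z * l s z)) (at z)" for s z
   by (intro has_derivative_mult dd_works symb_differentiable[OF Suc.prems(1)] symb_differentiable[OF Suc.prems(2)])
  show "symb r m (%s z. k s z * dd v (l s) z + dd v (k s) z * l s z)" for v
   using Suc.prems symb_SucD[OF Suc.prems(1)] symb_SucD[OF Suc.prems(2)] by (intro symb_add Suc.IH) auto
 qed (use Suc kbound_mult in "auto simp: case_prod_unfold intro: continuous_intros")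
qed

lemma symb_scalar:
 assumes "continuous_on {0<..1} c" "!!s. s \<in> {0<..1} ==> \<bar>c s\<bar> <= B"
 shows "symb False m (%s z. c s)"
proof -
 have c: "continuous_on ({0<..1} \<times> UNIV) (%(s, z). c s)"
  unfolding case_prod_unfold by (rule continuous_on_compose2[OF assms(1)]) (auto intro!: continuous_intros)
 have b: "kbound False (%s z. c s)" by (rule kbound_FalseI[of _ B 0]) (use assms(2) in simp)
 have z: "symb False m (%s z. 0)" for m
  by (induction m) (auto intro!: kbound_FalseI[of _ 0 0] simp: dd_const[abs_def] case_prod_unfold)
 show ?thesis by (cases m) (use c b z in "auto simp: dd_const[abs_def]")
qed

section \<open>Algebra of the kernel classes and their basic members\<close>

lemma kern_dd: "kern r k ==> kern r (%s. dd v (k s))" unfolding kern_def using symb.simps(2) by blast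

lemma kern_add: "kern r k ==> kern r l ==> kern r (%s z. k s z + l s z)" unfolding kern_def using symb_add by blast

lemma kern_mult: "kern False k ==> kern r l ==> kern r (%s z. k s z * l s z)" unfolding kern_def using symb_mult by blast

lemma kern_const: "kern False (%s z. c)" unfolding kern_def using symb_scalar[of "%_. c" "\<bar>c\<bar>"] by auto

lemma kern_scale: "kern False (%s z. s)" unfolding kern_def using symb_scalar[of "%s. s" 1] by auto

lemma kern_cmult: "kern r k ==> kern r (%s z. c * k s z)" using kern_mult[OF kern_const] .

lemma kern_minus: "kern r k ==> kern r (%s z. - k s z)" using kern_cmult[of r k "-1"] by simp

lemma kern_diff: "kern r k ==> kern r l ==> kern r (%s z. k s z - l s z)" using kern_add[OF _ kern_minus] by fastforce

lemma kern_zero: "kern r ((%s z. 0) :: 'n::finite kernel)"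
proof (cases r)
 case True
 have "symb True m ((%s z. 0) :: 'n kernel)" for m by (induction m) (auto simp: kbound_def case_prod_unfold dd_const[abs_def])
 thus ?thesis unfolding kern_def using True by simp
qed (use kern_const[of 0] in simp)

lemma kern_sum: "(!!i. i \<in> I ==> kern r (k i)) ==> kern r (%s z. SUM i:I. k i s z)"
 by (induction I rule: infinite_finite_induct) (auto intro: kern_add kern_zero)

lemma kern_differentiable: "kern r k ==> s \<in> {0<..1} ==> k s differentiable (at z)"
 unfolding kern_def using symb.simps(2) by blast

lemma kern_snd: "kern False (%s (z::(real ^ 'n::finite) \<times> (real ^ 'n)). snd z $ i)"
proof -
 have s: "symb False m (%s (z::(real ^ 'n) \<times> (real ^ 'n)). snd z $ i)" for m
 proof (cases m)
  have c: "continuous_on ({0<..1::real} \<times> UNIV) (%(s, z::(real ^ 'n) \<times> (real ^ 'n)). snd z $ i)"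
   by (auto simp: case_prod_unfold intro!: continuous_intros)
  have b: "kbound False (%s (z::(real ^ 'n) \<times> (real ^ 'n)). snd z $ i)"
   by (rule kbound_FalseI[of _ 1 1]) (auto intro!: add_increasing component_le_norm_cart)
  {
   case 0
   show ?thesis unfolding 0 using b c by simp
  next
   case (Suc j)
   have "((%z::(real ^ 'n) \<times> (real ^ 'n). snd z $ i) has_derivative (%v. snd v $ i)) (at z)" for z
    by (intro bounded_linear_imp_has_derivative bounded_linear_compose[OF bounded_linear_vec_nth bounded_linear_snd])
   thus ?thesis unfolding Suc using symb_scalar[of "%_. c" "\<bar>c\<bar>" for c]
    by (intro symb_SucI[OF c b, where k' = "%s z v. snd v $ i"]) auto
  }
 qed
 thus ?thesis by (simp add: kern_def)
qed

lemma symb_sum: "(!!i. i \<in> I ==> symb r m (k i)) ==> symb r m (%s z. SUM i:I. k i s z)"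
proof (induction I rule: infinite_finite_induct)
 case (insert x F)
 thus ?case by (auto intro: symb_add)
qed (use kern_zero in "auto simp: kern_def")

text \<open>The parameter \<open>a\<close> treats b(x) and b(x + s y) in a single induction; the
  chain rule contributes only the bounded factor a s.\<close>

lemma kern_shift:
 fixes b :: "real ^ 'n::finite => real"
 assumes "csm b" "a \<in> {0, 1}"
 shows "kern False (%s z. b (fst z + (a * s) *\<^sub>R snd z))"
proof -
 have "symb False m (%s z. b (fst z + (a * s) *\<^sub>R snd z))" for m using assms(1)
 proof (induction m arbitrary: b)
  case 0
  obtain C where C: "C > 0" "!!x. \<bar>b x\<bar> <= C" by (rule csm_bounded[OF 0], rule that)
  have "continuous_on ({0<..1} \<times> UNIV) (%(s, z). b (fst z + (a * s) *\<^sub>R snd z))" unfolding case_prod_unfold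
   by (rule continuous_on_compose2[OF smooth_cont[OF csm_smooth[OF 0, of UNIV]]]) (auto intro!: continuous_intros)
  thus ?case using C by (auto simp: kbound_def intro!: exI[of _ 0] exI[of _ C])
 next
  case (Suc m)
  have "symb False 0 (%s z. b (fst z + (a * s) *\<^sub>R snd z))"
  proof -
   obtain C where C: "C > 0" "!!x. \<bar>b x\<bar> <= C" by (rule csm_bounded[OF Suc.prems], rule that)
   have "continuous_on ({0<..1} \<times> UNIV) (%(s, z). b (fst z + (a * s) *\<^sub>R snd z))" unfolding case_prod_unfold
    by (rule continuous_on_compose2[OF smooth_cont[OF csm_smooth[OF Suc.prems, of UNIV]]]) (auto intro!: continuous_intros)
   thus ?thesis using C by (auto simp: kbound_def intro!: exI[of _ 0] exI[of _ C])
  qed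
  note base = this
  show ?case
  proof (intro symb_SucI)
   show "((%z. b (fst z + (a * s) *\<^sub>R snd z)) has_derivative
     (%v. SU i. (fst v $ i + a * s * snd v $ i) * dx i b (fst z + (a * s) *\<^sub>R snd z))) (at z)" for s z
   proof -
    have "((%z. fst z + (a * s) *\<^sub>R snd z) has_derivative (%v. fst v + (a * s) *\<^sub>R snd v)) (at z)"
     by (auto intro!: derivative_eq_intros)
    note t = has_derivative_compose[OF this dd_works[OF csm_differentiable[OF Suc.prems]]]
    show ?thesis by (rule has_derivative_eq_rhs[OF t]) (rule ext, subst dd_axis[OF csm_differentiable[OF Suc.prems]], simp)
   qed
   have s: "symb False m (%s z. c + a * s * d)" for c d
   proof (rule symb_scalar)
    show "\<bar>c + a * s * d\<bar> <= \<bar>c\<bar> + \<bar>d\<bar>" if "s \<in> {0<..1}" for s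
     using that assms(2) mult_right_mono[of s 1 "\<bar>d\<bar>"] by (auto simp: abs_mult intro!: order.trans[OF abs_triangle_ineq])
   qed (auto intro!: continuous_intros)
   show "symb False m (%s z. SU i. (fst v $ i + a * s * snd v $ i) * dx i b (fst z + (a * s) *\<^sub>R snd z))" for v
    by (intro symb_sum symb_mult Suc.IH csm_dd[OF Suc.prems] s)
  qed (use base in auto)
 qed
 thus ?thesis by (simp add: kern_def)
qed

lemma kern_fst: "csm b ==> kern False (%s z. b (fst z))" using kern_shift[of b 0] by simp

lemma kern_target: "csm b ==> kern False (%s z. b (fst z + s *\<^sub>R snd z))" using kern_shift[of b 1] by simp

text \<open>Division by s is harmless uniformly down to s = 0: the quotient is at most a Lipschitz
  constant times |y|, its x-derivatives are quotients of the same form for derivatives of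
  \<open>b\<close>, and in y-derivatives the division by s cancels.\<close>

lemma kern_quotient:
 fixes b :: "real ^ 'n::finite => real"
 assumes "csm b"
 shows "kern False (%s z. (b (fst z + s *\<^sub>R snd z) - b (fst z)) / s)"
proof -
 have "symb False m (%s z. (b (fst z + s *\<^sub>R snd z) - b (fst z)) / s)" for m using assms
 proof (induction m arbitrary: b)
  have base: "symb False 0 (%s z. (b (fst z + s *\<^sub>R snd z) - b (fst z)) / s)" if b: "csm b" for b :: "real ^ 'n => real"
  proof -
   obtain C where C: "C > 0" "!!x v. \<bar>dd v b x\<bar> <= C * norm v" by (rule csm_dd_bound[OF b], rule that)
   have "\<bar>(b (x + s *\<^sub>R y) - b x) / s\<bar> <= C * (1 + norm y) ^ 1" if "s \<in> {0<..1}" for s x y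
   proof -
    have "\<bar>(b (x + s *\<^sub>R y) - b x) / s\<bar> <= C * norm y"
     using csm_lipschitz[OF C(2) b, of s x y] that by (simp add: divide_le_eq mult.commute)
    also have "... <= C * (1 + norm y) ^ 1" using C(1) by simp
    finally show ?thesis .
   qed
   hence "kbound False (%s z. (b (fst z + s *\<^sub>R snd z) - b (fst z)) / s)"
    using kbound_FalseI[of "%s z. (b (fst z + s *\<^sub>R snd z) - b (fst z)) / s" C 1] unfolding fst_conv snd_conv by blast
   moreover have "continuous_on ({0<..1} \<times> UNIV) (%(s, z). (b (fst z + s *\<^sub>R snd z) - b (fst z)) / s)"
    unfolding case_prod_unfold
    by (intro continuous_intros continuous_on_compose2[OF smooth_cont[OF csm_smooth[OF b, of UNIV]]]) auto
   ultimately show ?thesis by simp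
  qed
  {
   case 0
   thus ?case by (rule base)
  next
  case (Suc m)
  show ?case
  proof (intro symb_SucI)
   show "((%z. (b (fst z + s *\<^sub>R snd z) - b (fst z)) / s) has_derivative
     (%v. (SU i. fst v $ i * ((dx i b (fst z + s *\<^sub>R snd z) - dx i b (fst z)) / s))
       + (SU i. snd v $ i * dx i b (fst z + s *\<^sub>R snd z)))) (at z)" if "s \<in> {0<..1}" for s z
   proof -
    have 1: "((%z. fst z + s *\<^sub>R snd z) has_derivative (%v. fst v + s *\<^sub>R snd v)) (at z)"
     by (auto intro!: derivative_eq_intros)
    have 2: "(fst has_derivative fst) (at z)" by (auto intro!: derivative_eq_intros)
    note d = has_derivative_compose[OF 1 dd_works[OF csm_differentiable[OF Suc.prems]]]
     has_derivative_compose[OF 2 dd_works[OF csm_differentiable[OF Suc.prems]]]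
    have "((%z. (b (fst z + s *\<^sub>R snd z) - b (fst z)) / s) has_derivative
     (%v. (dd (fst v + s *\<^sub>R snd v) b (fst z + s *\<^sub>R snd z) - dd (fst v) b (fst z)) / s)) (at z)"
     unfolding divide_inverse by (intro has_derivative_mult_left has_derivative_diff d)
    moreover have "(dd (fst v + s *\<^sub>R snd v) b (fst z + s *\<^sub>R snd z) - dd (fst v) b (fst z)) / s =
     (SU i. fst v $ i * ((dx i b (fst z + s *\<^sub>R snd z) - dx i b (fst z)) / s))
       + (SU i. snd v $ i * dx i b (fst z + s *\<^sub>R snd z))" for v
     using that unfolding dd_axis[OF csm_differentiable[OF Suc.prems], of "fst v"] dd_axis[OF csm_differentiable[OF Suc.prems], of "fst v + _"]
     by (simp add: sum.distrib[symmetric] sum_subtractf[symmetric] sum_divide_distrib field_simps flip: sum_distrib_left)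
    ultimately show ?thesis by simp
   qed
   show "symb False m (%s z. (SU i. fst v $ i * ((dx i b (fst z + s *\<^sub>R snd z) - dx i b (fst z)) / s))
       + (SU i. snd v $ i * dx i b (fst z + s *\<^sub>R snd z)))" for v
    using kern_target[OF csm_dd[OF Suc.prems]] kern_const unfolding kern_def
    by (intro symb_add symb_sum symb_mult Suc.IH csm_dd[OF Suc.prems]) auto
  qed (use base[OF Suc.prems] in auto)
  }
 qed
 thus ?thesis by (simp add: kern_def)
qed

text \<open>A derivative only replaces the prefactor p by p' - p Q', again of polynomial growth.
  Hence the decay has to be estimated for the undifferentiated kernel alone.\<close>

lemma kern_gauss:
 assumes Q: "kern False Q" and l: "l > 0" "!!s x y. s \<in> {0<..1} ==> Q s (x, y) >= l * (norm y)\<^sup>2"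
  and p: "kern False p"
 shows "kern True (%s z. p s z * exp (- Q s z))"
proof -
 have base: "symb True 0 (%s z. p s z * exp (- Q s z))" if p: "kbound False p" "continuous_on ({0<..1} \<times> UNIV) (%(s, z). p s z)" for p
 proof -
  have "continuous_on ({0<..1} \<times> UNIV) (%(s, z). Q s z)" using Q symb_base(1) by (auto simp: kern_def)
  hence "continuous_on ({0<..1} \<times> UNIV) (%(s, z). p s z * exp (- Q s z))"
   using p(2) by (auto simp: case_prod_unfold intro!: continuous_intros)
  moreover have "kbound True (%s z. p s z * exp (- Q s z))" unfolding kbound_def if_P[OF TrueI]
  proof
   fix M
   obtain N C where C: "ALL s:{0<..1}. ALL x y. \<bar>p s (x, y)\<bar> <= C * (1 + norm y) ^ N"
    using p unfolding kbound_def by auto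
   have "((%t::real. (1 + t) ^ (N + M) * exp (- (l * t\<^sup>2))) \<longlongrightarrow> 0) at_top" using l(1) by real_asymp
   hence "\<forall>\<^sub>F t::real in at_top. (1 + t) ^ (N + M) * exp (- (l * t\<^sup>2)) < 1" by (rule order_tendstoD) auto
   then obtain R where R: "!!t. t >= R ==> (1 + t) ^ (N + M) * exp (- (l * t\<^sup>2)) < 1"
    by (auto simp: eventually_at_top_linorder)
   have D: "(1 + t) ^ (N + M) * exp (- (l * t\<^sup>2)) <= 1 + (1 + \<bar>R\<bar>) ^ (N + M)" if "t >= 0" for t
   proof (cases "t >= R")
    case True
    thus ?thesis using R[OF True] by (smt (verit) zero_le_power)
   next
    case False
    have "(1 + t) ^ (N + M) * exp (- (l * t\<^sup>2)) <= (1 + \<bar>R\<bar>) ^ (N + M) * 1"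
     using False that l by (intro mult_mono power_mono) auto
    thus ?thesis by simp
   qed
   have "\<bar>p s (x, y) * exp (- Q s (x, y))\<bar> * (1 + norm y) ^ M <= \<bar>C\<bar> * (1 + (1 + \<bar>R\<bar>) ^ (N + M))" if s: "s \<in> {0<..1}" for s x y
   proof -
    have "\<bar>p s (x, y)\<bar> <= \<bar>C\<bar> * (1 + norm y) ^ N"
     using C s by (auto intro: order.trans[OF _ mult_right_mono[OF abs_ge_self]])
    hence "\<bar>p s (x, y) * exp (- Q s (x, y))\<bar> * (1 + norm y) ^ M <= (\<bar>C\<bar> * (1 + norm y) ^ N * exp (- (l * (norm y)\<^sup>2))) * (1 + norm y) ^ M"
     unfolding abs_mult using l(2)[OF s] by (intro mult_mono) auto
    also have "... = \<bar>C\<bar> * ((1 + norm y) ^ (N + M) * exp (- (l * (norm y)\<^sup>2)))" by (simp add: power_add)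
    also have "... <= \<bar>C\<bar> * (1 + (1 + \<bar>R\<bar>) ^ (N + M))" using D[of "norm y"] by (intro mult_left_mono) auto
    finally show ?thesis .
   qed
   thus "EX C. ALL s:{0<..1}. ALL x y. \<bar>p s (x, y) * exp (- Q s (x, y))\<bar> * (1 + norm y) ^ M <= C" by blast
  qed
  ultimately show ?thesis by simp
 qed
 have "symb True m (%s z. p s z * exp (- Q s z))" for m using p
 proof (induction m arbitrary: p)
  case 0
  hence "kbound False p" "continuous_on ({0<..1} \<times> UNIV) (%(s, z). p s z)" using symb_base unfolding kern_def by blast+
  thus ?case by (rule base)
 next
  case (Suc m)
  show ?case
  proof (rule symb_SucI)
   show "((%z. p s z * exp (- Q s z)) has_derivative (%v. (dd v (p s) z - p s z * dd v (Q s) z) * exp (- Q s z))) (at z)"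
    if "s \<in> {0<..1}" for s z
    using dd_works[OF kern_differentiable[OF Suc.prems that, of z]] dd_works[OF kern_differentiable[OF Q that, of z]]
    by (auto intro!: derivative_eq_intros simp: algebra_simps)
   show "symb True m (%s z. (dd v (p s) z - p s z * dd v (Q s) z) * exp (- Q s z))" for v
    by (intro Suc.IH kern_diff kern_mult kern_dd Suc.prems Q)
   have "kbound False p" "continuous_on ({0<..1} \<times> UNIV) (%(s, z). p s z)"
    using Suc.prems symb_base unfolding kern_def by blast+
   thus "continuous_on ({0<..1} \<times> UNIV) (%(s, z). p s z * exp (- Q s z))"
    "kbound True (%s z. p s z * exp (- Q s z))" using base by auto
  qed
 qed
 thus ?thesis by (simp add: kern_def)
qed

subsection \<open>Differentiation under the integral sign\<close>

lemma abs_integral_le: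
 fixes f g :: "'w => real"
 assumes "integrable M f" "integrable M g" "!!w. w \<in> space M ==> \<bar>f w\<bar> <= C * g w"
 shows "\<bar>\<integral>w. f w \<partial>M\<bar> <= C * (LINT w|M. g w)"
proof -
 have "\<bar>\<integral>w. f w \<partial>M\<bar> <= (LINT w|M. \<bar>f w\<bar>)" by (rule integral_abs_bound)
 also have "... <= (LINT w|M. C * g w)" using assms by (intro integral_mono) auto
 finally show ?thesis by simp
qed

text \<open>Dominated convergence for the normalized Taylor remainder. On the convex set
  \<open>S\<close> the mean value inequality bounds the difference quotient by \<open>B\<close>, and
  the linear term is bounded by \<open>B\<close> as well, whence the majorant 2 B.\<close>

lemma has_derivative_lebesgue_integral:
 fixes f :: "'b::euclidean_space => 'w => real"
 assumes S: "open S" "convex S" "x0 \<in> S"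
  and d: "!!x w. x \<in> S ==> w \<in> space M ==> ((%x. f x w) has_derivative f' x w) (at x)"
  and i: "!!x. x \<in> S ==> integrable M (f x)"
  and m: "!!v. (%w. f' x0 w v) \<in> borel_measurable M"
  and b: "!!x w v. x \<in> S ==> w \<in> space M ==> \<bar>f' x w v\<bar> <= norm v * B w"
  and B: "integrable M B"
 shows "((%x. \<integral>w. f x w \<partial>M) has_derivative (%v. \<integral>w. f' x0 w v \<partial>M)) (at x0)"
proof -
 have i': "integrable M (%w. f' x0 w v)" for v
  by (rule Bochner_Integration.integrable_bound[OF integrable_mult_right[OF B, of "norm v"] m])
   (use b[OF S(3)] in "fastforce intro: order.trans")
 have lin: "linear (f' x0 w)" if "w \<in> space M" for w using d[OF S(3) that] has_derivative_linear by blast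
 have B0: "B w >= 0" if "w \<in> space M" for w
 proof -
  obtain v :: 'b where v: "v \<in> Basis" using nonempty_Basis by blast
  have "0 <= norm v * B w" using b[OF S(3) that, of v] by linarith
  thus ?thesis using v by simp
 qed
 have bl: "bounded_linear (%v. \<integral>w. f' x0 w v \<partial>M)"
 proof (rule bounded_linear_intro[where K = "\<integral>w. B w \<partial>M"])
  show "(LINT w|M. f' x0 w (u + v)) = (LINT w|M. f' x0 w u) + (LINT w|M. f' x0 w v)" for u v
   by (subst Bochner_Integration.integral_add[symmetric, OF i' i'])
    (auto intro!: Bochner_Integration.integral_cong linear_add[OF lin])
  show "(LINT w|M. f' x0 w (c *\<^sub>R v)) = c *\<^sub>R (LINT w|M. f' x0 w v)" for c v
  proof -
   have "(LINT w|M. f' x0 w (c *\<^sub>R v)) = (LINT w|M. c *\<^sub>R f' x0 w v)"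
    by (intro Bochner_Integration.integral_cong) (auto simp: linear_cmul[OF lin])
   thus ?thesis by simp
  qed
  show "norm (LINT w|M. f' x0 w v) <= norm v * (LINT w|M. B w)" for v using abs_integral_le[OF i' B b[OF S(3)], of v] by simp
 qed
 moreover have "((%y. norm ((LINT w|M. f y w) - (LINT w|M. f x0 w) - (LINT w|M. f' x0 w (y - x0))) / norm (y - x0)) \<longlongrightarrow> 0) (at x0)"
  unfolding tendsto_at_iff_sequentially
 proof (intro allI impI)
  fix X :: "nat => 'b" assume "ALL i. X i \<in> UNIV - {x0}" and X: "X \<longlonglongrightarrow> x0"
  hence ne: "X i ~= x0" for i by auto
  \<comment> \<open>The value 0 is taken when \<open>X i\<close> lies outside \<open>S\<close>,
    which happens for finitely many \<open>i\<close> only; this makes every \<open>h i\<close>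
    integrable and dominated.\<close>
  define h where "h i w = (if X i \<in> S then (f (X i) w - f x0 w - f' x0 w (X i - x0)) / norm (X i - x0) else 0)" for i w
  have h_int: "integrable M (h i)" for i
  proof (cases "X i \<in> S")
   case True
   thus ?thesis using i[OF True] i[OF S(3)] i' by (auto simp: h_def[abs_def])
  qed (simp add: h_def[abs_def])
  have "(%i. \<integral>w. h i w \<partial>M) \<longlonglongrightarrow> (LINT w|M. 0)"
  proof (rule integral_dominated_convergence[where w = "%w. 2 * B w"])
   show "integrable M (%w. 2 * B w)" using B by simp
   show "AE w in M. (%i. h i w) \<longlonglongrightarrow> 0"
   proof (rule AE_I2)
    fix w assume w: "w \<in> space M"
    have "((%y. norm (f y w - f x0 w - f' x0 w (y - x0)) / norm (y - x0)) \<longlongrightarrow> 0) (at x0)"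
     using d[OF S(3) w] by (simp add: has_derivative_iff_norm)
    hence "((%y. norm (f y w - f x0 w - f' x0 w (y - x0)) / norm (y - x0)) \<circ> X) \<longlonglongrightarrow> 0"
     using X ne by (auto simp: tendsto_at_iff_sequentially)
    hence "(%i. norm ((f (X i) w - f x0 w - f' x0 w (X i - x0)) / norm (X i - x0))) \<longlonglongrightarrow> 0"
     by (simp add: o_def)
    hence "(%i. (f (X i) w - f x0 w - f' x0 w (X i - x0)) / norm (X i - x0)) \<longlonglongrightarrow> 0"
     by (rule tendsto_norm_zero_cancel)
    thus "(%i. h i w) \<longlonglongrightarrow> 0"
    proof (rule Lim_transform_eventually)
     show "\<forall>\<^sub>F i in sequentially. (f (X i) w - f x0 w - f' x0 w (X i - x0)) / norm (X i - x0) = h i w"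
      using topological_tendstoD[OF X S(1,3)] by eventually_elim (simp add: h_def)
    qed
   qed
   show "AE w in M. norm (h i w) <= 2 * B w" for i
   proof (rule AE_I2)
    fix w assume w: "w \<in> space M"
    show "norm (h i w) <= 2 * B w"
    proof (cases "X i \<in> S")
     case True
     have "norm (f (X i) w - f x0 w) <= B w * norm (X i - x0)"
     proof (rule differentiable_bound[OF S(2) _ _ True S(3)])
      show "x \<in> S ==> ((%x. f x w) has_derivative f' x w) (at x within S)" for x
       using d[OF _ w] has_derivative_at_withinI by blast
      show "x \<in> S ==> onorm (f' x w) <= B w" for x using b[OF _ w] by (intro onorm_le) (simp add: mult.commute)
     qed
     moreover have "norm (f' x0 w (X i - x0)) <= B w * norm (X i - x0)" using b[OF S(3) w] by (simp add: mult.commute)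
     ultimately have "norm (f (X i) w - f x0 w - f' x0 w (X i - x0)) <= 2 * B w * norm (X i - x0)"
      using norm_triangle_ineq4[of "f (X i) w - f x0 w" "f' x0 w (X i - x0)"] by linarith
     thus ?thesis using True ne[of i] by (simp add: h_def divide_le_eq)
    qed (use B0[OF w] in "simp add: h_def")
   qed
  qed (use h_int in auto)
  hence "(%i. norm (LINT w|M. h i w)) \<longlonglongrightarrow> 0" using tendsto_norm_zero by fastforce
  thus "((%y. norm ((LINT w|M. f y w) - (LINT w|M. f x0 w) - (LINT w|M. f' x0 w (y - x0))) / norm (y - x0)) \<circ> X) \<longlonglongrightarrow> 0"
  proof (rule Lim_transform_eventually)
   show "\<forall>\<^sub>F i in sequentially. norm (LINT w|M. h i w) =
    ((%y. norm ((LINT w|M. f y w) - (LINT w|M. f x0 w) - (LINT w|M. f' x0 w (y - x0))) / norm (y - x0)) \<circ> X) i"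
    using topological_tendstoD[OF X S(1,3)]
   proof eventually_elim
    case (elim n)
    have "(LINT w|M. h n w) = (LINT w|M. f (X n) w - f x0 w - f' x0 w (X n - x0)) / norm (X n - x0)"
     using elim by (simp add: h_def[abs_def])
    also have "(LINT w|M. f (X n) w - f x0 w - f' x0 w (X n - x0)) =
      (LINT w|M. f (X n) w) - (LINT w|M. f x0 w) - (LINT w|M. f' x0 w (X n - x0))" using i[OF elim] i[OF S(3)] i' by simp
    finally show ?case by simp
   qed
  qed
 qed
 ultimately show ?thesis by (simp add: has_derivative_iff_norm)
qed

subsection \<open>Integrals of kernels\<close>

text \<open>An integrable weight: two powers per coordinate, so that it is dominated by the product
  of the functions 1 / (1 + t^2) of the single coordinates.\<close>

definition wt :: "real ^ 'n::finite => real" where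
 "wt y = 1 / (1 + norm y) ^ (2 * CARD('n))"

lemma wt_pos: "wt y > 0" "wt y >= 0" by (auto simp: wt_def add_pos_nonneg intro!: zero_less_power divide_nonneg_nonneg)

lemma continuous_wt [continuous_intros]: "continuous_on S wt"
 unfolding wt_def[abs_def] by (intro continuous_intros) (auto simp: add_nonneg_eq_0_iff)

lemma integrable_wt: "integrable lborel (wt :: real ^ 'n::finite => real)"
proof -
 have 1: "set_integrable lborel (einterval (-\<infinity>) \<infinity>) (%t. inverse (1 + t\<^sup>2) :: real)"
  by (rule interval_integral_FTC_nonneg(1)[where F = arctan and A = "- (pi / 2)" and B = "pi / 2"])
   (auto intro!: derivative_eq_intros continuous_intros simp: ereal_tendsto_simps tendsto_arctan_at_bot tendsto_arctan_at_top add_nonneg_eq_0_iff)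
 have 2: "(\<integral>\<^sup>+t. ennreal (inverse (1 + t\<^sup>2)) \<partial>lborel) < \<infinity>"
  using 1 unfolding set_integrable_def by (simp add: integrable_iff_bounded einterval_def add_nonneg_nonneg)
 have 3: "(\<integral>\<^sup>+(y::real ^ 'n). (\<Prod>b\<in>Basis. ennreal (inverse (1 + (y \<bullet> b)\<^sup>2))) \<partial>lborel) < \<infinity>"
  using 2 by (subst nn_integral_lborel_prod) (auto simp: prod_ennreal less_top add_nonneg_nonneg power_less_top_ennreal)
 have le: "wt y <= (\<Prod>b\<in>Basis. inverse (1 + (y \<bullet> b)\<^sup>2))" for y :: "real ^ 'n"
 proof -
  have "(\<Prod>b\<in>(Basis::(real ^ 'n) set). inverse ((1 + norm y)\<^sup>2)) <= (\<Prod>b\<in>Basis. inverse (1 + (y \<bullet> b)\<^sup>2))"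
  proof (intro prod_mono conjI)
   fix b :: "real ^ 'n" assume "b \<in> Basis"
   hence "(y \<bullet> b)\<^sup>2 <= (norm y)\<^sup>2" using Basis_le_norm[of b y] by (metis abs_le_square_iff abs_norm_cancel)
   hence "1 + (y \<bullet> b)\<^sup>2 <= (1 + norm y)\<^sup>2" by (simp add: power2_sum add_increasing2)
   thus "inverse ((1 + norm y)\<^sup>2) <= inverse (1 + (y \<bullet> b)\<^sup>2)"
    by (intro le_imp_inverse_le) (auto simp: add_pos_nonneg)
  qed auto
  thus ?thesis by (simp add: wt_def power_mult inverse_eq_divide power_one_over flip: power_inverse)
 qed
 show ?thesis
 proof (rule integrableI_bounded)
  show "wt \<in> borel_measurable lborel" by (simp add: borel_measurable_continuous_onI continuous_wt)
  have "(\<integral>\<^sup>+(y::real ^ 'n). ennreal (norm (wt y)) \<partial>lborel) <= (\<integral>\<^sup>+(y::real ^ 'n). (\<Prod>b\<in>Basis. ennreal (inverse (1 + (y \<bullet> b)\<^sup>2))) \<partial>lborel)"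
   using le by (intro nn_integral_mono) (auto simp: prod_ennreal add_nonneg_nonneg abs_of_nonneg[OF wt_pos(2)] intro!: ennreal_leI)
  thus "(\<integral>\<^sup>+(y::real ^ 'n). ennreal (norm (wt y)) \<partial>lborel) < \<infinity>" using 3 by (rule le_less_trans)
 qed
qed

lemma kern_bound:
 fixes h :: "'n::finite kernel"
 assumes "kern True h"
 obtains C where "C >= 0" "!!s x y. s \<in> {0<..1} ==> \<bar>h s (x, y)\<bar> <= C * wt y"
proof -
 have "kbound True h" using assms symb_base(2) by (auto simp: kern_def)
 then obtain C where C: "ALL s:{0<..1}. ALL x y. \<bar>h s (x, y)\<bar> * (1 + norm y) ^ (2 * CARD('n)) <= C"
  unfolding kbound_def if_P[OF TrueI] by blast
 have "\<bar>h s (x, y)\<bar> <= \<bar>C\<bar> * wt y" if "s \<in> {0<..1}" for s x y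
 proof -
  have "\<bar>h s (x, y)\<bar> * (1 + norm y) ^ (2 * CARD('n)) <= \<bar>C\<bar>" using C that by (meson abs_ge_self order.trans)
  moreover have "(1 + norm y) ^ (2 * CARD('n)) > 0" by (simp add: add_pos_nonneg)
  ultimately show ?thesis by (simp add: wt_def le_divide_eq)
 qed
 thus ?thesis using that[of "\<bar>C\<bar>"] by simp
qed

lemma kern_continuous: "kern r h ==> continuous_on ({0<..1} \<times> UNIV) (%(s, z). h s z)"
 using symb_base(1) by (auto simp: kern_def)

lemma kern_measurable:
 assumes "kern r h" "s \<in> {0<..1}"
 shows "(%y. h s (x, y)) \<in> borel_measurable lborel"
proof -
 have "continuous_on UNIV (%y. (%(s, z). h s z) (s, (x, y)))"
  using assms(2) by (intro continuous_on_compose2[OF kern_continuous[OF assms(1)]]) (auto intro!: continuous_intros)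
 thus ?thesis by (simp add: borel_measurable_continuous_onI)
qed

definition Jint :: "'n::finite kernel => real => real ^ 'n => real" where
 "Jint h s x = (LBINT y. h s (x, y))"

lemma kern_integrable:
 assumes "kern True h" "s \<in> {0<..1}"
 shows "integrable lborel (%y. h s (x, y))"
proof -
 obtain C where C: "C >= 0" "!!s x y. s \<in> {0<..1} ==> \<bar>h s (x, y)\<bar> <= C * wt y"
  by (rule kern_bound[OF assms(1)], rule that)
 show ?thesis
  by (rule Bochner_Integration.integrable_bound[OF integrable_mult_right[OF integrable_wt, of C] kern_measurable[OF assms]])
   (use C(2)[OF assms(2)] in "auto intro!: AE_I2 order.trans[OF _ abs_ge_self]")
qed

lemma Jint_le:
 fixes h :: "'n::finite kernel"
 assumes "s \<in> {0<..1}" "!!y. \<bar>h s (x, y)\<bar> <= C * wt y"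
 shows "\<bar>Jint h s x\<bar> <= C * (LBINT y. wt (y :: real ^ 'n))"
proof (cases "integrable lborel (%y. h s (x, y))")
 case True
 thus ?thesis unfolding Jint_def by (rule abs_integral_le[OF _ integrable_wt]) (rule assms(2))
next
 \<comment> \<open>The integral then has the default value 0, and the claim reduces to nonnegativity
   of \<open>C\<close>.\<close>
 case False
 have "0 <= C * wt (0 :: real ^ 'n)" using assms(2)[of 0] by linarith
 hence "C >= 0" using wt_pos(1)[of "0 :: real ^ 'n"] by (simp add: zero_le_mult_iff)
 thus ?thesis using False by (simp add: Jint_def not_integrable_integral_eq wt_pos)
qed

lemma dd_fst_axis:
 fixes f :: "(real ^ 'n) \<times> (real ^ 'n) => real"
 assumes "f differentiable (at z)"
 shows "dd (v, 0) f z = (SU i. v $ i * dd (axis i 1, 0) f z)"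
proof -
 note lin = linear_dd[OF assms]
 have "dd (v, 0) f z = dd (SU i. v $ i *\<^sub>R (axis i 1, 0)) f z" by (rule arg_cong[of _ _ "%v. dd v f z"])
   (simp add: prod_eq_iff fst_sum snd_sum vec_eq_iff axis_def if_distrib cong: if_cong)
 also have "... = (SU i. v $ i * dd (axis i 1, 0) f z)" unfolding linear_sum[OF lin] linear_cmul[OF lin] by simp
 finally show ?thesis .
qed

lemma kern_dd_bound:
 fixes h :: "'n::finite kernel"
 assumes "kern True h"
 obtains C where "C >= 0" "!!s x y v. s \<in> {0<..1} ==> \<bar>dd (v, 0) (h s) (x, y)\<bar> <= norm v * (C * wt y)"
proof -
 have "ALL i. EX C>=0. ALL s:{0<..1}. ALL x y. \<bar>dd (axis i 1, 0) (h s) (x, y)\<bar> <= C * wt y"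
  by (rule allI, rule kern_bound[OF kern_dd[OF assms]], blast)
 from choice[OF this] obtain C where
  C: "!!i. C i >= 0" "!!i s x y. s \<in> {0<..1} ==> \<bar>dd (axis i 1, 0) (h s) (x, y)\<bar> <= C i * wt y" by blast
 have "\<bar>dd (v, 0) (h s) (x, y)\<bar> <= norm v * ((SU i. C i) * wt y)" if s: "s \<in> {0<..1}" for s x y v
 proof -
  have "\<bar>dd (v, 0) (h s) (x, y)\<bar> <= (SU i. \<bar>v $ i * dd (axis i 1, 0) (h s) (x, y)\<bar>)"
   using sum_abs by (subst dd_fst_axis[OF kern_differentiable[OF assms s]]) blast
  also have "... <= (SU i. norm v * (C i * wt y))"
   using C(2)[OF s] by (intro sum_mono) (auto simp: abs_mult intro!: mult_mono component_le_norm_cart)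
  finally show ?thesis by (simp add: sum_distrib_left sum_distrib_right)
 qed
 thus ?thesis using that[of "SU i. C i"] C(1) by (simp add: sum_nonneg)
qed

lemma Jint_has_derivative:
 assumes "kern True h" "s \<in> {0<..1}"
 shows "(Jint h s has_derivative (%v. Jint (%s. dd (v, 0) (h s)) s x)) (at x)"
proof -
 obtain C where C: "C >= 0" "!!s x y v. s \<in> {0<..1} ==> \<bar>dd (v, 0) (h s) (x, y)\<bar> <= norm v * (C * wt y)"
  by (rule kern_dd_bound[OF assms(1)], rule that)
 show ?thesis unfolding Jint_def[abs_def]
 proof (rule has_derivative_lebesgue_integral[where S = UNIV and B = "%y. C * wt y"])
  show "((%x. h s (x, y)) has_derivative (%v. dd (v, 0) (h s) (x, y))) (at x)" for x y
  proof -
   have "((%x. (x, y)) has_derivative (%v. (v, 0))) (at x)" by (auto intro!: derivative_eq_intros)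
   from has_derivative_compose[OF this dd_works[OF kern_differentiable[OF assms]]] show ?thesis .
  qed
  show "(%w. dd (v, 0) (h s) (x, w)) \<in> borel_measurable lborel" for v x
   by (rule kern_measurable[OF kern_dd[OF assms(1)] assms(2)])
 qed (use C assms kern_integrable[OF assms] integrable_wt in auto)
qed

lemma Jint_continuous:
 assumes "kern True h"
 shows "continuous_on {0<..1} (%s. Jint h s x)" unfolding continuous_on_sequentially o_def
proof (intro allI ballI impI)
 fix X :: "nat => real" and a assume a: "a \<in> {0<..1}" and X: "(ALL n. X n \<in> {0<..1}) & X \<longlonglongrightarrow> a"
 obtain C where C: "C >= 0" "!!s x y. s \<in> {0<..1} ==> \<bar>h s (x, y)\<bar> <= C * wt y"
  by (rule kern_bound[OF assms], rule that)
 show "(%n. Jint h (X n) x) \<longlonglongrightarrow> Jint h a x" unfolding Jint_def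
 proof (rule integral_dominated_convergence[where w = "%y. C * wt y"])
  have "continuous_on {0<..1} (%s. (%(s, z). h s z) (s, (x, y)))" for y
   by (rule continuous_on_compose2[OF kern_continuous[OF assms]]) (auto intro!: continuous_intros)
  thus "AE y in lborel. (%n. h (X n) (x, y)) \<longlonglongrightarrow> h a (x, y)"
   using X a by (auto simp: continuous_on_sequentially o_def)
 qed (use X a C kern_measurable[OF assms] integrable_wt in auto)
qed

text \<open>Integration by parts in \<open>y\<close>: the integral over \<open>y + t w\<close> does not depend on \<open>t\<close>.\<close>

lemma Jint_dd_snd:
 fixes h :: "'n::finite kernel"
 assumes "kern True h" "s \<in> {0<..1}"
 shows "Jint (%s. dd (0, w) (h s)) s x = 0"
proof -
 obtain C where C: "C >= 0" "!!s x y. s \<in> {0<..1} ==> \<bar>dd (0, w) (h s) (x, y)\<bar> <= C * wt y"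
  by (rule kern_bound[OF kern_dd[OF assms(1), of "(0, w)"]], rule that)
 \<comment> \<open>For |t| < 1 the weight at y + t w is at most (1 + |w|)^(2 n) times the weight at
   y, which makes the majorant independent of t.\<close>
 define D where "D = C * (1 + norm w) ^ (2 * CARD('n))"
 have inv: "(LBINT y. h s (x, y + c)) = (LBINT y. h s (x, y))" for c
  using integral_distr[of "(+) c" lborel borel "%y. h s (x, y)"] kern_measurable[OF assms, of x]
  by (simp add: lborel_distr_plus add.commute)
 have "((%t. \<integral>y. h s (x, y + t *\<^sub>R w) \<partial>lborel) has_derivative (%v. \<integral>y. v * dd (0, w) (h s) (x, y + 0 *\<^sub>R w) \<partial>lborel)) (at 0)"
 proof (rule has_derivative_lebesgue_integral[where S = "ball 0 1" and B = "%y. D * wt y"])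
  show "((%t. h s (x, y + t *\<^sub>R w)) has_derivative (%v. v * dd (0, w) (h s) (x, y + t *\<^sub>R w))) (at t)" for t y
  proof -
   have "((%t. (x, y + t *\<^sub>R w)) has_derivative (%v. (0, v *\<^sub>R w))) (at t)" by (auto intro!: derivative_eq_intros)
   from has_derivative_compose[OF this dd_works[OF kern_differentiable[OF assms]]]
   have "((%t. h s (x, y + t *\<^sub>R w)) has_derivative (%v. dd (0, v *\<^sub>R w) (h s) (x, y + t *\<^sub>R w))) (at t)" .
   moreover have "dd (0, v *\<^sub>R w) (h s) (x, y + t *\<^sub>R w) = v * dd (0, w) (h s) (x, y + t *\<^sub>R w)" for v
    using linear_cmul[OF linear_dd[OF kern_differentiable[OF assms, of "(x, y + t *\<^sub>R w)"]], of v "(0, w)"] by simp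
   ultimately show ?thesis by simp
  qed
  show "integrable lborel (%y. h s (x, y + t *\<^sub>R w))" for t
  proof -
   have "integrable (distr lborel borel ((+) (t *\<^sub>R w))) (%y. h s (x, y))"
    unfolding lborel_distr_plus by (rule kern_integrable[OF assms])
   thus ?thesis by (subst (asm) integrable_distr_eq) (auto simp: add.commute intro: kern_measurable[OF assms, simplified])
  qed
  show "\<bar>v * dd (0, w) (h s) (x, y + t *\<^sub>R w)\<bar> <= norm v * (D * wt y)" if t: "t \<in> ball 0 1" for t y v
  proof -
   have "norm y <= norm (y + t *\<^sub>R w) + norm (t *\<^sub>R w)" by (metis add_diff_cancel_right' norm_triangle_ineq4)
   moreover have "norm (t *\<^sub>R w) <= norm w" using t by (simp add: mult_left_le_one_le)
   moreover have "0 <= norm (y + t *\<^sub>R w) * norm w" by simp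
   ultimately have "1 + norm y <= (1 + norm (y + t *\<^sub>R w)) * (1 + norm w)" unfolding distrib_left distrib_right by linarith
   hence "(1 + norm y) ^ (2 * CARD('n)) <= (1 + norm (y + t *\<^sub>R w)) ^ (2 * CARD('n)) * (1 + norm w) ^ (2 * CARD('n))"
    unfolding power_mult_distrib[symmetric] by (intro power_mono) auto
   hence "wt (y + t *\<^sub>R w) <= (1 + norm w) ^ (2 * CARD('n)) * wt y"
    unfolding wt_def by (simp add: divide_simps add_nonneg_eq_0_iff add_pos_nonneg) (simp add: mult.commute)
   hence "C * wt (y + t *\<^sub>R w) <= D * wt y" unfolding D_def mult.assoc by (rule mult_left_mono[OF _ C(1)])
   thus ?thesis using C(2)[OF assms(2), of x "y + t *\<^sub>R w"] by (simp add: abs_mult mult_left_mono)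
  qed
  show "(%y. v * dd (0, w) (h s) (x, y + 0 *\<^sub>R w)) \<in> borel_measurable lborel" for v
   using kern_measurable[OF kern_dd[OF assms(1)] assms(2), of "(0, w)" x] by simp
 qed (use integrable_wt in auto)
 moreover have "(%t. \<integral>y. h s (x, y + t *\<^sub>R w) \<partial>lborel) = (%t. \<integral>y. h s (x, y) \<partial>lborel)"
  by (rule ext) (rule inv)
 ultimately have "((%t::real. \<integral>y. h s (x, y) \<partial>lborel) has_derivative (%v. v * Jint (%s. dd (0, w) (h s)) s x)) (at 0)"
  by (simp add: Jint_def)
 moreover have "((%t::real. \<integral>y. h s (x, y) \<partial>lborel) has_derivative (%v. 0)) (at 0)" by simp
 ultimately have "(%v. v * Jint (%s. dd (0, w) (h s)) s x) = (%v. 0)" by (rule has_derivative_unique)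
 thus ?thesis by (metis mult_1)
qed


lemma Jint_add:
 "kern True h ==> kern True k ==> s \<in> {0<..1} ==> Jint (%s z. h s z + k s z) s x = Jint h s x + Jint k s x"
 by (simp add: Jint_def kern_integrable)

lemma Jint_cmult: "Jint (%s z. c s * h s z) s x = c s * Jint h s x" by (simp add: Jint_def)

lemma Jint_bound:
 fixes h :: "'n::finite kernel"
 assumes "kern True h"
 obtains C where "C >= 0" "!!s x. s \<in> {0<..1} ==> \<bar>Jint h s x\<bar> <= C"
proof -
 obtain C where C: "C >= 0" "!!s x y. s \<in> {0<..1} ==> \<bar>h s (x, y)\<bar> <= C * wt y"
  by (rule kern_bound[OF assms], rule that)
 thus ?thesis using that[of "C * (LBINT y. wt (y :: real ^ 'n))"] Jint_le[OF _ C(2)] by (simp add: wt_pos)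
qed

section \<open>Integration over the scale with an exponential weight\<close>

definition Iint :: "real => 'n::finite kernel => real ^ 'n => real" where
 "Iint ka h x = (LBINT s. indicator {0<..1} s * (exp (- ka * s\<^sup>2) * Jint h s x))"

text \<open>The mass of the weight in s. It is the factor through which sup norms of operators
  become small for large \<open>ka\<close>.\<close>

definition theta :: "real => real" where
 "theta ka = (LBINT s. indicator {0<..1} s * exp (- ka * s\<^sup>2))"

lemma integrable_unit: "integrable lborel (%s::real. indicator {0<..1} s * (B :: real))" by simp

lemma measurable_unit:
 "continuous_on {0<..1::real} f ==> (%s. indicator {0<..1} s * f s :: real) \<in> borel_measurable lborel"
 using borel_measurable_continuous_on_indicator[of "{0<..1::real}" f] by simp

lemma integrable_unitI:
 assumes "continuous_on {0<..1::real} f" "!!s. s \<in> {0<..1} ==> \<bar>f s\<bar> <= B"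
 shows "integrable lborel (%s. indicator {0<..1} s * f s :: real)"
 by (rule Bochner_Integration.integrable_bound[OF integrable_unit[of B] measurable_unit[OF assms(1)]])
  (use assms(2) in "auto simp: indicator_def intro!: AE_I2 order.trans[OF _ abs_ge_self]")

lemma Iint_integrable:
 assumes "kern True h" "ka >= 0"
 shows "integrable lborel (%s. indicator {0<..1} s * (exp (- ka * s\<^sup>2) * Jint h s x))"
proof -
 obtain C where C: "C >= 0" "!!s x. s \<in> {0<..1} ==> \<bar>Jint h s x\<bar> <= C" by (rule Jint_bound[OF assms(1)], rule that)
 show ?thesis
 proof (rule integrable_unitI[where B = C])
  show "\<bar>exp (- ka * s\<^sup>2) * Jint h s x\<bar> <= C" if "s \<in> {0<..1}" for s
   using mult_mono[of "exp (- ka * s\<^sup>2)" 1 "\<bar>Jint h s x\<bar>" C] C that assms(2) by (simp add: abs_mult)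
 qed (intro continuous_intros Jint_continuous assms)
qed

lemma Iint_cong:
 "(!!s y. s \<in> {0<..1} ==> h s (x, y) = k s (x, y)) ==> Iint ka h x = Iint ka k x"
 unfolding Iint_def Jint_def by (intro Bochner_Integration.integral_cong) (auto simp: indicator_def)

lemma Iint_add:
 "kern True h ==> kern True k ==> ka >= 0 ==> Iint ka (%s z. h s z + k s z) x = Iint ka h x + Iint ka k x" unfolding Iint_def
 by (subst Bochner_Integration.integral_add[symmetric, OF Iint_integrable Iint_integrable])
  (auto intro!: Bochner_Integration.integral_cong simp: Jint_add indicator_def distrib_left)

lemma Iint_cmult: "Iint ka (%s z. c * h s z) x = c * Iint ka h x"
 unfolding Iint_def Jint_cmult integral_mult_right_zero[symmetric] by (simp add: mult_ac)

lemma Iint_diff: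
 "kern True h ==> kern True k ==> ka >= 0 ==> Iint ka (%s z. h s z - k s z) x = Iint ka h x - Iint ka k x"
 using Iint_add[of h "%s z. - 1 * k s z"] Iint_cmult[of ka "- 1" k] kern_minus[of True k] by simp

lemma Iint_zero: "Iint ka (%s z. 0) x = 0" by (simp add: Iint_def Jint_def)

lemma Iint_sum:
 "(!!i. i \<in> I ==> kern True (h i)) ==> ka >= 0 ==> Iint ka (%s z. SUM i:I. h i s z) x = (SUM i:I. Iint ka (h i) x)"
 by (induction I rule: infinite_finite_induct) (auto simp: Iint_zero Iint_add kern_sum)

lemma Iint_dd_snd: "kern True h ==> Iint ka (%s. dd (0, w) (h s)) x = 0"
proof -
 assume "kern True h"
 hence "indicator {0<..1} s * (exp (- ka * s\<^sup>2) * Jint (%s. dd (0, w) (h s)) s x) = 0" for s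
  using Jint_dd_snd by (auto simp: indicator_def)
 thus ?thesis unfolding Iint_def by (simp only: integral_zero)
qed

lemma Iint_has_derivative:
 assumes "kern True h" "ka >= 0"
 shows "(Iint ka h has_derivative (%v. Iint ka (%s. dd (v, 0) (h s)) x)) (at x)"
proof -
 obtain C where C: "C >= 0" "!!s x y v. s \<in> {0<..1} ==> \<bar>dd (v, 0) (h s) (x, y)\<bar> <= norm v * (C * wt y)"
  by (rule kern_dd_bound[OF assms(1)], rule that)
 define D where "D = C * (LBINT y. wt (y :: real ^ 'a))"
 have D: "\<bar>Jint (%s. dd (v, 0) (h s)) s x\<bar> <= norm v * D" if "s \<in> {0<..1}" for s v x
  using Jint_le[OF that, of "%s. dd (v, 0) (h s)" x "norm v * C"] C(2)[OF that] by (simp add: D_def mult_ac)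
 show ?thesis unfolding Iint_def[abs_def]
 proof (rule has_derivative_lebesgue_integral[where S = UNIV and B = "%s. indicator {0<..1} s * D"])
  show "((%x. indicator {0<..1} s * (exp (- ka * s\<^sup>2) * Jint h s x)) has_derivative
    (%v. indicator {0<..1} s * (exp (- ka * s\<^sup>2) * Jint (%s. dd (v, 0) (h s)) s x))) (at x)" for x s
  proof (cases "s \<in> {0<..1}")
   case True
   thus ?thesis by (intro has_derivative_mult_right Jint_has_derivative[OF assms(1)])
  qed simp
  show "(%s. indicator {0<..1} s * (exp (- ka * s\<^sup>2) * Jint (%s. dd (v, 0) (h s)) s x)) \<in> borel_measurable lborel" for v
   by (rule measurable_unit) (intro continuous_intros Jint_continuous kern_dd assms)
  show "\<bar>indicator {0<..1} s * (exp (- ka * s\<^sup>2) * Jint (%s. dd (v, 0) (h s)) s x)\<bar> <= norm v * (indicator {0<..1} s * D)" for x s v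
  proof (cases "s \<in> {0<..1}")
   case True
   thus ?thesis using D[OF True, of v x] assms(2)
    mult_mono[of "exp (- ka * s\<^sup>2)" 1 "\<bar>Jint (%s. dd (v, 0) (h s)) s x\<bar>" "norm v * D"] by (simp add: abs_mult)
  qed simp
 qed (use Iint_integrable[OF assms] in auto)
qed

lemma dd_Iint: "kern True h ==> ka >= 0 ==> dd v (Iint ka h) x = Iint ka (%s. dd (v, 0) (h s)) x"
 by (rule dd_eqI[OF Iint_has_derivative])

lemma smooth_on_Iint:
 assumes "kern True h" "ka >= 0"
 shows "smooth_on UNIV (Iint ka h)"
proof -
 have "Ck_on m UNIV (Iint ka h)" for m using assms(1)
 proof (induction m arbitrary: h)
  case 0
  thus ?case using has_derivative_continuous[OF Iint_has_derivative[OF 0 assms(2)]] by (simp add: continuous_on_eq_continuous_at)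
 next
  case (Suc m)
  show ?case by (rule Ck_on_SucI[OF open_UNIV Iint_has_derivative[OF Suc.prems assms(2)]]) (rule Suc.IH[OF kern_dd[OF Suc.prems]])
 qed
 thus ?thesis by (simp add: smooth_on_def)
qed

lemma Iint_le:
 fixes h :: "'n::finite kernel"
 assumes "kern True h" "ka >= 0" "!!s y. s \<in> {0<..1} ==> \<bar>h s (x, y)\<bar> <= C * wt y"
 shows "\<bar>Iint ka h x\<bar> <= C * (LBINT y. wt (y :: real ^ 'n)) * theta ka"
proof -
 show ?thesis unfolding Iint_def theta_def
 proof (rule abs_integral_le[OF Iint_integrable[OF assms(1,2)]])
  show "integrable lborel (%s. indicator {0<..1} s * exp (- ka * s\<^sup>2))"
   using assms(2) by (intro integrable_unitI[where B = 1]) (auto intro!: continuous_intros)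
  show "\<bar>indicator {0<..1} s * (exp (- ka * s\<^sup>2) * Jint h s x)\<bar>
    <= C * (LBINT y. wt (y :: real ^ 'n)) * (indicator {0<..1} s * exp (- ka * s\<^sup>2))" for s
  proof (cases "s \<in> {0<..1}")
   case True
   have "\<bar>Jint h s x\<bar> <= C * (LBINT y. wt (y :: real ^ 'n))" by (rule Jint_le[OF True]) (rule assms(3)[OF True])
   thus ?thesis using True mult_right_mono[of "\<bar>Jint h s x\<bar>" _ "exp (- ka * s\<^sup>2)"] by (simp add: abs_mult mult_ac)
  qed simp
 qed
qed

text \<open>The interval is split at d: the part below d has length at most e/2, and above d the
  weight is at most e/2 as soon as ka d^2 is at least 2/e.\<close>

lemma theta_small:
 assumes "e > 0"
 obtains ka0 where "ka0 > 0" "!!ka. ka >= ka0 ==> theta ka <= e"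
proof -
 define d where "d = min (e / 2) 1"
 have d: "d > 0" "d <= 1" "d <= e / 2" using assms by (auto simp: d_def)
 have "theta ka <= e" if k: "ka >= 2 / (e * d\<^sup>2)" for ka
 proof -
  have k0: "ka > 0" using k d assms by (smt (verit) divide_pos_pos mult_pos_pos zero_less_power)
  have "exp (- ka * s\<^sup>2) <= e / 2" if "d < s" for s
  proof -
   have "2 / e <= ka * d\<^sup>2" using k d assms by (simp add: field_simps)
   also have "... <= ka * s\<^sup>2" using that d k0 by (intro mult_left_mono power_mono) auto
   also have "... <= exp (ka * s\<^sup>2)" using exp_ge_add_one_self[of "ka * s\<^sup>2"] by linarith
   finally show ?thesis using assms by (simp add: exp_minus field_simps)
  qed
  hence "indicator {0<..1} s * exp (- ka * s\<^sup>2) <= indicator {0<..d} s + e / 2 * indicator {0<..1::real} s" for s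
   using k0 assms d by (auto simp: indicator_def not_le intro: add_increasing2)
  hence "theta ka <= (LBINT s. indicator {0<..d} s + e / 2 * indicator {0<..1::real} s)" unfolding theta_def using k0
   by (intro integral_mono integrable_unitI[where B = 1] Bochner_Integration.integrable_add integrable_mult_right)
    (use d in "auto intro!: continuous_intros integrable_real_indicator")
  also have "... = d + e / 2" using d by simp
  finally show ?thesis using d by simp
 qed
 thus ?thesis using that[of "2 / (e * d\<^sup>2)"] d assms by auto
qed

subsection \<open>Operators with kernels\<close>

text \<open>\<open>kop ka k F x\<close> is the integral of \<open>e\<close> to the power \<open>- ka s\<^sup>2\<close> times \<open>k s (x, y) F (x + s y)\<close>.\<close>

definition shf :: "(real ^ 'n::finite => real) => 'n kernel" where
 "shf F s z = F (fst z + s *\<^sub>R snd z)"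

definition kop :: "real => 'n::finite kernel => (real ^ 'n => real) => real ^ 'n => real" where
 "kop ka k F = Iint ka (%s z. k s z * shf F s z)"

definition ksupp :: "(real ^ 'n::finite) set => 'n kernel => bool" where
 "ksupp Q k \<longleftrightarrow> (ALL s:{0<..1}. ALL x y. k s (x, y) ~= 0 --> x \<in> Q & x + s *\<^sub>R y \<in> Q)"

lemma ksuppD:
 "ksupp Q k ==> s \<in> {0<..1} ==> x \<notin> Q \<or> x + s *\<^sub>R y \<notin> Q ==> k s (x, y) = 0"
 unfolding ksupp_def by blast

lemma kern_shf: "csm F ==> kern False (shf F)" using kern_target by (simp add: shf_def[abs_def])

lemma kern_mult_shf: "kern True k ==> csm F ==> kern True (%s z. k s z * shf F s z)"
 using kern_mult[OF kern_shf, of F True k] by (simp add: mult.commute)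

lemma dd_shf:
 assumes "csm F"
 shows "dd (v, w) (shf F s) z = dd v F (fst z + s *\<^sub>R snd z) + s * dd w F (fst z + s *\<^sub>R snd z)"
proof -
 have "((%z. fst z + s *\<^sub>R snd z) has_derivative (%v. fst v + s *\<^sub>R snd v)) (at z)"
  by (auto intro!: derivative_eq_intros)
 note has_derivative_compose[OF this dd_works[OF csm_differentiable[OF assms]]]
 hence "dd (v, w) (shf F s) z = dd (v + s *\<^sub>R w) F (fst z + s *\<^sub>R snd z)"
  unfolding shf_def[abs_def] using dd_eqI by fastforce
 also have "... = dd v F (fst z + s *\<^sub>R snd z) + s * dd w F (fst z + s *\<^sub>R snd z)"
  using linear_add[OF linear_dd[OF csm_differentiable[OF assms]]] linear_cmul[OF linear_dd[OF csm_differentiable[OF assms]]] by simp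
 finally show ?thesis .
qed

lemma dd_mult_shf:
 assumes "kern r k" "csm F" "s \<in> {0<..1}"
 shows "dd (v, w) (%z. k s z * shf F s z) z = k s z * shf (dd v F) s z + s * k s z * shf (dd w F) s z + dd (v, w) (k s) z * shf F s z"
 using dd_mult[OF kern_differentiable[OF assms(1,3)] kern_differentiable[OF kern_shf[OF assms(2)] assms(3)]]
 by (simp add: dd_shf[OF assms(2)] shf_def algebra_simps)

lemma dd_kop:
 assumes "kern True k" "csm F" "ka >= 0"
 shows "dd v (kop ka k F) x = kop ka (%s. dd (v, 0) (k s)) F x + kop ka k (dd v F) x"
proof -
 have "dd v (kop ka k F) x = Iint ka (%s z. dd (v, 0) (%z. k s z * shf F s z) z) x"
  unfolding kop_def by (rule dd_Iint[OF kern_mult_shf[OF assms(1,2)] assms(3)])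
 also have "... = Iint ka (%s z. dd (v, 0) (k s) z * shf F s z + k s z * shf (dd v F) s z) x"
  using linear_0[OF linear_dd[OF csm_differentiable[OF assms(2)]]]
  by (intro Iint_cong, subst dd_mult_shf[OF assms(1,2)]) (simp_all add: shf_def)
 also have "... = kop ka (%s. dd (v, 0) (k s)) F x + kop ka k (dd v F) x"
  unfolding kop_def by (rule Iint_add) (intro kern_mult_shf kern_dd csm_dd assms)+
 finally show ?thesis .
qed

text \<open>A y-derivative of F(x + s y) carries a factor s. A kernel divisible by s can therefore
  take over a derivative of \<open>F\<close>, because the full y-derivative of the product
  integrates to 0.\<close>

lemma kop_ibp:
 assumes "kern True k" "csm F" "ka >= 0"
 shows "kop ka (%s z. s * k s z) (dd w F) x = - kop ka (%s. dd (0, w) (k s)) F x"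
proof -
 have 0: "dd 0 F y = 0" for y using linear_0[OF linear_dd[OF csm_differentiable[OF assms(2)]]] .
 have "0 = Iint ka (%s z. dd (0, w) (%z. k s z * shf F s z) z) x" using Iint_dd_snd[OF kern_mult_shf[OF assms(1,2)]] by simp
 also have "... = Iint ka (%s z. s * k s z * shf (dd w F) s z + dd (0, w) (k s) z * shf F s z) x"
  by (intro Iint_cong, subst dd_mult_shf[OF assms(1,2)]) (simp_all add: shf_def 0)
 also have "... = kop ka (%s z. s * k s z) (dd w F) x + kop ka (%s. dd (0, w) (k s)) F x"
  unfolding kop_def by (rule Iint_add) (intro kern_mult_shf kern_dd csm_dd assms kern_mult[OF kern_scale])+
 finally show ?thesis by simp
qed

lemma kop_add:
 assumes "kern True k" "kern True l" "csm F" "ka >= 0"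
 shows "kop ka (%s z. k s z + l s z) F x = kop ka k F x + kop ka l F x"
 using Iint_add[OF kern_mult_shf[OF assms(1,3)] kern_mult_shf[OF assms(2,3)] assms(4)] by (simp add: kop_def distrib_right)

lemma kop_cmult: "kop ka (%s z. c * k s z) F x = c * kop ka k F x" by (simp add: kop_def mult.assoc Iint_cmult)

lemma kop_sum:
 assumes "!!i. i \<in> I ==> kern True (k i)" "csm F" "ka >= 0"
 shows "kop ka (%s z. SUM i:I. k i s z) F x = (SUM i:I. kop ka (k i) F x)"
 using Iint_sum[of I "%i s z. k i s z * shf F s z", OF kern_mult_shf assms(3)] assms(1,2) by (simp add: kop_def sum_distrib_right)

lemma kop_cong:
 "(!!s y. s \<in> {0<..1} ==> k s (x, y) * F (x + s *\<^sub>R y) = l s (x, y) * G (x + s *\<^sub>R y)) ==> kop ka k F x = kop ka l G x"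
 unfolding kop_def by (rule Iint_cong) (simp add: shf_def)

lemma smooth_on_kop: "kern True k ==> csm F ==> ka >= 0 ==> smooth_on UNIV (kop ka k F)"
 unfolding kop_def by (intro smooth_on_Iint kern_mult_shf)

lemma kop_outside: "ksupp Q k ==> x \<notin> Q ==> kop ka k F x = 0"
proof -
 assume "ksupp Q k" "x \<notin> Q"
 hence "k s (x, y) = 0" if "s \<in> {0<..1}" for s y using that ksuppD by blast
 hence "kop ka k F x = kop ka (%s z. 0) F x" by (intro kop_cong) auto
 thus ?thesis by (simp add: kop_def Iint_zero)
qed

lemma kop_eq_on:
 assumes "ksupp Q k" "!!x. x \<in> Q ==> F x = G x"
 shows "kop ka k F x = kop ka k G x"
proof (rule kop_cong)
 fix s :: real and y assume "s \<in> {0<..1}"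
 thus "k s (x, y) * F (x + s *\<^sub>R y) = k s (x, y) * G (x + s *\<^sub>R y)"
  using assms(2)[of "x + s *\<^sub>R y"] ksuppD[OF assms(1), of s x y] by (cases "x + s *\<^sub>R y \<in> Q") auto
qed

text \<open>The constant depends on the kernel alone: \<open>ka\<close> enters only through
  \<open>theta ka\<close>, and \<open>F\<close> only through its values on \<open>Q\<close>. One
  choice of \<open>ka\<close> can thus make a given kernel small on all functions at once.\<close>

lemma kop_le:
 fixes k :: "'n::finite kernel"
 assumes "kern True k" "ksupp Q k"
 obtains C where "C >= 0"
  "!!ka F B x. ka >= 0 ==> csm F ==> (!!x. x \<in> Q ==> \<bar>F x\<bar> <= B) ==> B >= 0 ==> \<bar>kop ka k F x\<bar> <= C * theta ka * B"
proof -
 obtain C where C: "C >= 0" "!!s x y. s \<in> {0<..1} ==> \<bar>k s (x, y)\<bar> <= C * wt y"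
  by (rule kern_bound[OF assms(1)], rule that)
 have "\<bar>kop ka k F x\<bar> <= (C * (LBINT y. wt (y :: real ^ 'n))) * theta ka * B"
  if a: "ka >= 0" "csm F" "!!x. x \<in> Q ==> \<bar>F x\<bar> <= B" "B >= 0" for ka F B x
 proof -
  have "\<bar>k s (x, y) * shf F s (x, y)\<bar> <= (C * B) * wt y" if s: "s \<in> {0<..1}" for s y
  proof (cases "k s (x, y) = 0")
   case True
   thus ?thesis using C(1) a(4) wt_pos(2)[of y] by simp
  next
   case False
   hence "x + s *\<^sub>R y \<in> Q" using assms(2) s by (auto simp: ksupp_def)
   hence "\<bar>F (x + s *\<^sub>R y)\<bar> <= B" using a(3) by blast
   hence "\<bar>k s (x, y)\<bar> * \<bar>F (x + s *\<^sub>R y)\<bar> <= (C * wt y) * B"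
    using C(2)[OF s, of x y] by (intro mult_mono) auto
   thus ?thesis by (simp add: shf_def abs_mult mult_ac)
  qed
  from Iint_le[OF kern_mult_shf[OF assms(1) a(2)] a(1), of x "C * B", OF this]
  show ?thesis by (simp add: kop_def mult_ac)
 qed
 thus ?thesis using that[of "C * (LBINT y. wt (y :: real ^ 'n))"] C(1) by (simp add: wt_pos)
qed

text \<open>Since \<open>Q\<close> is closed, the set where the support condition forces the kernel
  to vanish is open, so derivatives vanish on it too.\<close>

lemma ksupp_dd:
 assumes "closed Q" "ksupp Q k"
 shows "ksupp Q (%s. dd v (k s))" unfolding ksupp_def
proof (intro ballI allI impI)
 fix s :: real and x y assume s: "s \<in> {0<..1}" and nz: "dd v (k s) (x, y) ~= 0"
 define S where "S = {z. fst z \<notin> Q \<or> fst z + s *\<^sub>R snd z \<notin> Q}"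
 have "open {z::(real ^ 'a) \<times> (real ^ 'a). fst z \<in> - Q}" "open {z::(real ^ 'a) \<times> (real ^ 'a). fst z + s *\<^sub>R snd z \<in> - Q}"
  using open_vimage[of "- Q" "fst :: (real ^ 'a) \<times> (real ^ 'a) => _"]
   open_vimage[of "- Q" "%z::(real ^ 'a) \<times> (real ^ 'a). fst z + s *\<^sub>R snd z"] assms(1)
  by (simp_all add: vimage_def closed_def continuous_on_fst continuous_on_snd continuous_on_add continuous_on_scaleR)
 from open_Un[OF this] have "open S" unfolding S_def by (simp add: Un_def)
 have z: "k s z = 0" if "z \<in> S" for z using ksuppD[OF assms(2) s, of "fst z" "snd z"] that by (auto simp: S_def)
 show "x \<in> Q & x + s *\<^sub>R y \<in> Q"
 proof (rule ccontr)
  assume "\<not> ?thesis"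
  hence "(x, y) \<in> S" by (auto simp: S_def)
  hence "dd v (k s) (x, y) = dd v (%_. 0) (x, y)" using dd_cong_open[OF \<open>open S\<close>] z by metis
  thus False using nz by simp
 qed
qed

lemma ksupp_mult1: "ksupp Q k ==> ksupp Q (%s z. l s z * k s z)" by (auto simp: ksupp_def)

lemma ksupp_mult2: "ksupp Q k ==> ksupp Q (%s z. k s z * l s z)" by (auto simp: ksupp_def)

lemma ksupp_add: "ksupp Q k ==> ksupp Q l ==> ksupp Q (%s z. k s z + l s z)" unfolding ksupp_def by (metis add.right_neutral)

lemma ksupp_sum: "(!!i. i \<in> I ==> ksupp Q (k i)) ==> ksupp Q (%s z. SUM i:I. k i s z)"
 by (induction I rule: infinite_finite_induct) (auto intro: ksupp_add simp: ksupp_def[of Q "%s z. 0"])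

text \<open>The kernel of the commutator of an operator with the vector field \<open>b\<close>: the difference
 \<open>b (x + s y) - b x\<close> provides the factor \<open>s\<close> needed to integrate by parts.\<close>

definition kcomm :: "('n::finite => real ^ 'n => real) => 'n kernel => 'n kernel" where
 "kcomm b k s z = (SU j. b j (fst z) * dd (axis j 1, 0) (k s) z
   + dd (0, axis j 1) (%z. ((b j (fst z + s *\<^sub>R snd z) - b j (fst z)) / s) * k s z) z)"

lemma kern_kcomm:
 assumes "!!j. csm (b j)" "kern True k"
 shows "kern True (kcomm b k)"
proof -
 have "kern True (%s z. (b j (fst z + s *\<^sub>R snd z) - b j (fst z)) / s * k s z)" for j
  by (rule kern_mult[OF kern_quotient[OF assms(1)] assms(2)])
 from kern_dd[OF this] show ?thesis unfolding kcomm_def[abs_def]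
  by (intro kern_sum kern_add kern_mult[OF kern_fst[OF assms(1)] kern_dd[OF assms(2)]])
qed

lemma ksupp_kcomm:
 assumes "closed Q" "ksupp Q k"
 shows "ksupp Q (kcomm b k)" unfolding kcomm_def[abs_def]
 by (intro ksupp_sum ksupp_add ksupp_mult1 ksupp_dd[OF assms(1)] assms(2))

lemma kop_commutator:
 assumes b: "!!j. csm (b j)" and k: "kern True k" and F: "csm F" and "ka >= 0"
 shows "(SU j. b j x * dx j (kop ka k F) x)
  = kop ka k (%x. SU j. b j x * dx j F x) x + kop ka (kcomm b k) F x"
proof -
 define B where "B j s z = (b j (fst z + s *\<^sub>R snd z) - b j (fst z)) / s" for j s z
 have bk: "kern True (%s. dd (0, axis j 1) (%z. (b j (fst z + s *\<^sub>R snd z) - b j (fst z)) / s * k s z))" for j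
  by (rule kern_dd[OF kern_mult[OF kern_quotient[OF b] k]])
 have kB: "kern True (%s z. B j s z * k s z)" for j unfolding B_def by (rule kern_mult[OF kern_quotient[OF b] k])
 have bF: "csm (%x. b j x * dx j F x)" for j by (intro csm_mult csm_smooth b csm_dd F)
 have main: "b j x * dx j (kop ka k F) x = kop ka k (%x. b j x * dx j F x) x
   + kop ka (%s z. b j (fst z) * dd (axis j 1, 0) (k s) z + dd (0, axis j 1) (%z. B j s z * k s z) z) F x" for j
 proof -
  have "b j x * kop ka k (dx j F) x = kop ka (%s z. b j x * k s z) (dx j F) x" by (simp add: kop_cmult)
  \<comment> \<open>Here b(x) is written as b(x + s y) minus s times the difference quotient
    \<open>B\<close>; the first part moves inside next to the derivative of
    \<open>F\<close>.\<close>
  also have "... = Iint ka (%s z. k s z * shf (%x. b j x * dx j F x) s z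
    - s * (B j s z * k s z) * shf (dx j F) s z) x" unfolding kop_def by (rule Iint_cong) (auto simp: shf_def B_def field_simps)
  also have "... = kop ka k (%x. b j x * dx j F x) x - kop ka (%s z. s * (B j s z * k s z)) (dx j F) x"
   unfolding kop_def using assms(4) by (intro Iint_diff kern_mult_shf k bF csm_dd F kern_mult[OF kern_scale] kB)
  also have "... = kop ka k (%x. b j x * dx j F x) x + kop ka (%s. dd (0, axis j 1) (%z. B j s z * k s z)) F x"
   using kop_ibp[OF kB F assms(4)] by simp
  finally have "b j x * kop ka k (dx j F) x = ..." .
  moreover have "b j x * kop ka (%s. dd (axis j 1, 0) (k s)) F x = kop ka (%s z. b j (fst z) * dd (axis j 1, 0) (k s) z) F x"
   unfolding kop_cmult[symmetric] by (rule kop_cong) simp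
  ultimately show ?thesis unfolding dd_kop[OF k F assms(4)] distrib_left
   by (subst kop_add[OF kern_mult[OF kern_fst[OF b] kern_dd[OF k]] kern_dd[OF kB] F assms(4)]) simp
 qed
 have "(SU j. kop ka k (%x. b j x * dx j F x) x) = kop ka k (%x. SU j. b j x * dx j F x) x"
  using Iint_sum[of UNIV "%j s z. k s z * shf (%x. b j x * dx j F x) s z", OF kern_mult_shf[OF k bF] assms(4)]
  by (simp add: kop_def shf_def sum_distrib_left)
 moreover have "(SU j. kop ka (%s z. b j (fst z) * dd (axis j 1, 0) (k s) z + dd (0, axis j 1) (%z. B j s z * k s z) z) F x)
   = kop ka (kcomm b k) F x" unfolding kcomm_def[abs_def] by (subst kop_sum[symmetric, OF _ F assms(4)])
   (simp_all only: B_def kern_add[OF kern_mult[OF kern_fst[OF b] kern_dd[OF k]] bk])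
 ultimately show ?thesis unfolding main by (simp add: sum.distrib)
qed

text \<open>Off \<open>S\<close> the complement of the closed ball is a neighbourhood on which the
  product is 0, so values of \<open>F\<close> outside \<open>S\<close> do no harm.\<close>

lemma csm_cutoff_mult:
 fixes F :: "real ^ 'n::finite => real"
 assumes "open S" "r > 0" "cball a (2 * r) \<subseteq> S" "smooth_on S F"
 shows "csm (%x. cutoff a r x * F x)"
proof -
 have "smooth_on UNIV (%x. cutoff a r x * F x)"
 proof (rule smooth_on_local)
  fix x
  show "EX T. open T & x \<in> T & smooth_on T (%x. cutoff a r x * F x)"
  proof (cases "x \<in> S")
   case True
   thus ?thesis using assms by (blast intro: smooth_intros smooth_on_cutoff)
  next
   case False
   have "smooth_on (- cball a (2 * r)) (%x. cutoff a r x * F x)" by (rule smooth_on_cong[OF smooth_on_const[of _ 0]])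
     (use cutoff_eq_0[OF assms(2), where a = a] in "auto simp: dist_norm norm_minus_commute")
   thus ?thesis using False assms(3) by (intro exI[of _ "- cball a (2 * r)"]) auto
  qed
 qed
 moreover have "cutoff a r x * F x = 0" if "x \<notin> cball a (2 * r)" for x
  using cutoff_eq_0[OF assms(2), of x a] that by (auto simp: dist_norm norm_minus_commute)
 ultimately show ?thesis unfolding csm_def using compact_cball by blast
qed

lemma csm_cutoff: "r > 0 ==> csm (cutoff a r)" using csm_cutoff_mult[OF open_UNIV, of r a "%_. 1"] smooth_on_const by auto

subsection \<open>The local parametrix\<close>

lemma scaled_line_has_derivative:
 fixes h0 :: "(real ^ 'n::finite) \<times> (real ^ 'n) => real"
 assumes h0: "kern True (%s. h0)" and F: "csm F"
 shows "((%s. \<integral>y. h0 (x, y) * F (x + s *\<^sub>R y) \<partial>lborel) has_real_derivative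
   (SU i. \<integral>y. (snd (x, y) $ i * h0 (x, y)) * dx i F (x + s *\<^sub>R y) \<partial>lborel)) (at s)"
proof -
 have m: "(%y. k (x, y) * G (x + s *\<^sub>R y)) \<in> borel_measurable lborel" if "kern True (%s. k)" "csm G" for k G s
 proof -
  have "G \<in> borel_measurable borel" using smooth_cont[OF csm_smooth[OF that(2)]] borel_measurable_continuous_onI by blast
  moreover have "(%y. x + s *\<^sub>R y) \<in> borel_measurable borel" by simp
  ultimately have "(%y. G (x + s *\<^sub>R y)) \<in> borel_measurable borel" using measurable_compose by blast
  thus ?thesis using kern_measurable[OF that(1), of 1 x] by auto
 qed
 have int: "integrable lborel (%y. k (x, y) * G (x + s *\<^sub>R y))" if k: "kern True (%s. k)" and G: "csm G" for k G s
 proof -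
  obtain B where B: "B > 0" "!!x. \<bar>G x\<bar> <= B" by (rule csm_bounded[OF G], rule that)
  show ?thesis
   by (rule Bochner_Integration.integrable_bound[OF integrable_mult_right[OF integrable_abs[OF kern_integrable[OF k, of 1]], of B] m[OF k G]])
    (use B in "auto simp: abs_mult mult.commute[of B] intro!: AE_I2 mult_left_mono")
 qed
 have ky: "kern True (%s z. snd z $ i * h0 z)" for i by (rule kern_mult[OF kern_snd h0])
 have "ALL i. EX B>0. ALL x. \<bar>dx i F x\<bar> <= B" by (rule allI, rule csm_bounded[OF csm_dd[OF F]], blast)
 from choice[OF this] obtain B where B: "!!i. B i > 0" "!!i x. \<bar>dx i F x\<bar> <= B i" by blast
 have "((%s. \<integral>y. h0 (x, y) * F (x + s *\<^sub>R y) \<partial>lborel) has_derivative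
   (%v. \<integral>y. v * (SU i. (snd (x, y) $ i * h0 (x, y)) * dx i F (x + s *\<^sub>R y)) \<partial>lborel)) (at s)"
 proof (rule has_derivative_lebesgue_integral[where S = UNIV and B = "%y. SU i. \<bar>snd (x, y) $ i * h0 (x, y)\<bar> * B i"])
  show "((%s. h0 (x, y) * F (x + s *\<^sub>R y)) has_derivative
   (%v. v * (SU i. (snd (x, y) $ i * h0 (x, y)) * dx i F (x + s *\<^sub>R y)))) (at s)" for s y
  proof -
   have "((%s. F (x + s *\<^sub>R y)) has_real_derivative dd y F (x + s *\<^sub>R y)) (at s)"
    by (rule dd_DERIV_line[OF csm_differentiable[OF F]])
   from DERIV_cmult[OF this, of "h0 (x, y)"] show ?thesis unfolding has_field_derivative_def by (rule has_derivative_eq_rhs)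
     (rule ext, subst dd_axis[OF csm_differentiable[OF F], of y], simp add: sum_distrib_left mult_ac)
  qed
  show "(%y. v * (SU i. (snd (x, y) $ i * h0 (x, y)) * dx i F (x + s *\<^sub>R y))) \<in> borel_measurable lborel" for v
   by (intro borel_measurable_times borel_measurable_const borel_measurable_sum m[OF ky csm_dd[OF F]])
  show "\<bar>v * (SU i. (snd (x, y) $ i * h0 (x, y)) * dx i F (x + s *\<^sub>R y))\<bar>
    <= norm v * (SU i. \<bar>snd (x, y) $ i * h0 (x, y)\<bar> * B i)" for s y v unfolding abs_mult real_norm_def
   by (intro mult_left_mono order.trans[OF sum_abs] sum_mono) (auto simp: abs_mult intro!: mult_mono B)
  show "integrable lborel (%y. SU i. \<bar>snd (x, y) $ i * h0 (x, y)\<bar> * B i)"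
   by (intro Bochner_Integration.integrable_sum integrable_mult_left integrable_abs kern_integrable[OF ky, of 1]) auto
 qed (use int[OF h0 F] in auto)
 moreover have "(LBINT y. v * (SU i. (snd (x, y) $ i * h0 (x, y)) * dx i F (x + s *\<^sub>R y)))
   = (SU i. \<integral>y. (snd (x, y) $ i * h0 (x, y)) * dx i F (x + s *\<^sub>R y) \<partial>lborel) * v" for v
  using int[OF ky csm_dd[OF F]] by (simp add: mult.commute)
 ultimately show ?thesis unfolding has_field_derivative_def by (metis (no_types, lifting) ext has_derivative_eq_rhs)
qed

text \<open>The fundamental theorem of calculus for (1 - s) exp (- ka s^2) V s, where V s integrates
  h0(x, y) F(x + s y) over y. The endpoint s = 1 contributes nothing, s = 0 leaves F x times the
  mass of \<open>h0\<close>, and the derivative of 1 - s gives the last term.\<close>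

lemma Iint_ftc:
 fixes h0 :: "(real ^ 'n::finite) \<times> (real ^ 'n) => real"
 assumes h0: "kern True (%s. h0)" and F: "csm F" and "ka >= 0"
 shows "Iint ka (%s z. (1 - s) * (2 * ka * s * (h0 z * shf F s z) - (SU i. (snd z $ i * h0 z) * shf (dx i F) s z))) x
  = F x * (LBINT y. h0 (x, y)) - Iint ka (%s z. h0 z * shf F s z) x"
proof -
 define V where "V s = (LBINT y. h0 (x, y) * F (x + s *\<^sub>R y))" for s
 define V' where "V' s = (SU i. \<integral>y. (snd (x, y) $ i * h0 (x, y)) * dx i F (x + s *\<^sub>R y) \<partial>lborel)" for s
 have ky: "kern True (%s z. snd z $ i * h0 z)" for i by (rule kern_mult[OF kern_snd h0])
 have V: "(V has_real_derivative V' s) (at s)" for s unfolding V_def[abs_def] V'_def by (rule scaled_line_has_derivative[OF h0 F])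
 have V': "isCont V' s" for s unfolding V'_def[abs_def]
  by (intro continuous_sum DERIV_isCont[OF scaled_line_has_derivative[OF ky csm_dd[OF F]]])
 define f where "f s = exp (- ka * s\<^sup>2) * ((1 - s) * (V' s - 2 * ka * s * V s) - V s)" for s
 have ftc: "(LBINT s. f s * indicator {0..1} s) = (1 - 1) * exp (- ka * 1\<^sup>2) * V 1 - (1 - 0) * exp (- ka * 0\<^sup>2) * V 0"
 proof (rule integral_FTC_Icc_real)
  show "((%s. (1 - s) * exp (- ka * s\<^sup>2) * V s) has_real_derivative f s) (at s)" for s
   unfolding f_def by (auto intro!: derivative_eq_intros V simp: algebra_simps)
  show "isCont f s" for s unfolding f_def by (intro continuous_intros V' DERIV_isCont[OF V])
 qed simp
 have J1: "Jint (%s z. h0 z * shf F s z) s x = V s" for s by (simp add: Jint_def V_def shf_def)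
 have J2: "Jint (%s z. (1 - s) * (2 * ka * s * (h0 z * shf F s z) - (SU i. (snd z $ i * h0 z) * shf (dx i F) s z))) s x
   = (1 - s) * (2 * ka * s * V s - V' s)" if "s \<in> {0<..1}" for s
 proof -
  have k1: "kern True (%s z. h0 z * shf F s z)" by (rule kern_mult_shf[OF h0 F])
  have k2: "kern True (%s z. (snd z $ i * h0 z) * shf (dx i F) s z)" for i by (rule kern_mult_shf[OF ky csm_dd[OF F]])
  show ?thesis using that kern_integrable[OF k1 that, of x] kern_integrable[OF k2 that, of x]
   by (simp add: Jint_def V_def V'_def shf_def mult.assoc)
 qed
 have "(LBINT s. f s * indicator {0..1} s) = (LBINT s. f s * indicator {0<..1} s)"
 proof (rule integral_cong_AE)
  have "f \<in> borel_measurable lborel" unfolding f_def[abs_def]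
   by (simp, intro borel_measurable_continuous_onI continuous_at_imp_continuous_on ballI continuous_intros V' DERIV_isCont[OF V])
  thus "(%s. f s * indicator {0..1} s) \<in> borel_measurable lborel" "(%s. f s * indicator {0<..1} s) \<in> borel_measurable lborel"
   by auto
  show "AE s in lborel. f s * indicator {0..1} s = f s * indicator {0<..1} s"
   using AE_lborel_singleton[of 0] by eventually_elim (auto simp: indicator_def)
 qed
 also have "... = - Iint ka (%s z. (1 - s) * (2 * ka * s * (h0 z * shf F s z) - (SU i. (snd z $ i * h0 z) * shf (dx i F) s z))) x
   - Iint ka (%s z. h0 z * shf F s z) x"
 proof -
  have k1: "kern True (%s z. h0 z * shf F s z)" by (rule kern_mult_shf[OF h0 F])
  have k2: "kern True (%s z. (1 - s) * (2 * ka * s * (h0 z * shf F s z) - (SU i. (snd z $ i * h0 z) * shf (dx i F) s z)))"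
   by (intro kern_mult[of _ True] kern_diff kern_const kern_scale kern_sum kern_mult_shf[OF ky csm_dd[OF F]]
    kern_mult[OF kern_mult[OF kern_mult[OF kern_const kern_const] kern_scale] k1])
  have "f s * indicator {0<..1} s = - (indicator {0<..1} s * (exp (- ka * s\<^sup>2) *
    Jint (%s z. (1 - s) * (2 * ka * s * (h0 z * shf F s z) - (SU i. (snd z $ i * h0 z) * shf (dx i F) s z))) s x))
    - indicator {0<..1} s * (exp (- ka * s\<^sup>2) * Jint (%s z. h0 z * shf F s z) s x)" for s
  proof (cases "s \<in> {0<..1}")
   case True
   show ?thesis unfolding J2[OF True] J1 f_def by (simp add: algebra_simps)
  qed simp
  thus ?thesis unfolding Iint_def using Iint_integrable[OF k1 assms(3), of x] Iint_integrable[OF k2 assms(3), of x] by simp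
 qed
 finally have "- V 0 = - Iint ka (%s z. (1 - s) * (2 * ka * s * (h0 z * shf F s z) - (SU i. (snd z $ i * h0 z) * shf (dx i F) s z))) x
   - Iint ka (%s z. h0 z * shf F s z) x" using ftc by simp
 moreover have "V 0 = F x * (LBINT y. h0 (x, y))" by (simp add: V_def)
 ultimately show ?thesis by linarith
qed

text \<open>The kernel left over when \<open>ka\<close> minus the operator with coefficients
  \<open>A\<close>, \<open>b\<close> acts on the kernel 2 s (1 - s) h. The term - h stems from
  differentiating 1 - s; every other term contains an x-derivative of \<open>h\<close> or a
  first-order coefficient. After integration by parts none of them differentiates
  \<open>F\<close>.\<close>

definition rker :: "('n::finite => 'n => real ^ 'n => real) => ('n => real ^ 'n => real) =>
  ((real ^ 'n) \<times> (real ^ 'n) => real) => 'n kernel" where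
 "rker A b h s z = - h z
  - ((SU i. SU j. A i j (fst z) * ((1 - s) * (2 * s * dd (axis i 1, 0) (dd (axis j 1, 0) h) z
     - 2 * dd (0, axis i 1) (dd (axis j 1, 0) h) z - 2 * dd (0, axis j 1) (dd (axis i 1, 0) h) z)))
   + (SU i. b i (fst z) * ((1 - s) * (2 * s * dd (axis i 1, 0) h z - 2 * dd (0, axis i 1) h z))))"

lemma kern_rker:
 assumes "kern True (%s. h)" "!!i j. csm (A i j)" "!!i. csm (b i)"
 shows "kern True (rker A b h)" unfolding rker_def[abs_def]
 by (intro kern_diff kern_minus kern_add kern_sum kern_mult[OF kern_fst] kern_mult[of "%s z. 1 - s"]
   kern_mult[OF kern_mult[OF kern_const kern_scale]] kern_mult[OF kern_const] kern_const kern_scale kern_dd assms)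

text \<open>The assumption \<open>heat\<close> expresses that \<open>h\<close> is a Gaussian in y
  whose quadratic form inverts \<open>A\<close>. Where both derivatives fall on \<open>F\<close>,
  one integration by parts and \<open>heat\<close> leave - (1 - s) y_j h times the
  \<open>j\<close>-th derivative of \<open>F\<close> in the kernel of ka u - A ddu; together with
  \<open>ka\<close> times \<open>u\<close> this is the expression integrated by
  \<open>Iint_ftc\<close>.\<close>

lemma parametrix:
 fixes A :: "'n::finite => 'n => real ^ 'n => real"
 assumes h: "kern True (%s. h)" and F: "csm F" and k0: "ka >= 0"
  and heat: "!!y j. (SU i. A i j x * dd (0, axis i 1) h (x, y)) = - (1 / 2) * (y $ j * h (x, y))"
 defines "u \<equiv> kop ka (%s z. 2 * s * (1 - s) * h z) F"
 shows "ka * u x - (SU i. SU j. A i j x * dx i (dx j u) x) - (SU i. b i x * dx i u x)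
  = F x * (LBINT y. h (x, y)) + kop ka (rker A b h) F x"
proof -
 define kE where "kE s z = s * (2 * (1 - s) * h z)" for s :: real and z
 have u: "u = kop ka kE F" unfolding u_def kE_def by (simp add: mult_ac)
 have k1: "kern True (%s z. 2 * (1 - s) * l z)" if "kern True (%s. l)" for l :: "(real ^ 'n) \<times> (real ^ 'n) => real"
  by (intro kern_mult[OF kern_mult[OF kern_const kern_diff[OF kern_const kern_scale]]] that)
 have ks: "kern True (%s z. s * (2 * (1 - s) * l z))" if "kern True (%s. l)" for l :: "(real ^ 'n) \<times> (real ^ 'n) => real"
  by (rule kern_mult[OF kern_scale k1[OF that]])
 have kE: "kern True kE" unfolding kE_def[abs_def] by (rule ks[OF h])
 have hd: "kern True (%s. dd v h)" "kern True (%s. dd w (dd v h))" for v w using kern_dd[OF h] kern_dd[OF kern_dd[OF h]] by auto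
 have dc: "dd v (%z. c * l z) z = c * dd v l z" if "kern True (%s. l)" for v c z and l :: "(real ^ 'n) \<times> (real ^ 'n) => real"
  by (rule dd_cmult[OF kern_differentiable[OF that, of 1]]) simp
 have dE: "(%s. dd v (%z. s * (2 * (1 - s) * l z))) = (%s z. s * (2 * (1 - s) * dd v l z))" if "kern True (%s. l)"
  for v and l :: "(real ^ 'n) \<times> (real ^ 'n) => real" using dc[OF that] by (auto simp: fun_eq_iff simp flip: mult.assoc)
 have dE': "(%s. dd v (%z. 2 * (1 - s) * l z)) = (%s z. 2 * (1 - s) * dd v l z)" if "kern True (%s. l)"
  for v and l :: "(real ^ 'n) \<times> (real ^ 'n) => real" using dc[OF that] by (auto simp: fun_eq_iff)
 have ibp: "kop ka (%s z. s * (2 * (1 - s) * l z)) (dd w G) x = - kop ka (%s z. 2 * (1 - s) * dd (0, w) l z) G x"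
  if "kern True (%s. l)" "csm G" for l :: "(real ^ 'n) \<times> (real ^ 'n) => real" and G w
  using kop_ibp[OF k1[OF that(1)] that(2) k0, of w x] unfolding dE'[OF that(1)] .
 have d1: "dd v u = (%x. kop ka (%s z. s * (2 * (1 - s) * dd (v, 0) h z)) F x + kop ka kE (dd v F) x)" for v
  unfolding u by (rule ext, subst dd_kop[OF kE F k0]) (simp only: kE_def[abs_def] dE[OF h])
 have sm: "kop ka k G differentiable (at x)" if "kern True k" "csm G" for k G x
  using smooth_on_kop[OF that k0] smooth_diff by blast
 \<comment> \<open>Derivatives on \<open>F\<close> are moved back to the kernel as far as the single
   factor s allows; only in the last term does one derivative remain on \<open>F\<close>.\<close>
 have d2: "dd w (dd v u) x = kop ka (%s z. s * (2 * (1 - s) * dd (w, 0) (dd (v, 0) h) z)) F x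
   - kop ka (%s z. 2 * (1 - s) * dd (0, w) (dd (v, 0) h) z) F x
   - kop ka (%s z. 2 * (1 - s) * dd (0, v) (dd (w, 0) h) z) F x
   - kop ka (%s z. 2 * (1 - s) * dd (0, w) h z) (dd v F) x" for v w
 proof -
  have "dd w (dd v u) x = dd w (kop ka (%s z. s * (2 * (1 - s) * dd (v, 0) h z)) F) x + dd w (kop ka kE (dd v F)) x"
   unfolding d1 by (rule dd_add; intro sm ks hd F kE csm_dd)
  also have "dd w (kop ka (%s z. s * (2 * (1 - s) * dd (v, 0) h z)) F) x =
    kop ka (%s z. s * (2 * (1 - s) * dd (w, 0) (dd (v, 0) h) z)) F x
    + kop ka (%s z. s * (2 * (1 - s) * dd (v, 0) h z)) (dd w F) x"
   by (subst dd_kop[OF ks[OF hd(1)] F k0]) (simp only: dE[OF hd(1)])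
  also have "dd w (kop ka kE (dd v F)) x = kop ka (%s z. s * (2 * (1 - s) * dd (w, 0) h z)) (dd v F) x + kop ka kE (dd w (dd v F)) x"
   by (subst dd_kop[OF kE csm_dd[OF F] k0]) (simp only: dE[OF h] kE_def[abs_def])
  finally show ?thesis using ibp[OF hd(1) F, of "(v, 0)" w] ibp[OF hd(1) F, of "(w, 0)" v] ibp[OF h csm_dd[OF F], of w v]
   by (simp add: kE_def[abs_def])
 qed
 have heat': "(SU i. A i j x * kop ka (%s z. 2 * (1 - s) * dd (0, axis i 1) h z) G x)
   = - kop ka (%s z. (1 - s) * (snd z $ j * h z)) G x" if "csm G" for j G
 proof -
  have "(SU i. A i j x * kop ka (%s z. 2 * (1 - s) * dd (0, axis i 1) h z) G x)
   = kop ka (%s z. SU i. A i j x * (2 * (1 - s) * dd (0, axis i 1) h z)) G x"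
   by (subst kop_sum[OF _ that k0]) (simp_all only: kop_cmult kern_cmult k1 hd)
  also have "... = kop ka (%s z. - 1 * ((1 - s) * (snd z $ j * h z))) G x"
  proof (rule kop_cong)
   fix s :: real and y :: "real ^ 'n"
   have e: "(SU i. A i j x * (2 * (1 - s) * dd (0, axis i 1) h (x, y))) = 2 * (1 - s) * (- (1 / 2) * (y $ j * h (x, y)))"
    unfolding heat[symmetric] sum_distrib_left by (simp only: mult_ac)
   show "(SU i. A i j x * (2 * (1 - s) * dd (0, axis i 1) h (x, y))) * G (x + s *\<^sub>R y)
     = - 1 * ((1 - s) * (snd (x, y) $ j * h (x, y))) * G (x + s *\<^sub>R y)" unfolding e by simp
  qed
  finally show ?thesis by (simp only: kop_cmult)
 qed
 have ky: "kern True (%s z. (1 - s) * (snd z $ j * h z))" for j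
  by (intro kern_mult[of "%s z. 1 - s"] kern_diff kern_const kern_scale kern_mult[OF kern_snd h])
 have ftc: "ka * u x - (SU j. kop ka (%s z. (1 - s) * (snd z $ j * h z)) (dx j F) x)
   = F x * (LBINT y. h (x, y)) - kop ka (%s. h) F x"
 proof -
  have "Iint ka (%s z. (1 - s) * (2 * ka * s * (h z * shf F s z) - (SU i. (snd z $ i * h z) * shf (dx i F) s z))) x
   = Iint ka (%s z. ka * (kE s z * shf F s z) - (SU i. (1 - s) * (snd z $ i * h z) * shf (dx i F) s z)) x"
   by (intro Iint_cong) (simp add: kE_def algebra_simps sum_distrib_left)
  also have "... = ka * u x - (SU j. kop ka (%s z. (1 - s) * (snd z $ j * h z)) (dx j F) x)" unfolding u kop_def
   by (subst Iint_diff[OF _ _ k0], intro kern_cmult kern_mult_shf kE F, intro kern_sum kern_mult_shf ky csm_dd F)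
    (subst Iint_sum[OF _ k0], auto simp: Iint_cmult intro!: kern_mult_shf ky csm_dd F)
  finally show ?thesis using Iint_ftc[OF h F k0, of x] by (simp add: kop_def)
 qed
 define K2 where "K2 i j s z = (1 - s) * (2 * s * dd (axis i 1, 0) (dd (axis j 1, 0) h) z
     - 2 * dd (0, axis i 1) (dd (axis j 1, 0) h) z - 2 * dd (0, axis j 1) (dd (axis i 1, 0) h) z)" for i j :: 'n and s z
 define K1 where "K1 i s z = (1 - s) * (2 * s * dd (axis i 1, 0) h z - 2 * dd (0, axis i 1) h z)" for i :: 'n and s z
 have kK: "kern True (K2 i j)" "kern True (K1 i)" for i j unfolding K2_def[abs_def] K1_def[abs_def]
  by (intro kern_diff kern_mult[of "%s z. 1 - s"]
   kern_mult[OF kern_mult[OF kern_const kern_scale]] kern_mult[OF kern_const] kern_const kern_scale hd)+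
 have K2: "kop ka (K2 i j) F x = kop ka (%s z. s * (2 * (1 - s) * dd (axis i 1, 0) (dd (axis j 1, 0) h) z)) F x
   - kop ka (%s z. 2 * (1 - s) * dd (0, axis i 1) (dd (axis j 1, 0) h) z) F x
   - kop ka (%s z. 2 * (1 - s) * dd (0, axis j 1) (dd (axis i 1, 0) h) z) F x" for i j
 proof -
  have "kop ka (K2 i j) F x = Iint ka (%s z. s * (2 * (1 - s) * dd (axis i 1, 0) (dd (axis j 1, 0) h) z) * shf F s z
   - 2 * (1 - s) * dd (0, axis i 1) (dd (axis j 1, 0) h) z * shf F s z
   - 2 * (1 - s) * dd (0, axis j 1) (dd (axis i 1, 0) h) z * shf F s z) x"
   unfolding kop_def by (rule Iint_cong) (simp add: K2_def algebra_simps)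
  thus ?thesis unfolding kop_def
   by (simp only: Iint_diff[OF kern_diff[OF kern_mult_shf kern_mult_shf] kern_mult_shf k0] Iint_diff[OF kern_mult_shf kern_mult_shf k0]
     ks[OF hd(2)] k1[OF hd(2)] F)
 qed
 have K1: "kop ka (K1 i) F x = kop ka (%s z. s * (2 * (1 - s) * dd (axis i 1, 0) h z)) F x
   - kop ka (%s z. 2 * (1 - s) * dd (0, axis i 1) h z) F x" for i
 proof -
  have "kop ka (K1 i) F x = Iint ka (%s z. s * (2 * (1 - s) * dd (axis i 1, 0) h z) * shf F s z
   - 2 * (1 - s) * dd (0, axis i 1) h z * shf F s z) x" unfolding kop_def by (rule Iint_cong) (simp add: K1_def algebra_simps)
  thus ?thesis unfolding kop_def by (simp only: Iint_diff[OF kern_mult_shf kern_mult_shf k0] ks[OF hd(1)] k1[OF hd(1)] F)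
 qed
 have "kop ka (rker A b h) F x = Iint ka (%s z. - 1 * (h z * shf F s z)
   - ((SU i. SU j. A i j x * (K2 i j s z * shf F s z)) + (SU i. b i x * (K1 i s z * shf F s z)))) x"
  unfolding kop_def by (rule Iint_cong) (simp add: rker_def K2_def K1_def sum_distrib_right sum_distrib_left algebra_simps)
 also have "... = - kop ka (%s. h) F x
   - ((SU i. SU j. A i j x * kop ka (K2 i j) F x) + (SU i. b i x * kop ka (K1 i) F x))"
 proof -
  note k = kern_mult_shf[OF kK(1) F] kern_mult_shf[OF kK(2) F]
  have k2: "kern True (%s z. SU j. A i j x * (K2 i j s z * shf F s z))" for i by (intro kern_sum kern_cmult k)
  have k3: "kern True (%s z. SU i. SU j. A i j x * (K2 i j s z * shf F s z))" by (intro kern_sum[OF k2])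
  have k4: "kern True (%s z. SU i. b i x * (K1 i s z * shf F s z))" by (intro kern_sum kern_cmult k)
  show ?thesis unfolding kop_def
   by (simp only: Iint_diff[OF kern_cmult[OF kern_mult_shf[OF h F]] kern_add[OF k3 k4] k0] Iint_add[OF k3 k4 k0]
    Iint_sum[OF k2 k0] Iint_sum[OF kern_cmult[OF k(1)] k0] Iint_sum[OF kern_cmult[OF k(2)] k0] Iint_cmult)
 qed
 finally have R: "kop ka (rker A b h) F x = - kop ka (%s. h) F x
   - ((SU i. SU j. A i j x * kop ka (K2 i j) F x) + (SU i. b i x * kop ka (K1 i) F x))" .
 have S2: "(SU i. SU j. A i j x * dx i (dx j u) x)
   = (SU i. SU j. A i j x * kop ka (K2 i j) F x)
    + (SU j. kop ka (%s z. (1 - s) * (snd z $ j * h z)) (dx j F) x)"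
 proof -
  have "(SU i. SU j. A i j x * dx i (dx j u) x)
   = (SU i. SU j. A i j x * kop ka (K2 i j) F x)
    - (SU i. SU j. A i j x * kop ka (%s z. 2 * (1 - s) * dd (0, axis i 1) h z) (dx j F) x)"
   by (simp add: d2 K2 right_diff_distrib sum_subtractf)
  also have "(SU i. SU j. A i j x * kop ka (%s z. 2 * (1 - s) * dd (0, axis i 1) h z) (dx j F) x)
   = - (SU j. kop ka (%s z. (1 - s) * (snd z $ j * h z)) (dx j F) x)"
   by (subst sum.swap) (simp only: heat'[OF csm_dd[OF F]] sum_negf)
  finally show ?thesis by simp
 qed
 have S1: "(SU i. b i x * dx i u x) = (SU i. b i x * kop ka (K1 i) F x)"
  using ibp[OF h F] by (intro sum.cong) (simp_all add: d1 K1 kE_def[abs_def])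
 show ?thesis using ftc unfolding R S2 S1 by linarith
qed

subsection \<open>The Gaussian kernel of a positive definite matrix function\<close>

text \<open>\<open>G\<close> will be the metric matrix in a chart and \<open>A\<close> its inverse.
  The radius 8 r accommodates two nested cutoffs: \<open>\<chi>1\<close> is supported in radius 2 r,
  well inside the ball of radius 4 r on which \<open>\<xi>\<close> equals 1.\<close>

locale gauss_cell =
 fixes a :: "real ^ 'n::finite" and r :: real and \<Omega> :: "(real ^ 'n) set"
  and G A :: "'n => 'n => real ^ 'n => real"
 assumes open_dom: "open \<Omega>" and r_pos: "r > 0" and ball_sub: "cball a (8 * r) \<subseteq> \<Omega>"
  and G_smooth: "smooth_on \<Omega> (G i j)" and A_smooth: "smooth_on \<Omega> (A i j)"
  and G_sym: "x \<in> \<Omega> ==> G i j x = G j i x"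
  and G_pos: "x \<in> \<Omega> ==> y ~= 0 ==> 0 < (SU i. SU j. G i j x * y $ i * y $ j)"
  and A_sym: "x \<in> \<Omega> ==> A i j x = A j i x"
  and A_inv: "x \<in> \<Omega> ==> (SU j. A i j x * G j k x) = (if i = k then 1 else 0)"
begin

abbreviation "\<chi>1 \<equiv> cutoff a r"
abbreviation "\<xi> \<equiv> cutoff a (4 * r)"

text \<open>Blends the metric into the identity matrix, which gives a quadratic form on the whole
  space that is uniformly positive definite.\<close>

definition Gt :: "'n => 'n => real ^ 'n => real" where
 "Gt i j x = (if i = j then 1 else 0) + \<xi> x * (G i j x - (if i = j then 1 else 0))"

definition At :: "'n => 'n => real ^ 'n => real" where
 "At i j x = \<xi> x * A i j x"

text \<open>The exponent |y|^2 / 4 of the heat kernel at time 1, with the metric frozen at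
  x.\<close>

definition Qf :: "(real ^ 'n) \<times> (real ^ 'n) => real" where
 "Qf z = (1 / 4) * (SU i. SU j. Gt i j (fst z) * snd z $ i * snd z $ j)"

definition hk :: "(real ^ 'n) \<times> (real ^ 'n) => real" where
 "hk z = \<chi>1 (fst z) * exp (- Qf z)"

lemma xi_csm: "smooth_on \<Omega> F ==> csm (%x. \<xi> x * F x)"
 using csm_cutoff_mult[OF open_dom, of "4 * r" a F] r_pos ball_sub by simp

lemma csm_At: "csm (At i j)" unfolding At_def[abs_def] by (rule xi_csm[OF A_smooth])

lemma xi_1: "norm (x - a) <= 4 * r ==> \<xi> x = 1" using cutoff_eq_1[of "4 * r" x a] r_pos by simp

lemma chi_supp: "\<chi>1 x ~= 0 ==> norm (x - a) < 2 * r"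
 using cutoff_eq_0[OF r_pos, of a x] cutoff_eq_0[OF r_pos, of x a] by (metis not_le)

lemma kern_Qf: "kern False (%s. Qf)"
proof -
 have c: "csm (%x. \<xi> x * (G i j x - (if i = j then 1 else 0)))" for i j by (intro xi_csm smooth_intros G_smooth open_dom)
 show ?thesis unfolding Qf_def[abs_def] Gt_def
  by (intro kern_mult[OF kern_const] kern_sum kern_mult[of _ False] kern_add kern_const kern_snd kern_fst[OF c])
qed

lemma Gt_pos: obtains l where "l > 0" "!!x y. (SU i. SU j. Gt i j x * y $ i * y $ j) >= l * (norm y)\<^sup>2"
proof -
 define f where "f z = (SU i. SU j. G i j (fst z) * snd z $ i * snd z $ j)" for z
 let ?K = "cball a (8 * r) \<times> sphere (0 :: real ^ 'n) 1"
 have "continuous_on ?K (%z. G i j (fst z))" for i j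
  by (rule continuous_on_compose2[OF smooth_cont[OF G_smooth]]) (use ball_sub in "auto intro!: continuous_intros")
 hence "continuous_on ?K f" unfolding f_def[abs_def] by (intro continuous_intros)
 moreover have "compact ?K" by (intro compact_Times) auto
 moreover have "?K ~= {}"
 proof -
  have "norm (axis undefined 1 :: real ^ 'n) = 1" by simp
  hence "(a, axis undefined 1) \<in> ?K" using r_pos by simp
  thus ?thesis by blast
 qed
 ultimately obtain z0 where z0: "z0 \<in> ?K" "!!z. z \<in> ?K ==> f z0 <= f z" using continuous_attains_inf[of ?K f] by blast
 have "fst z0 \<in> \<Omega>" "snd z0 ~= 0" using z0(1) ball_sub by (auto simp: mem_Times_iff subset_iff)
 hence "f z0 > 0" using G_pos[of "fst z0" "snd z0"] unfolding f_def by simp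
 \<comment> \<open>The minimum over a compact ball times the unit sphere serves the metric; capped
   at 1 it also serves the identity matrix and hence all convex combinations.\<close>
 define l where "l = min (f z0) 1"
 have l: "l > 0" using \<open>f z0 > 0\<close> by (simp add: l_def)
 have G: "(SU i. SU j. G i j x * y $ i * y $ j) >= l * (norm y)\<^sup>2" if x: "x \<in> cball a (8 * r)" for x y
 proof (cases "y = 0")
  case False
  have "f z0 <= f (x, y /\<^sub>R norm y)" using z0(2)[of "(x, y /\<^sub>R norm y)"] x False by simp
  also have "... = (SU i. SU j. G i j x * y $ i * y $ j) / (norm y)\<^sup>2"
   by (simp add: f_def power2_eq_square divide_inverse mult_ac sum_distrib_left)
  finally have "f z0 * (norm y)\<^sup>2 <= (SU i. SU j. G i j x * y $ i * y $ j)" using False by (simp add: le_divide_eq)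
  moreover have "l * (norm y)\<^sup>2 <= f z0 * (norm y)\<^sup>2" by (intro mult_right_mono) (auto simp: l_def)
  ultimately show ?thesis by linarith
 qed simp
 have y2: "(norm y)\<^sup>2 = (SU i. SU j. (if i = j then 1 else 0) * y $ i * y $ j)" for y :: "real ^ 'n"
  by (simp add: power2_norm_eq_inner inner_vec_def if_distrib[of "%c. c * _"] cong: if_cong)
 have "(SU i. SU j. Gt i j x * y $ i * y $ j) >= l * (norm y)\<^sup>2" for x y
 proof -
  have e: "(SU i. SU j. Gt i j x * y $ i * y $ j) = (1 - \<xi> x) * (norm y)\<^sup>2 + \<xi> x * (SU i. SU j. G i j x * y $ i * y $ j)"
   unfolding y2 sum_distrib_left sum.distrib[symmetric] Gt_def by (intro sum.cong refl) (simp add: algebra_simps)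
  have "\<xi> x * (SU i. SU j. G i j x * y $ i * y $ j) >= \<xi> x * (l * (norm y)\<^sup>2)"
  proof (cases "x \<in> cball a (8 * r)")
   case True
   thus ?thesis using G cutoff_bounds(1) by (intro mult_left_mono)
  next
   case False
   hence "\<xi> x = 0" using cutoff_eq_0[of "4 * r" x a] cutoff_eq_0[of "4 * r" a x] r_pos by (simp add: dist_norm norm_minus_commute)
   thus ?thesis by simp
  qed
  moreover have "(1 - \<xi> x) * (norm y)\<^sup>2 >= (1 - \<xi> x) * (l * (norm y)\<^sup>2)"
   using cutoff_bounds(2)[of a "4 * r" x] l mult_right_mono[of l 1 "(norm y)\<^sup>2"]
   by (intro mult_left_mono) (auto simp: l_def)
  ultimately have "(1 - \<xi> x) * (l * (norm y)\<^sup>2) + \<xi> x * (l * (norm y)\<^sup>2) <= (SU i. SU j. Gt i j x * y $ i * y $ j)"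
   unfolding e by linarith
  thus ?thesis by (simp add: algebra_simps)
 qed
 thus ?thesis using that l by blast
qed

lemma kern_gauss_poly:
 assumes "kern False p"
 shows "kern True (%s z. p s z * exp (- Qf z))"
proof -
 obtain l where l: "l > 0" "!!x y. (SU i. SU j. Gt i j x * y $ i * y $ j) >= l * (norm y)\<^sup>2" by (rule Gt_pos, rule that)
 show ?thesis
 proof (rule kern_gauss[OF kern_Qf _ _ assms])
  show "l / 4 > 0" using l by simp
  show "l / 4 * (norm y)\<^sup>2 <= Qf (x, y)" for x y using l(2)[of y x] by (simp add: Qf_def)
 qed
qed

lemma kern_hk: "kern True (%s. hk)"
 using kern_gauss_poly[OF kern_fst[OF csm_cutoff[OF r_pos, of a]]] by (simp add: hk_def[abs_def])

lemma Gt_sym: "Gt i j x = Gt j i x"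
proof (cases "\<xi> x = 0")
 case False
 hence "norm (x - a) < 8 * r" using cutoff_eq_0[of "4 * r" x a] cutoff_eq_0[of "4 * r" a x] r_pos by force
 hence "x \<in> \<Omega>" using ball_sub by (auto simp: dist_norm norm_minus_commute)
 thus ?thesis using G_sym[of x i j] by (simp add: Gt_def)
qed (simp add: Gt_def)

lemma dd_gauss_snd:
 assumes p: "kern False (%s. p)" "!!x y. ((%t. p (x, y + t *\<^sub>R axis i 1)) has_real_derivative p' (x, y)) (at 0)"
 shows "dd (0, axis i 1) (%z. p z * exp (- Qf z)) (x, y)
  = (p' (x, y) - p (x, y) * ((1 / 2) * (SU m. Gt i m x * y $ m))) * exp (- Qf (x, y))"
proof -
 let ?f = "%z. p z * exp (- Qf z)"
 have d: "?f differentiable (at z)" for z using kern_differentiable[OF kern_gauss_poly[OF p(1)], of 1] by simp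
 have 1: "((%t. ?f ((x, y) + t *\<^sub>R (0, axis i 1))) has_real_derivative dd (0, axis i 1) ?f ((x, y) + 0 *\<^sub>R (0, axis i 1))) (at 0)"
  by (rule dd_DERIV_line[OF d])
 have Q: "((%t. Qf (x, y + t *\<^sub>R axis i 1)) has_real_derivative (1 / 2) * (SU m. Gt i m x * y $ m)) (at 0)"
 proof -
  have ax: "((%t. (y + t *\<^sub>R axis i 1) $ k) has_real_derivative (if k = i then 1 else 0)) (at 0)" for k
   by (auto intro!: derivative_eq_intros simp: axis_def)
  have "((%t. Qf (x, y + t *\<^sub>R axis i 1)) has_real_derivative
   (1 / 4) * (SU j. SU k. Gt j k x * (if j = i then 1 else 0) * y $ k + Gt j k x * y $ j * (if k = i then 1 else 0))) (at 0)"
   unfolding Qf_def fst_conv snd_conv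
   by (rule derivative_eq_intros ax refl | simp only: scaleR_zero_left add_0_right)+ (simp add: algebra_simps)
  moreover have "(SU j. SU k. Gt j k x * (if j = i then 1 else 0) * y $ k + Gt j k x * y $ j * (if k = i then 1 else 0))
    = 2 * (SU m. Gt i m x * y $ m)"
  proof -
   have "(SU j. SU k. Gt j k x * (if j = i then 1 else 0) * y $ k) = (SU m. Gt i m x * y $ m)"
    by (subst sum.swap) (simp add: if_distrib if_distribR cong: if_cong)
   moreover have "(SU j. SU k. Gt j k x * y $ j * (if k = i then 1 else 0)) = (SU m. Gt i m x * y $ m)"
    by (simp add: if_distrib if_distribR Gt_sym[of _ i] cong: if_cong)
   ultimately show ?thesis by (simp add: sum.distrib)
  qed
  ultimately show ?thesis by simp
 qed
 have "((%t. ?f (x, y + t *\<^sub>R axis i 1)) has_real_derivative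
   (p' (x, y) - p (x, y) * ((1 / 2) * (SU m. Gt i m x * y $ m))) * exp (- Qf (x, y))) (at 0)"
  by (rule derivative_eq_intros p(2) Q refl | simp only: scaleR_zero_left add_0_right)+ (simp add: algebra_simps)
 from DERIV_unique[OF 1[simplified] this] show ?thesis by simp
qed

lemma dd_hk_snd: "dd (0, axis i 1) hk (x, y) = - ((1 / 2) * (SU m. Gt i m x * y $ m)) * hk (x, y)"
 using dd_gauss_snd[of "%z. \<chi>1 (fst z)" i "%_. 0" x y] kern_fst[OF csm_cutoff[OF r_pos, of a]] by (simp add: hk_def[abs_def])

lemma near_dom: "norm (x - a) <= 8 * r ==> x \<in> \<Omega>" using ball_sub by (auto simp: dist_norm norm_minus_commute)

lemma Gt_eq: "norm (x - a) <= 4 * r ==> Gt i j x = G i j x" "norm (x - a) <= 4 * r ==> At i j x = A i j x"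
 using xi_1 by (auto simp: Gt_def At_def)

text \<open>The y-gradient of the Gaussian is - (1/2) G y times itself, and \<open>A\<close> inverts
  \<open>G\<close> wherever \<open>\<chi>1\<close> is nonzero.\<close>

lemma heat_hk: "(SU i. At i j x * dd (0, axis i 1) hk (x, y)) = - (1 / 2) * (y $ j * hk (x, y))"
proof (cases "\<chi>1 x = 0")
 case True
 thus ?thesis by (simp add: dd_hk_snd hk_def)
next
 case False
 hence n: "norm (x - a) <= 4 * r" "norm (x - a) <= 8 * r" using chi_supp r_pos by force+
 have "(SU i. At i j x * (SU m. Gt i m x * y $ m)) = (SU i. SU m. A j i x * G i m x * y $ m)"
  using A_sym[OF near_dom[OF n(2)]] by (simp add: Gt_eq[OF n(1)] sum_distrib_left mult.assoc)
 also have "... = (SU m. (SU i. A j i x * G i m x) * y $ m)" by (subst sum.swap) (simp add: sum_distrib_right)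
 also have "... = y $ j" by (simp add: A_inv[OF near_dom[OF n(2)]] if_distrib if_distribR cong: if_cong)
 finally have "(SU i. At i j x * (SU m. Gt i m x * y $ m)) = y $ j" .
 moreover have "(SU i. At i j x * dd (0, axis i 1) hk (x, y))
   = - (1 / 2) * ((SU i. At i j x * (SU m. Gt i m x * y $ m)) * hk (x, y))"
  unfolding dd_hk_snd sum_distrib_right sum_distrib_left by (intro sum.cong refl) (simp add: algebra_simps sum_distrib_left sum_negf)
 ultimately show ?thesis by simp
qed

text \<open>The Gaussian is left unnormalized. Its mass is a smooth factor, positive near the
  centre, which is divided out only after summing over cells.\<close>

definition Nk :: "real ^ 'n => real" where
 "Nk x = (LBINT y. hk (x, y))"

lemma smooth_Nk: "smooth_on UNIV Nk"
proof -
 have "Iint 0 (%s. hk) = Nk" by (rule ext) (simp add: Iint_def Jint_def Nk_def)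
 thus ?thesis using smooth_on_Iint[OF kern_hk, of 0] by simp
qed

lemma Nk_nonneg: "Nk x >= 0"
 unfolding Nk_def hk_def by (intro Bochner_Integration.integral_nonneg mult_nonneg_nonneg cutoff_bounds(1)) auto

lemma Nk_pos: "norm (x - a) <= r ==> Nk x > 0"
proof -
 assume n: "norm (x - a) <= r"
 hence c: "\<chi>1 x = 1" using cutoff_eq_1[OF r_pos, of x a] by simp
 have i: "integrable lborel (%y. hk (x, y))" using kern_integrable[OF kern_hk, of 1] by simp
 have "Nk x ~= 0"
 proof
  assume "Nk x = 0"
  hence "AE y in lborel. hk (x, y) = 0" unfolding Nk_def using integral_nonneg_eq_0_iff_AE[OF i] by (simp add: hk_def c)
  hence "AE y in (lborel :: (real ^ 'n) measure). False" by (simp add: hk_def c)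
  thus False by (simp add: AE_iff_null null_sets_def)
 qed
 thus ?thesis using Nk_nonneg[of x] by simp
qed

text \<open>The Gaussian with covariance matrix \<open>2 A\<close> exhibits \<open>A\<close> as an average of rank one matrices.\<close>

lemma trace_le:
 assumes n: "norm (x - a) <= r" and H: "!!y. (SU i. SU j. H i j * y $ i * y $ j) <= 0"
 shows "(SU i. SU j. A i j x * H i j) <= 0"
proof -
 have n4: "norm (x - a) <= 4 * r" and dom: "x \<in> \<Omega>" using n r_pos by (auto intro: near_dom)
 have k1: "kern False (%s z. \<chi>1 (fst z) * snd z $ j)" for j by (intro kern_mult kern_fst[OF csm_cutoff[OF r_pos]] kern_snd)
 have k2: "kern False (%s z. (\<chi>1 (fst z) * snd z $ j) * snd z $ m)" for j m by (intro kern_mult k1 kern_snd)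
 define M where "M j m = (LBINT y. hk (x, y) * y $ j * y $ m)" for j m
 have int: "integrable lborel (%y. hk (x, y) * y $ j * y $ m)" for j m
  using kern_integrable[OF kern_gauss_poly[OF k2[of j m]], of 1 x] by (simp add: hk_def mult_ac)
 have int0: "integrable lborel (%y. hk (x, y))" using kern_integrable[OF kern_hk, of 1] by simp
 \<comment> \<open>The integral of the y-derivative of y_j times the Gaussian is 0; this reads as G
   M = 2 \<open>Nk x\<close> times the identity for the second moments \<open>M\<close>.\<close>
 have GM: "(SU m. G i m x * M j m) = 2 * (if i = j then Nk x else 0)" for i j
 proof -
  have d: "((%t. \<chi>1 (fst (x, y + t *\<^sub>R axis i 1)) * snd (x, y + t *\<^sub>R axis i 1) $ j) has_real_derivative \<chi>1 (fst (x, y)) * (if i = j then 1 else 0)) (at 0)" for x y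
   by (auto intro!: derivative_eq_intros simp: axis_def)
  have "0 = Jint (%s. dd (0, axis i 1) (%z. (\<chi>1 (fst z) * snd z $ j) * exp (- Qf z))) 1 x"
   by (rule Jint_dd_snd[OF kern_gauss_poly[OF k1], symmetric]) simp
  also have "... = (LBINT y. (if i = j then 1 else 0) * hk (x, y) - (1 / 2) * (SU m. G i m x * (hk (x, y) * y $ j * y $ m)))"
   unfolding Jint_def by (intro Bochner_Integration.integral_cong refl, subst dd_gauss_snd[OF k1 d])
    (simp add: hk_def Gt_eq[OF n4] sum_distrib_left sum_distrib_right algebra_simps)
  also have "... = (if i = j then 1 else 0) * Nk x - (1 / 2) * (SU m. G i m x * M j m)" using int int0 by (simp add: Nk_def M_def)
  finally show ?thesis by (simp split: if_splits)
 qed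
 have M: "M j l = 2 * A l j x * Nk x" for j l
 proof -
  have "M j l = (SU m. (SU i. A l i x * G i m x) * M j m)" by (simp add: A_inv[OF dom] if_distrib if_distribR cong: if_cong)
  also have "... = (SU i. A l i x * (SU m. G i m x * M j m))"
   unfolding sum_distrib_right sum_distrib_left by (subst sum.swap) (simp add: mult.assoc)
  also have "... = 2 * A l j x * Nk x" by (simp add: GM if_distrib if_distribR cong: if_cong)
  finally show ?thesis .
 qed
 have "(SU i. SU j. H i j * M i j) = (LBINT y. hk (x, y) * (SU i. SU j. H i j * y $ i * y $ j))"
 proof -
  have e: "hk (x, y) * (SU i. SU j. H i j * y $ i * y $ j) = (SU i. SU j. H i j * (hk (x, y) * y $ i * y $ j))" for y
   by (simp add: sum_distrib_left mult_ac)
  show ?thesis unfolding e M_def by (simp add: int)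
 qed
 also have "... <= (\<integral>(y::real ^ 'n). 0 \<partial>lborel)"
 proof (rule integral_mono)
  show "integrable lborel (%y. hk (x, y) * (SU i. SU j. H i j * y $ i * y $ j))"
  proof -
   have e: "hk (x, y) * (SU i. SU j. H i j * y $ i * y $ j) = (SU i. SU j. H i j * (hk (x, y) * y $ i * y $ j))" for y
    by (simp add: sum_distrib_left mult_ac)
   show ?thesis unfolding e by (simp add: int)
  qed
  show "hk (x, y) * (SU i. SU j. H i j * y $ i * y $ j) <= 0" for y
   using H[of y] cutoff_bounds(1)[of a r x] by (simp add: hk_def mult_le_0_iff)
 qed simp
 finally have "2 * Nk x * (SU i. SU j. A i j x * H i j) <= 0" using A_sym[OF dom] by (simp add: M sum_distrib_left mult_ac)
 thus ?thesis using Nk_pos[OF n] by (simp add: mult_le_0_iff)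
qed

end

section \<open>Smooth functions on a closed manifold\<close>

type_synonym ('a, 'n) disc = "('a, 'n) chart \<times> (real ^ 'n) \<times> real"

locale mfd =
 fixes X :: "'a topology" and A :: "('a, 'n::finite) chart set"
 assumes closed_mfd: "closed_manifold X A"
begin

abbreviation "M \<equiv> topspace X"
abbreviation "SF \<equiv> smooth_functions A"

abbreviation "ci == chart_inv"

definition im :: "('a, 'n) chart => (real ^ 'n) set" where
 "im c = chart_map c ` chart_dom c"

section \<open>Charts and their inverses\<close>

lemma chart_props:
 assumes "c \<in> A"
 shows openin_dom: "openin X (chart_dom c)" and open_im: "open (im c)"
  and homeo: "homeomorphic_map (subtopology X (chart_dom c)) (top_of_set (im c)) (chart_map c)"
 using closed_mfd assms by (auto simp: closed_manifold_def smooth_atlas_def im_def)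

lemma dom_sub: "c \<in> A ==> chart_dom c \<subseteq> M" using openin_dom openin_subset by blast

lemma inj_chart: "c \<in> A ==> inj_on (chart_map c) (chart_dom c)"
 using homeomorphic_imp_injective_map[OF homeo] dom_sub by (simp add: Int_absorb1)

lemma inv_chart [simp]: "c \<in> A ==> p \<in> chart_dom c ==> ci c (chart_map c p) = p"
 unfolding chart_inv_def by (rule inv_into_f_f[OF inj_chart])

lemma chart_inv_chart [simp]: "x \<in> im c ==> chart_map c (ci c x) = x" unfolding chart_inv_def im_def by (rule f_inv_into_f)

lemma chart_inv_dom [simp]: "x \<in> im c ==> ci c x \<in> chart_dom c" unfolding chart_inv_def im_def by (rule inv_into_into)

lemma chart_im [simp]: "p \<in> chart_dom c ==> chart_map c p \<in> im c" by (simp add: im_def)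

lemma chart_inv_M [simp]: "c \<in> A ==> x \<in> im c ==> ci c x \<in> M" using dom_sub chart_inv_dom by blast

lemma cover: "p \<in> M ==> EX c:A. p \<in> chart_dom c" using closed_mfd unfolding closed_manifold_def smooth_atlas_def by blast

lemma chart_at: "p \<in> M ==> chart_at A p \<in> A & p \<in> chart_dom (chart_at A p)"
 unfolding chart_at_def by (rule someI_ex) (use cover in blast)

lemma continuous_chart: "c \<in> A ==> continuous_map (subtopology X (chart_dom c)) (top_of_set (im c)) (chart_map c)"
 by (rule homeomorphic_imp_continuous_map[OF homeo])

lemma continuous_inv:
 assumes "c \<in> A"
 shows "continuous_map (top_of_set (im c)) X (ci c)"
proof -
 obtain k where k: "homeomorphic_maps (subtopology X (chart_dom c)) (top_of_set (im c)) (chart_map c) k"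
  using homeo[OF assms] by (auto simp: homeomorphic_map_maps)
 hence kc: "continuous_map (top_of_set (im c)) (subtopology X (chart_dom c)) k"
  and ki: "!!p. p \<in> chart_dom c ==> k (chart_map c p) = p" using dom_sub[OF assms] by (auto simp: homeomorphic_maps_def)
 have "k x = ci c x" if "x \<in> im c" for x using ki[OF chart_inv_dom[OF that]] that by simp
 hence "continuous_map (top_of_set (im c)) (subtopology X (chart_dom c)) (ci c)" using continuous_map_eq[OF kc] by simp
 thus ?thesis by (simp add: continuous_map_in_subtopology)
qed

lemma open_vimage_inv:
 assumes "c \<in> A" "openin X W"
 shows "open {x \<in> im c. ci c x \<in> W}"
 using openin_continuous_map_preimage[OF continuous_inv[OF assms(1)] assms(2)] open_im[OF assms(1)] by (simp add: openin_open_eq)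

lemma openin_inv_image:
 assumes "c \<in> A" "open S" "S \<subseteq> im c"
 shows "openin X (ci c ` S)"
proof -
 have "openin (top_of_set (im c)) S" using assms open_im[OF assms(1)] by (simp add: openin_open_eq)
 from openin_continuous_map_preimage[OF continuous_chart[OF assms(1)] this]
 have "openin X {p \<in> M \<inter> chart_dom c. chart_map c p \<in> S}"
  using openin_dom[OF assms(1)] by (simp add: openin_open_subtopology)
 moreover have "{p \<in> M \<inter> chart_dom c. chart_map c p \<in> S} = ci c ` S"
 proof (intro equalityI subsetI)
  fix p assume "p \<in> {p \<in> M \<inter> chart_dom c. chart_map c p \<in> S}"
  thus "p \<in> ci c ` S" using inv_chart[OF assms(1)] by (metis (no_types, lifting) IntD2 image_eqI mem_Collect_eq)
 next
  fix p assume "p \<in> ci c ` S"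
  thus "p \<in> {p \<in> M \<inter> chart_dom c. chart_map c p \<in> S}" using assms(1,3) by auto
 qed
 ultimately show ?thesis by simp
qed

lemma closedin_inv_image:
 assumes "c \<in> A" "compact K" "K \<subseteq> im c"
 shows "closedin X (ci c ` K)"
proof -
 have "compactin X (ci c ` K)"
  by (rule image_compactin[OF _ continuous_inv[OF assms(1)]]) (use assms in "simp add: compactin_subtopology")
 thus ?thesis using closed_mfd compactin_imp_closedin by (auto simp: closed_manifold_def)
qed

section \<open>Transition maps and the algebra of smooth functions\<close>

definition ov :: "('a, 'n) chart => ('a, 'n) chart => (real ^ 'n) set" where
 "ov c d = chart_map c ` (chart_dom c \<inter> chart_dom d)"

definition tr :: "('a, 'n) chart => ('a, 'n) chart => real ^ 'n => real ^ 'n" where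
 "tr c d x = chart_map d (ci c x)"

lemma ov_eq: "c \<in> A ==> ov c d = {x \<in> im c. ci c x \<in> chart_dom d}"
 by (auto simp: ov_def)  (metis IntI chart_inv_chart chart_inv_dom image_eqI)

lemma open_ov: "c \<in> A ==> d \<in> A ==> open (ov c d)" unfolding ov_eq by (rule open_vimage_inv[OF _ openin_dom])

lemma ov_sub: "c \<in> A ==> ov c d \<subseteq> im c" by (auto simp: ov_eq)

lemma smooth_tr: "c \<in> A ==> d \<in> A ==> smooth_on (ov c d) (tr c d)"
 using closed_mfd unfolding closed_manifold_def smooth_atlas_def ov_def tr_def[abs_def] by (auto simp: comp_def)

lemma tr_ov: "c \<in> A ==> d \<in> A ==> x \<in> ov c d ==> tr c d x \<in> ov d c" by (auto simp: ov_def tr_def)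

lemma inv_tr: "c \<in> A ==> d \<in> A ==> x \<in> ov c d ==> ci d (tr c d x) = ci c x" by (auto simp: ov_def tr_def)

lemma tr_tr: "c \<in> A ==> d \<in> A ==> x \<in> ov c d ==> tr d c (tr c d x) = x" by (auto simp: ov_def tr_def)

lemma SF_iff: "f \<in> SF \<longleftrightarrow> (ALL c:A. smooth_on (im c) (%x. f (ci c x)))"
 by (simp add: smooth_functions_def im_def comp_def)

lemma SF_smooth: "f \<in> SF ==> c \<in> A ==> smooth_on (im c) (%x. f (ci c x))" by (simp add: SF_iff)

lemma SF_diff: "f \<in> SF ==> c \<in> A ==> x \<in> im c ==> (%x. f (ci c x)) differentiable (at x)"
 using SF_smooth smooth_diff by blast

lemma smooth_transfer:
 assumes "c \<in> A" "d \<in> A" "smooth_on S (%x. f (ci c x))" "open S" "S \<subseteq> im c"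
 shows "smooth_on {x \<in> ov d c. tr d c x \<in> S} (%x. f (ci d x))" "open {x \<in> ov d c. tr d c x \<in> S}"
proof -
 have o: "open {x \<in> ov d c. tr d c x \<in> S}"
  using continuous_open_preimage[OF smooth_cont[OF smooth_tr[OF assms(2,1)]] open_ov[OF assms(2,1)] assms(4)]
  by (simp add: vimage_def Int_def)
 have "smooth_on {x \<in> ov d c. tr d c x \<in> S} (%x. f (ci c (tr d c x)))"
  by (rule smooth_on_compose[OF o assms(4) _ smooth_on_subset[OF smooth_tr[OF assms(2,1)]] assms(3)]) auto
 thus "smooth_on {x \<in> ov d c. tr d c x \<in> S} (%x. f (ci d x))"
  by (rule smooth_on_cong[OF _ o]) (use inv_tr[OF assms(2,1)] in auto)
 show "open {x \<in> ov d c. tr d c x \<in> S}" by (rule o)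
qed

lemma SF_local:
 assumes "!!p. p \<in> M ==> EX c:A. EX S. open S & S \<subseteq> im c & p \<in> chart_dom c & chart_map c p \<in> S & smooth_on S (%x. f (ci c x))"
 shows "f \<in> SF" unfolding SF_iff
proof (intro ballI smooth_on_local)
 fix d x assume d: "d \<in> A" and x: "x \<in> im d"
 obtain c S where c: "c \<in> A" "open S" "S \<subseteq> im c" "ci d x \<in> chart_dom c" "chart_map c (ci d x) \<in> S"
  "smooth_on S (%x. f (ci c x))" using assms[OF chart_inv_M[OF d x]] by blast
 have "x \<in> ov d c" using c(4) x d by (simp add: ov_eq)
 hence "x \<in> {x \<in> ov d c. tr d c x \<in> S}" using c(5) by (simp add: tr_def)
 thus "EX T. open T & x \<in> T & smooth_on T (%x. f (ci d x))" using smooth_transfer[OF c(1) d c(6,2,3)] by blast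
qed

definition lift :: "('a, 'n) chart => (real ^ 'n => real) => 'a => real" where
 "lift c h p = (if p \<in> chart_dom c then h (chart_map c p) else 0)"

lemma lift_inv [simp]: "x \<in> im c ==> lift c h (ci c x) = h x" by (simp add: lift_def)

text \<open>Away from the domain of \<open>c\<close> the function vanishes in a neighbourhood,
  because the image of the compact set \<open>K\<close> is closed in a Hausdorff space.\<close>

lemma lift_smooth_chart:
 assumes c: "c \<in> A" "d \<in> A" and h: "smooth_on (ov c d) h" and K: "compact K" "K \<subseteq> im c" "!!x. x \<in> im c ==> x \<notin> K ==> h x = 0"
 shows "smooth_on (im d) (%x. lift c h (ci d x))"
proof (rule smooth_on_local)
 fix x assume x: "x \<in> im d"
 show "EX T. open T & x \<in> T & smooth_on T (%x. lift c h (ci d x))"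
 proof (cases "ci d x \<in> chart_dom c")
  case True
  have "smooth_on (ov d c) (%x. h (tr d c x))"
   by (rule smooth_on_compose[OF open_ov[OF c(2,1)] open_ov[OF c] _ smooth_tr[OF c(2,1)] h]) (use tr_ov[OF c(2,1)] in auto)
  hence "smooth_on (ov d c) (%x. lift c h (ci d x))"
   by (rule smooth_on_cong[OF _ open_ov[OF c(2,1)]]) (use c in "auto simp: lift_def tr_def ov_eq")
  thus ?thesis using open_ov[OF c(2,1)] x True c by (auto simp: ov_eq)
 next
  case False
  let ?T = "{x \<in> im d. ci d x \<in> M - ci c ` K}"
  have o: "open ?T" by (rule open_vimage_inv[OF c(2)]) (use closedin_inv_image[OF c(1) K(1,2)] in "simp add: openin_diff closedin_def")
  have "x \<in> ?T" using x False c K(2) by auto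
  moreover have "smooth_on ?T (%x. lift c h (ci d x))"
  proof (rule smooth_on_cong[OF smooth_on_const[of _ 0] o])
   fix y assume y: "y \<in> ?T"
   show "0 = lift c h (ci d y)"
   proof (cases "ci d y \<in> chart_dom c")
    case True
    have "chart_map c (ci d y) \<notin> K"
    proof
     assume "chart_map c (ci d y) \<in> K"
     hence "ci c (chart_map c (ci d y)) \<in> ci c ` K" by (rule imageI)
     thus False using y inv_chart[OF c(1) True] by auto
    qed
    thus ?thesis using K(3)[of "chart_map c (ci d y)"] True by (simp add: lift_def)
   qed (simp add: lift_def)
  qed
  ultimately show ?thesis using o by blast
 qed
qed

lemma lift_SF:
 assumes "c \<in> A" "smooth_on (im c) h" "compact K" "K \<subseteq> im c" "!!x. x \<in> im c ==> x \<notin> K ==> h x = 0"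
 shows "lift c h \<in> SF"
 unfolding SF_iff using lift_smooth_chart[OF assms(1) _ smooth_on_subset[OF assms(2) ov_sub[OF assms(1)]] assms(3-5)] by blast

lemma SF_const: "(%p. k) \<in> SF" by (simp add: SF_iff smooth_on_const)

lemma SF_add: "f \<in> SF ==> h \<in> SF ==> (%p. f p + h p) \<in> SF" by (simp add: SF_iff smooth_on_add open_im)

lemma SF_diff': "f \<in> SF ==> h \<in> SF ==> (%p. f p - h p) \<in> SF" by (simp add: SF_iff smooth_on_diff open_im)

lemma SF_mult: "f \<in> SF ==> h \<in> SF ==> (%p. f p * h p) \<in> SF" by (simp add: SF_iff smooth_on_mult open_im)

lemma SF_cmult: "f \<in> SF ==> (%p. k * f p) \<in> SF" by (rule SF_mult[OF SF_const])

lemma SF_sum: "(!!i. i \<in> I ==> f i \<in> SF) ==> (%p. SUM i:I. f i p) \<in> SF" by (simp add: SF_iff smooth_on_sum open_im)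

lemma SF_comp:
 fixes h :: "real => real"
 assumes "f \<in> SF" "open J" "smooth_on J h" "!!p. p \<in> M ==> f p \<in> J"
 shows "(%p. h (f p)) \<in> SF" unfolding SF_iff
proof
 fix c assume c: "c \<in> A"
 show "smooth_on (im c) (%x. h (f (ci c x)))"
  by (rule smooth_on_compose[OF open_im[OF c] assms(2) _ SF_smooth[OF assms(1) c] assms(3)]) (use assms(4) c in auto)
qed

lemma SF_inverse: "f \<in> SF ==> (!!p. p \<in> M ==> f p ~= 0) ==> (%p. inverse (f p)) \<in> SF"
 using SF_comp[OF _ _ smooth_on_inverse_real] by (auto simp: open_Compl)

lemma SF_continuous: "f \<in> SF ==> continuous_map X euclideanreal f"
proof -
 assume f: "f \<in> SF"
 have "openin X {p \<in> M. f p \<in> W}" if W: "open W" for W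
 proof (subst openin_subopen, intro ballI)
  fix p assume p: "p \<in> {p \<in> M. f p \<in> W}"
  obtain c where c: "c \<in> A" "p \<in> chart_dom c" using cover p by blast
  let ?S = "im c \<inter> (%x. f (ci c x)) -` W"
  have "continuous_on (im c) (%x. f (ci c x))" by (rule smooth_cont[OF SF_smooth[OF f c(1)]])
  hence "open ?S" by (rule continuous_open_preimage[OF _ open_im[OF c(1)] W])
  hence "openin X (ci c ` ?S)" by (rule openin_inv_image[OF c(1)]) auto
  moreover have "p \<in> ci c ` ?S" using c p by (intro image_eqI[of _ _ "chart_map c p"]) auto
  moreover have "ci c ` ?S \<subseteq> {p \<in> M. f p \<in> W}" using c by auto
  ultimately show "EX T. openin X T & p \<in> T & T \<subseteq> {p \<in> M. f p \<in> W}" by blast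
 qed
 thus ?thesis by (simp add: continuous_map_def)
qed

lemma SF_bounded:
 assumes "f \<in> SF"
 obtains C where "C > 0" "!!p. p \<in> M ==> \<bar>f p\<bar> <= C"
proof -
 have "compactin X M" using closed_mfd by (auto simp: closed_manifold_def compact_space_def)
 hence "compact (f ` M)" using image_compactin[OF _ SF_continuous[OF assms]] by auto
 hence "bounded (f ` M)" by (rule compact_imp_bounded)
 thus ?thesis using that by (auto simp: bounded_pos)
qed

lemma SF_attains_min:
 assumes "f \<in> SF" "M ~= {}"
 obtains p where "p \<in> M" "!!q. q \<in> M ==> f p <= f q"
proof -
 have "compactin X M" using closed_mfd by (auto simp: closed_manifold_def compact_space_def)
 hence "compact (f ` M)" using image_compactin[OF _ SF_continuous[OF assms(1)]] by auto
 thus ?thesis using compact_attains_inf[of "f ` M"] assms(2) that by blast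
qed

subsection \<open>Cells and vector fields\<close>

text \<open>The ball of radius r is what covers the manifold. The room up to 8 r serves cutoffs that
  equal 1 up to radius r, 2 r or 4 r and vanish beyond twice that radius.\<close>

definition cell :: "('a, 'n) disc => bool" where
 "cell i = (case i of (c, a, r) => c \<in> A & r > 0 & cball a (8 * r) \<subseteq> im c)"

definition core :: "('a, 'n) disc => 'a set" where
 "core i = (case i of (c, a, r) => ci c ` ball a r)"

lemma finite_cells: "EX I. finite I & (ALL i:I. cell i) & M = (\<Union>i\<in>I. core i)"
proof -
 have "EX i. cell i & p \<in> core i" if p: "p \<in> M" for p
 proof -
  obtain c where c: "c \<in> A" "p \<in> chart_dom c" using cover[OF p] by blast
  obtain e where e: "e > 0" "cball (chart_map c p) e \<subseteq> im c"
   using open_im[OF c(1)] chart_im[OF c(2)] open_contains_cball by blast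
  have "cell (c, chart_map c p, e / 8)" using c e by (simp add: cell_def)
  moreover have "p \<in> core (c, chart_map c p, e / 8)"
   using c e by (auto simp: core_def intro!: image_eqI[of _ _ "chart_map c p"])
  ultimately show ?thesis by blast
 qed
 hence M: "M \<subseteq> \<Union> (core ` {i. cell i})" by blast
 have op: "openin X (core i)" if "cell i" for i
 proof -
  obtain c a r where i: "i = (c, a, r)" by (cases i)
  have "ball a r \<subseteq> cball a (8 * r)" using that by (auto simp: i cell_def)
  thus ?thesis using that unfolding i cell_def core_def by (auto intro!: openin_inv_image)
 qed
 have cm: "compactin X M" using closed_mfd by (auto simp: closed_manifold_def compact_space_def)
 obtain F where F: "finite F" "F \<subseteq> core ` {i. cell i}" "M \<subseteq> \<Union> F"
  using conjunct2[OF cm[unfolded compactin_def], rule_format, of "core ` {i. cell i}"] M op by auto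
 then obtain I where I: "finite I" "I \<subseteq> {i. cell i}" "F = core ` I" using finite_subset_image[OF F(1,2)] by blast
 have "core i \<subseteq> M" if "i \<in> I" for i using op[THEN openin_subset] I(2) that by blast
 hence "M = (\<Union>i\<in>I. core i)" using F(3) I(3) by blast
 thus ?thesis using I by blast
qed

definition cells :: "('a, 'n) disc set" where
 "cells = (SOME I. finite I & (ALL i:I. cell i) & M = (\<Union>i\<in>I. core i))"

lemma cells: "finite cells" "i \<in> cells ==> cell i" "M = (\<Union>i\<in>cells. core i)"
 using someI_ex[OF finite_cells] unfolding cells_def by blast+

text \<open>A coordinate field of a cell cut off to a global field. It is the exact partial
  derivative on the ball of radius 2 r, which contains both the core and the support of the kernels
  of the cell.\<close>

definition vf :: "('a, 'n) disc \<times> 'n => ('a => real) => 'a => real" where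
 "vf ij f = (case ij of ((c, a, r), j) => lift c (%x. cutoff a (2 * r) x * dx j (%x. f (ci c x)) x))"

text \<open>The \<open>l\<close>-th component of such a field in an arbitrary chart
  \<open>d\<close>, extended by 0.\<close>

definition vcoef :: "('a, 'n) disc \<times> 'n => ('a, 'n) chart => 'n => real ^ 'n => real" where
 "vcoef ij d l x = (case ij of ((c, a, r), j) =>
   lift c (%y. cutoff a (2 * r) y * dx j (%y. tr c d y $ l) y) (ci d x))"

definition vfs :: "(('a, 'n) disc \<times> 'n) set" where
 "vfs = cells \<times> UNIV"

lemma finite_vfs: "finite vfs" by (simp add: vfs_def cells)

lemma cell_ball: "cell (c, a, r) ==> c \<in> A" "cell (c, a, r) ==> r > 0" "cell (c, a, r) ==> t <= 8 * r ==> cball a t \<subseteq> im c"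
 unfolding cell_def by (auto simp: subset_iff)

lemma cutoff_supp: "r > 0 ==> x \<notin> cball a (2 * r) ==> cutoff a r x = 0"
 by (rule cutoff_eq_0) (auto simp: dist_norm norm_minus_commute)

lemma vf_SF:
 assumes "ij \<in> vfs" "f \<in> SF"
 shows "vf ij f \<in> SF"
proof -
 obtain c a r j where ij: "ij = ((c, a, r), j)" by (metis prod.collapse)
 have c: "cell (c, a, r)" using assms(1) cells(2) by (auto simp: ij vfs_def)
 show ?thesis unfolding ij vf_def prod.case
  by (rule lift_SF[OF cell_ball(1)[OF c] _ compact_cball[of a "4 * r"] cell_ball(3)[OF c]])
   (use cutoff_supp[of "2 * r" _ a] cell_ball[OF c] in "auto intro!: smooth_intros smooth_on_cutoff SF_smooth open_im assms(2)")
qed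

lemma smooth_vcoef:
 assumes "ij \<in> vfs" "d \<in> A"
 shows "smooth_on (im d) (vcoef ij d l)"
proof -
 obtain c a r j where ij: "ij = ((c, a, r), j)" by (metis prod.collapse)
 have c: "cell (c, a, r)" using assms(1) cells(2) by (auto simp: ij vfs_def)
 show ?thesis unfolding ij vcoef_def[abs_def] prod.case
  by (rule lift_smooth_chart[OF cell_ball(1)[OF c] assms(2) _ compact_cball[of a "4 * r"] cell_ball(3)[OF c]])
   (use cutoff_supp[of "2 * r" _ a] cell_ball[OF c] in "auto intro!: smooth_intros smooth_on_cutoff smooth_tr open_ov assms(2)")
qed

lemma dd_chart_change:
 assumes c: "c \<in> A" "d \<in> A" and x: "x \<in> ov c d" and f: "(%y. f (ci d y)) differentiable (at (tr c d x))"
 shows "dd v (%x. f (ci c x)) x = (SU l. dd v (%x. tr c d x $ l) x * dx l (%y. f (ci d y)) (tr c d x))"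
proof -
 have "dd v (%x. f (ci c x)) x = dd v (%x. f (ci d (tr c d x))) x"
  by (rule dd_cong_open[OF open_ov[OF c] x]) (simp add: inv_tr[OF c])
 also have "... = (SU l. dd v (%x. tr c d x $ l) x * dx l (%y. f (ci d y)) (tr c d x))"
  by (rule dd_compose[OF smooth_diff[OF smooth_tr[OF c] x] f])
 finally show ?thesis .
qed

lemma vf_chart:
 assumes "ij \<in> vfs" "d \<in> A" "f \<in> SF" "x \<in> im d"
 shows "vf ij f (ci d x) = (SU l. vcoef ij d l x * dx l (%x. f (ci d x)) x)"
proof -
 obtain c a r j where ij: "ij = ((c, a, r), j)" by (metis prod.collapse)
 have c: "cell (c, a, r)" using assms(1) cells(2) by (auto simp: ij vfs_def)
 note cA = cell_ball(1)[OF c]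
 show ?thesis
 proof (cases "ci d x \<in> chart_dom c")
  case True
  hence xo: "x \<in> ov d c" using assms by (simp add: ov_eq)
  have "(%y. f (ci d y)) differentiable (at (tr c d (tr d c x)))"
   unfolding tr_tr[OF assms(2) cA xo] by (rule SF_diff[OF assms(3,2,4)])
  from dd_chart_change[OF cA assms(2) tr_ov[OF assms(2) cA xo] this, of "axis j 1"]
  show ?thesis using True unfolding tr_tr[OF assms(2) cA xo]
   by (simp add: ij vf_def vcoef_def lift_def sum_distrib_left mult.assoc flip: tr_def)
 qed (simp add: ij vf_def vcoef_def lift_def)
qed

lemma vf_core:
 assumes "((c, a, r), j) \<in> vfs" "f \<in> SF" "x \<in> cball a (2 * r)"
 shows "vf ((c, a, r), j) f (ci c x) = dx j (%x. f (ci c x)) x"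
proof -
 have c: "cell (c, a, r)" using assms(1) cells(2) by (auto simp: vfs_def)
 hence "x \<in> im c" using cell_ball(3)[of c a r "2 * r"] cell_ball(2)[of c a r] assms(3) by auto
 moreover have "cutoff a (2 * r) x = 1"
  by (rule cutoff_eq_1) (use c assms(3) in "auto simp: cell_def dist_norm norm_minus_commute")
 ultimately show ?thesis by (simp add: vf_def)
qed

end

section \<open>The Riemannian metric in charts\<close>

locale rmfd = mfd X A for X :: "'a topology" and A :: "('a, 'n::finite) chart set" +
 fixes g :: "'a metric_tensor"
 assumes riem: "riemannian_metric X A g"
begin

definition pd :: "('a, 'n) chart => 'n => ('a => real) => real ^ 'n => real" where
 "pd c i f x = dx i (%x. f (ci c x)) x"

lemma partial_eq: "partial c i f p = pd c i f (chart_map c p)" by (simp add: partial_def pd_def dd_def comp_def)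

lemma smooth_pd: "f \<in> SF ==> c \<in> A ==> smooth_on (im c) (pd c i f)"
 unfolding pd_def[abs_def] by (intro smooth_intros SF_smooth)

definition Gm :: "('a, 'n) chart => real ^ 'n => real ^ 'n ^ 'n" where
 "Gm c x = metric_matrix A g c (ci c x)"

definition Am :: "('a, 'n) chart => real ^ 'n => real ^ 'n ^ 'n" where
 "Am c x = inv_metric A g c (ci c x)"

definition vd :: "('a, 'n) chart => real ^ 'n => real" where
 "vd c x = volume_density A g c (ci c x)"

lemma smooth_Gm: "c \<in> A ==> smooth_on (im c) (%x. Gm c x $ i $ j)"
 using riem unfolding riemannian_metric_def Gm_def im_def by auto

lemma coord_vector_tangent:
 assumes "c \<in> A" "p \<in> chart_dom c"
 shows "coord_vector A c i p \<in> tangent_space A p"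
proof -
 have x: "chart_map c p \<in> im c" "ci c (chart_map c p) = p" using assms by auto
 have d: "(%x. f (ci c x)) differentiable (at (chart_map c p))" if "f \<in> SF" for f by (rule SF_diff[OF that assms(1) x(1)])
 have lin: "(%q. a * f q + b * h q) \<in> SF" "(%q. f q * h q) \<in> SF" if "f \<in> SF" "h \<in> SF" for f h a b
  using that by (auto intro: SF_add SF_cmult SF_mult)
 have "pd c i (%q. a * f q + b * h q) (chart_map c p) = a * pd c i f (chart_map c p) + b * pd c i h (chart_map c p)"
  if "f \<in> SF" "h \<in> SF" for f h a b
  unfolding pd_def using d[OF that(1)] d[OF that(2)] by (subst dd_add) (auto simp: dd_cmult)
 moreover have "pd c i (%q. f q * h q) (chart_map c p) = f p * pd c i h (chart_map c p) + h p * pd c i f (chart_map c p)"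
  if "f \<in> SF" "h \<in> SF" for f h unfolding pd_def using d[OF that(1)] d[OF that(2)] x(2) by (subst dd_mult) auto
 ultimately show ?thesis using lin by (simp add: tangent_space_def coord_vector_def partial_eq)
qed

lemma zero_tangent: "(%f. 0) \<in> tangent_space A p" by (simp add: tangent_space_def)

lemma tangent_lin:
 "v \<in> tangent_space A p ==> w \<in> tangent_space A p ==> (%f. a * v f + b * w f) \<in> tangent_space A p"
 by (simp add: tangent_space_def algebra_simps)

lemma tangent_sum:
 "finite I ==> (!!i. i \<in> I ==> v i \<in> tangent_space A p) ==> (%f. SUM i:I. a i * v i f) \<in> tangent_space A p"
proof (induction I rule: finite_induct)
 case (insert i I)
 thus ?case using tangent_lin[of "v i" p "%f. SUM i:I. a i * v i f" "a i" 1] by simp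
qed (simp add: zero_tangent)

lemma g_sym: "p \<in> M ==> v \<in> tangent_space A p ==> w \<in> tangent_space A p ==> g p v w = g p w v"
 using riem unfolding riemannian_metric_def by blast

lemma g_lin: "p \<in> M ==> v \<in> tangent_space A p ==> w \<in> tangent_space A p ==> z \<in> tangent_space A p ==>
  g p (%f. a * v f + b * w f) z = a * g p v z + b * g p w z" using riem unfolding riemannian_metric_def by blast

lemma g_pos: "p \<in> M ==> v \<in> tangent_space A p ==> v ~= (%_. 0) ==> g p v v > 0"
 using riem unfolding riemannian_metric_def by blast

lemma g_sum:
 assumes "p \<in> M" "z \<in> tangent_space A p"
 shows "finite I ==> (!!i. i \<in> I ==> v i \<in> tangent_space A p) ==>
  g p (%f. SUM i:I. a i * v i f) z = (SUM i:I. a i * g p (v i) z)"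
proof (induction I rule: finite_induct)
 case empty
 show ?case using g_lin[OF assms(1) zero_tangent zero_tangent assms(2), of 0 0] by simp
next
 case (insert i I)
 have "g p (%f. a i * v i f + 1 * (SUM i:I. a i * v i f)) z = a i * g p (v i) z + 1 * g p (%f. SUM i:I. a i * v i f) z"
  by (rule g_lin[OF assms(1) _ tangent_sum assms(2)]) (use insert in auto)
 thus ?case using insert by simp
qed

lemma g_sum2:
 assumes "p \<in> M" "!!i. v i \<in> tangent_space A p" "!!i. w i \<in> tangent_space A p"
 shows "g p (%f. SU i. a i * v i f) (%f. SU j. b j * w j f)
  = (SUM i:(UNIV::'n set). SUM j:(UNIV::'n set). a i * b j * g p (v i) (w j))"
proof -
 have t: "(%f. SU j. b j * w j f) \<in> tangent_space A p" by (rule tangent_sum) (use assms in auto)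
 have "g p (v i) (%f. SU j. b j * w j f) = (SU j. b j * g p (v i) (w j))" for i
  using g_sum[OF assms(1) assms(2)[of i], of UNIV w b] assms g_sym[OF assms(1) assms(2)[of i] t]
   g_sym[OF assms(1) assms(2)[of i] assms(3)] by simp
 thus ?thesis using g_sum[OF assms(1) t, of UNIV v a] assms by (simp add: sum_distrib_left mult.assoc)
qed

section \<open>Change of chart for the metric, its positivity and its inverse\<close>

definition Jm :: "('a, 'n) chart => ('a, 'n) chart => real ^ 'n => real ^ 'n ^ 'n" where
 "Jm c d x = (\<chi> k i. dx i (%x. tr c d x $ k) x)"

lemma smooth_Jm: "c \<in> A ==> d \<in> A ==> smooth_on (ov c d) (%x. Jm c d x $ k $ i)"
 unfolding Jm_def by (simp, intro smooth_intros smooth_tr open_ov)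

lemma pd_change:
 assumes "c \<in> A" "d \<in> A" "x \<in> ov c d" "(%y. f (ci d y)) differentiable (at (tr c d x))"
 shows "pd c i f x = (SU l. Jm c d x $ l $ i * pd d l f (tr c d x))" using dd_chart_change[OF assms] by (simp add: pd_def Jm_def)

lemma coord_vector_change:
 assumes "c \<in> A" "d \<in> A" "x \<in> ov c d"
 shows "coord_vector A c i (ci c x) = (%f. SU l. Jm c d x $ l $ i * coord_vector A d l (ci c x) f)"
proof
 fix f
 have x: "x \<in> im c" "ci c x \<in> chart_dom d" using assms(1,3) by (auto simp: ov_eq)
 show "coord_vector A c i (ci c x) f = (SU l. Jm c d x $ l $ i * coord_vector A d l (ci c x) f)"
 proof (cases "f \<in> SF")
  case True
  have "(%y. f (ci d y)) differentiable (at (tr c d x))" by (rule SF_diff[OF True assms(2)]) (use x in "simp add: tr_def")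
  from pd_change[OF assms this] show ?thesis using True x(1) by (simp add: coord_vector_def partial_eq tr_def)
 qed (simp add: coord_vector_def)
qed

lemma metric_change:
 assumes "c \<in> A" "d \<in> A" "x \<in> ov c d"
 shows "Gm c x = transpose (Jm c d x) ** Gm d (tr c d x) ** Jm c d x"
proof -
 have x: "x \<in> im c" "ci c x \<in> chart_dom d" "ci c x \<in> M" using assms(1,3) by (auto simp: ov_eq)
 have "Gm c x $ i $ j = (SU k. SU l. Jm c d x $ k $ i * Jm c d x $ l $ j * Gm d (tr c d x) $ k $ l)" for i j
  unfolding Gm_def metric_matrix_def inv_tr[OF assms] vec_lambda_beta coord_vector_change[OF assms]
  by (rule g_sum2[OF x(3)]) (rule coord_vector_tangent[OF assms(2) x(2)])+
 also have "... i j = (transpose (Jm c d x) ** Gm d (tr c d x) ** Jm c d x) $ i $ j" for i j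
  unfolding matrix_matrix_mult_def transpose_def vec_lambda_beta sum_distrib_right by (subst sum.swap) (simp add: mult_ac)
 finally show ?thesis by (simp add: vec_eq_iff)
qed

lemma metric_sym: "c \<in> A ==> x \<in> im c ==> Gm c x $ i $ j = Gm c x $ j $ i"
 unfolding Gm_def metric_matrix_def by (simp add: g_sym coord_vector_tangent)

text \<open>Positivity of the metric speaks about nonzero derivations of global functions, so a
  combination of coordinate vectors must be shown nonzero: it sends a cut-off coordinate function,
  extended by 0, to the nonzero number y_k.\<close>

lemma metric_pos:
 assumes c: "c \<in> A" and x: "x \<in> im c" and y: "y ~= 0"
 shows "0 < (SU i. SU j. Gm c x $ i $ j * y $ i * y $ j)"
proof -
 let ?p = "ci c x"
 define v where "v = (%f. SU i. y $ i * coord_vector A c i ?p f)"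
 have t: "coord_vector A c i ?p \<in> tangent_space A ?p" for i by (rule coord_vector_tangent[OF c]) (use x in auto)
 have vt: "v \<in> tangent_space A ?p" unfolding v_def by (rule tangent_sum) (use t in auto)
 obtain k where k: "y $ k ~= 0" using y by (auto simp: vec_eq_iff)
 obtain e where e: "e > 0" "cball x e \<subseteq> im c" using open_im[OF c] x open_contains_cball by blast
 define h where "h z = cutoff x (e / 2) z * z $ k" for z
 have hs: "smooth_on S h" if "open S" for S unfolding h_def[abs_def] by (intro smooth_intros smooth_on_cutoff that)
 have f: "lift c h \<in> SF"
  by (rule lift_SF[OF c hs[OF open_im[OF c]] compact_cball e(2)]) (use cutoff_supp[of "e / 2" _ x] e in "auto simp: h_def")
 have "pd c i (lift c h) x = (if i = k then 1 else 0)" for i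
 proof -
  have "pd c i (lift c h) x = dx i (%z. z $ k) x" unfolding pd_def
  proof (rule dd_cong_open[of "ball x (e / 2)"])
   fix z assume "z \<in> ball x (e / 2)"
   hence "z \<in> im c" "norm (z - x) <= e / 2" using e by (auto simp: dist_norm norm_minus_commute)
   thus "lift c h (ci c z) = z $ k" using e cutoff_eq_1[of "e / 2" z x] by (simp add: h_def)
  qed (use e in auto)
  also have "... = axis i 1 $ k" by (rule dd_eqI) (rule bounded_linear_imp_has_derivative[OF bounded_linear_vec_nth])
  finally show ?thesis by (simp add: axis_def)
 qed
 note e = this
 have "v (lift c h) = y $ k" using f x c by (simp add: v_def coord_vector_def partial_eq e mult_delta_right)
 hence "v ~= (%_. 0)" using k by auto
 hence "0 < g ?p v v" using g_pos[OF _ vt] c x by simp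
 also have "g ?p v v = (SU i. SU j. y $ i * y $ j * g ?p (coord_vector A c i ?p) (coord_vector A c j ?p))"
  unfolding v_def by (rule g_sum2) (use c x t in auto)
 finally show ?thesis by (simp add: Gm_def metric_matrix_def mult_ac)
qed

end

text \<open>All matrices on the segment from the identity to \<open>B\<close> are positive definite,
  hence invertible; the determinant is continuous along it, starts at 1 and never vanishes.\<close>

lemma pos_def_det_pos:
 fixes B :: "real ^ 'n ^ 'n"
 assumes "!!y. y ~= 0 ==> 0 < (SU i. SU j. B $ i $ j * y $ i * y $ j)"
 shows "det B > 0"
proof -
 define C where "C t = (1 - t) *\<^sub>R mat 1 + t *\<^sub>R B" for t :: real
 have nz: "det (C t) ~= 0" if t: "t \<in> {0..1}" for t
 proof -
  have "y = 0" if "C t *v y = 0" for y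
  proof (rule ccontr)
   assume y: "y ~= 0"
   have "0 = y \<bullet> (C t *v y)" using that by simp
   also have "... = (1 - t) * (norm y)\<^sup>2 + t * (SU i. SU j. B $ i $ j * y $ i * y $ j)"
    unfolding C_def matrix_vector_mult_add_rdistrib scaleR_matrix_vector_assoc[symmetric] matrix_vector_mul_lid inner_add_right inner_scaleR_right
     power2_norm_eq_inner by (simp add: inner_vec_def matrix_vector_mult_def sum_distrib_left mult_ac)
   also have "... > 0"
   proof (cases "t = 0")
    case False
    thus ?thesis using assms[OF y] t by (simp add: add_nonneg_pos)
   qed (use y in simp)
   finally show False by simp
  qed
  hence "invertible (C t)" by (simp add: invertible_left_inverse matrix_left_invertible_ker)
  thus ?thesis by (simp add: invertible_det_nz)
 qed
 have cont: "continuous_on {0..1} (%t. det (C t))" unfolding det_def C_def by (intro continuous_intros)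
 have "det (C 0) = 1" by (simp add: C_def)
 hence "det (C 1) > 0"
  using IVT2'[of "%t. det (C t)" 1 0 0] cont nz by (metis atLeastAtMost_iff less_eq_real_def not_le zero_le_one)
 thus ?thesis by (simp add: C_def)
qed

context rmfd
begin

lemma det_pos: "c \<in> A ==> x \<in> im c ==> det (Gm c x) > 0" by (rule pos_def_det_pos[OF metric_pos])

lemma vd_eq: "vd c x = sqrt (det (Gm c x))" by (simp add: vd_def volume_density_def Gm_def)

lemma vd_pos: "c \<in> A ==> x \<in> im c ==> vd c x > 0" by (simp add: vd_eq det_pos)

lemma smooth_det:
 fixes B :: "'b::euclidean_space => real ^ 'k::finite ^ 'k"
 assumes "open S" "!!i j. smooth_on S (%x. B x $ i $ j)"
 shows "smooth_on S (%x. det (B x))" unfolding det_def by (intro smooth_intros assms)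

lemma smooth_vd: "c \<in> A ==> smooth_on (im c) (vd c)"
 unfolding vd_eq[abs_def] by (intro smooth_intros smooth_det open_im smooth_Gm) (auto simp: det_pos)

lemma inverse_metric:
 assumes "c \<in> A" "x \<in> im c"
 shows "Am c x ** Gm c x = mat 1" "Gm c x ** Am c x = mat 1"
proof -
 have "invertible (Gm c x)" using det_pos[OF assms] by (simp add: invertible_det_nz)
 hence "Gm c x ** matrix_inv (Gm c x) = mat 1 & matrix_inv (Gm c x) ** Gm c x = mat 1"
  unfolding invertible_def matrix_inv_def by (rule someI_ex)
 thus "Am c x ** Gm c x = mat 1" "Gm c x ** Am c x = mat 1" by (simp_all add: Am_def Gm_def inv_metric_def)
qed

lemma inverse_metric_unique:
 assumes "c \<in> A" "x \<in> im c" "B ** Gm c x = mat 1"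
 shows "B = Am c x" by (metis assms inverse_metric(2) matrix_mul_assoc matrix_mul_lid matrix_mul_rid)

text \<open>The inverse matrix is defined by choice; Cramer's rule writes its entries as quotients
  of determinants with smooth entries.\<close>

lemma smooth_Am:
 assumes c: "c \<in> A"
 shows "smooth_on (im c) (%x. Am c x $ i $ j)"
proof -
 define B where "B x = (\<chi> k l. if l = i then axis j 1 $ k else Gm c x $ k $ l)" for x
 have "Am c x $ i $ j = det (B x) / det (Gm c x)" if x: "x \<in> im c" for x
 proof -
  have "Gm c x *v (Am c x *v axis j 1) = axis j 1" by (simp add: matrix_vector_mul_assoc inverse_metric(2)[OF c x])
  hence "Am c x *v axis j 1 = (\<chi> k. det (\<chi> i' j'. if j' = k then axis j 1 $ i' else Gm c x $ i' $ j') / det (Gm c x))"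
   using cramer[of "Gm c x" "Am c x *v axis j 1" "axis j 1"] det_pos[OF c x] by simp
  moreover have "(Am c x *v axis j 1) $ i = Am c x $ i $ j" by (simp add: matrix_vector_mult_basis column_def)
  ultimately show ?thesis by (simp add: B_def)
 qed
 moreover have "smooth_on (im c) (%x. det (B x) / det (Gm c x))"
 proof (rule smooth_on_divide[OF open_im[OF c] smooth_det[OF open_im[OF c]] smooth_det[OF open_im[OF c] smooth_Gm[OF c]]])
  show "smooth_on (im c) (%x. B x $ k $ l)" for k l by (cases "l = i") (auto simp: B_def intro!: smooth_intros smooth_Gm c)
  show "x \<in> im c ==> det (Gm c x) ~= 0" for x using det_pos[OF c] by force
 qed
 ultimately show ?thesis using smooth_on_cong[OF _ open_im[OF c]] by force
qed

lemma inverse_metric_sym: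
 assumes "c \<in> A" "x \<in> im c"
 shows "Am c x $ i $ j = Am c x $ j $ i"
proof -
 have "transpose (Gm c x) = Gm c x" using metric_sym[OF assms] by (simp add: transpose_def vec_eq_iff)
 hence "transpose (Am c x) ** Gm c x = mat 1"
  using arg_cong[OF inverse_metric(2)[OF assms], of transpose] by (simp add: matrix_transpose_mul transpose_mat)
 hence "transpose (Am c x) = Am c x" by (rule inverse_metric_unique[OF assms])
 from arg_cong[OF this, of "%B. B $ j $ i"] show ?thesis by (simp add: transpose_def)
qed

lemma Jm_inverse:
 assumes "c \<in> A" "d \<in> A" "x \<in> ov c d"
 shows "Jm d c (tr c d x) ** Jm c d x = mat 1"
proof -
 have t: "tr c d x \<in> ov d c" by (rule tr_ov[OF assms])
 have "(SU k. Jm d c (tr c d x) $ i $ k * Jm c d x $ k $ j) = (if i = j then 1 else 0)" for i j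
 proof -
  have "(SU k. dx j (%x. tr c d x $ k) x * dx k (%y. tr d c y $ i) (tr c d x)) = dx j (%x. tr d c (tr c d x) $ i) x"
   by (rule dd_compose[symmetric], rule smooth_diff[OF smooth_tr[OF assms(1,2)] assms(3)])
    (rule smooth_diff[OF smooth_on_component[OF open_ov[OF assms(2,1)] smooth_tr[OF assms(2,1)]] t])
  also have "... = dx j (%x. x $ i) x" by (rule dd_cong_open[OF open_ov[OF assms(1,2)] assms(3)]) (simp add: tr_tr[OF assms(1,2)])
  also have "... = axis j 1 $ i" by (rule dd_eqI) (rule bounded_linear_imp_has_derivative[OF bounded_linear_vec_nth])
  finally show ?thesis by (simp add: Jm_def axis_def mult.commute)
 qed
 thus ?thesis by (simp add: matrix_matrix_mult_def mat_def vec_eq_iff)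
qed

lemma Jm_inverse2:
 assumes "c \<in> A" "d \<in> A" "x \<in> ov c d"
 shows "Jm c d x ** Jm d c (tr c d x) = mat 1" using Jm_inverse[OF assms(2,1) tr_ov[OF assms]] by (simp add: tr_tr[OF assms])

lemma inverse_metric_change:
 assumes "c \<in> A" "d \<in> A" "x \<in> ov c d"
 shows "Am d (tr c d x) = Jm c d x ** Am c x ** transpose (Jm c d x)"
proof -
 let ?J = "Jm c d x" and ?K = "Jm d c (tr c d x)"
 have x: "x \<in> im c" "tr c d x \<in> im d" using assms ov_sub tr_ov[OF assms] by blast+
 have "?J ** Am c x ** transpose ?J ** Gm d (tr c d x) = ?J ** Am c x ** (transpose ?J ** Gm d (tr c d x) ** ?J) ** ?K"
  by (simp add: matrix_mul_assoc[symmetric] Jm_inverse2[OF assms])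
 also have "... = ?J ** (Am c x ** Gm c x) ** ?K" by (simp add: metric_change[OF assms] matrix_mul_assoc)
 also have "... = mat 1" by (simp add: inverse_metric[OF assms(1) x(1)] Jm_inverse2[OF assms])
 finally show ?thesis using inverse_metric_unique[OF assms(2) x(2)] by simp
qed

lemma vd_change:
 assumes "c \<in> A" "d \<in> A" "x \<in> ov c d"
 shows "vd c x = \<bar>det (Jm c d x)\<bar> * vd d (tr c d x)" unfolding vd_eq metric_change[OF assms] det_mul det_transpose
 by (simp add: real_sqrt_mult)

lemma gauss_cell:
 assumes "cell (c, a, r)"
 shows "gauss_cell a r (im c) (%i j x. Gm c x $ i $ j) (%i j x. Am c x $ i $ j)"
proof
 note c = cell_ball(1)[OF assms]
 show "open (im c)" "r > 0" "cball a (8 * r) \<subseteq> im c" using assms open_im by (auto simp: cell_def)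
 show "smooth_on (im c) (%x. Gm c x $ i $ j)" "smooth_on (im c) (%x. Am c x $ i $ j)" for i j
  by (rule smooth_Gm[OF c], rule smooth_Am[OF c])
 fix x assume x: "x \<in> im c"
 show "Gm c x $ i $ j = Gm c x $ j $ i" "Am c x $ i $ j = Am c x $ j $ i" for i j
  by (rule metric_sym[OF c x], rule inverse_metric_sym[OF c x])
 show "y ~= 0 ==> 0 < (SU i. SU j. Gm c x $ i $ j * y $ i * y $ j)" for y by (rule metric_pos[OF c x])
 show "(SU j. Am c x $ i $ j * Gm c x $ j $ k) = (if i = k then 1 else 0)" for i k
  using inverse_metric(1)[OF c x] by (simp add: matrix_matrix_mult_def mat_def vec_eq_iff)
qed

end

section \<open>Change of variables for arbitrary finite index types\<close>

text \<open>The library states the change of variables formula for well-ordered index types, so the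
 coordinates are renumbered by initial segments of the natural numbers.\<close>

typedef ('n::finite) idx = "{..<CARD('n)}" by (rule exI[of _ 0]) simp

instance idx :: (finite) finite
proof
 show "finite (UNIV :: 'a idx set)" using type_definition.Abs_image[OF type_definition_idx] finite_imageI finite_lessThan by metis
qed

instantiation idx :: (finite) wellorder
begin

definition "less_eq_idx (x :: 'a idx) (y :: 'a idx) \<longleftrightarrow> Rep_idx x <= Rep_idx y"
definition "less_idx (x :: 'a idx) (y :: 'a idx) \<longleftrightarrow> Rep_idx x < Rep_idx y"

instance
proof
 fix P :: "'a idx => bool" and a :: "'a idx"
 assume step: "!!x. (!!y. y < x ==> P y) ==> P x"
 show "P a" by (induction a rule: measure_induct_rule[of Rep_idx]) (rule step, simp add: less_idx_def)
qed (auto simp: less_eq_idx_def less_idx_def Rep_idx_inject)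

end

lemma card_idx: "CARD('n::finite idx) = CARD('n)" by (simp add: type_definition.card[OF type_definition_idx])

definition reidx :: "('m => 'n) => real ^ 'n => real ^ 'm" where
 "reidx b x = (\<chi> i. x $ b i)"

lemma linear_reidx: "linear (reidx b :: real ^ 'n::finite => real ^ 'm::finite)"
 by (rule linearI) (simp_all add: reidx_def vec_eq_iff)

lemma bounded_linear_reidx: "bounded_linear (reidx b :: real ^ 'n::finite => real ^ 'm::finite)"
 using linear_reidx linear_conv_bounded_linear by blast

lemma reidx_inv:
 "bij b ==> reidx b (reidx (inv b) y) = y" "bij b ==> reidx (inv b) (reidx b x) = x"
 by (simp_all add: reidx_def vec_eq_iff bij_def inv_f_f surj_f_inv_f)

lemma measurable_reidx [measurable]: "(reidx b :: real ^ 'n::finite => real ^ 'm::finite) \<in> borel \<rightarrow>\<^sub>M borel"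
 by (intro borel_measurable_continuous_onI linear_continuous_on bounded_linear_reidx)

lemma prod_Basis_cart: "(\<Prod>e\<in>Basis. (x :: real ^ 'k::finite) \<bullet> e) = (\<Prod>i\<in>UNIV. x $ i)"
proof -
 have B: "(Basis :: (real ^ 'k) set) = (%i. axis i 1) ` UNIV" by (auto simp: Basis_vec_def)
 have i: "inj (%i::'k. axis i (1::real))" by (auto simp: inj_on_def axis_eq_axis)
 show ?thesis unfolding B prod.reindex[OF i] by (simp add: inner_axis)
qed

lemma image_reidx:
 assumes "bij (b :: 'm::finite => 'n::finite)"
 shows "reidx b ` T = reidx (inv b) -` T"
proof (intro equalityI subsetI)
 fix y assume "y \<in> reidx (inv b) -` T"
 thus "y \<in> reidx b ` T" using reidx_inv(1)[OF assms, of y] by (intro image_eqI[of _ _ "reidx (inv b) y"]) auto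
qed (auto simp: reidx_inv(2)[OF assms])

lemma lborel_reidx:
 assumes b: "bij (b :: 'm::finite => 'n::finite)"
 shows "distr lborel borel (reidx b) = lborel"
proof (rule lborel_eqI[symmetric])
 fix l u :: "real ^ 'm" assume le: "!!e. e \<in> Basis ==> l \<bullet> e <= u \<bullet> e"
 have le': "l $ i <= u $ i" for i using le[of "axis i 1"] by (simp add: axis_in_Basis_iff inner_axis)
 have "reidx b -` box l u = box (reidx (inv b) l) (reidx (inv b) u)"
 proof (intro set_eqI)
  fix x :: "real ^ 'n"
  have "(ALL i. l $ i < x $ b i & x $ b i < u $ i) \<longleftrightarrow> (ALL j. l $ inv b j < x $ j & x $ j < u $ inv b j)"
   using b by (metis bij_inv_eq_iff)
  thus "x \<in> reidx b -` box l u \<longleftrightarrow> x \<in> box (reidx (inv b) l) (reidx (inv b) u)"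
   by (simp add: mem_box_cart reidx_def)
 qed
 hence "emeasure (distr lborel borel (reidx b)) (box l u) = emeasure lborel (box (reidx (inv b) l) (reidx (inv b) u))"
  by (simp add: emeasure_distr)
 also have "... = (\<Prod>e\<in>Basis. (reidx (inv b) u - reidx (inv b) l) \<bullet> e)"
  by (rule emeasure_lborel_box) (auto simp: Basis_vec_def inner_axis reidx_def le')
 also have "(\<Prod>e\<in>Basis. (reidx (inv b) u - reidx (inv b) l) \<bullet> e) = (\<Prod>j\<in>UNIV. u $ inv b j - l $ inv b j)"
  unfolding prod_Basis_cart by (simp add: reidx_def)
 also have "... = (\<Prod>i\<in>UNIV. u $ i - l $ i)"
  by (rule prod.reindex_bij_betw[of "inv b" UNIV UNIV "%i. u $ i - l $ i"]) (use b bij_imp_bij_inv in auto)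
 finally show "emeasure (distr lborel borel (reidx b)) (box l u) = (\<Prod>e\<in>Basis. (u - l) \<bullet> e)"
  by (simp add: prod_Basis_cart)
qed simp

lemma emeasure_reidx:
 assumes "bij (b :: 'm::finite => 'n::finite)" "T \<in> sets borel"
 shows "emeasure lborel (reidx b ` T) = emeasure lborel T"
proof -
 have "reidx b ` T = reidx (inv b) -` T" by (rule image_reidx[OF assms(1)])
 moreover have "emeasure (distr lborel borel (reidx (inv b))) T = emeasure lborel (reidx (inv b) -` T)"
  using assms(2) by (simp add: emeasure_distr)
 ultimately show ?thesis using lborel_reidx[OF bij_imp_bij_inv[OF assms(1)]] by simp
qed

lemma sets_reidx:
 assumes "bij (b :: 'm::finite => 'n::finite)" "T \<in> sets borel"
 shows "reidx b ` T \<in> sets borel"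
proof -
 have "reidx b ` T = reidx (inv b) -` T" by (rule image_reidx[OF assms(1)])
 thus ?thesis using measurable_sets[OF measurable_reidx assms(2), of "inv b"] by simp
qed

text \<open>Conjugation by a bijection turns a transposition into a transposition and so preserves
  the length of a decomposition.\<close>

lemma sign_conj:
 assumes b: "bij (b :: 'm::finite => 'n::finite)" and p: "p permutes UNIV"
 shows "sign (b \<circ> p \<circ> inv b) = sign p"
proof -
 have conj: "swapidseq n (b \<circ> p \<circ> inv b)" if "swapidseq n p" for n and p :: "'m => 'm" using that
 proof (induction n p rule: swapidseq.induct)
  case id
  have "b \<circ> id \<circ> inv b = id" using b by (simp add: fun_eq_iff bij_is_surj surj_f_inv_f)
  thus ?case by (metis swapidseq.id)
 next
  case (comp_Suc n p x y)
  have "b \<circ> (Transposition.transpose x y \<circ> p) \<circ> inv b = Transposition.transpose (b x) (b y) \<circ> (b \<circ> p \<circ> inv b)"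
   using b by (auto simp: fun_eq_iff Transposition.transpose_def bij_def inj_eq)
  moreover have "b x ~= b y" using comp_Suc(2) b by (simp add: bij_def inj_eq)
  ultimately show ?case using swapidseq.comp_Suc[OF comp_Suc(3), of "b x" "b y"] by (simp only: not_False_eq_True simp_thms)
 qed
 obtain n where n: "swapidseq n p" using permutation_permutes[of p] p unfolding permutation_def by (metis finite)
 have "evenperm p = even n" using evenperm_unique[OF n] by simp
 moreover have "evenperm (b \<circ> p \<circ> inv b) = even n" using evenperm_unique[OF conj[OF n]] by simp
 ultimately show ?thesis by (simp add: sign_def)
qed

lemma det_reidx:
 fixes B :: "real ^ 'n::finite ^ 'n"
 assumes b: "bij (b :: 'm::finite => 'n)"
 shows "det (\<chi> i j. B $ b i $ b j) = det B"
proof -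
 have bb: "inv b (b i) = i" "b (inv b j) = j" for i j using b by (simp_all add: bij_def surj_f_inv_f)
 have bij: "bij_betw (%p. b \<circ> p \<circ> inv b) {p. p permutes (UNIV::'m set)} {p. p permutes (UNIV::'n set)}"
 proof (rule bij_betw_byWitness[where f' = "%q. inv b \<circ> q \<circ> b"])
  show "ALL p:{p. p permutes UNIV}. inv b \<circ> (b \<circ> p \<circ> inv b) \<circ> b = p"
   "ALL q:{p. p permutes UNIV}. b \<circ> (inv b \<circ> q \<circ> b) \<circ> inv b = q" by (auto simp: fun_eq_iff bb)
  show "(%p. b \<circ> p \<circ> inv b) ` {p. p permutes UNIV} \<subseteq> {p. p permutes UNIV}"
   "(%q. inv b \<circ> q \<circ> b) ` {p. p permutes UNIV} \<subseteq> {p. p permutes UNIV}"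
   using b bij_imp_bij_inv[OF b] by (auto simp: bij_betw_def[symmetric] permutes_univ bij_iff simp flip: bij_iff intro!: bij_comp)
 qed
 have "det B = (SUM q:{p. p permutes (UNIV::'n set)}. of_int (sign q) * (\<Prod>j\<in>UNIV. B $ j $ q j))" by (simp add: det_def)
 also have "... = (SUM p:{p. p permutes (UNIV::'m set)}. of_int (sign (b \<circ> p \<circ> inv b)) * (\<Prod>j\<in>UNIV. B $ j $ (b \<circ> p \<circ> inv b) j))"
  by (rule sum.reindex_bij_betw[OF bij, symmetric])
 also have "... = (SUM p:{p. p permutes (UNIV::'m set)}. of_int (sign p) * (\<Prod>i\<in>UNIV. B $ b i $ b (p i)))"
 proof (intro sum.cong refl arg_cong2[of _ _ _ _ "(*)"])
  fix p assume "p \<in> {p. p permutes (UNIV::'m set)}"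
  thus "real_of_int (sign (b \<circ> p \<circ> inv b)) = real_of_int (sign p)" using sign_conj[OF b] by simp
  show "(\<Prod>j\<in>UNIV. B $ j $ (b \<circ> p \<circ> inv b) j) = (\<Prod>i\<in>UNIV. B $ b i $ b (p i))"
   using prod.reindex_bij_betw[OF b, of "%j. B $ j $ (b \<circ> p \<circ> inv b) j"] by (simp add: bb)
 qed
 finally show ?thesis by (simp add: det_def)
qed

text \<open>If either side is finite, the change of variables formula for real integrals applies and
  makes both sides equal; otherwise both are infinite.\<close>

lemma emeasure_differentiable_image_wellorder:
 fixes f :: "real ^ 'm::{finite,wellorder} => real ^ 'm::_"
 assumes S: "S \<in> sets borel" and fS: "f ` S \<in> sets borel"
  and d: "!!x. x \<in> S ==> (f has_derivative f' x) (at x within S)" and inj: "inj_on f S"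
  and m: "(%x. indicator S x * \<bar>det (matrix (f' x))\<bar>) \<in> borel_measurable borel"
 shows "emeasure lborel (f ` S) = (\<integral>\<^sup>+x. ennreal \<bar>det (matrix (f' x))\<bar> * indicator S x \<partial>lborel)"
proof (cases "emeasure lborel (f ` S) < \<infinity>")
 case True
 hence "f ` S \<in> lmeasurable" using fS by (simp add: fmeasurable_def)
 hence "((%x. \<bar>det (matrix (f' x))\<bar>) has_integral measure lebesgue (f ` S)) S"
  using has_measure_differentiable_image[OF _ d inj] S by auto
 hence "(\<integral>\<^sup>+x. ennreal \<bar>det (matrix (f' x))\<bar> * indicator S x \<partial>lborel) = ennreal (measure lebesgue (f ` S))"
  by (intro nn_integral_has_integral_lebesgue') auto
 also have "... = emeasure lborel (f ` S)"
 proof -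
  have "measure lebesgue (f ` S) = measure lborel (f ` S)" using fS by (intro measure_completion) simp
  moreover have "emeasure lborel (f ` S) = ennreal (measure lborel (f ` S))"
   using True by (intro emeasure_eq_ennreal_measure) auto
  ultimately show ?thesis by (simp only:)
 qed
 finally show ?thesis by (rule sym)
next
 case False
 have "(\<integral>\<^sup>+x. ennreal \<bar>det (matrix (f' x))\<bar> * indicator S x \<partial>lborel) = \<infinity>"
 proof (rule ccontr)
  assume fin: "(\<integral>\<^sup>+x. ennreal \<bar>det (matrix (f' x))\<bar> * indicator S x \<partial>lborel) ~= \<infinity>"
  have eq: "(\<integral>\<^sup>+x. ennreal \<bar>det (matrix (f' x))\<bar> * indicator S x \<partial>lborel) = (\<integral>\<^sup>+x. ennreal (indicator S x * \<bar>det (matrix (f' x))\<bar>) \<partial>lborel)"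
   by (intro nn_integral_cong) (auto simp: indicator_def)
  obtain I where I: "(\<integral>\<^sup>+x. ennreal (indicator S x * \<bar>det (matrix (f' x))\<bar>) \<partial>lborel) = ennreal I" "I >= 0"
   using fin unfolding eq infinity_ennreal_def
   by (cases "\<integral>\<^sup>+x. ennreal (indicator S x * \<bar>det (matrix (f' x))\<bar>) \<partial>lborel" rule: ennreal_cases) auto
  have "((%x. indicator S x * \<bar>det (matrix (f' x))\<bar>) has_integral I) UNIV"
   by (rule nn_integral_has_integral[OF m _ _ I(2)]) (use I in auto)
  hence "((%x. if x \<in> S then \<bar>det (matrix (f' x))\<bar> else 0) has_integral I) UNIV"
   by (rule has_integral_cong[THEN iffD1, rotated]) (auto simp: indicator_def)
  hence "((%x. \<bar>det (matrix (f' x))\<bar>) has_integral I) S" by (simp only: has_integral_restrict_UNIV)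
  hence "f ` S \<in> lmeasurable" using has_measure_differentiable_image[OF _ d inj] S by auto
  thus False using False fS by (simp add: fmeasurable_def)
 qed
 thus ?thesis using False by (simp add: not_less top_unique)
qed

theorem emeasure_differentiable_image:
 fixes f :: "real ^ 'n::finite => real ^ 'n"
 assumes S: "S \<in> sets borel" and fS: "f ` S \<in> sets borel"
  and d: "!!x. x \<in> S ==> (f has_derivative f' x) (at x)" and inj: "inj_on f S"
  and m: "(%x. indicator S x * \<bar>det (matrix (f' x))\<bar>) \<in> borel_measurable borel"
 shows "emeasure lborel (f ` S) = (\<integral>\<^sup>+x. ennreal \<bar>det (matrix (f' x))\<bar> * indicator S x \<partial>lborel)"
proof -
 obtain b :: "'n idx => 'n" where b: "bij b" using finite_same_card_bij[of "UNIV :: 'n idx set" "UNIV :: 'n set"] card_idx by auto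
 note binv = bij_imp_bij_inv[OF b]
 define L where "L = (reidx b :: real ^ 'n => real ^ 'n idx)"
 define K where "K = (reidx (inv b) :: real ^ 'n idx => real ^ 'n)"
 have LK [simp]: "L (K y) = y" "K (L x) = x" for x y unfolding L_def K_def by (rule reidx_inv[OF b])+
 have bl: "bounded_linear L" "bounded_linear K" unfolding L_def K_def by (rule bounded_linear_reidx)+
 have Lm: "L \<in> borel \<rightarrow>\<^sub>M borel" "K \<in> borel \<rightarrow>\<^sub>M borel" unfolding L_def K_def by (rule measurable_reidx)+
 define F where "F y = L (f (K y))" for y
 define F' where "F' y = (%v. L (f' (K y) (K v)))" for y
 have det: "det (matrix (F' y)) = det (matrix (f' (K y)))" for y
 proof -
  have "K (axis j 1) = axis (b j) 1" for j
   using b by (auto simp: K_def reidx_def vec_eq_iff axis_def bij_inv_eq_iff) (metis bij_inv_eq_iff)+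
  note Kax = this
  have "matrix (F' y) = (\<chi> i j. matrix (f' (K y)) $ b i $ b j)"
   by (simp add: matrix_def F'_def Kax, simp add: L_def reidx_def vec_eq_iff)
  thus ?thesis using det_reidx[OF b] by simp
 qed
 have img: "F ` (L ` S) = L ` (f ` S)" by (simp add: image_image F_def)
 have mem: "y \<in> L ` S \<longleftrightarrow> K y \<in> S" for y by (metis LK image_iff)
 have "emeasure lborel (F ` (L ` S)) = (\<integral>\<^sup>+y. ennreal \<bar>det (matrix (F' y))\<bar> * indicator (L ` S) y \<partial>lborel)"
 proof (rule emeasure_differentiable_image_wellorder)
  show "L ` S \<in> sets borel" "F ` (L ` S) \<in> sets borel" unfolding img unfolding L_def by (intro sets_reidx b S fS)+
  show "inj_on F (L ` S)" by (rule inj_onI) (use inj in "auto simp: F_def inj_on_def", metis LK(2))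
  show "(F has_derivative F' y) (at y within L ` S)" if "y \<in> L ` S" for y
  proof -
   have "K y \<in> S" using that by (simp add: mem)
   from has_derivative_compose[OF has_derivative_compose[OF bounded_linear_imp_has_derivative[OF bl(2)] d[OF this]] bounded_linear_imp_has_derivative[OF bl(1)]]
   show ?thesis unfolding F_def F'_def by (rule has_derivative_at_withinI)
  qed
  have "(%y. indicator S (K y) * \<bar>det (matrix (f' (K y)))\<bar>) \<in> borel_measurable borel"
   by (rule measurable_compose[OF Lm(2) m])
  thus "(%y. indicator (L ` S) y * \<bar>det (matrix (F' y))\<bar>) \<in> borel_measurable borel"
   unfolding det by (simp add: indicator_def mem)
 qed
 also have "... = (\<integral>\<^sup>+y. ennreal \<bar>det (matrix (f' (K y)))\<bar> * indicator S (K y) \<partial>lborel)"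
  by (intro nn_integral_cong) (simp add: det indicator_def mem)
 also have "... = (\<integral>\<^sup>+y. ennreal (indicator S (K y) * \<bar>det (matrix (f' (K y)))\<bar>) \<partial>lborel)"
  by (intro nn_integral_cong) (simp add: indicator_def)
 also have "... = (\<integral>\<^sup>+x. ennreal (indicator S x * \<bar>det (matrix (f' x))\<bar>) \<partial>distr lborel borel K)"
  using m Lm by (subst nn_integral_distr) auto
 also have "... = (\<integral>\<^sup>+x. ennreal \<bar>det (matrix (f' x))\<bar> * indicator S x \<partial>lborel)"
  unfolding K_def lborel_reidx[OF binv] by (intro nn_integral_cong) (simp add: indicator_def)
 finally show ?thesis unfolding img unfolding L_def emeasure_reidx[OF b fS] .
qed

section \<open>The Riemannian volume measure\<close>

text \<open>The formula for sets says that two measures coincide: the image under \<open>f\<close>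
  of the Jacobian density on \<open>S\<close>, and Lebesgue measure restricted to the image of
  \<open>S\<close>. Integrating \<open>h\<close> against both gives the claim. Extending
  \<open>f\<close> by 0 off \<open>S\<close> is harmless since the density vanishes there.\<close>

lemma nn_integral_differentiable_image:
 fixes f :: "real ^ 'n::finite => real ^ 'n"
 assumes S: "S \<in> sets borel" and fT: "!!T. T \<in> sets borel ==> T \<subseteq> S ==> f ` T \<in> sets borel"
  and d: "!!x. x \<in> S ==> (f has_derivative f' x) (at x)" and inj: "inj_on f S"
  and m: "(%x. indicator S x * \<bar>det (matrix (f' x))\<bar>) \<in> borel_measurable borel"
  and h: "h \<in> borel_measurable borel"
 shows "(\<integral>\<^sup>+y. h y * indicator (f ` S) y \<partial>lborel) = (\<integral>\<^sup>+x. ennreal \<bar>det (matrix (f' x))\<bar> * h (f x) * indicator S x \<partial>lborel)"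
proof -
 define w where "w x = ennreal (indicator S x * \<bar>det (matrix (f' x))\<bar>)" for x
 have wm: "w \<in> borel_measurable borel" unfolding w_def[abs_def] using m by simp
 define F where "F x = (if x \<in> S then f x else 0)" for x
 have "continuous_on S f" using d has_derivative_continuous_on has_derivative_at_withinI by blast
 hence Fm: "F \<in> borel \<rightarrow>\<^sub>M borel"
  unfolding F_def[abs_def] using borel_measurable_continuous_on_if[OF S, of f "%_. 0"] by simp
 have "distr (density lborel w) borel F = density lborel (indicator (f ` S))"
 proof (rule measure_eqI)
  fix T assume "T \<in> sets (distr (density lborel w) borel F)"
  hence T: "T \<in> sets borel" by simp
  have FT: "F -` T \<in> sets borel" using measurable_sets[OF Fm T] by simp
  have e: "f ` (S \<inter> F -` T) = f ` S \<inter> T" by (auto simp: F_def)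
  have "emeasure (distr (density lborel w) borel F) T = emeasure (density lborel w) (F -` T)"
   using T Fm by (simp add: emeasure_distr)
  also have "... = (\<integral>\<^sup>+x. w x * indicator (F -` T) x \<partial>lborel)"
   using FT wm by (simp add: emeasure_density)
  also have "... = (\<integral>\<^sup>+x. ennreal \<bar>det (matrix (f' x))\<bar> * indicator (S \<inter> F -` T) x \<partial>lborel)"
   by (intro nn_integral_cong) (auto simp: w_def indicator_def)
  also have "... = emeasure lborel (f ` (S \<inter> F -` T))"
  proof (rule emeasure_differentiable_image[symmetric])
   show "S \<inter> F -` T \<in> sets borel" using S FT by auto
   thus "f ` (S \<inter> F -` T) \<in> sets borel" by (rule fT) auto
   show "inj_on f (S \<inter> F -` T)" using inj by (rule inj_on_subset) auto
   have "(%x. indicator (F -` T) x * (indicator S x * \<bar>det (matrix (f' x))\<bar>)) \<in> borel_measurable borel"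
    using m FT by measurable
   thus "(%x. indicator (S \<inter> F -` T) x * \<bar>det (matrix (f' x))\<bar>) \<in> borel_measurable borel"
    by (rule measurable_cong[THEN iffD1, rotated]) (auto simp: indicator_def)
  qed (use d in auto)
  also have "... = emeasure (density lborel (indicator (f ` S))) T"
  proof -
   have "emeasure (density lborel (indicator (f ` S))) T = (\<integral>\<^sup>+x. indicator (f ` S) x * indicator T x \<partial>lborel)"
    using T fT[OF S] by (subst emeasure_density) auto
   also have "... = emeasure lborel (f ` S \<inter> T)" using T fT[OF S] by (simp add: indicator_inter_arith[symmetric])
   finally show ?thesis unfolding e by simp
  qed
  finally show "emeasure (distr (density lborel w) borel F) T = emeasure (density lborel (indicator (f ` S))) T" .
 qed simp
 hence "(\<integral>\<^sup>+y. h y \<partial>density lborel (indicator (f ` S))) = (\<integral>\<^sup>+y. h y \<partial>distr (density lborel w) borel F)" by simp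
 also have "... = (\<integral>\<^sup>+x. w x * h (F x) \<partial>lborel)"
  using wm Fm h by (simp add: nn_integral_distr nn_integral_density)
 also have "... = (\<integral>\<^sup>+x. ennreal \<bar>det (matrix (f' x))\<bar> * h (f x) * indicator S x \<partial>lborel)"
  by (intro nn_integral_cong) (auto simp: w_def F_def indicator_def)
 also have "(\<integral>\<^sup>+y. h y \<partial>density lborel (indicator (f ` S))) = (\<integral>\<^sup>+y. h y * indicator (f ` S) y \<partial>lborel)"
  using h fT[OF S] by (simp add: nn_integral_density mult.commute)
 finally show ?thesis .
qed

context rmfd
begin

section \<open>Borel sets and volume densities in single charts\<close>

abbreviation "SM \<equiv> sigma_sets M {U. openin X U}"

lemma opens_Pow: "{U. openin X U} \<subseteq> Pow M" using openin_subset by auto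

lemma SM_algebra: "sigma_algebra M SM" by (rule sigma_algebra_sigma_sets[OF opens_Pow])

lemma sets_chart_vimage: "c \<in> A ==> B \<in> SM ==> {x \<in> im c. ci c x \<in> B} \<in> sets borel"
proof -
 assume c: "c \<in> A" and "B \<in> SM"
 from this(2) show ?thesis
 proof (induction rule: sigma_sets.induct)
  case (Basic a)
  thus ?case using open_vimage_inv[OF c] by auto
 next
  case (Compl a)
  have "{x \<in> im c. ci c x \<in> M - a} = im c - {x \<in> im c. ci c x \<in> a}" using c by auto
  thus ?case using Compl open_im[OF c] by auto
 next
  case (Union a)
  have "{x \<in> im c. ci c x \<in> (\<Union>i. a i)} = (\<Union>i. {x \<in> im c. ci c x \<in> a i})" by auto
  thus ?case using Union by auto
 qed simp
qed

lemma chart_image_eq: "c \<in> A ==> B \<subseteq> chart_dom c ==> chart_map c ` B = {x \<in> im c. ci c x \<in> B}"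
 by (auto simp: im_def)

lemma sets_chart_image: "c \<in> A ==> B \<in> SM ==> B \<subseteq> chart_dom c ==> chart_map c ` B \<in> sets borel"
 using sets_chart_vimage chart_image_eq by simp

lemma continuous_preimage_borel:
 fixes f :: "real ^ 'n => real ^ 'n"
 assumes "open S" "continuous_on S f" "T \<in> sets borel"
 shows "{y \<in> S. f y \<in> T} \<in> sets borel"
proof -
 have m: "(%x. if x \<in> S then f x else 0) \<in> borel \<rightarrow>\<^sub>M borel"
  using borel_measurable_continuous_on_if[OF _ assms(2), of "%_. 0"] assms(1) by simp
 have "{y \<in> S. f y \<in> T} = S \<inter> (%x. if x \<in> S then f x else 0) -` T" by auto
 thus ?thesis using measurable_sets[OF m assms(3)] assms(1) by auto
qed

text \<open>The value that the defining property of the volume prescribes for a Borel set inside the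
  domain of \<open>c\<close>.\<close>

definition mc :: "('a, 'n) chart => 'a set => ennreal" where
 "mc c B = (\<integral>\<^sup>+x. ennreal (vd c x) * indicator (chart_map c ` B) x \<partial>lborel)"

lemma measurable_on_im:
 "c \<in> A ==> continuous_on (im c) f ==> (%x. indicator (im c) x * f x :: real) \<in> borel_measurable borel"
 using borel_measurable_continuous_on_indicator[of "im c" f] open_im by simp

lemma measurable_vd: "c \<in> A ==> (%x. indicator (im c) x * vd c x) \<in> borel_measurable borel"
 by (intro measurable_on_im smooth_cont smooth_vd)

lemma mc_eq: "B \<subseteq> chart_dom c ==> mc c B = (\<integral>\<^sup>+x. ennreal (indicator (im c) x * vd c x) * indicator (chart_map c ` B) x \<partial>lborel)"
 unfolding mc_def by (intro nn_integral_cong) (auto simp: indicator_def im_def)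

lemma mc_emeasure:
 assumes "c \<in> A" "B \<in> SM" "B \<subseteq> chart_dom c"
 shows "mc c B = emeasure (density lborel (%x. ennreal (indicator (im c) x * vd c x))) (chart_map c ` B)"
 unfolding mc_eq[OF assms(3)] using measurable_vd[OF assms(1)] sets_chart_image[OF assms] by (subst emeasure_density) auto

text \<open>The Jacobian determinant of the transition map is the ratio of the two volume densities,
  so the prescriptions of two charts are consistent.\<close>

lemma mc_change:
 assumes c: "c \<in> A" "d \<in> A" and B: "B \<in> SM" "B \<subseteq> chart_dom c" "B \<subseteq> chart_dom d"
 shows "mc c B = mc d B"
proof -
 let ?S = "chart_map c ` B" and ?t = "tr c d"
 have So: "?S \<subseteq> ov c d" using B by (auto simp: ov_def)
 have S: "?S \<in> sets borel" by (rule sets_chart_image[OF c(1) B(1,2)])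
 have timg: "?t ` T = {y \<in> ov d c. tr d c y \<in> T}" if "T \<subseteq> ov c d" for T
 proof (intro equalityI subsetI)
  fix y assume "y \<in> ?t ` T"
  thus "y \<in> {y \<in> ov d c. tr d c y \<in> T}" using that tr_ov[OF c] tr_tr[OF c] by force
 next
  fix y assume "y \<in> {y \<in> ov d c. tr d c y \<in> T}"
  thus "y \<in> ?t ` T" using tr_tr[OF c(2,1)] by (intro image_eqI[of _ _ "tr d c y"]) auto
 qed
 have td: "(?t has_derivative (%v. dd v ?t x)) (at x)" if "x \<in> ?S" for x
  using dd_works[OF smooth_diff[OF smooth_tr[OF c]]] that So by blast
 have mat: "matrix (%v. dd v ?t x) = Jm c d x" if "x \<in> ?S" for x
  using dd_component[OF smooth_diff[OF smooth_tr[OF c], of x]] that So by (auto simp: matrix_def Jm_def)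
 have imgS: "?t ` ?S = chart_map d ` B" using B c by (auto simp: tr_def image_image intro!: image_cong)
 have "(\<integral>\<^sup>+y. ennreal (indicator (im d) y * vd d y) * indicator (?t ` ?S) y \<partial>lborel)
  = (\<integral>\<^sup>+x. ennreal \<bar>det (matrix (%v. dd v ?t x))\<bar> * ennreal (indicator (im d) (?t x) * vd d (?t x)) * indicator ?S x \<partial>lborel)"
 proof (rule nn_integral_differentiable_image[OF S _ td])
  show "?t ` T \<in> sets borel" if "T \<in> sets borel" "T \<subseteq> ?S" for T
   using timg[of T] continuous_preimage_borel[OF open_ov[OF c(2,1)] smooth_cont[OF smooth_tr[OF c(2,1)]] that(1)] that(2) So by auto
  show "inj_on ?t ?S" using tr_tr[OF c] So by (metis inj_on_def subsetD)
  have "continuous_on (ov c d) (%x. \<bar>det (Jm c d x)\<bar>)"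
   by (intro continuous_intros smooth_cont smooth_det open_ov c smooth_Jm)
  hence "(%x. indicator (ov c d) x * \<bar>det (Jm c d x)\<bar>) \<in> borel_measurable borel"
   using borel_measurable_continuous_on_indicator[of "ov c d" "%x. \<bar>det (Jm c d x)\<bar>"] open_ov[OF c] by simp
  hence "(%x. indicator ?S x * (indicator (ov c d) x * \<bar>det (Jm c d x)\<bar>)) \<in> borel_measurable borel"
   using S by measurable
  thus "(%x. indicator ?S x * \<bar>det (matrix (%v. dd v ?t x))\<bar>) \<in> borel_measurable borel"
   by (rule measurable_cong[THEN iffD1, rotated]) (use So mat in "auto simp: indicator_def")
  show "(%y. ennreal (indicator (im d) y * vd d y)) \<in> borel_measurable borel" using measurable_vd[OF c(2)] by simp
 qed
 also have "... = mc c B" unfolding mc_def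
 proof (intro nn_integral_cong)
  fix x
  show "ennreal \<bar>det (matrix (%v. dd v ?t x))\<bar> * ennreal (indicator (im d) (?t x) * vd d (?t x)) * indicator ?S x = ennreal (vd c x) * indicator ?S x"
  proof (cases "x \<in> ?S")
   case True
   hence "?t x \<in> im d" using So tr_ov[OF c] ov_sub[OF c(2)] by blast
   thus ?thesis using mat[OF True] vd_change[OF c, of x] True So by (auto simp: ennreal_mult')
  qed simp
 qed
 finally show ?thesis unfolding imgS mc_eq[OF B(3)] by simp
qed

lemma mc_additive:
 assumes "c \<in> A" "finite I" "!!i. i \<in> I ==> B i \<in> SM" "!!i. i \<in> I ==> B i \<subseteq> chart_dom c" "disjoint_family_on B I"
 shows "mc c (\<Union>i\<in>I. B i) = (SUM i:I. mc c (B i))"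
proof -
 let ?D = "density lborel (%x. ennreal (indicator (im c) x * vd c x))"
 interpret sa: sigma_algebra M SM by (rule SM_algebra)
 have U: "(\<Union>i\<in>I. B i) \<in> SM" using assms(2,3) by (intro sa.finite_UN) auto
 have "mc c (\<Union>i\<in>I. B i) = emeasure ?D (\<Union>i\<in>I. chart_map c ` B i)"
  using mc_emeasure[OF assms(1) U] assms(4) by (auto simp: image_UN)
 also have "... = (SUM i:I. emeasure ?D (chart_map c ` B i))"
 proof (rule sum_emeasure[symmetric, OF _ _ assms(2)])
  show "(%i. chart_map c ` B i) ` I \<subseteq> sets ?D" using sets_chart_image[OF assms(1,3,4)] by auto
  show "disjoint_family_on (%i. chart_map c ` B i) I"
   using assms(5) inj_chart[OF assms(1)] assms(4) unfolding disjoint_family_on_def by (metis inj_on_image_Int image_empty)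
 qed
 also have "... = (SUM i:I. mc c (B i))" using mc_emeasure[OF assms(1,3,4)] by simp
 finally show ?thesis .
qed

lemma mc_countably_additive:
 fixes B :: "nat => 'a set"
 assumes "c \<in> A" "!!i. B i \<in> SM" "!!i. B i \<subseteq> chart_dom c" "disjoint_family B"
 shows "(\<Sum>i. mc c (B i)) = mc c (\<Union>i. B i)"
proof -
 let ?D = "density lborel (%x. ennreal (indicator (im c) x * vd c x))"
 interpret sa: sigma_algebra M SM by (rule SM_algebra)
 have U: "(\<Union>i. B i) \<in> SM" using assms(2) by (intro sa.countable_UN) auto
 have "(\<Sum>i. mc c (B i)) = (\<Sum>i. emeasure ?D (chart_map c ` B i))" using mc_emeasure[OF assms(1-3)] by simp
 also have "... = emeasure ?D (\<Union>i. chart_map c ` B i)"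
 proof (rule suminf_emeasure)
  show "range (%i. chart_map c ` B i) \<subseteq> sets ?D" using sets_chart_image[OF assms(1-3)] by auto
  show "disjoint_family (%i. chart_map c ` B i)" using assms(4) inj_chart[OF assms(1)] assms(3) unfolding disjoint_family_on_def
   by (metis inj_on_image_Int image_empty)
 qed
 also have "... = mc c (\<Union>i. B i)" using mc_emeasure[OF assms(1) U UN_least[OF assms(3)]] by (simp add: image_UN)
 finally show ?thesis .
qed

text \<open>Successive differences of the cores. Each piece lies in a compact part of one chart,
  which later makes the total volume finite.\<close>

lemma partition:
 obtains I :: "nat set" and D ch where "finite I" "!!i. i \<in> I ==> ch i \<in> A" "!!i. i \<in> I ==> D i \<in> SM"
  "!!i. i \<in> I ==> D i \<subseteq> chart_dom (ch i)"
  "!!i. i \<in> I ==> EX K. compact K & K \<subseteq> im (ch i) & chart_map (ch i) ` D i \<subseteq> K"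
  "disjoint_family_on D I" "M = (\<Union>i\<in>I. D i)"
proof -
 obtain e and m :: nat where e: "bij_betw e {..<m} cells" using ex_bij_betw_nat_finite[OF cells(1)] by (metis atLeast0LessThan)
 interpret sa: sigma_algebra M SM by (rule SM_algebra)
 define D where "D k = core (e k) - (\<Union>j<k. core (e j))" for k
 have ce: "cell (e k)" if "k < m" for k using bij_betwE[OF e] that cells(2) by blast
 have op: "core i \<in> SM" "core i \<subseteq> chart_dom (fst i)" "fst i \<in> A" if i: "cell i" for i
 proof -
  obtain c a r where cr: "i = (c, a, r)" by (cases i)
  have b: "ball a r \<subseteq> im c" using cell_ball(3)[OF i[unfolded cr], of r] cell_ball(2)[OF i[unfolded cr]] by auto
  thus "core i \<in> SM" using openin_inv_image[OF cell_ball(1)[OF i[unfolded cr]] open_ball b] by (auto simp: cr core_def)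
  show "core i \<subseteq> chart_dom (fst i)" using b by (auto simp: cr core_def)
  show "fst i \<in> A" using cell_ball(1)[OF i[unfolded cr]] by (simp add: cr)
 qed
 have DS: "D k \<in> SM" if "k < m" for k unfolding D_def using that ce op(1) by (intro sa.Diff sa.finite_UN) auto
 have comp: "EX K. compact K & K \<subseteq> im (fst (e k)) & chart_map (fst (e k)) ` D k \<subseteq> K" if k: "k < m" for k
 proof -
  obtain c a r where cr: "e k = (c, a, r)" by (cases "e k")
  have b: "cball a r \<subseteq> im c" using cell_ball(3)[OF ce[OF k, unfolded cr], of r] cell_ball(2)[OF ce[OF k, unfolded cr]] by auto
  have "chart_map c ` D k \<subseteq> cball a r" using b unfolding D_def cr core_def by (auto simp: subset_iff)
  thus ?thesis using b by (auto simp: cr intro!: exI[of _ "cball a r"])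
 qed
 have D1: "D i \<inter> D j = {}" if "i < j" for i j using that unfolding D_def by blast
 have "D i \<inter> D j = {}" if "i ~= j" for i j
 proof (cases "i < j")
  case False
  hence "j < i" using that by simp
  from D1[OF this] show ?thesis by blast
 qed (rule D1)
 hence disj: "disjoint_family_on D {..<m}" unfolding disjoint_family_on_def by blast
 have un: "M = (\<Union>k<m. D k)"
 proof -
  have "(\<Union>k<m. D k) = (\<Union>k<m. core (e k))"
  proof (intro equalityI subsetI)
   fix p assume "p \<in> (\<Union>k<m. core (e k))"
   then obtain k where k: "k < m" "p \<in> core (e k)" by auto
   define l where "l = (LEAST l. p \<in> core (e l))"
   have "p \<in> core (e l)" unfolding l_def by (rule LeastI[of _ k]) (rule k)
   moreover have "l <= k" unfolding l_def by (rule Least_le) (rule k)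
   moreover have "\<not> p \<in> core (e j)" if "j < l" for j using not_less_Least[OF that[unfolded l_def]] .
   ultimately show "p \<in> (\<Union>k<m. D k)" using k by (auto simp: D_def intro!: bexI[of _ l])
  qed (auto simp: D_def)
  also have "... = (\<Union>i\<in>cells. core i)" unfolding bij_betw_imp_surj_on[OF e, symmetric] by simp
  finally show ?thesis using cells(3) by simp
 qed
 have sub: "D k \<subseteq> chart_dom (fst (e k))" if "k < m" for k using op(2)[OF ce[OF that]] unfolding D_def by blast
 show ?thesis by (rule that[of "{..<m}" "%k. fst (e k)" D]) (use DS comp disj un op(3) ce sub in auto)
qed

section \<open>The volume measure and integrals supported in one chart\<close>

abbreviation "vol \<equiv> riemannian_volume X A g"

text \<open>\<open>riemannian_volume\<close> is a definite description and carries no information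
  before this. A candidate is summed over a Borel partition into chart pieces; consistency between
  charts gives it the prescribed values, and additivity forces any other candidate to agree.\<close>

lemma riemannian_volume_unique_existence: "\<exists>!\<mu>. is_riemannian_volume X A g \<mu>"
proof -
 obtain I :: "nat set" and D ch where I: "finite I" and D: "!!i. i \<in> I ==> ch i \<in> A" "!!i. i \<in> I ==> D i \<in> SM"
  "!!i. i \<in> I ==> D i \<subseteq> chart_dom (ch i)"
  and K: "!!i. i \<in> I ==> EX K. compact K & K \<subseteq> im (ch i) & chart_map (ch i) ` D i \<subseteq> K"
  and disj: "disjoint_family_on D I" and un: "M = (\<Union>i\<in>I. D i)" by (rule partition, rule that)
 interpret sa: sigma_algebra M SM by (rule SM_algebra)
 define \<mu>0 where "\<mu>0 B = (SUM i:I. mc (ch i) (B \<inter> D i))" for B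
 define \<mu> where "\<mu> = measure_of M SM \<mu>0"
 have sub: "SM \<subseteq> Pow M" using sa.space_closed .
 have BD: "B \<inter> D i \<in> SM" "B \<inter> D i \<subseteq> chart_dom (ch i)" if "B \<in> SM" "i \<in> I" for B i
  using D(2,3)[OF that(2)] that(1) by auto
 have dBD: "disjoint_family_on (%i. B \<inter> D i) I" for B using disj by (auto simp: disjoint_family_on_def)
 have BU: "(\<Union>i\<in>I. B \<inter> D i) = B" if "B \<in> SM" for B using sub that un by auto
 have em: "emeasure \<mu> B = \<mu>0 B" if "B \<in> SM" for B unfolding \<mu>_def
 proof (rule emeasure_measure_of_sigma[OF SM_algebra _ _ that])
  show "positive SM \<mu>0" by (simp add: positive_def \<mu>0_def mc_def)
  show "countably_additive SM \<mu>0"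
  proof (rule countably_additiveI)
   fix B :: "nat => 'a set" assume B: "range B \<subseteq> SM" "disjoint_family B"
   have "(\<Sum>k. \<mu>0 (B k)) = (SUM i:I. \<Sum>k. mc (ch i) (B k \<inter> D i))"
    unfolding \<mu>0_def by (rule suminf_sum) simp
   also have "... = (SUM i:I. mc (ch i) (\<Union>k. B k \<inter> D i))"
   proof (intro sum.cong refl)
    fix i assume i: "i \<in> I"
    show "(\<Sum>k. mc (ch i) (B k \<inter> D i)) = mc (ch i) (\<Union>k. B k \<inter> D i)"
    proof (rule mc_countably_additive[OF D(1)[OF i]])
     have "B k \<in> SM" for k using B(1) by auto
     thus "B k \<inter> D i \<in> SM" "B k \<inter> D i \<subseteq> chart_dom (ch i)" for k using BD[OF _ i] by blast+
     show "disjoint_family (%k. B k \<inter> D i)" using B(2) unfolding disjoint_family_on_def by blast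
    qed
   qed
   finally show "(\<Sum>k. \<mu>0 (B k)) = \<mu>0 (\<Union>k. B k)" by (simp add: \<mu>0_def)
  qed
 qed
 have sp: "space \<mu> = M" "sets \<mu> = SM" unfolding \<mu>_def using sub opens_Pow by (auto simp: sigma_sets_sigma_sets_eq)
 have "is_riemannian_volume X A g \<mu>" unfolding is_riemannian_volume_def
 proof (intro conjI ballI impI)
  fix c B assume c: "c \<in> A" and B: "B \<in> sets \<mu>" "B \<subseteq> chart_dom c"
  have BS: "B \<in> SM" using B sp by simp
  have "emeasure \<mu> B = (SUM i:I. mc (ch i) (B \<inter> D i))" by (simp add: em[OF BS] \<mu>0_def)
  also have "... = (SUM i:I. mc c (B \<inter> D i))" using BD[OF BS] D(1) B c by (intro sum.cong refl mc_change) auto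
  also have "... = mc c (\<Union>i\<in>I. B \<inter> D i)" by (rule mc_additive[symmetric, OF c I]) (use BD[OF BS] B dBD in auto)
  finally show "emeasure \<mu> B = (\<integral>\<^sup>+x\<in>chart_map c ` B. ennreal (volume_density A g c (ci c x)) \<partial>lborel)"
   unfolding BU[OF BS] by (simp add: mc_def vd_def)
 qed (use sp in auto)
 moreover have "\<nu> = \<mu>" if "is_riemannian_volume X A g \<nu>" for \<nu>
 proof (rule measure_eqI)
  have s: "sets \<nu> = SM" and e: "!!c B. c \<in> A ==> B \<in> SM ==> B \<subseteq> chart_dom c ==> emeasure \<nu> B = mc c B"
   using that unfolding is_riemannian_volume_def mc_def vd_def by auto
  thus "sets \<nu> = sets \<mu>" using sp by simp
  fix B assume "B \<in> sets \<nu>"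
  hence B: "B \<in> SM" using s by simp
  have "emeasure \<nu> (\<Union>i\<in>I. B \<inter> D i) = (SUM i:I. emeasure \<nu> (B \<inter> D i))"
   by (rule sum_emeasure[symmetric, OF _ dBD I]) (use BD[OF B] s in auto)
  thus "emeasure \<nu> B = emeasure \<mu> B" using e[OF D(1) BD[OF B]] unfolding BU[OF B] by (simp add: em[OF B] \<mu>0_def)
 qed
 ultimately show ?thesis by blast
qed

lemma vol: "is_riemannian_volume X A g vol" unfolding riemannian_volume_def by (rule theI'[OF riemannian_volume_unique_existence])

lemma space_vol [simp]: "space vol = M" and sets_vol [simp]: "sets vol = SM" using vol by (auto simp: is_riemannian_volume_def)

lemma emeasure_vol: "c \<in> A ==> B \<in> SM ==> B \<subseteq> chart_dom c ==> emeasure vol B = mc c B"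
 using vol unfolding is_riemannian_volume_def mc_def vd_def by auto

lemma measurable_vol: "continuous_map X euclideanreal f ==> f \<in> borel_measurable vol"
proof (rule borel_measurableI)
 fix S :: "real set" assume "continuous_map X euclideanreal f" "open S"
 hence "openin X {p \<in> M. f p \<in> S}" by (simp add: continuous_map_def)
 moreover have "f -` S \<inter> space vol = {p \<in> M. f p \<in> S}" by auto
 ultimately show "f -` S \<inter> space vol \<in> sets vol" by auto
qed

lemma finite_vol: "emeasure vol M < \<infinity>"
proof -
 obtain I :: "nat set" and D ch where I: "finite I" and D: "!!i. i \<in> I ==> ch i \<in> A" "!!i. i \<in> I ==> D i \<in> SM"
  "!!i. i \<in> I ==> D i \<subseteq> chart_dom (ch i)"
  and K: "!!i. i \<in> I ==> EX K. compact K & K \<subseteq> im (ch i) & chart_map (ch i) ` D i \<subseteq> K"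
  and disj: "disjoint_family_on D I" and un: "M = (\<Union>i\<in>I. D i)" by (rule partition, rule that)
 have "emeasure vol (D i) < \<infinity>" if i: "i \<in> I" for i
 proof -
  obtain K where K: "compact K" "K \<subseteq> im (ch i)" "chart_map (ch i) ` D i \<subseteq> K" using K[OF i] by blast
  have "continuous_on K (vd (ch i))" using continuous_on_subset[OF smooth_cont[OF smooth_vd[OF D(1)[OF i]]] K(2)] .
  hence "bounded (vd (ch i) ` K)" using K(1) compact_continuous_image compact_imp_bounded by blast
  then obtain C where C: "!!x. x \<in> K ==> \<bar>vd (ch i) x\<bar> <= C" by (auto simp: bounded_iff)
  have "mc (ch i) (D i) <= (\<integral>\<^sup>+x. ennreal C * indicator K x \<partial>lborel)" unfolding mc_def
  proof (rule nn_integral_mono)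
   fix x
   show "ennreal (vd (ch i) x) * indicator (chart_map (ch i) ` D i) x <= ennreal C * indicator K x"
    using C[of x] K(3) by (cases "x \<in> chart_map (ch i) ` D i") (auto simp: subset_iff intro!: ennreal_leI)
  qed
  also have "... = ennreal C * emeasure lborel K" using K(1) by (intro nn_integral_cmult_indicator) (auto simp: borel_compact)
  also have "... < \<infinity>" using emeasure_compact_finite[OF K(1)] by (simp add: ennreal_mult_less_top)
  finally show ?thesis using emeasure_vol[OF D[OF i]] by simp
 qed
 moreover have "emeasure vol M = (SUM i:I. emeasure vol (D i))"
  unfolding un by (rule sum_emeasure[symmetric, OF _ disj I]) (use D in auto)
 ultimately show ?thesis using I by (simp add: ennreal_sum_less_top)
qed

lemma integrable_vol:
 assumes "f \<in> SF"
 shows "integrable vol f"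
proof -
 interpret finite_measure vol by standard (use finite_vol in auto)
 obtain C where "C > 0" "!!p. p \<in> M ==> \<bar>f p\<bar> <= C" by (rule SF_bounded[OF assms], rule that)
 thus ?thesis by (intro integrable_const_bound[where B = C] AE_I2 measurable_vol SF_continuous[OF assms]) auto
qed

text \<open>On a chart domain the volume is the image of the density under the inverse chart. To
  have a total measurable map, \<open>k\<close> sends everything outside the chart image to one
  point \<open>p0\<close>; the density is 0 there.\<close>

lemma vol_integral:
 assumes c: "c \<in> A" and f: "f \<in> borel_measurable vol" and supp: "!!p. p \<in> M ==> p \<notin> chart_dom c ==> f p = 0"
 shows "(LINT p|vol. f p) = (LBINT x. indicator (im c) x * (vd c x * f (ci c x)))"
proof (cases "chart_dom c = {}")
 case True
 hence "(LINT p|vol. f p) = (LINT p|vol. 0)" using supp by (intro Bochner_Integration.integral_cong) auto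
 moreover have "im c = {}" using True by (simp add: im_def)
 ultimately show ?thesis by simp
next
 case False
 then obtain p0 where p0: "p0 \<in> chart_dom c" by blast
 hence p0M: "p0 \<in> M" using dom_sub[OF c] by blast
 have dS: "chart_dom c \<in> SM" using openin_dom[OF c] by auto
 define k where "k x = (if x \<in> im c then ci c x else p0)" for x
 define w where "w x = indicator (im c) x * vd c x" for x
 have w: "w \<in> borel_measurable borel" "!!x. w x >= 0"
  unfolding w_def[abs_def] using measurable_vd[OF c] vd_pos[OF c] by (auto simp: indicator_def less_imp_le)
 have km: "k \<in> borel \<rightarrow>\<^sub>M vol"
 proof (rule measurableI)
  show "k x \<in> space vol" for x using c p0M by (simp add: k_def)
  fix B assume "B \<in> sets vol"
  hence B: "{x \<in> im c. ci c x \<in> B} \<in> sets borel" using sets_chart_vimage[OF c] by simp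
  have "k -` B \<inter> space borel = {x \<in> im c. ci c x \<in> B} \<union> (if p0 \<in> B then - im c else {})"
   by (auto simp: k_def split: if_splits)
  thus "k -` B \<inter> space borel \<in> sets borel" using B open_im[OF c] by auto
 qed
 have "distr (density lborel w) vol k = density vol (indicator (chart_dom c))"
 proof (rule measure_eqI)
  fix B assume "B \<in> sets (distr (density lborel w) vol k)"
  hence B: "B \<in> SM" by simp
  interpret sa: sigma_algebra M SM by (rule SM_algebra)
  have BD: "B \<inter> chart_dom c \<in> SM" using B dS by auto
  have "emeasure (distr (density lborel w) vol k) B = emeasure (density lborel w) (k -` B)"
   using B km by (subst emeasure_distr) auto
  also have "... = (\<integral>\<^sup>+x. ennreal (w x) * indicator (k -` B) x \<partial>lborel)"
   using measurable_sets[OF km, of B] B w by (subst emeasure_density) auto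
  also have "... = (\<integral>\<^sup>+x. ennreal (vd c x) * indicator (chart_map c ` (B \<inter> chart_dom c)) x \<partial>lborel)"
   using chart_image_eq[OF c, of "B \<inter> chart_dom c"] by (intro nn_integral_cong) (auto simp: w_def indicator_def k_def)
  also have "... = emeasure vol (B \<inter> chart_dom c)" using emeasure_vol[OF c BD] by (simp add: mc_def)
  also have "... = emeasure (density vol (indicator (chart_dom c))) B"
  proof -
   have "emeasure (density vol (indicator (chart_dom c))) B = (\<integral>\<^sup>+p. indicator (chart_dom c) p * indicator B p \<partial>vol)"
    using B dS borel_measurable_indicator[of "chart_dom c" vol] by (subst emeasure_density) auto
   also have "... = emeasure vol (B \<inter> chart_dom c)" using BD by (simp add: indicator_inter_arith[symmetric] Int_commute)
   finally show ?thesis by simp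
  qed
  finally show "emeasure (distr (density lborel w) vol k) B = emeasure (density vol (indicator (chart_dom c))) B" .
 qed simp
 note eq = this
 have dens: "density vol (indicator (chart_dom c)) = density vol (%p. ennreal (indicator (chart_dom c) p))"
  by (intro arg_cong[of _ _ "density vol"]) (auto simp: indicator_def)
 have "(LINT p|vol. f p) = (LINT p|vol. indicator (chart_dom c) p *\<^sub>R f p)"
  using supp by (intro Bochner_Integration.integral_cong) (auto simp: indicator_def)
 also have "... = (\<integral>p. f p \<partial>density vol (indicator (chart_dom c)))"
  unfolding dens using f dS borel_measurable_indicator[of "chart_dom c" vol] by (subst integral_density) auto
 also have "... = (\<integral>p. f p \<partial>distr (density lborel w) vol k)" by (simp only: eq)
 also have "... = (\<integral>x. f (k x) \<partial>density lborel w)" using f km by (subst integral_distr) auto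
 also have "... = (LBINT x. w x *\<^sub>R f (k x))" using w measurable_compose[OF km f] by (subst integral_density) auto
 also have "... = (LBINT x. indicator (im c) x * (vd c x * f (ci c x)))"
  by (intro Bochner_Integration.integral_cong) (auto simp: w_def k_def indicator_def)
 finally show ?thesis .
qed

end

section \<open>Integration by parts and the Laplace--Beltrami operator\<close>

lemma csm_measurable: "csm h ==> h \<in> borel_measurable borel"
 using smooth_cont[OF csm_smooth[of h UNIV]] borel_measurable_continuous_onI by blast

lemma csm_bound_ball:
 assumes "csm (h :: real ^ 'n::finite => real)"
 obtains C R where "C > 0" "R > 0" "!!x. \<bar>h x\<bar> <= C * indicator (cball 0 R) x"
proof -
 obtain K where K: "compact K" "!!x. x \<notin> K ==> h x = 0" using assms by (auto simp: csm_def)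
 obtain C where C: "C > 0" "!!x. \<bar>h x\<bar> <= C" by (rule csm_bounded[OF assms], rule that)
 obtain R where R: "R > 0" "!!x. x \<in> K ==> norm x <= R" using compact_imp_bounded[OF K(1)] by (auto simp: bounded_pos)
 have "\<bar>h x\<bar> <= C * indicator (cball 0 R) x" for x using C(2)[of x] K(2)[of x] R(2)[of x] by (cases "x \<in> K") auto
 thus ?thesis using that C R by blast
qed

lemma integrable_cball: "integrable lborel (%x. C * indicator (cball (a :: real ^ 'n) R) x :: real)"
 using emeasure_compact_finite[OF compact_cball[of a R]] by (intro integrable_mult_right integrable_real_indicator) auto

lemma csm_integrable:
 assumes "csm (h :: real ^ 'n::finite => real)"
 shows "integrable lborel h"
proof -
 obtain C R where C: "C > 0" "R > 0" "!!x. \<bar>h x\<bar> <= C * indicator (cball 0 R) x" by (rule csm_bound_ball[OF assms], rule that)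
 have "norm (h x) <= norm (C * indicator (cball 0 R) x)" for x using C(3)[of x] by (simp add: indicator_def split: if_splits)
 thus ?thesis using csm_measurable[OF assms]
  by (intro Bochner_Integration.integrable_bound[OF integrable_cball[of C 0 R]] AE_I2) auto
qed

text \<open>By translation invariance the integral of h(y + t w) does not depend on t, and its
  derivative at t = 0 is the integral in question.\<close>

lemma csm_integral_dd:
 fixes h :: "real ^ 'n::finite => real"
 assumes "csm h"
 shows "(LBINT x. dd w h x) = 0"
proof -
 obtain C R where C: "C > 0" "R > 0" "!!x. \<bar>dd w h x\<bar> <= C * indicator (cball 0 R) x"
  by (rule csm_bound_ball[OF csm_dd[OF assms, of w]], rule that)
 have inv: "(LBINT y. h (y + c)) = (LBINT y. h y)" for c using integral_distr[of "(+) c" lborel borel h] csm_measurable[OF assms]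
  by (simp add: lborel_distr_plus add.commute)
 have "((%t. \<integral>y. h (y + t *\<^sub>R w) \<partial>lborel) has_derivative (%v. \<integral>y. v * dd w h (y + 0 *\<^sub>R w) \<partial>lborel)) (at 0)"
 proof (rule has_derivative_lebesgue_integral[where S = "ball 0 1" and B = "%y. C * indicator (cball 0 (R + norm w)) y"])
  show "((%t. h (y + t *\<^sub>R w)) has_derivative (%v. v * dd w h (y + t *\<^sub>R w))) (at t)" for t y
   using dd_DERIV_line[OF csm_differentiable[OF assms], where x = y and t = t and v = w] by (simp add: has_field_derivative_def mult_commute_abs)
  show "integrable lborel (%y. h (y + t *\<^sub>R w))" for t
  proof -
   have "integrable (distr lborel borel ((+) (t *\<^sub>R w))) h" unfolding lborel_distr_plus by (rule csm_integrable[OF assms])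
   thus ?thesis using csm_measurable[OF assms] by (subst (asm) integrable_distr_eq) (auto simp: add.commute)
  qed
  show "\<bar>v * dd w h (y + t *\<^sub>R w)\<bar> <= norm v * (C * indicator (cball 0 (R + norm w)) y)" if t: "t \<in> ball 0 1" for t y v
  proof -
   have "norm y <= norm (y + t *\<^sub>R w) + norm (t *\<^sub>R w)" by (metis add_diff_cancel_right' norm_triangle_ineq4)
   moreover have "norm (t *\<^sub>R w) <= norm w" using t by (simp add: mult_left_le_one_le)
   ultimately have "indicator (cball 0 R) (y + t *\<^sub>R w) <= (indicator (cball 0 (R + norm w)) y :: real)"
    by (auto simp: indicator_def)
   hence "C * indicator (cball 0 R) (y + t *\<^sub>R w) <= C * (indicator (cball 0 (R + norm w)) y :: real)" using C(1) by simp
   hence "\<bar>dd w h (y + t *\<^sub>R w)\<bar> <= C * indicator (cball 0 (R + norm w)) y"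
    using C(3)[of "y + t *\<^sub>R w"] by linarith
   thus ?thesis by (simp add: abs_mult mult_left_mono)
  qed
  show "(%y. v * dd w h (y + 0 *\<^sub>R w)) \<in> borel_measurable lborel" for v
   using csm_measurable[OF csm_dd[OF assms]] by simp
 qed (use integrable_cball in auto)
 hence "((%t::real. \<integral>y. h y \<partial>lborel) has_derivative (%v. v * (LBINT x. dd w h x))) (at 0)" by (simp add: inv)
 moreover have "((%t::real. \<integral>y. h y \<partial>lborel) has_derivative (%v. 0)) (at 0)" by simp
 ultimately have "(%v. v * (LBINT x. dd w h x)) = (%v. 0)" by (rule has_derivative_unique)
 thus ?thesis by (metis mult_1)
qed

context rmfd
begin

section \<open>Chart expressions of the Laplacian and of the inner product of gradients\<close>

definition lap :: "('a, 'n) chart => ('a => real) => real ^ 'n => real" where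
 "lap c v x = (1 / vd c x) * (SU i. dx i (%y. vd c y * (SU j. Am c y $ i $ j * pd c j v y)) x)"

definition gq :: "('a, 'n) chart => ('a => real) => ('a => real) => real ^ 'n => real" where
 "gq c u v x = (SU i. SU j. Am c x $ i $ j * pd c i u x * pd c j v x)"

definition lapM :: "('a => real) => 'a => real" where
 "lapM v p = lap (chart_at A p) v (chart_map (chart_at A p) p)"

definition gM :: "('a => real) => ('a => real) => 'a => real" where
 "gM u v p = gq (chart_at A p) u v (chart_map (chart_at A p) p)"

lemma smooth_flux: "c \<in> A ==> v \<in> SF ==> smooth_on (im c) (%y. vd c y * (SU j. Am c y $ i $ j * pd c j v y))"
 by (intro smooth_on_mult smooth_on_sum smooth_vd smooth_Am smooth_pd open_im)

lemma smooth_lap: "c \<in> A ==> v \<in> SF ==> smooth_on (im c) (lap c v)"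
proof -
 assume a: "c \<in> A" "v \<in> SF"
 have "vd c x ~= 0" if "x \<in> im c" for x using vd_pos[OF a(1) that] by simp
 hence 1: "smooth_on (im c) (%x. 1 / vd c x)" by (rule smooth_on_divide[OF open_im[OF a(1)] smooth_on_const smooth_vd[OF a(1)]])
 show ?thesis unfolding lap_def[abs_def]
  by (rule smooth_on_mult[OF open_im[OF a(1)] 1 smooth_on_sum[OF open_im[OF a(1)] smooth_on_dd[OF smooth_flux[OF a]]]])
qed

lemma smooth_gq: "c \<in> A ==> u \<in> SF ==> v \<in> SF ==> smooth_on (im c) (gq c u v)"
 unfolding gq_def[abs_def] by (intro smooth_on_mult smooth_on_sum smooth_Am smooth_pd open_im)

lemma gq_change:
 assumes "c \<in> A" "d \<in> A" "x \<in> ov c d" "u \<in> SF" "v \<in> SF"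
 shows "gq c u v x = gq d u v (tr c d x)"
proof -
 have x: "x \<in> im c" "tr c d x \<in> im d" using assms ov_sub tr_ov[OF assms(1-3)] by blast+
 note ch = pd_change[OF assms(1-3) SF_diff[OF _ assms(2) x(2)]]
 have "gq d u v (tr c d x) = (SU k. SU l. (SU j. (SU i. Jm c d x $ k $ i * Am c x $ i $ j) * Jm c d x $ l $ j) * pd d k u (tr c d x) * pd d l v (tr c d x))"
  unfolding gq_def inverse_metric_change[OF assms(1-3)] by (simp add: matrix_matrix_mult_def transpose_def)
 also have "... = (SU i. SU j. Am c x $ i $ j * (SU k. Jm c d x $ k $ i * pd d k u (tr c d x)) * (SU l. Jm c d x $ l $ j * pd d l v (tr c d x)))"
 proof -
  let ?t = "%k l i j. Am c x $ i $ j * (Jm c d x $ k $ i * pd d k u (tr c d x)) * (Jm c d x $ l $ j * pd d l v (tr c d x))"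
  have "(SU k. SU l. (SU j. (SU i. Jm c d x $ k $ i * Am c x $ i $ j) * Jm c d x $ l $ j) * pd d k u (tr c d x) * pd d l v (tr c d x))
    = (SU k. SU l. SU j. SU i. ?t k l i j)" by (simp add: sum_distrib_left sum_distrib_right mult_ac)
  also have "... = (SU k. SU j. SU i. SU l. ?t k l i j)"
   by (subst sum.swap, rule sum.cong[OF refl], rule sum.cong[OF refl], subst sum.swap, rule refl)
  also have "... = (SU j. SU i. SU k. SU l. ?t k l i j)" by (subst sum.swap, rule sum.cong[OF refl], subst sum.swap, rule refl)
  also have "... = (SU i. SU j. SU k. SU l. ?t k l i j)" by (rule sum.swap)
  also have "... = (SU i. SU j. Am c x $ i $ j * (SU k. Jm c d x $ k $ i * pd d k u (tr c d x)) * (SU l. Jm c d x $ l $ j * pd d l v (tr c d x)))"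
   by (simp only: mult.assoc sum_product) (simp only: sum_distrib_left mult.assoc)
  finally show ?thesis .
 qed
 also have "... = gq c u v x" by (simp add: gq_def ch[OF assms(4)] ch[OF assms(5)])
 finally show ?thesis by simp
qed

definition ext :: "('a, 'n) chart => (real ^ 'n => real) => real ^ 'n => real" where
 "ext c h x = (if x \<in> im c then h x else 0)"

lemma csm_ext:
 assumes c: "c \<in> A" and h: "smooth_on (im c) h" and K: "compact K" "K \<subseteq> im c" "!!x. x \<in> im c ==> x \<notin> K ==> h x = 0"
 shows "csm (ext c h)"
proof -
 have z: "ext c h x = 0" if "x \<notin> K" for x using that K(3) by (auto simp: ext_def)
 have "smooth_on UNIV (ext c h)"
 proof (rule smooth_on_local)
  fix x
  show "EX T. open T & x \<in> T & smooth_on T (ext c h)"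
  proof (cases "x \<in> im c")
   case True
   have "smooth_on (im c) (ext c h)" by (rule smooth_on_cong[OF h open_im[OF c]]) (simp add: ext_def)
   thus ?thesis using True open_im[OF c] by blast
  next
   case False
   have o: "open (- K)" using K(1) by (simp add: compact_imp_closed open_Compl)
   have "smooth_on (- K) (ext c h)" by (rule smooth_on_cong[OF smooth_on_const[of _ 0] o]) (use z in auto)
   thus ?thesis using False K(2) o by blast
  qed
 qed
 thus ?thesis unfolding csm_def using K(1) z by blast
qed

text \<open>The product of \<open>w\<close> with the flux of \<open>v\<close> has compact support,
  so its divergence integrates to 0; the product rule splits that divergence into the two
  integrands.\<close>

lemma ibp_chart:
 assumes c: "c \<in> A" and v: "v \<in> SF" and w: "smooth_on (im c) w" and K: "compact K" "K \<subseteq> im c" "!!x. x \<in> im c ==> x \<notin> K ==> w x = 0"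
 shows "(LBINT x. indicator (im c) x * (vd c x * (SU i. SU j. Am c x $ i $ j * dx i w x * pd c j v x)))
  = - (LBINT x. indicator (im c) x * (vd c x * (w x * lap c v x)))"
proof -
 define F where "F i y = vd c y * (SU j. Am c y $ i $ j * pd c j v y)" for i y
 have Fs: "smooth_on (im c) (F i)" for i unfolding F_def[abs_def] by (rule smooth_flux[OF c v])
 define h where "h i = ext c (%x. w x * F i x)" for i
 have h: "csm (h i)" for i unfolding h_def
  by (rule csm_ext[OF c _ K(1,2)]) (use K(3) in "auto intro!: smooth_on_mult w Fs open_im c")
 have "csm (ext c (%x. w x * (vd c x * lap c v x)))"
  by (rule csm_ext[OF c _ K(1,2)]) (use K(3) in "auto intro!: smooth_on_mult w smooth_vd smooth_lap v open_im c")
 note int2 = csm_integrable[OF this]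
 have dw0: "dx i w x = 0" if "x \<in> im c" "x \<notin> K" for x i
 proof -
  have o: "open (im c - K)" using K(1) open_im[OF c] by (simp add: compact_imp_closed open_Diff)
  have "dx i w x = dx i (%_. 0) x" by (rule dd_cong_open[OF o]) (use that K(3) in auto)
  thus ?thesis by simp
 qed
 have "csm (ext c (%x. SU i. dx i w x * F i x))"
  by (rule csm_ext[OF c _ K(1,2)]) (use dw0 in "auto intro!: smooth_on_mult smooth_on_sum smooth_on_dd w Fs open_im c")
 note int1 = csm_integrable[OF this]
 have pt: "(SU i. dx i (h i) x) = ext c (%x. SU i. dx i w x * F i x) x + ext c (%x. w x * (vd c x * lap c v x)) x" for x
 proof (cases "x \<in> im c")
  case True
  have "dx i (h i) x = dx i (%x. w x * F i x) x" for i by (rule dd_cong_open[OF open_im[OF c] True]) (simp add: h_def ext_def)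
  also have "... i = w x * dx i (F i) x + dx i w x * F i x" for i
   by (rule dd_mult[OF smooth_diff[OF w True] smooth_diff[OF Fs True]])
  finally show ?thesis using True vd_pos[OF c True] by (simp add: ext_def sum.distrib lap_def F_def[abs_def] sum_distrib_left)
 next
  case False
  have o: "open (- K)" using K(1) by (simp add: compact_imp_closed open_Compl)
  have "dx i (h i) x = dx i (%_. 0) x" for i by (rule dd_cong_open[OF o]) (use False K(2,3) in "auto simp: h_def ext_def")
  thus ?thesis using False by (simp add: ext_def)
 qed
 have "0 = (SU i. \<integral>x. dx i (h i) x \<partial>lborel)" using csm_integral_dd[OF h] by simp
 also have "... = (LBINT x. (SU i. dx i (h i) x))"
  by (rule Bochner_Integration.integral_sum[symmetric]) (rule csm_integrable[OF csm_dd[OF h]])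
 also have "... = (LBINT x. ext c (%x. SU i. dx i w x * F i x) x) + (LBINT x. ext c (%x. w x * (vd c x * lap c v x)) x)"
  unfolding pt by (rule Bochner_Integration.integral_add[OF int1 int2])
 also have "(LBINT x. ext c (%x. SU i. dx i w x * F i x) x)
   = (LBINT x. indicator (im c) x * (vd c x * (SU i. SU j. Am c x $ i $ j * dx i w x * pd c j v x)))"
  by (intro Bochner_Integration.integral_cong refl) (simp add: ext_def F_def sum_distrib_left mult_ac)
 also have "(LBINT x. ext c (%x. w x * (vd c x * lap c v x)) x) = (LBINT x. indicator (im c) x * (vd c x * (w x * lap c v x)))"
  by (intro Bochner_Integration.integral_cong refl) (simp add: ext_def mult_ac)
 finally show ?thesis by simp
qed

lemma gq_gM: "c \<in> A ==> x \<in> im c ==> u \<in> SF ==> v \<in> SF ==> gM u v (ci c x) = gq c u v x"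
proof -
 assume a: "c \<in> A" "x \<in> im c" "u \<in> SF" "v \<in> SF"
 let ?d = "chart_at A (ci c x)"
 have d: "?d \<in> A" "ci c x \<in> chart_dom ?d" using chart_at[OF chart_inv_M[OF a(1,2)]] by auto
 hence "x \<in> ov c ?d" using a by (simp add: ov_eq)
 from gq_change[OF a(1) d(1) this a(3,4)] show ?thesis by (simp add: gM_def tr_def)
qed

lemma gM_SF: "u \<in> SF ==> v \<in> SF ==> gM u v \<in> SF" unfolding SF_iff[of "gM u v"]
proof
 fix c assume "u \<in> SF" "v \<in> SF" "c \<in> A"
 thus "smooth_on (im c) (%x. gM u v (ci c x))" by (intro smooth_on_cong[OF smooth_gq open_im]) (simp_all add: gq_gM)
qed

lemma gM_supp:
 assumes "c \<in> A" "compact K" "K \<subseteq> im c" "u \<in> SF" "v \<in> SF" "!!p. p \<in> M ==> p \<notin> ci c ` K ==> u p = 0"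
  "p \<in> M" "p \<notin> chart_dom c"
 shows "gM u v p = 0"
proof -
 obtain d where d: "d \<in> A" "p \<in> chart_dom d" using cover[OF assms(7)] by blast
 let ?T = "{x \<in> im d. ci d x \<in> M - ci c ` K}"
 have o: "open ?T" by (rule open_vimage_inv[OF d(1)]) (use closedin_inv_image[OF assms(1-3)] in "simp add: openin_diff closedin_def")
 have x: "chart_map d p \<in> ?T" using d assms(1,3,7,8) by auto
 have "pd d i u (chart_map d p) = 0" for i
 proof -
  have "pd d i u (chart_map d p) = dx i (%_. 0) (chart_map d p)"
   unfolding pd_def by (rule dd_cong_open[OF o x]) (use assms(6) in auto)
  thus ?thesis by simp
 qed
 hence "gq d u v (chart_map d p) = 0" by (simp add: gq_def)
 thus ?thesis using gq_gM[OF d(1) _ assms(4,5), of "chart_map d p"] d by simp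
qed

lemma ibp_local:
 assumes c: "c \<in> A" and K: "compact K" "K \<subseteq> im c" and w: "w \<in> SF" "!!p. p \<in> M ==> p \<notin> ci c ` K ==> w p = 0" and v: "v \<in> SF"
 shows "(LINT p|vol. gM w v p) = - (LBINT x. indicator (im c) x * (vd c x * (w (ci c x) * lap c v x)))"
proof -
 have wK: "w (ci c x) = 0" if "x \<in> im c" "x \<notin> K" for x
 proof -
  have "ci c x \<notin> ci c ` K"
  proof
   assume "ci c x \<in> ci c ` K"
   then obtain y where "y \<in> K" "ci c x = ci c y" by blast
   hence "x = y" using that K(2) chart_inv_chart by (metis subsetD)
   thus False using \<open>y \<in> K\<close> that by simp
  qed
  thus ?thesis using w(2) c that by simp
 qed
 have "(LINT p|vol. gM w v p) = (LBINT x. indicator (im c) x * (vd c x * gM w v (ci c x)))"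
  by (rule vol_integral[OF c measurable_vol[OF SF_continuous[OF gM_SF[OF w(1) v]]] gM_supp[OF c K w(1) v w(2)]])
 also have "... = (LBINT x. indicator (im c) x * (vd c x * (SU i. SU j. Am c x $ i $ j * dx i (%x. w (ci c x)) x * pd c j v x)))"
  by (intro Bochner_Integration.integral_cong refl) (auto simp: indicator_def gq_gM[OF c _ w(1) v] gq_def pd_def)
 also have "... = - (LBINT x. indicator (im c) x * (vd c x * (w (ci c x) * lap c v x)))"
  by (rule ibp_chart[OF c v SF_smooth[OF w(1) c] K wK])
 finally show ?thesis .
qed

text \<open>Both chart expressions of the Laplacian represent the same functional on test functions
 supported in the overlap.\<close>

lemma lap_change_le:
 assumes c: "c \<in> A" and d: "d \<in> A" and x0: "x0 \<in> ov c d" and v: "v \<in> SF"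
 shows "lap c v x0 <= lap d v (tr c d x0)"
proof (rule ccontr)
 assume "\<not> ?thesis"
 hence gt: "lap c v x0 - lap d v (tr c d x0) > 0" by simp
 \<comment> \<open>If the difference is positive at \<open>x0\<close>, it is positive on a small
   ball. Testing with a bump supported there produces an integral that vanishes although its
   integrand is nonnegative and positive near \<open>x0\<close>.\<close>
 define D where "D x = lap c v x - lap d v (tr c d x)" for x
 have "smooth_on (ov c d) (%x. lap d v (tr c d x))"
  by (rule smooth_on_compose[OF open_ov[OF c d] open_im[OF d] _ smooth_tr[OF c d] smooth_lap[OF d v]])
   (use tr_ov[OF c d] ov_sub[OF d] in blast)
 hence Ds: "smooth_on (ov c d) D" unfolding D_def[abs_def]
  by (intro smooth_on_diff open_ov c d smooth_on_subset[OF smooth_lap[OF c v] ov_sub[OF c]])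
 hence "continuous_on (ov c d) D" by (rule smooth_cont)
 hence "open (ov c d \<inter> D -` {0<..})" by (rule continuous_open_preimage[OF _ open_ov[OF c d]]) simp
 then obtain e where e: "e > 0" "cball x0 e \<subseteq> ov c d \<inter> D -` {0<..}"
  using gt x0 open_contains_cball unfolding D_def by (metis (no_types, lifting) IntI greaterThan_iff vimageI)
 let ?K = "cball x0 e"
 have Kc: "?K \<subseteq> im c" using e ov_sub[OF c] by blast
 have z: "cutoff x0 (e / 2) x = 0" if "x \<notin> ?K" for x using cutoff_supp[of "e / 2" x x0] that e by simp
 define w where "w = lift c (cutoff x0 (e / 2))"
 have w: "w \<in> SF" unfolding w_def by (rule lift_SF[OF c smooth_on_cutoff[OF open_im[OF c]] compact_cball Kc]) (use z in auto)
 have ws: "w p = 0" if "p \<in> M" "p \<notin> ci c ` ?K" for p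
 proof (cases "p \<in> chart_dom c")
  case True
  hence "chart_map c p \<notin> ?K" using that inv_chart[OF c True] by (metis image_eqI)
  thus ?thesis using True z by (simp add: w_def lift_def)
 qed (simp add: w_def lift_def)
 let ?Kd = "tr c d ` ?K"
 have Kd: "compact ?Kd" "?Kd \<subseteq> im d"
 proof -
  have "continuous_on ?K (tr c d)" using continuous_on_subset[OF smooth_cont[OF smooth_tr[OF c d]]] e by blast
  thus "compact ?Kd" by (rule compact_continuous_image) simp
  show "?Kd \<subseteq> im d" using e tr_ov[OF c d] ov_sub[OF d] by blast
 qed
 have wsd: "w p = 0" if "p \<in> M" "p \<notin> ci d ` ?Kd" for p
 proof -
  have "ci d ` ?Kd = ci c ` ?K" unfolding image_image by (rule image_cong[OF refl]) (use e inv_tr[OF c d] in blast)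
  thus ?thesis using ws that by simp
 qed
 have sm: "smooth_on (im c) (%x. cutoff x0 (e / 2) x * (if x \<in> ov c d then lap d v (tr c d x) else 0))"
 proof (rule smooth_on_local)
  fix x assume x: "x \<in> im c"
  show "EX T. open T & x \<in> T & smooth_on T (%x. cutoff x0 (e / 2) x * (if x \<in> ov c d then lap d v (tr c d x) else 0))"
  proof (cases "x \<in> ov c d")
   case True
   have "smooth_on (ov c d) (%x. cutoff x0 (e / 2) x * (if x \<in> ov c d then lap d v (tr c d x) else 0))"
    by (rule smooth_on_cong[OF smooth_on_mult[OF open_ov[OF c d] smooth_on_cutoff[OF open_ov[OF c d], of x0 "e / 2"] \<open>smooth_on (ov c d) (%x. lap d v (tr c d x))\<close>] open_ov[OF c d]]) simp
   thus ?thesis using True open_ov[OF c d] by blast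
  next
   case False
   have "smooth_on (- ?K) (%x. cutoff x0 (e / 2) x * (if x \<in> ov c d then lap d v (tr c d x) else 0))"
    by (rule smooth_on_cong[OF smooth_on_const[of _ 0]]) (use z in auto)
   moreover have "x \<in> - ?K" using False e by auto
   ultimately show ?thesis by (intro exI[of _ "- ?K"]) auto
  qed
 qed
 \<comment> \<open>The bump times the expression in chart \<open>d\<close>, as a global function;
   its integral can be evaluated in either chart.\<close>
 define q where "q = lift c (%x. cutoff x0 (e / 2) x * (if x \<in> ov c d then lap d v (tr c d x) else 0))"
 have q: "q \<in> SF" unfolding q_def by (rule lift_SF[OF c sm compact_cball Kc]) (use z in auto)
 have qd: "q (ci d y) = w (ci d y) * lap d v y" if y: "y \<in> im d" for y
 proof (cases "ci d y \<in> chart_dom c")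
  case True
  hence "y \<in> ov d c" using y d by (simp add: ov_eq)
  hence "tr d c y \<in> ov c d" "tr c d (tr d c y) = y" using tr_ov[OF d c] tr_tr[OF d c] by auto
  thus ?thesis using True by (simp add: q_def w_def lift_def tr_def)
 qed (simp add: q_def w_def lift_def)
 have "(LINT p|vol. gM w v p) = - (LBINT x. indicator (im d) x * (vd d x * (w (ci d x) * lap d v x)))"
  by (rule ibp_local[OF d Kd w wsd v])
 also have "... = - (LBINT x. indicator (im d) x * (vd d x * q (ci d x)))"
  by (intro arg_cong[of _ _ uminus] Bochner_Integration.integral_cong refl) (auto simp: indicator_def qd)
 also have "... = - (LINT p|vol. q p)"
 proof (subst vol_integral[OF d measurable_vol[OF SF_continuous[OF q]]])
  fix p assume p: "p \<in> M" "p \<notin> chart_dom d"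
  show "q p = 0"
  proof (cases "p \<in> chart_dom c")
   case True
   hence "chart_map c p \<notin> ov c d" using p c by (simp add: ov_eq)
   thus ?thesis using True by (simp add: q_def lift_def)
  qed (simp add: q_def lift_def)
 qed simp
 also have "(LINT p|vol. q p) = (LBINT x. indicator (im c) x * (vd c x * q (ci c x)))"
  by (rule vol_integral[OF c measurable_vol[OF SF_continuous[OF q]]]) (simp add: q_def lift_def)
 finally have eq: "(LBINT x. indicator (im c) x * (vd c x * (w (ci c x) * lap c v x)))
   = (LBINT x. indicator (im c) x * (vd c x * q (ci c x)))" using ibp_local[OF c compact_cball Kc w ws v] by simp
 define f where "f = ext c (%x. vd c x * (w (ci c x) * lap c v x) - vd c x * q (ci c x))"
 have c1: "csm (ext c (%x. vd c x * (w (ci c x) * lap c v x)))" "csm (ext c (%x. vd c x * q (ci c x)))"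
  by (rule csm_ext[OF c _ compact_cball Kc];
   use z in "auto simp: w_def q_def intro!: smooth_on_mult smooth_vd smooth_lap c v open_im SF_smooth w[unfolded w_def] q[unfolded q_def]")+
 have fe: "f x = ext c (%x. vd c x * (w (ci c x) * lap c v x)) x - ext c (%x. vd c x * q (ci c x)) x" for x
  by (simp add: f_def ext_def)
 have fv: "f x = (if x \<in> ?K then vd c x * (cutoff x0 (e / 2) x * D x) else 0)" for x
  using z[of x] Kc e(2) by (auto simp: f_def ext_def w_def q_def D_def algebra_simps subset_iff)
 have f0: "f x >= 0" for x
  using e(2) Kc vd_pos[OF c] cutoff_bounds(1)[of x0 "e / 2" x] unfolding fv by (auto simp: subset_iff less_imp_le)
 have fi: "integrable lborel f" unfolding fe using csm_integrable[OF c1(1)] csm_integrable[OF c1(2)] by simp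
 have "(LBINT x. f x) = 0"
 proof -
  have "(LBINT x. ext c (%x. vd c x * (w (ci c x) * lap c v x)) x) = (LBINT x. ext c (%x. vd c x * q (ci c x)) x)"
  proof -
   have "ext c h x = indicator (im c) x * h x" for h x by (simp add: ext_def)
   thus ?thesis using eq by simp
  qed
  thus ?thesis unfolding fe using csm_integrable[OF c1(1)] csm_integrable[OF c1(2)] by simp
 qed
 hence ae: "AE x in lborel. f x = 0" using integral_nonneg_eq_0_iff_AE[OF fi] f0 by simp
 have pos: "f x > 0" if "x \<in> ball x0 (e / 2)" for x
 proof -
  have "x \<in> ?K" using that e by auto
  moreover have "cutoff x0 (e / 2) x = 1" by (rule cutoff_eq_1) (use e that in "auto simp: dist_norm norm_minus_commute")
  ultimately show ?thesis using e(2) Kc vd_pos[OF c] by (auto simp: fv subset_iff)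
 qed
 from ae have "AE x in lborel. x \<notin> ball x0 (e / 2)" by eventually_elim (use pos in force)
 hence "emeasure lborel (ball x0 (e / 2)) = 0"
  by (metis (no_types, lifting) AE_iff_null_sets[of "ball x0 (e / 2)" lborel] null_setsD1 sets_lborel borel_open open_ball)
 hence "negligible (ball x0 (e / 2))" by (simp add: negligible_iff_emeasure0)
 thus False using open_not_negligible[of "ball x0 (e / 2)"] e by simp
qed

lemma lap_change:
 assumes c: "c \<in> A" and d: "d \<in> A" and x: "x \<in> ov c d" and v: "v \<in> SF"
 shows "lap c v x = lap d v (tr c d x)"
 using lap_change_le[OF assms] lap_change_le[OF d c tr_ov[OF c d x] v] by (simp add: tr_tr[OF c d x])

lemma lapM_chart: "c \<in> A ==> x \<in> im c ==> v \<in> SF ==> lapM v (ci c x) = lap c v x"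
proof -
 assume a: "c \<in> A" "x \<in> im c" "v \<in> SF"
 let ?d = "chart_at A (ci c x)"
 have d: "?d \<in> A" "ci c x \<in> chart_dom ?d" using chart_at[OF chart_inv_M[OF a(1,2)]] by auto
 hence "x \<in> ov c ?d" using a by (simp add: ov_eq)
 from lap_change[OF a(1) d(1) this a(3)] show ?thesis by (simp add: lapM_def tr_def)
qed

lemma lapM_SF: "v \<in> SF ==> lapM v \<in> SF" unfolding SF_iff[of "lapM v"]
proof
 fix c assume "v \<in> SF" "c \<in> A"
 thus "smooth_on (im c) (%x. lapM v (ci c x))" by (intro smooth_on_cong[OF smooth_lap open_im]) (simp_all add: lapM_chart)
qed

lemma partial_dd: "partial (c :: ('a, 'n) chart) i F p = dx i (%x. F (ci c x)) (chart_map c p)" by (simp add: partial_eq pd_def)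

lemma laplace_beltrami_eq:
 assumes u: "u \<in> SF" and p: "p \<in> M"
 shows "laplace_beltrami A g u p = lapM u p"
proof -
 define c where "c = chart_at A p"
 have c: "c \<in> A" "p \<in> chart_dom c" using chart_at[OF p] by (auto simp: c_def)
 have x: "chart_map c p \<in> im c" using c by simp
 have "dx i (%x. volume_density A g c (ci c x) *
   (SU j. inv_metric A g c (ci c x) $ i $ j * differential u (ci c x) (coord_vector A c j (ci c x)))) (chart_map c p)
  = dx i (%y. vd c y * (SU j. Am c y $ i $ j * pd c j u y)) (chart_map c p)" for i
  by (rule dd_cong_open[OF open_im[OF c(1)] x]) (simp add: vd_def Am_def differential_def coord_vector_def u partial_eq)
 thus ?thesis unfolding laplace_beltrami_def codifferential_def Let_def c_def[symmetric] partial_dd lapM_def lap_def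
  using c by (simp add: vd_def)
qed

lemma grad_norm_sq_eq:
 assumes u: "u \<in> SF" and p: "p \<in> M"
 shows "grad_norm_sq A g u p = gM u u p"
proof -
 define c where "c = chart_at A p"
 define x where "x = chart_map c p"
 have c: "c \<in> A" "p \<in> chart_dom c" using chart_at[OF p] by (auto simp: c_def)
 have x: "x \<in> im c" "ci c x = p" using c by (auto simp: x_def)
 define a where "a i = (SU j. Am c x $ i $ j * pd c j u x)" for i
 have grad: "gradient A g u p = (%f. SU i. a i * coord_vector A c i p f)"
  unfolding gradient_def Let_def c_def[symmetric] partial_eq a_def by (simp add: Am_def x_def c sum_distrib_right)
 have Ga: "(SU k. Gm c x $ i $ k * a k) = pd c i u x" for i
 proof -
  have "(SU k. Gm c x $ i $ k * a k) = (SU j. (SU k. Gm c x $ i $ k * Am c x $ k $ j) * pd c j u x)"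
   unfolding a_def sum_distrib_left sum_distrib_right by (subst sum.swap) (simp add: mult.assoc)
  also have "... = (SU j. (Gm c x ** Am c x) $ i $ j * pd c j u x)" by (simp add: matrix_matrix_mult_def)
  also have "... = pd c i u x" unfolding inverse_metric(2)[OF c(1) x(1)] by (simp add: mat_def mult_delta_left)
  finally show ?thesis .
 qed
 have "grad_norm_sq A g u p = (SU i. SU k. a i * a k * g p (coord_vector A c i p) (coord_vector A c k p))"
  unfolding grad_norm_sq_def grad by (rule g_sum2[OF p]) (rule coord_vector_tangent[OF c])+
 also have "... = (SU i. a i * (SU k. Gm c x $ i $ k * a k))" by (simp add: Gm_def metric_matrix_def x sum_distrib_left mult_ac)
 also have "... = gq c u u x" unfolding Ga by (simp add: gq_def a_def sum_distrib_right sum_distrib_left mult_ac)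
 finally show ?thesis by (simp add: gM_def c_def x_def)
qed

section \<open>Localization by bumps and global integration by parts\<close>

definition bump :: "('a, 'n) disc => 'a => real" where
 "bump i = (case i of (c, a, r) => lift c (cutoff a r))"

lemma bump_SF: "cell i ==> bump i \<in> SF"
proof -
 assume i: "cell i"
 obtain c a r where cr: "i = (c, a, r)" by (cases i)
 note ci = i[unfolded cr]
 show ?thesis unfolding cr bump_def prod.case
  by (rule lift_SF[OF cell_ball(1)[OF ci] smooth_on_cutoff[OF open_im[OF cell_ball(1)[OF ci]]] compact_cball[of a "2 * r"] cell_ball(3)[OF ci]])
   (use cell_ball(2)[OF ci] cutoff_supp[of r _ a] in auto)
qed

lemma bump_nonneg: "bump i p >= 0" by (cases i) (simp add: bump_def lift_def cutoff_bounds)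

lemma bump_core: "cell i ==> p \<in> core i ==> bump i p = 1"
proof -
 assume i: "cell i" and p: "p \<in> core i"
 obtain c a r where cr: "i = (c, a, r)" by (cases i)
 note ci = i[unfolded cr]
 obtain x where x: "x \<in> ball a r" "p = ci c x" using p by (auto simp: cr core_def)
 have "x \<in> im c" using cell_ball(3)[OF ci, of r] cell_ball(2)[OF ci] x(1) by auto
 thus ?thesis using x cutoff_eq_1[OF cell_ball(2)[OF ci], of x a] by (simp add: cr bump_def dist_norm norm_minus_commute)
qed

lemma bump_supp: "p \<notin> ci c ` cball a (2 * r) ==> cell (c, a, r) ==> bump (c, a, r) p = 0"
 using inv_chart[of c p] cutoff_supp[of r "chart_map c p" a] cell_ball[of c a r]
 unfolding bump_def prod.case lift_def by (metis image_eqI)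

lemma bump_sum_pos: "p \<in> M ==> (SUM i:cells. bump i p) > 0"
proof -
 assume "p \<in> M"
 then obtain i where i: "i \<in> cells" "p \<in> core i" using cells(3) by auto
 have "bump i p <= (SUM i:cells. bump i p)" by (rule member_le_sum) (use i cells(1) bump_nonneg in auto)
 thus ?thesis using bump_core[OF cells(2)[OF i(1)] i(2)] by simp
qed

lemma pd_sum: "c \<in> A ==> x \<in> im c ==> (!!i. i \<in> I ==> f i \<in> SF) ==> pd c k (%p. SUM i:I. f i p) x = (SUM i:I. pd c k (f i) x)"
 unfolding pd_def by (rule dd_sum) (rule SF_diff)

lemma gM_sum:
 assumes "p \<in> M" "!!i. i \<in> I ==> f i \<in> SF" "v \<in> SF"
 shows "gM (%p. SUM i:I. f i p) v p = (SUM i:I. gM (f i) v p)"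
proof -
 let ?c = "chart_at A p"
 have c: "?c \<in> A" "chart_map ?c p \<in> im ?c" using chart_at[OF assms(1)] by auto
 let ?x = "chart_map ?c p"
 have ps: "pd ?c k (%p. SUM i:I. f i p) ?x = (SUM i:I. pd ?c k (f i) ?x)" for k by (rule pd_sum[OF c assms(2)])
 have "gM (%p. SUM i:I. f i p) v p = (SU k. SU l. SUM i:I. Am ?c ?x $ k $ l * pd ?c k (f i) ?x * pd ?c l v ?x)"
  unfolding gM_def gq_def ps by (simp add: sum_distrib_left sum_distrib_right)
 also have "... = (SU k. SUM i:I. SU l. Am ?c ?x $ k $ l * pd ?c k (f i) ?x * pd ?c l v ?x)"
  by (rule sum.cong[OF refl]) (rule sum.swap)
 also have "... = (SUM i:I. gM (f i) v p)" unfolding gM_def gq_def by (rule sum.swap)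
 finally show ?thesis .
qed

text \<open>The bumps divided by their sum form a partition of unity, which cuts \<open>u\<close>
  into pieces supported in single charts. Both sides are additive over the pieces.\<close>

theorem integration_by_parts:
 assumes u: "u \<in> SF" and v: "v \<in> SF"
 shows "(LINT p|vol. gM u v p) = - (LINT p|vol. u p * lapM v p)"
proof -
 define w where "w i p = u p * bump i p * inverse (SUM i:cells. bump i p)" for i p
 have bs: "(%p. SUM i:cells. bump i p) \<in> SF" by (rule SF_sum) (rule bump_SF[OF cells(2)])
 have w: "w i \<in> SF" if "i \<in> cells" for i unfolding w_def[abs_def]
  by (intro SF_mult u bump_SF cells(2) that SF_inverse bs) (use bump_sum_pos in force)
 have usum: "u p = (SUM i:cells. w i p)" if "p \<in> M" for p
  using bump_sum_pos[OF that] by (simp add: w_def sum_distrib_left[symmetric] sum_distrib_right[symmetric])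
 have gu: "gM u v p = (SUM i:cells. gM (w i) v p)" if p: "p \<in> M" for p
 proof -
  let ?c = "chart_at A p"
  have c: "?c \<in> A" "chart_map ?c p \<in> im ?c" using chart_at[OF p] by auto
  have "pd ?c k u (chart_map ?c p) = pd ?c k (%p. SUM i:cells. w i p) (chart_map ?c p)" for k
   unfolding pd_def by (rule dd_cong_open[OF open_im[OF c(1)] c(2)]) (use usum c(1) in auto)
  hence "gM u v p = gM (%p. SUM i:cells. w i p) v p" by (simp add: gM_def gq_def)
  thus ?thesis using gM_sum[OF p w v] by simp
 qed
 have loc: "(LINT p|vol. gM (w i) v p) = - (LINT p|vol. w i p * lapM v p)" if i: "i \<in> cells" for i
 proof -
  obtain c a r where cr: "i = (c, a, r)" by (cases i)
  have ci: "cell (c, a, r)" using cells(2)[OF i] by (simp add: cr)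
  note c = cell_ball(1)[OF ci]
  have K: "cball a (2 * r) \<subseteq> im c" using cell_ball(3)[OF ci, of "2 * r"] cell_ball(2)[OF ci] by simp
  have z: "w i p = 0" if "p \<notin> ci c ` cball a (2 * r)" for p using bump_supp[OF that ci] by (simp add: w_def cr)
  have wl: "(%p. w i p * lapM v p) \<in> SF" by (intro SF_mult w i lapM_SF v)
  have "(LINT p|vol. w i p * lapM v p) = (LBINT x. indicator (im c) x * (vd c x * (w i (ci c x) * lapM v (ci c x))))"
  proof (rule vol_integral[OF c measurable_vol[OF SF_continuous[OF wl]]])
   fix p assume "p \<in> M" "p \<notin> chart_dom c"
   hence "p \<notin> ci c ` cball a (2 * r)" using K by auto
   thus "w i p * lapM v p = 0" using z by simp
  qed
  also have "... = (LBINT x. indicator (im c) x * (vd c x * (w i (ci c x) * lap c v x)))"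
   by (intro Bochner_Integration.integral_cong refl) (auto simp: indicator_def lapM_chart[OF c _ v])
  finally show ?thesis using ibp_local[OF c compact_cball K w[OF i] z v] by simp
 qed
 have "(LINT p|vol. gM u v p) = (LINT p|vol. (SUM i:cells. gM (w i) v p))"
  by (rule Bochner_Integration.integral_cong) (auto simp: gu)
 also have "... = (SUM i:cells. \<integral>p. gM (w i) v p \<partial>vol)"
  by (rule Bochner_Integration.integral_sum) (intro integrable_vol gM_SF w v)
 also have "... = - (SUM i:cells. \<integral>p. w i p * lapM v p \<partial>vol)" by (simp add: loc sum_negf)
 also have "(SUM i:cells. \<integral>p. w i p * lapM v p \<partial>vol) = (LINT p|vol. (SUM i:cells. w i p * lapM v p))"
  by (rule Bochner_Integration.integral_sum[symmetric]) (intro integrable_vol SF_mult lapM_SF w v)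
 also have "... = (LINT p|vol. u p * lapM v p)" by (rule Bochner_Integration.integral_cong) (auto simp: usum sum_distrib_right)
 finally show ?thesis .
qed

text \<open>The first-order coefficients of the Laplacian in nondivergence form, the form required
  by the parametrix and the maximum principles.\<close>

definition Bm :: "('a, 'n) chart => 'n => real ^ 'n => real" where
 "Bm c j x = (1 / vd c x) * (SU i. dx i (%y. vd c y * Am c y $ i $ j) x)"

lemma smooth_Bm: "c \<in> A ==> smooth_on (im c) (Bm c j)"
proof -
 assume c: "c \<in> A"
 have "vd c x ~= 0" if "x \<in> im c" for x using vd_pos[OF c that] by simp
 hence 1: "smooth_on (im c) (%x. 1 / vd c x)" by (rule smooth_on_divide[OF open_im[OF c] smooth_on_const smooth_vd[OF c]])
 show ?thesis unfolding Bm_def[abs_def]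
  by (rule smooth_on_mult[OF open_im[OF c] 1 smooth_on_sum[OF open_im[OF c] smooth_on_dd[OF smooth_on_mult[OF open_im[OF c] smooth_vd[OF c] smooth_Am[OF c]]]]])
qed

lemma lap_nondiv:
 assumes c: "c \<in> A" and x: "x \<in> im c" and v: "v \<in> SF"
 shows "lap c v x = (SU i. SU j. Am c x $ i $ j * dx i (dx j (%x. v (ci c x))) x)
   + (SU j. Bm c j x * pd c j v x)"
proof -
 have d: "(%y. vd c y * Am c y $ i $ j) differentiable (at x)" "pd c j v differentiable (at x)" for i j
  using smooth_diff[OF smooth_on_mult[OF open_im[OF c] smooth_vd[OF c] smooth_Am[OF c]] x]
   smooth_diff[OF smooth_pd[OF v c] x] by auto
 have "dx i (%y. vd c y * (SU j. Am c y $ i $ j * pd c j v y)) x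
   = (SU j. vd c x * Am c x $ i $ j * dx i (pd c j v) x + dx i (%y. vd c y * Am c y $ i $ j) x * pd c j v x)" for i
 proof -
  have "dx i (%y. vd c y * (SU j. Am c y $ i $ j * pd c j v y)) x = dx i (%y. SU j. (vd c y * Am c y $ i $ j) * pd c j v y) x"
   by (simp add: sum_distrib_left mult.assoc)
  also have "... = (SU j. dx i (%y. (vd c y * Am c y $ i $ j) * pd c j v y) x)" by (rule dd_sum) (intro differentiable_mult d)
  finally show ?thesis by (simp add: dd_mult[OF d])
 qed
 moreover have "(SU i. SU j. dx i (%y. vd c y * Am c y $ i $ j) x * pd c j v x)
   = (SU j. (SU i. dx i (%y. vd c y * Am c y $ i $ j) x) * pd c j v x)" by (subst sum.swap) (simp add: sum_distrib_right)
 moreover have pj: "pd c j v = dx j (%x. v (ci c x))" for j by (simp add: pd_def[abs_def])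
 moreover have "vd c x * (SU j. Bm c j x * pd c j v x) = (SU j. (SU i. dx i (%y. vd c y * Am c y $ i $ j) x) * pd c j v x)"
  using vd_pos[OF c x] by (simp add: Bm_def sum_distrib_left[of "vd c x"])
 ultimately have "vd c x * lap c v x = vd c x * ((SU i. SU j. Am c x $ i $ j * dx i (pd c j v) x) + (SU j. Bm c j x * pd c j v x))"
  using vd_pos[OF c x] by (simp add: lap_def sum.distrib distrib_left sum_distrib_left mult.assoc)
 thus ?thesis using vd_pos[OF c x] pj by simp
qed

end

section \<open>Scalar curvature\<close>

text \<open>\<open>dG\<close> has the shape of the derivative of a metric transformed by the
  Jacobian \<open>J\<close>, with \<open>H\<close> the second derivatives of the transition map. In
  the alternating sum four of the six terms with \<open>H\<close> cancel by its symmetry, and the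
  other two coincide.\<close>

lemma christoffel_first_kind:
 fixes J :: "'n::finite => 'n => real" and H :: "'n => 'n => 'n => real"
 assumes H: "!!m i j. H m i j = H m j i"
  and dG: "!!i j l. dG i j l = (SU n. J n l * (SU m. H m i j * G' m n)) + (SU n. J n j * (SU m. H m i l * G' m n))
   + (SU n. SU q. SU m. J n l * J q i * J m j * D q m n)"
 shows "dG i j l + dG j i l - dG l i j
  = (SU n. J n l * (2 * (SU m. H m i j * G' m n) + (SU q. SU m. J q i * J m j * (D q m n + D m q n - D n q m))))"
proof -
 let ?D = "%n q m. J n l * J q i * J m j * D q m n"
 have 1: "(SU n. SU q. SU m. J n l * J q j * J m i * D q m n) = (SU n. SU q. SU m. J n l * J q i * J m j * D m q n)"
  by (rule sum.cong[OF refl], subst sum.swap) (simp add: mult_ac)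
 have 2: "(SU n. SU q. SU m. J n j * J q l * J m i * D q m n) = (SU n. SU q. SU m. J n l * J q i * J m j * D n q m)"
  by (subst sum.swap, rule sum.cong[OF refl], subst sum.swap) (simp add: mult_ac)
 show ?thesis unfolding dG H[of _ j i] H[of _ l i] H[of _ l j] 1 2
  by (simp add: distrib_left right_diff_distrib sum.distrib sum_subtractf sum_distrib_left mult_ac)
qed

text \<open>Raising the index with \<open>A\<close>: since \<open>A'\<close> is J A J^T and inverts
  \<open>G'\<close>, the second-derivative term collapses to \<open>H p\<close>, the inhomogeneous
  term in the transformation law of a connection.\<close>

lemma christoffel_second_kind:
 fixes J :: "'n::finite => 'n => real" and A A' :: "'n => 'n => real"
 assumes A': "!!p n. A' p n = (SU k. SU l. J p k * A k l * J n l)"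
  and inv: "!!p m. (SU n. A' p n * G' m n) = (if p = m then 1 else 0)"
  and F: "!!l. F l = (SU n. J n l * (2 * (SU m. H m * G' m n) + (SU q. SU m. U q m * E q m n)))"
 shows "(SU k. J p k * ((1 / 2) * (SU l. A k l * F l)))
  = (SU q. SU m. U q m * ((1 / 2) * (SU n. A' p n * E q m n))) + H p"
proof -
 define W where "W n = 2 * (SU m. H m * G' m n) + (SU q. SU m. U q m * E q m n)" for n
 have "(SU k. J p k * (SU l. A k l * F l)) = (SU k. SU l. SU n. J p k * A k l * J n l * W n)"
  unfolding F W_def[symmetric] by (simp add: sum_distrib_left mult.assoc)
 also have "... = (SU k. SU n. SU l. J p k * A k l * J n l * W n)" by (rule sum.cong[OF refl], rule sum.swap)
 also have "... = (SU n. A' p n * W n)" unfolding A' by (subst sum.swap) (simp add: sum_distrib_right)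
 also have "... = 2 * (SU n. SU m. H m * (A' p n * G' m n)) + (SU n. SU q. SU m. U q m * (A' p n * E q m n))"
  by (simp add: W_def distrib_left sum.distrib sum_distrib_left mult_ac)
 also have "(SU n. SU m. H m * (A' p n * G' m n)) = H p"
  by (subst sum.swap) (simp add: sum_distrib_left[symmetric] inv if_distrib[of "(*) _"] cong: if_cong)
 also have "(SU n. SU q. SU m. U q m * (A' p n * E q m n)) = (SU q. SU m. U q m * (SU n. A' p n * E q m n))"
  by (subst sum.swap, rule sum.cong[OF refl], subst sum.swap) (simp add: sum_distrib_left)
 finally have "(SU k. J p k * (SU l. A k l * F l)) = 2 * H p + (SU q. SU m. U q m * (SU n. A' p n * E q m n))" .
 moreover have "(SU k. J p k * ((1 / 2) * (SU l. A k l * F l))) = (1 / 2) * (SU k. J p k * (SU l. A k l * F l))"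
  by (simp add: sum_distrib_left)
 moreover have "(SU q. SU m. U q m * ((1 / 2) * (SU n. A' p n * E q m n))) = (1 / 2) * (SU q. SU m. U q m * (SU n. A' p n * E q m n))"
  by (simp add: sum_distrib_left)
 ultimately show ?thesis by simp
qed

lemma matrix_distribs:
 fixes A B C :: "real ^ 'n::finite ^ 'n"
 shows "(A + B) ** C = A ** C + B ** C" "(A - B) ** C = A ** C - B ** C"
  "C ** (A + B) = C ** A + C ** B" "C ** (A - B) = C ** A - C ** B"
 by (vector matrix_matrix_mult_def sum.distrib sum_subtractf algebra_simps)+

text \<open>The curvature \<open>dw + w \<and> w\<close> of a matrix-valued connection form is covariant under the
 gauge transformation given by \<open>J\<close>.\<close>

lemma gauge_covariance:
 fixes J :: "real ^ 'n::finite ^ 'n" and w b H :: "'n => real ^ 'n ^ 'n"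
 assumes 1: "!!j. J ** w j = b j ** J + H j"
  and 2: "H i ** w j + J ** dw i j = db i j ** J + b j ** H i + HH"
  and 3: "H j ** w i + J ** dw j i = db j i ** J + b i ** H j + HH"
 shows "J ** (dw i j - dw j i + w i ** w j - w j ** w i) = (db i j - db j i + b i ** b j - b j ** b i) ** J"
proof -
 have H: "H j = J ** w j - b j ** J" for j using 1[of j] by simp
 have "J ** dw i j = db i j ** J + b j ** H i + HH - H i ** w j" using 2 by (metis add_diff_cancel_left')
 moreover have "J ** dw j i = db j i ** J + b i ** H j + HH - H j ** w i" using 3 by (metis add_diff_cancel_left')
 ultimately have "J ** dw i j - J ** dw j i = db i j ** J + b j ** H i - H i ** w j - (db j i ** J + b i ** H j - H j ** w i)"
  by simp
 thus ?thesis unfolding H matrix_distribs by (simp add: matrix_mul_assoc algebra_simps)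
qed

context rmfd
begin

section \<open>Christoffel symbols and curvature in charts, and their transformation laws\<close>

definition Ga :: "('a, 'n) chart => 'n => 'n => 'n => real ^ 'n => real" where
 "Ga c k i j x = (1 / 2) * (SU l. Am c x $ k $ l *
   (dx i (%x. Gm c x $ j $ l) x + dx j (%x. Gm c x $ i $ l) x - dx l (%x. Gm c x $ i $ j) x))"

text \<open>For each pair i, j the curvature as a matrix in its remaining indices, with a matrix
  commutator as its last two terms; the gauge argument works on this form.\<close>

definition Rm :: "('a, 'n) chart => 'n => 'n => real ^ 'n => real ^ 'n ^ 'n" where
 "Rm c i j x = (\<chi> l k. dx i (Ga c l j k) x) - (\<chi> l k. dx j (Ga c l i k) x)
   + (\<chi> l k. Ga c l i k x) ** (\<chi> l k. Ga c l j k x) - (\<chi> l k. Ga c l j k x) ** (\<chi> l k. Ga c l i k x)"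

definition Sc :: "('a, 'n) chart => real ^ 'n => real" where
 "Sc c x = (SU j. SU k. Am c x $ j $ k * (SU i. Rm c i j x $ i $ k))"

lemma smooth_Ga: "c \<in> A ==> smooth_on (im c) (Ga c k i j)" unfolding Ga_def[abs_def]
 by (intro smooth_on_mult smooth_on_sum smooth_on_add smooth_on_diff smooth_on_const smooth_on_dd smooth_Am smooth_Gm open_im)

lemma smooth_Sc: "c \<in> A ==> smooth_on (im c) (Sc c)" unfolding Sc_def[abs_def] Rm_def matrix_matrix_mult_def
 by (simp, intro smooth_on_mult smooth_on_sum smooth_on_add smooth_on_diff smooth_on_dd smooth_Am smooth_Ga open_im)

lemma christoffel_Ga:
 assumes "c \<in> A" "x \<in> im c"
 shows "christoffel A g c k i j (ci c x) = Ga c k i j x"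
 unfolding christoffel_def partial_dd Ga_def using assms by (simp add: Gm_def Am_def)

lemma scalar_curvature_Sc:
 assumes p: "p \<in> M"
 shows "scalar_curvature A g p = Sc (chart_at A p) (chart_map (chart_at A p) p)"
proof -
 define c where "c = chart_at A p"
 define x where "x = chart_map c p"
 have c: "c \<in> A" "p \<in> chart_dom c" using chart_at[OF p] by (auto simp: c_def)
 have x: "x \<in> im c" "ci c x = p" using c by (auto simp: x_def)
 have pc: "partial c i (christoffel A g c l j k) p = dx i (Ga c l j k) x" for i l j k unfolding partial_dd x_def[symmetric]
  by (rule dd_cong_open[OF open_im[OF c(1)] x(1)]) (rule christoffel_Ga[OF c(1)])
 have "ricci A g c j k p = (SU i. Rm c i j x $ i $ k)" for j k
  unfolding ricci_def riemann_def pc christoffel_Ga[OF c(1) x(1), unfolded x(2)] Rm_def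
  by (simp add: matrix_matrix_mult_def sum_subtractf sum.distrib algebra_simps)
 thus ?thesis unfolding scalar_curvature_def Let_def c_def[symmetric] x_def[symmetric] Sc_def by (simp add: Am_def x)
qed

lemma dd_tr:
 assumes c: "c \<in> A" and d: "d \<in> A" and x: "x \<in> ov c d" and h: "smooth_on (im d) h"
 shows "dx i (%x. h (tr c d x)) x = (SU q. Jm c d x $ q $ i * dx q h (tr c d x))"
proof -
 have "tr c d x \<in> im d" using tr_ov[OF c d x] ov_sub[OF d] by blast
 thus ?thesis using dd_compose[OF smooth_diff[OF smooth_tr[OF c d] x] smooth_diff[OF h], of "axis i 1"] by (simp add: Jm_def)
qed

lemma smooth_on_tr:
 assumes c: "c \<in> A" and d: "d \<in> A" and h: "smooth_on (im d) h"
 shows "smooth_on (ov c d) (%x. h (tr c d x))" by (rule smooth_on_compose[OF open_ov[OF c d] open_im[OF d] _ smooth_tr[OF c d] h])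
  (use tr_ov[OF c d] ov_sub[OF d] in blast)

lemma dd_Jm_sym:
 assumes "c \<in> A" "d \<in> A" "x \<in> ov c d"
 shows "dx i (%x. Jm c d x $ m $ j) x = dx j (%x. Jm c d x $ m $ i) x"
proof -
 have "smooth_on (ov c d) (%x. tr c d x $ m)" by (intro smooth_intros smooth_tr assms open_ov)
 from dd_symm[OF open_ov[OF assms(1,2)] this assms(3)] show ?thesis by (simp add: Jm_def)
qed

lemma dd_metric_change:
 assumes c: "c \<in> A" and d: "d \<in> A" and x: "x \<in> ov c d"
 defines "J \<equiv> %k i. Jm c d x $ k $ i" and "H \<equiv> %m i j. dx i (%x. Jm c d x $ m $ j) x"
  and "G' \<equiv> %m n. Gm d (tr c d x) $ m $ n" and "D \<equiv> %q m n. dx q (%y. Gm d y $ m $ n) (tr c d x)"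
 shows "dx i (%x. Gm c x $ j $ l) x = (SU n. J n l * (SU m. H m i j * G' m n)) + (SU n. J n j * (SU m. H m i l * G' m n))
   + (SU n. SU q. SU m. J n l * J q i * J m j * D q m n)"
proof -
 note xd = subsetD[OF ov_sub[OF d] tr_ov[OF c d x]]
 have dJ: "(%x. Jm c d x $ k $ i) differentiable (at x)" for k i by (rule smooth_diff[OF smooth_Jm[OF c d] x])
 have dG: "(%x. Gm d (tr c d x) $ m $ n) differentiable (at x)" for m n
  by (rule smooth_diff[OF smooth_on_tr[OF c d smooth_Gm[OF d]] x])
 have Gs: "G' m n = G' n m" for m n unfolding G'_def by (rule metric_sym[OF d xd])
 have dGt: "dx i (%x. Gm d (tr c d x) $ m $ n) x = (SU q. J q i * D q m n)" for m n
  unfolding J_def D_def by (rule dd_tr[OF c d x smooth_Gm[OF d]])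
 have "dx i (%x. Gm c x $ j $ l) x
   = dx i (%x. SU n. SU m. Jm c d x $ n $ l * (Jm c d x $ m $ j * Gm d (tr c d x) $ m $ n)) x"
  by (rule dd_cong_open[OF open_ov[OF c d] x])
   (simp add: metric_change[OF c d] matrix_matrix_mult_def transpose_def sum_distrib_right sum_distrib_left mult_ac)
 also have "... = (SU n. SU m. J n l * (J m j * (SU q. J q i * D q m n) + H m i j * G' m n) + H n i l * (J m j * G' m n))"
  by (simp add: dd_sum dd_mult dJ dG differentiable_mult differentiable_sum dGt) (simp add: J_def H_def G'_def)
 also have "... = (SU n. J n l * (SU m. H m i j * G' m n)) + (SU n. SU m. H n i l * (J m j * G' m n))
   + (SU n. SU m. SU q. J n l * J q i * J m j * D q m n)" by (simp add: distrib_left sum.distrib sum_distrib_left mult_ac)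
 also have "(SU n. SU m. H n i l * (J m j * G' m n)) = (SU n. SU m. H n i l * (J m j * G' n m))"
  by (intro sum.cong refl, subst Gs, rule refl)
 also have "... = (SU n. J n j * (SU m. H m i l * G' m n))" by (subst sum.swap) (simp add: sum_distrib_left mult_ac)
 also have "(SU n. SU m. SU q. J n l * J q i * J m j * D q m n) = (SU n. SU q. SU m. J n l * J q i * J m j * D q m n)"
  by (rule sum.cong[OF refl], rule sum.swap)
 finally show ?thesis .
qed

lemma Ga_change:
 assumes c: "c \<in> A" and d: "d \<in> A" and x: "x \<in> ov c d"
 shows "(SU k. Jm c d x $ p $ k * Ga c k i j x)
  = (SU m. (SU q. Jm c d x $ q $ i * Ga d p q m (tr c d x)) * Jm c d x $ m $ j) + dx i (%x. Jm c d x $ p $ j) x"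
proof -
 note xd = subsetD[OF ov_sub[OF d] tr_ov[OF c d x]]
 have inv: "(SU n. Am d (tr c d x) $ p $ n * Gm d (tr c d x) $ m $ n) = (if p = m then 1 else 0)" for p m
 proof -
  have "(Am d (tr c d x) ** Gm d (tr c d x)) $ p $ m = (SU n. Am d (tr c d x) $ p $ n * Gm d (tr c d x) $ m $ n)"
   by (simp add: matrix_matrix_mult_def metric_sym[OF d xd, of _ m])
  thus ?thesis unfolding inverse_metric(1)[OF d xd] by (simp add: mat_def)
 qed
 have A': "Am d (tr c d x) $ p $ n = (SU k. SU l. Jm c d x $ p $ k * Am c x $ k $ l * Jm c d x $ n $ l)" for p n
  unfolding inverse_metric_change[OF c d x] by (simp add: matrix_matrix_mult_def transpose_def sum_distrib_right) (rule sum.swap)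
 note F = christoffel_first_kind[OF dd_Jm_sym[OF c d x] dd_metric_change[OF c d x]]
 have "(SU k. Jm c d x $ p $ k * Ga c k i j x)
  = (SU q. SU m. (Jm c d x $ q $ i * Jm c d x $ m $ j) * Ga d p q m (tr c d x)) + dx i (%x. Jm c d x $ p $ j) x"
  unfolding Ga_def by (rule christoffel_second_kind[OF A' inv F])
 also have "(SU q. SU m. (Jm c d x $ q $ i * Jm c d x $ m $ j) * Ga d p q m (tr c d x))
  = (SU m. (SU q. Jm c d x $ q $ i * Ga d p q m (tr c d x)) * Jm c d x $ m $ j)"
  by (subst sum.swap) (simp add: sum_distrib_right sum_distrib_left mult_ac)
 finally show ?thesis .
qed

text \<open>The transformation law of the Christoffel symbols is differentiated once more. All terms
  with higher derivatives of the transition map that are symmetric in i and j drop out of the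
  antisymmetrized expression.\<close>

lemma Rm_change:
 assumes c: "c \<in> A" and d: "d \<in> A" and x: "x \<in> ov c d"
 shows "Jm c d x ** Rm c i j x = (SU q. SU r. (Jm c d x $ q $ i * Jm c d x $ r $ j) *\<^sub>R (Rm d q r (tr c d x) ** Jm c d x))"
proof -
 note xc = subsetD[OF ov_sub[OF c] x]
 let ?y = "tr c d x"
 define J where "J = Jm c d"
 define w where "w j = (\<chi> l k. Ga c l j k x)" for j
 \<comment> \<open>The connection matrices of \<open>d\<close> along the coordinate directions of
   \<open>c\<close>; \<open>J\<close> acts as the gauge transformation between \<open>w\<close> and
   \<open>b\<close>.\<close>
 define b where "b j = (\<chi> p m. SU q. J x $ q $ j * Ga d p q m ?y)" for j
 define H where "H j = (\<chi> p k. dx j (%x. J x $ p $ k) x)" for j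
 define dw where "dw i j = (\<chi> l k. dx i (Ga c l j k) x)" for i j
 define db where "db i j = (\<chi> p m. dx i (%x. SU q. J x $ q $ j * Ga d p q m (tr c d x)) x)" for i j
 have dJ: "(%x. J x $ k $ i) differentiable (at x)" for k i unfolding J_def by (rule smooth_diff[OF smooth_Jm[OF c d] x])
 have dJ2: "(%x. dx j (%x. J x $ k $ i) x) differentiable (at x)" for k i j
  unfolding J_def by (rule smooth_diff[OF smooth_on_dd[OF smooth_Jm[OF c d]] x])
 have dG: "Ga c k i j differentiable (at x)" for i j k by (rule smooth_diff[OF smooth_Ga[OF c] xc])
 have dG': "(%x. Ga d k i j (tr c d x)) differentiable (at x)" for i j k
  by (rule smooth_diff[OF smooth_on_tr[OF c d smooth_Ga[OF d]] x])
 have 1: "J x ** w j = b j ** J x + H j" for j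
  using Ga_change[OF c d x] by (simp add: vec_eq_iff matrix_matrix_mult_def w_def b_def H_def J_def)
 have 2: "H i ** w j + J x ** dw i j = db i j ** J x + b j ** H i + (\<chi> p k. dx i (%x. dx j (%x. J x $ p $ k) x) x)" for i j
 proof -
  have e: "dx i (%x. SU l. J x $ p $ l * Ga c l j k x) x = dx i (%x. (SU m. (SU q. J x $ q $ j * Ga d p q m (tr c d x)) * J x $ m $ k) + dx j (%x. J x $ p $ k) x) x" for p k
   unfolding J_def by (rule dd_cong_open[OF open_ov[OF c d] x]) (rule Ga_change[OF c d])
  have "dx i (%x. SU l. J x $ p $ l * Ga c l j k x) x = (SU l. J x $ p $ l * dx i (Ga c l j k) x + dx i (%x. J x $ p $ l) x * Ga c l j k x)" for p k
   by (simp add: dd_sum dd_mult dJ dG differentiable_mult)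
  moreover have "dx i (%x. (SU m. (SU q. J x $ q $ j * Ga d p q m (tr c d x)) * J x $ m $ k) + dx j (%x. J x $ p $ k) x) x
    = (SU m. (SU q. J x $ q $ j * Ga d p q m ?y) * dx i (%x. J x $ m $ k) x + dx i (%x. SU q. J x $ q $ j * Ga d p q m (tr c d x)) x * J x $ m $ k)
    + dx i (%x. dx j (%x. J x $ p $ k) x) x" for p k
   by (subst dd_add) (simp_all add: dd_sum[of UNIV "%m x. (SU q. J x $ q $ j * Ga d p q m (tr c d x)) * J x $ m $ k"] dd_mult dJ dJ2 dG' differentiable_mult)
  ultimately show ?thesis using e
   by (simp add: vec_eq_iff matrix_matrix_mult_def w_def b_def H_def dw_def db_def sum.distrib add_ac)
 qed
 have 3: "H j ** w i + J x ** dw j i = db j i ** J x + b i ** H j + (\<chi> p k. dx i (%x. dx j (%x. J x $ p $ k) x) x)"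
  using 2[of j i] dd_symm[OF open_ov[OF c d] smooth_Jm[OF c d] x, of "axis i 1" "axis j 1"] by (simp add: J_def)
 have R: "Rm c i j x = dw i j - dw j i + w i ** w j - w j ** w i" by (simp add: Rm_def dw_def w_def)
 define w' where "w' q = (\<chi> p m. Ga d p q m ?y)" for q
 define dw' where "dw' r q = (\<chi> p m. dx r (Ga d p q m) ?y)" for r q
 have db: "db i j = (SU q. SU r. (J x $ q $ i * J x $ r $ j) *\<^sub>R dw' q r) + (\<chi> p m. SU q. dx i (%x. J x $ q $ j) x * Ga d p q m ?y)" for i j
 proof -
  have "dx i (%x. SU q. J x $ q $ j * Ga d p q m (tr c d x)) x
   = (SU q. J x $ q $ j * (SU r. J x $ r $ i * dx r (Ga d p q m) ?y)) + (SU q. dx i (%x. J x $ q $ j) x * Ga d p q m ?y)" for p m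
   by (simp add: dd_sum dd_mult dJ dG' differentiable_mult sum.distrib dd_tr[OF c d x smooth_Ga[OF d]] J_def[symmetric])
  moreover have "(SU q. J x $ q $ j * (SU r. J x $ r $ i * dx r (Ga d p q m) ?y))
   = (SU q. SU r. J x $ q $ i * J x $ r $ j * dx q (Ga d p r m) ?y)" for p m
   by (simp add: sum_distrib_left) (subst sum.swap, simp add: mult_ac)
  ultimately show ?thesis by (simp add: vec_eq_iff db_def dw'_def)
 qed
 have Hs: "dx i (%x. J x $ q $ j) x = dx j (%x. J x $ q $ i) x" for q unfolding J_def by (rule dd_Jm_sym[OF c d x])
 have bs: "b j = (SU q. J x $ q $ j *\<^sub>R w' q)" for j by (simp add: vec_eq_iff b_def w'_def)
 have bb: "b i ** b j = (SU q. SU r. (J x $ q $ i * J x $ r $ j) *\<^sub>R (w' q ** w' r))" for i j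
 proof -
  have "(b i ** b j) $ p $ m = (SU l. SU q. SU r. J x $ q $ i * J x $ r $ j * (w' q $ p $ l * w' r $ l $ m))" for p m
   by (simp add: bs matrix_matrix_mult_def sum_product mult_ac)
  also have "... p m = (SU q. SU l. SU r. J x $ q $ i * J x $ r $ j * (w' q $ p $ l * w' r $ l $ m))" for p m by (rule sum.swap)
  also have "... p m = (SU q. SU r. SU l. J x $ q $ i * J x $ r $ j * (w' q $ p $ l * w' r $ l $ m))" for p m
   by (rule sum.cong[OF refl], rule sum.swap)
  finally show ?thesis by (simp add: vec_eq_iff matrix_matrix_mult_def sum_distrib_left)
 qed
 have sw: "(SU q. SU r. (J x $ q $ j * J x $ r $ i) *\<^sub>R Y q r) = (SU q. SU r. (J x $ q $ i * J x $ r $ j) *\<^sub>R Y r q)"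
  for Y :: "'n => 'n => real ^ 'n ^ 'n" by (subst sum.swap) (simp add: mult.commute)
 have "db i j - db j i + b i ** b j - b j ** b i = (SU q. SU r. (J x $ q $ i * J x $ r $ j) *\<^sub>R Rm d q r ?y)"
  unfolding db bb sw[of "dw'"] sw[of "%q r. w' q ** w' r"]
  by (simp add: Hs Rm_def dw'_def[symmetric] w'_def[symmetric] scaleR_diff_right scaleR_add_right sum.distrib sum_subtractf)
 moreover have lin: "linear (%B :: real ^ 'n ^ 'n. B ** J x)"
  by (rule linearI, rule matrix_distribs(1)) (simp add: scalar_matrix_assoc)
 ultimately show ?thesis
  using gauge_covariance[OF 1 2 3] unfolding R by (simp add: linear_sum[OF lin] linear_cmul[OF lin] flip: J_def)
qed

text \<open>In the Ricci trace one Jacobian cancels against its inverse \<open>K\<close>, and the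
  two remaining Jacobians turn the inverse metric of \<open>c\<close> into that of
  \<open>d\<close>.\<close>

lemma Sc_change:
 assumes c: "c \<in> A" and d: "d \<in> A" and x: "x \<in> ov c d"
 shows "Sc c x = Sc d (tr c d x)"
proof -
 let ?y = "tr c d x"
 define J where "J = Jm c d x"
 define K where "K = Jm d c ?y"
 have JK: "(SU e. K $ e $ i * J $ q $ e) = (if q = i then 1 else 0)" for q i
 proof -
  have "(J ** K) $ q $ i = (SU e. K $ e $ i * J $ q $ e)" by (simp add: matrix_matrix_mult_def mult.commute)
  thus ?thesis using Jm_inverse2[OF c d x] by (simp add: J_def K_def mat_def)
 qed
 define Z where "Z a b = (SU q. SU r. J $ r $ a * (Rm d q r ?y ** J) $ q $ b)" for a b
 have Rc: "Rm c e a x $ e $ b = (SU i. SU q. K $ e $ i * J $ q $ e * (SU r. J $ r $ a * (Rm d q r ?y ** J) $ i $ b))" for e a b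
 proof -
  have "Rm c e a x = K ** (J ** Rm c e a x)" using Jm_inverse[OF c d x] by (simp add: matrix_mul_assoc J_def K_def)
  hence "Rm c e a x $ e $ b = (K ** (J ** Rm c e a x)) $ e $ b" by simp
  also have "... = (SU i. K $ e $ i * (J ** Rm c e a x) $ i $ b)" by (simp add: matrix_matrix_mult_def[of K])
  also have "... = (SU i. SU q. K $ e $ i * J $ q $ e * (SU r. J $ r $ a * (Rm d q r ?y ** J) $ i $ b))"
   unfolding J_def Rm_change[OF c d x] by (simp add: sum_distrib_left mult_ac)
  finally show ?thesis .
 qed
 have "(SU e. Rm c e a x $ e $ b) = Z a b" for a b
 proof -
  define Y where "Y i q = (SU r. J $ r $ a * (Rm d q r ?y ** J) $ i $ b)" for i q
  have "(SU e. Rm c e a x $ e $ b) = (SU i. SU q. (SU e. K $ e $ i * J $ q $ e) * Y i q)"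
   unfolding Rc Y_def[symmetric] by (subst sum.swap, rule sum.cong[OF refl], subst sum.swap) (simp add: sum_distrib_right)
  also have "... = (SU i. Y i i)" unfolding JK by (simp add: if_distrib[of "%z. z * _"] cong: if_cong)
  finally show ?thesis by (simp add: Y_def Z_def)
 qed
 hence "Sc c x = (SU a. SU b. Am c x $ a $ b * Z a b)" by (simp add: Sc_def)
 also have "... = (SU a. SU b. SU q. SU r. SU m. J $ r $ a * Am c x $ a $ b * J $ m $ b * Rm d q r ?y $ q $ m)"
  by (simp add: Z_def matrix_matrix_mult_def sum_distrib_left mult_ac)
 also have "... = (SU q. SU r. SU m. SU a. SU b. J $ r $ a * Am c x $ a $ b * J $ m $ b * Rm d q r ?y $ q $ m)"
  by (simp only: sum.cartesian_product UNIV_Times_UNIV)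
   (rule sum.reindex_bij_witness[of _ "%(q, r, m, a, b). (a, b, q, r, m)" "%(a, b, q, r, m). (q, r, m, a, b)"]; auto)
 also have "... = (SU q. SU r. SU m. Am d ?y $ r $ m * Rm d q r ?y $ q $ m)"
 proof -
  have "(SU a. SU b. J $ r $ a * Am c x $ a $ b * J $ m $ b) = Am d ?y $ r $ m" for r m
   unfolding inverse_metric_change[OF c d x] J_def[symmetric]
   by (simp add: matrix_matrix_mult_def transpose_def sum_distrib_right) (rule sum.swap)
  thus ?thesis by (simp add: sum_distrib_right[symmetric])
 qed
 also have "... = (SU r. SU m. SU q. Am d ?y $ r $ m * Rm d q r ?y $ q $ m)"
  by (subst sum.swap, rule sum.cong[OF refl], rule sum.swap)
 also have "... = Sc d ?y" by (simp add: Sc_def sum_distrib_left)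
 finally show ?thesis .
qed

text \<open>The definition selects a chart separately at each point; chart independence lets one
  fixed chart compute the value on its whole domain.\<close>

lemma scalar_curvature_SF: "scalar_curvature A g \<in> SF" unfolding SF_iff
proof
 fix c assume c: "c \<in> A"
 have "scalar_curvature A g (ci c x) = Sc c x" if x: "x \<in> im c" for x
 proof -
  let ?d = "chart_at A (ci c x)"
  have d: "?d \<in> A" "ci c x \<in> chart_dom ?d" using chart_at[OF chart_inv_M[OF c x]] by auto
  hence "x \<in> ov c ?d" using x c by (simp add: ov_eq)
  from Sc_change[OF c d(1) this] show ?thesis using scalar_curvature_Sc[OF chart_inv_M[OF c x]] by (simp add: tr_def)
 qed
 thus "smooth_on (im c) (%x. scalar_curvature A g (ci c x))" by (intro smooth_on_cong[OF smooth_Sc[OF c] open_im[OF c]]) simp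
qed

end

section \<open>Norms and integral operators on the manifold\<close>

context mfd
begin

text \<open>The \<open>C\<^sup>k\<close> norm, measured with the vector fields \<open>vfs\<close>, which span all tangent spaces.\<close>

primrec N :: "nat => ('a => real) => real" where
 "N 0 f = Sup (insert 0 ((%p. \<bar>f p\<bar>) ` M))"
| "N (Suc k) f = N k f + (SUM i:vfs. N k (vf i f))"

abbreviation dN :: "nat => ('a => real) => ('a => real) => real" where
 "dN m f h == N m (%p. f p - h p)"

lemma bdd_SF: "f \<in> SF ==> bdd_above (insert 0 ((%p. \<bar>f p\<bar>) ` M))"
 using SF_bounded[of f] by (metis bdd_above_insert bdd_aboveI2)

lemma N0_ge: "f \<in> SF ==> p \<in> M ==> \<bar>f p\<bar> <= N 0 f" using cSup_upper[OF _ bdd_SF] by auto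

lemma N0_le: "(!!p. p \<in> M ==> \<bar>f p\<bar> <= B) ==> 0 <= B ==> N 0 f <= B" by (auto intro!: cSup_least)

lemma N_nonneg: "f \<in> SF ==> N k f >= 0"
 by (induction k arbitrary: f) (auto intro!: cSup_upper bdd_SF add_nonneg_nonneg sum_nonneg vf_SF)

lemma vf_lift: "vf ((c, a, r), j) f = lift c (%x. cutoff a (2 * r) x * dx j (%x. f (ci c x)) x)" by (simp add: vf_def)

lemma vfs_c: "((c, a, r), j) \<in> vfs ==> c \<in> A" using cells(2) cell_ball(1)[of c a r] by (auto simp: vfs_def)

lemma vf_cong: "i \<in> vfs ==> (!!p. p \<in> M ==> f p = h p) ==> vf i f = vf i h"
proof -
 assume i: "i \<in> vfs" and e: "!!p. p \<in> M ==> f p = h p"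
 obtain c a r j where cr: "i = ((c, a, r), j)" by (metis prod.collapse)
 have c: "c \<in> A" using vfs_c i by (simp add: cr)
 have "dd v (%x. f (ci c x)) x = dd v (%x. h (ci c x)) x" if "x \<in> im c" for v x
  by (rule dd_cong_open[OF open_im[OF c] that]) (simp add: e c)
 thus ?thesis by (auto simp: cr vf_lift lift_def fun_eq_iff)
qed

lemma N_cong: "(!!p. p \<in> M ==> f p = h p) ==> N k f = N k h"
proof (induction k arbitrary: f h)
 case 0
 thus ?case by (simp cong: image_cong)
next
 case (Suc k)
 show ?case using Suc.IH[OF Suc.prems] vf_cong[OF _ Suc.prems] by simp
qed

declare N.simps [simp del]
lemmas N_Suc = N.simps(2)

lemma vf_rules:
 assumes "i \<in> vfs" "f \<in> SF" "h \<in> SF"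
 shows vf_add: "vf i (%p. f p + h p) p = vf i f p + vf i h p"
  and vf_diff: "vf i (%p. f p - h p) p = vf i f p - vf i h p"
  and vf_mult: "vf i (%p. f p * h p) p = f p * vf i h p + vf i f p * h p"
  and vf_cmult: "vf i (%p. k * f p) p = k * vf i f p"
proof -
 obtain c a r j where cr: "i = ((c, a, r), j)" by (metis prod.collapse)
 have c: "c \<in> A" using vfs_c assms(1) by (simp add: cr)
 note d = SF_diff[OF assms(2) c] SF_diff[OF assms(3) c]
 show "vf i (%p. f p + h p) p = vf i f p + vf i h p" "vf i (%p. f p - h p) p = vf i f p - vf i h p"
  "vf i (%p. f p * h p) p = f p * vf i h p + vf i f p * h p" "vf i (%p. k * f p) p = k * vf i f p"
  by (auto simp: cr vf_lift lift_def dd_add dd_diff dd_mult dd_cmult d c algebra_simps)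
qed

lemma vf_comp:
 assumes "i \<in> vfs" "f \<in> SF" "p \<in> M" "(h has_real_derivative h') (at (f p))"
 shows "vf i (%p. h (f p)) p = h' * vf i f p"
proof -
 obtain c a r j where cr: "i = ((c, a, r), j)" by (metis prod.collapse)
 have c: "c \<in> A" using vfs_c assms(1) by (simp add: cr)
 have "dd v (%x. h (f (ci c x))) (chart_map c p) = h' * dd v (%x. f (ci c x)) (chart_map c p)" if "p \<in> chart_dom c" for v
  by (rule dd_real_compose[OF SF_diff[OF assms(2) c]]) (use that assms(4) c in auto)
 thus ?thesis by (auto simp: cr vf_lift lift_def)
qed

lemma vf_local:
 assumes "i \<in> vfs" "openin X W" "p \<in> W" "!!q. q \<in> W ==> f q = h q"
 shows "vf i f p = vf i h p"
proof -
 obtain c a r j where cr: "i = ((c, a, r), j)" by (metis prod.collapse)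
 have c: "c \<in> A" using vfs_c assms(1) by (simp add: cr)
 have "dd v (%x. f (ci c x)) (chart_map c p) = dd v (%x. h (ci c x)) (chart_map c p)" if "p \<in> chart_dom c" for v
  by (rule dd_cong_open[OF open_vimage_inv[OF c assms(2)]]) (use that assms(3,4) c in auto)
 thus ?thesis by (auto simp: cr vf_lift lift_def)
qed

lemma N_add: "f \<in> SF ==> h \<in> SF ==> N k (%p. f p + h p) <= N k f + N k h"
proof (induction k arbitrary: f h)
 case 0
 have "\<bar>f p + h p\<bar> <= N 0 f + N 0 h" if "p \<in> M" for p using N0_ge[OF 0(1) that] N0_ge[OF 0(2) that] by linarith
 thus ?case using N_nonneg[OF 0(1), of 0] N_nonneg[OF 0(2), of 0] by (intro N0_le) auto
next
 case (Suc k)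
 have "N k (vf i (%p. f p + h p)) <= N k (vf i f) + N k (vf i h)" if "i \<in> vfs" for i
  using Suc.IH[OF vf_SF[OF that Suc.prems(1)] vf_SF[OF that Suc.prems(2)]] vf_add[OF that Suc.prems] by presburger
 from sum_mono[OF this, of vfs "%i. i"] show ?case using Suc.IH[OF Suc.prems] by (simp add: N_Suc sum.distrib)
qed

lemma N_cmult: "f \<in> SF ==> N k (%p. c * f p) <= \<bar>c\<bar> * N k f"
proof (induction k arbitrary: f)
 case 0
 have "\<bar>c * f p\<bar> <= \<bar>c\<bar> * N 0 f" if "p \<in> M" for p
  using mult_left_mono[OF N0_ge[OF 0 that], of "\<bar>c\<bar>"] by (simp add: abs_mult)
 thus ?case using N_nonneg[OF 0, of 0] by (intro N0_le) auto
next
 case (Suc k)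
 have "N k (vf i (%p. c * f p)) <= \<bar>c\<bar> * N k (vf i f)" if "i \<in> vfs" for i
  using Suc.IH[OF vf_SF[OF that Suc.prems]] vf_cmult[OF that Suc.prems Suc.prems] by presburger
 from sum_mono[OF this, of vfs "%i. i"] show ?case using Suc.IH[OF Suc.prems] by (simp add: N_Suc distrib_left sum_distrib_left)
qed

lemma N_diff: "f \<in> SF ==> h \<in> SF ==> dN k f h <= N k f + N k h"
 using N_add[OF _ SF_cmult, of f h k "-1"] N_cmult[of h k "-1"] by simp

lemma N_sum: "finite I ==> (!!i. i \<in> I ==> f i \<in> SF) ==> N k (%p. SUM i:I. f i p) <= (SUM i:I. N k (f i))"
proof (induction I rule: finite_induct)
 case empty
 show ?case using N_cmult[OF SF_const[of 0], of k 0] by simp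
next
 case (insert i I)
 thus ?case using N_add[of "f i" "%p. SUM i:I. f i p" k] SF_sum[of I f] by fastforce
qed

lemma N_mono: "f \<in> SF ==> N k f <= N (Suc k) f"
 using sum_nonneg[of vfs "%i. N k (vf i f)"] N_nonneg vf_SF by (auto simp: N_Suc)

lemma N_vf: "f \<in> SF ==> i \<in> vfs ==> N k (vf i f) <= N (Suc k) f"
proof -
 assume f: "f \<in> SF" and i: "i \<in> vfs"
 have "N k (vf i f) <= (SUM i:vfs. N k (vf i f))" by (rule member_le_sum[OF i _ finite_vfs]) (use N_nonneg vf_SF f in auto)
 thus ?thesis using N_nonneg[OF f, of k] by (simp add: N_Suc)
qed

lemma N_mult: "EX C>=0. ALL f:SF. ALL h:SF. N k (%p. f p * h p) <= C * N k f * N k h"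
proof (induction k)
 case 0
 have "N 0 (%p. f p * h p) <= 1 * N 0 f * N 0 h" if f: "f \<in> SF" and h: "h \<in> SF" for f h
  using mult_mono[OF N0_ge[OF f] N0_ge[OF h] N_nonneg[OF f]] N_nonneg[OF f] N_nonneg[OF h] by (intro N0_le) (auto simp: abs_mult)
 thus ?case by (intro exI[of _ 1]) auto
next
 case (Suc k)
 then obtain C where C: "C >= 0" "!!f h. f \<in> SF ==> h \<in> SF ==> N k (%p. f p * h p) <= C * N k f * N k h" by blast
 have "N (Suc k) (%p. f p * h p) <= (C + real (card vfs) * (2 * C)) * N (Suc k) f * N (Suc k) h" if f: "f \<in> SF" and h: "h \<in> SF" for f h
 proof -
  let ?B = "C * N (Suc k) f * N (Suc k) h"
  have le: "N k (%p. u p * v p) <= ?B" if "u \<in> SF" "v \<in> SF" "N k u <= N (Suc k) f" "N k v <= N (Suc k) h" for u v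
  proof -
   have "N k u * N k v <= N (Suc k) f * N (Suc k) h" using that N_nonneg f by (intro mult_mono) auto
   thus ?thesis using order_trans[OF C(2)[OF that(1,2)]] C(1) by (simp add: mult.assoc mult_left_mono)
  qed
  have "N k (vf i (%p. f p * h p)) <= 2 * ?B" if i: "i \<in> vfs" for i
  proof -
   have "N k (vf i (%p. f p * h p)) = N k (%p. f p * vf i h p + vf i f p * h p)" by (rule N_cong) (rule vf_mult[OF i f h])
   also have "... <= N k (%p. f p * vf i h p) + N k (%p. vf i f p * h p)" by (intro N_add SF_mult vf_SF i f h)
   finally show ?thesis
    using le[OF f vf_SF[OF i h] N_mono[OF f] N_vf[OF h i]] le[OF vf_SF[OF i f] h N_vf[OF f i] N_mono[OF h]] by simp
  qed
  hence "(SUM i:vfs. N k (vf i (%p. f p * h p))) <= (SUM i:vfs. 2 * ?B)" by (rule sum_mono)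
  thus ?thesis using le[OF f h N_mono[OF f] N_mono[OF h]] by (simp add: N_Suc[of _ "%p. f p * h p"] algebra_simps)
 qed
 thus ?case using C(1) by (intro exI[of _ "C + real (card vfs) * (2 * C)"]) auto
qed

lemma N_mult_left:
 assumes "f \<in> SF"
 shows "EX C>=0. ALL h:SF. N k (%p. f p * h p) <= C * N k h"
proof -
 obtain C where C: "C >= 0" "ALL f:SF. ALL h:SF. N k (%p. f p * h p) <= C * N k f * N k h" using N_mult by blast
 thus ?thesis using assms N_nonneg[OF assms] by (intro exI[of _ "C * N k f"]) auto
qed

subsection \<open>Kernel operators in a cell\<close>

definition cq :: "('a, 'n) disc => (real ^ 'n) set" where
 "cq i = (case i of (c, a, r) => cball a (2 * r))"

text \<open>A function on the manifold read in the chart of a cell. The cutoff equals 1 up to radius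
  4 r, hence on the support \<open>cq\<close> of the kernels, and does not influence their
  operators.\<close>

definition cF :: "('a, 'n) disc => ('a => real) => real ^ 'n => real" where
 "cF i f x = (case i of (c, a, r) => cutoff a (4 * r) x * f (ci c x))"

definition KT :: "('a, 'n) disc => real => 'n kernel => ('a => real) => 'a => real" where
 "KT i ka k f = lift (fst i) (kop ka k (cF i f))"

lemma cF_csm: "cell i ==> f \<in> SF ==> csm (cF i f)"
proof -
 assume i: "cell i" and f: "f \<in> SF"
 obtain c a r where cr: "i = (c, a, r)" by (cases i)
 note ci = i[unfolded cr]
 show ?thesis unfolding cr cF_def[abs_def] prod.case
  by (rule csm_cutoff_mult[OF open_im[OF cell_ball(1)[OF ci]] _ _ SF_smooth[OF f cell_ball(1)[OF ci]]])
   (use cell_ball(2)[OF ci] cell_ball(3)[OF ci] in auto)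
qed

lemma cF_near: "cell (c, a, r) ==> norm (x - a) <= 4 * r ==> cF (c, a, r) f x = f (ci c x)"
 by (simp add: cF_def cutoff_eq_1 cell_ball(2))

lemma KT_SF:
 assumes "cell i" "kern True k" "ksupp (cq i) k" "f \<in> SF" "ka >= 0"
 shows "KT i ka k f \<in> SF"
proof -
 obtain c a r where cr: "i = (c, a, r)" by (cases i)
 note ci = assms(1)[unfolded cr]
 show ?thesis unfolding KT_def
  by (rule lift_SF[OF _ smooth_on_subset[OF smooth_on_kop[OF assms(2) cF_csm[OF assms(1,4)] assms(5)]] compact_cball[of a "2 * r"]])
   (use cell_ball(1)[OF ci] cell_ball(3)[OF ci, of "2 * r"] cell_ball(2)[OF ci] kop_outside[OF assms(3)] in "auto simp: cr cq_def")
qed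

lemma KT_zero: "ksupp (cq (c, a, r)) k ==> cell (c, a, r) ==> p \<notin> ci c ` cball a (2 * r) ==> KT (c, a, r) ka k f p = 0"
 using kop_outside[of "cball a (2 * r)" k "chart_map c p"] inv_chart[of c p] cell_ball(1)[of c a r]
 unfolding KT_def lift_def cq_def by (metis case_prod_conv fst_conv image_eqI)

lemma KT_le:
 assumes "cell i" "kern True k" "ksupp (cq i) k"
 obtains C where "C >= 0" "!!ka f. ka >= 0 ==> f \<in> SF ==> N 0 (KT i ka k f) <= C * theta ka * N 0 f"
proof -
 obtain c a r where cr: "i = (c, a, r)" by (cases i)
 note ci = assms(1)[unfolded cr]
 obtain C where C: "C >= 0" "!!ka F B x. ka >= 0 ==> csm F ==> (!!x. x \<in> cq i ==> \<bar>F x\<bar> <= B) ==> B >= 0 ==> \<bar>kop ka k F x\<bar> <= C * theta ka * B"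
  using kop_le[OF assms(2,3)] by metis
 show ?thesis
 proof (rule that[OF C(1)])
  fix ka :: real and f assume k: "ka >= 0" and f: "f \<in> SF"
  have "\<bar>cF i f x\<bar> <= N 0 f" if "x \<in> cq i" for x
  proof -
   have x: "x \<in> cball a (2 * r)" "norm (x - a) <= 4 * r" using that cell_ball(2)[OF ci] by (auto simp: cr cq_def dist_norm norm_minus_commute)
   hence "ci c x \<in> M" using cell_ball(1)[OF ci] cell_ball(3)[OF ci, of "2 * r"] cell_ball(2)[OF ci] by (intro chart_inv_M) auto
   thus ?thesis using N0_ge[OF f] by (simp add: cr cF_near[OF ci x(2)])
  qed
  from C(2)[OF k cF_csm[OF assms(1) f] this N_nonneg[OF f]]
  have "\<bar>kop ka k (cF i f) x\<bar> <= C * theta ka * N 0 f" for x .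
  thus "N 0 (KT i ka k f) <= C * theta ka * N 0 f"
   by (intro N0_le) (auto simp: KT_def lift_def intro: order_trans[OF abs_ge_zero])
 qed
qed

text \<open>Components of the field \<open>j\<close> in the chart of the cell \<open>i\<close>, made
  global so that they can enter \<open>kcomm\<close>.\<close>

definition cb :: "('a, 'n) disc => ('a, 'n) disc \<times> 'n => 'n => real ^ 'n => real" where
 "cb i j l x = (case i of (c, a, r) => cutoff a (4 * r) x * vcoef j c l x)"

lemma cb_csm: "cell i ==> j \<in> vfs ==> csm (cb i j l)"
proof -
 assume i: "cell i" and j: "j \<in> vfs"
 obtain c a r where cr: "i = (c, a, r)" by (cases i)
 note ci = i[unfolded cr]
 show ?thesis unfolding cr cb_def[abs_def] prod.case
  by (rule csm_cutoff_mult[OF open_im[OF cell_ball(1)[OF ci]] _ _ smooth_vcoef[OF j cell_ball(1)[OF ci]]])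
   (use cell_ball(2)[OF ci] cell_ball(3)[OF ci] in auto)
qed

text \<open>Reduces a field acting on an operator to a Euclidean computation on the support of the
  kernel. Since functions are total, points outside \<open>M\<close> are included; both sides have
  the default value 0 there.\<close>

lemma vf_KT_eq:
 assumes i: "cell i" and k: "kern True k" "ksupp (cq i) k" and f: "f \<in> SF" and ka: "ka >= 0" and j: "j \<in> vfs"
  and h: "!!x. x \<in> cq i ==> (SU l. cb i j l x * dx l (kop ka k (cF i f)) x) = h x"
  and h0: "!!x. x \<notin> cq i ==> h x = 0"
 shows "vf j (KT i ka k f) p = lift (fst i) h p"
proof -
 obtain c a r where cr: "i = (c, a, r)" by (cases i)
 note ci = i[unfolded cr]
 note c = cell_ball(1)[OF ci] and r = cell_ball(2)[OF ci]
 have K: "cball a (2 * r) \<subseteq> im c" using cell_ball(3)[OF ci, of "2 * r"] r by simp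
 consider "p \<in> ci c ` cball a (2 * r)" | "p \<notin> ci c ` cball a (2 * r)" by blast
 thus ?thesis
 proof cases
  case 1
  then obtain x where x: "x \<in> cball a (2 * r)" "p = ci c x" by blast
  hence xi: "x \<in> im c" and n: "norm (x - a) <= 4 * r" using K r by (auto simp: dist_norm norm_minus_commute)
  have "vf j (KT i ka k f) p = (SU l. vcoef j c l x * dx l (%x. KT i ka k f (ci c x)) x)"
   unfolding x(2) by (rule vf_chart[OF j c KT_SF[OF i k f ka] xi])
  moreover have "dd v (%x. KT i ka k f (ci c x)) x = dd v (kop ka k (cF i f)) x" for v
   by (rule dd_cong_open[OF open_im[OF c] xi]) (simp add: KT_def cr)
  ultimately show ?thesis using h[of x] x xi n r by (simp add: cr cq_def cb_def cutoff_eq_1)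
 next
  case 2
  have "lift (fst i) h p = 0"
   using 2 inv_chart[OF c, of p] h0[of "chart_map c p"] unfolding lift_def cr cq_def by (metis case_prod_conv fst_conv image_eqI)
  moreover have "vf j (KT i ka k f) p = 0"
  proof (cases "p \<in> M")
   case True
   have "vf j (KT i ka k f) p = vf j (%_. 0) p" by (rule vf_local[OF j, of "M - ci c ` cball a (2 * r)"])
     (use closedin_inv_image[OF c compact_cball K] 2 True KT_zero[OF k(2)[unfolded cr] ci] in "auto simp: closedin_def cr")
   thus ?thesis using vf_cmult[OF j SF_const SF_const, of 0 0 p] by simp
  next
   case False
   obtain c a r l where "j = ((c, a, r), l)" by (metis prod.collapse)
   thus ?thesis using False dom_sub[OF vfs_c[of c a r l]] j by (auto simp: vf_lift lift_def)
  qed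
  ultimately show ?thesis by simp
 qed
qed

text \<open>On the support of the kernel all cutoffs equal 1, so the Euclidean commutator formula
  carries over unchanged.\<close>

lemma KT_vf:
 assumes i: "cell i" and k: "kern True k" "ksupp (cq i) k" and f: "f \<in> SF" and ka: "ka >= 0" and j: "j \<in> vfs"
 shows "vf j (KT i ka k f) p = KT i ka k (vf j f) p + KT i ka (kcomm (cb i j) k) f p"
proof -
 obtain c a r where cr: "i = (c, a, r)" by (cases i)
 note ci = i[unfolded cr]
 note c = cell_ball(1)[OF ci] and r = cell_ball(2)[OF ci]
 have K: "cball a (2 * r) \<subseteq> im c" using cell_ball(3)[OF ci, of "2 * r"] r by simp
 have cl: "closed (cq i)" by (simp add: cr cq_def)
 have e: "(SU l. cb i j l x * dx l (cF i f) x) = cF i (vf j f) x" if "x \<in> cq i" for x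
 proof -
  have x: "x \<in> ball a (4 * r)" "x \<in> im c" "norm (x - a) <= 4 * r" using that K r by (auto simp: cr cq_def dist_norm norm_minus_commute)
  have "dd v (cF i f) x = dd v (%x. f (ci c x)) x" for v
   by (rule dd_cong_open[OF open_ball x(1)]) (simp add: cr cF_near[OF ci] dist_norm norm_minus_commute)
  thus ?thesis using vf_chart[OF j c f x(2)] cutoff_eq_1[of "4 * r" x a] x r by (simp add: cr cF_def cb_def)
 qed
 have "vf j (KT i ka k f) p = lift (fst i) (%x. kop ka k (cF i (vf j f)) x + kop ka (kcomm (cb i j) k) (cF i f) x) p"
 proof (rule vf_KT_eq[OF assms])
  show "(SU l. cb i j l x * dx l (kop ka k (cF i f)) x) = kop ka k (cF i (vf j f)) x + kop ka (kcomm (cb i j) k) (cF i f) x" for x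
   unfolding kop_commutator[OF cb_csm[OF i j] k(1) cF_csm[OF i f] ka] using kop_eq_on[OF k(2) e] by simp
  show "kop ka k (cF i (vf j f)) x + kop ka (kcomm (cb i j) k) (cF i f) x = 0" if "x \<notin> cq i" for x
   using kop_outside[OF k(2) that] kop_outside[OF ksupp_kcomm[OF cl k(2)] that] by simp
 qed
 thus ?thesis by (simp add: KT_def lift_def)
qed

lemma theta_nonneg: "0 <= theta ka" unfolding theta_def by (rule Bochner_Integration.integral_nonneg) simp

text \<open>The leading constant of an operator in every norm is its \<open>C\<^sup>0\<close> bound, because commutators
 with the vector fields are operators of the same kind.\<close>

lemma KT_leading:
 assumes i: "cell i" and ka: "ka >= 0"
 shows "kern True k ==> ksupp (cq i) k ==> (!!f. f \<in> SF ==> N 0 (KT i ka k f) <= q * N 0 f) ==>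
  EX D>=0. ALL f:SF. N m (KT i ka k f) <= q * N m f + D * (case m of 0 => 0 | Suc l => N l f)"
proof (induction m arbitrary: k q)
 case 0
 thus ?case by (intro exI[of _ 0]) simp
next
 case (Suc m)
 let ?Z = "%f. case m of 0 => 0 | Suc l => N l f"
 have Z: "?Z f <= N m f" if "f \<in> SF" for f using that N_mono N_nonneg by (cases m) auto
 have Zv: "?Z (vf j f) <= N m f" if "f \<in> SF" "j \<in> vfs" for f j using that N_vf N_nonneg by (cases m) auto
 have cl: "closed (cq i)" by (cases i) (simp add: cq_def)
 obtain E where E: "E >= 0" "!!f. f \<in> SF ==> N m (KT i ka k f) <= q * N m f + E * ?Z f" using Suc.IH[OF Suc.prems] by blast
 have kc: "kern True (kcomm (cb i j) k)" "ksupp (cq i) (kcomm (cb i j) k)" if "j \<in> vfs" for j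
  by (rule kern_kcomm[OF cb_csm[OF i that] Suc.prems(1)], rule ksupp_kcomm[OF cl Suc.prems(2)])
 have "EX C>=0. ALL f:SF. N m (KT i ka (kcomm (cb i j) k) f) <= C * N m f" if j: "j \<in> vfs" for j
 proof -
  obtain C where C: "C >= 0" "!!ka f. ka >= 0 ==> f \<in> SF ==> N 0 (KT i ka (kcomm (cb i j) k) f) <= C * theta ka * N 0 f"
   using KT_le[OF i kc[OF j]] by metis
  obtain D where D: "D >= 0" "!!f. f \<in> SF ==> N m (KT i ka (kcomm (cb i j) k) f) <= C * theta ka * N m f + D * ?Z f"
   using Suc.IH[OF kc[OF j] C(2)[OF ka]] by blast
  have "N m (KT i ka (kcomm (cb i j) k) f) <= (C * theta ka + D) * N m f" if "f \<in> SF" for f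
   using D(2)[OF that] mult_left_mono[OF Z[OF that] D(1)] by (simp add: distrib_right)
  thus ?thesis using C(1) D(1) theta_nonneg by (intro exI[of _ "C * theta ka + D"]) auto
 qed
 then obtain D where D: "!!j. j \<in> vfs ==> D j >= 0"
  "!!j f. j \<in> vfs ==> f \<in> SF ==> N m (KT i ka (kcomm (cb i j) k) f) <= D j * N m f" by metis
 have "N (Suc m) (KT i ka k f) <= q * N (Suc m) f + (E + (SUM j:vfs. E + D j)) * N m f" if f: "f \<in> SF" for f
 proof -
  have "N m (vf j (KT i ka k f)) <= q * N m (vf j f) + (E + D j) * N m f" if j: "j \<in> vfs" for j
  proof -
   have "N m (vf j (KT i ka k f)) = N m (%p. KT i ka k (vf j f) p + KT i ka (kcomm (cb i j) k) f p)"
    by (rule N_cong) (rule KT_vf[OF i Suc.prems(1,2) f ka j])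
   also have "... <= N m (KT i ka k (vf j f)) + N m (KT i ka (kcomm (cb i j) k) f)"
    by (intro N_add KT_SF i Suc.prems(1,2) ka vf_SF kc j f)
   finally show ?thesis using E(2)[OF vf_SF[OF j f]] D(2)[OF j f] mult_left_mono[OF Zv[OF f j] E(1)] by (simp add: distrib_right)
  qed
  hence "(SUM j:vfs. N m (vf j (KT i ka k f))) <= (SUM j:vfs. q * N m (vf j f) + (E + D j) * N m f)" by (rule sum_mono)
  thus ?thesis using E(2)[OF f] mult_left_mono[OF Z[OF f] E(1)]
   by (simp add: N_Suc sum.distrib sum_distrib_left[symmetric] sum_distrib_right[symmetric] algebra_simps)
 qed
 moreover have "E + (SUM j:vfs. E + D j) >= 0" using E(1) D(1) by (simp add: sum_nonneg)
 ultimately show ?case by auto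
qed

lemma KT_bound:
 assumes i: "cell i" and k: "kern True k" "ksupp (cq i) k" and ka: "ka >= 0"
 shows "EX C>=0. ALL f:SF. N m (KT i ka k f) <= C * N m f"
proof -
 obtain C where C: "C >= 0" "!!ka f. ka >= 0 ==> f \<in> SF ==> N 0 (KT i ka k f) <= C * theta ka * N 0 f"
  using KT_le[OF i k] by metis
 obtain D where D: "D >= 0" "!!f. f \<in> SF ==> N m (KT i ka k f) <= C * theta ka * N m f + D * (case m of 0 => 0 | Suc l => N l f)"
  using KT_leading[OF i ka k C(2)[OF ka]] by blast
 have "(case m of 0 => 0 | Suc l => N l f) <= N m f" if "f \<in> SF" for f using that N_mono N_nonneg by (cases m) auto
 hence "N m (KT i ka k f) <= (C * theta ka + D) * N m f" if "f \<in> SF" for f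
  using D(2)[OF that] mult_left_mono[OF _ D(1)] that by (fastforce simp: distrib_right)
 thus ?thesis using C(1) D(1) theta_nonneg by (intro exI[of _ "C * theta ka + D"]) auto
qed

end

section \<open>The parametrix on the manifold\<close>

context mfd
begin

text \<open>The factor s pays for one derivative: a derivative falling on the argument is integrated
  by parts against s. A field applied to the output is thus an operator with kernel
  \<open>k''\<close> that leaves the argument undifferentiated.\<close>

lemma KT_gain:
 assumes i: "cell i" and e: "kern True e" "ksupp (cq i) e" and ka: "ka >= 0"
 shows "EX C>=0. ALL f:SF. N (Suc m) (KT i ka (%s z. s * e s z) f) <= C * N m f"
proof -
 have cl: "closed (cq i)" by (cases i) (simp add: cq_def)
 have k: "kern True (%s z. s * e s z)" "ksupp (cq i) (%s z. s * e s z)"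
  using kern_mult[OF kern_scale e(1)] ksupp_mult1[OF e(2)] by auto
 define d where "d l s z = dd (axis l 1, 0) (%z. s * e s z) z + (-1) * dd (0, axis l 1) (e s) z" for l :: 'n and s z
 have d: "kern True (d l)" "ksupp (cq i) (d l)" for l unfolding d_def[abs_def]
  by (intro kern_add kern_cmult kern_dd k(1) e(1), rule ksupp_add[OF ksupp_dd[OF cl k(2)] ksupp_mult1[OF ksupp_dd[OF cl e(2)]]])
 define k'' where "k'' j s z = (SU l. cb i j l (fst z) * d l s z)" for j s z
 have k'': "kern True (k'' j)" "ksupp (cq i) (k'' j)" if "j \<in> vfs" for j
  unfolding k''_def[abs_def] by (auto intro!: kern_sum kern_mult kern_fst cb_csm i that d ksupp_sum ksupp_mult1)
 have eq: "vf j (KT i ka (%s z. s * e s z) f) p = KT i ka (k'' j) f p" if j: "j \<in> vfs" and f: "f \<in> SF" for j f p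
  unfolding KT_def[of _ _ "k'' j"]
 proof (rule vf_KT_eq[OF i k f ka j])
  note F = cF_csm[OF i f]
  have "dx l (kop ka (%s z. s * e s z) (cF i f)) x = kop ka (d l) (cF i f) x" for l x
  proof -
   have "kop ka (d l) (cF i f) x = kop ka (%s. dd (axis l 1, 0) (%z. s * e s z)) (cF i f) x + kop ka (%s z. (-1) * dd (0, axis l 1) (e s) z) (cF i f) x"
    unfolding d_def[abs_def] by (rule kop_add[OF kern_dd[OF k(1)] kern_cmult[OF kern_dd[OF e(1)]] F ka])
   thus ?thesis unfolding dd_kop[OF k(1) F ka] kop_ibp[OF e(1) F ka] kop_cmult by simp
  qed
  hence "(SU l. cb i j l x * dx l (kop ka (%s z. s * e s z) (cF i f)) x) = (SU l. kop ka (%s z. cb i j l x * d l s z) (cF i f) x)" for x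
   by (simp add: kop_cmult)
  also have "... x = (SU l. kop ka (%s z. cb i j l (fst z) * d l s z) (cF i f) x)" for x by (intro sum.cong refl kop_cong) simp
  also have "... x = kop ka (k'' j) (cF i f) x" for x unfolding k''_def[abs_def]
   by (rule kop_sum[symmetric]) (auto intro!: kern_mult kern_fst cb_csm i j d F ka)
  finally show "(SU l. cb i j l x * dx l (kop ka (%s z. s * e s z) (cF i f)) x) = kop ka (k'' j) (cF i f) x" for x .
  show "kop ka (k'' j) (cF i f) x = 0" if "x \<notin> cq i" for x by (rule kop_outside[OF k''(2)[OF j] that])
 qed
 obtain C where C: "C >= 0" "!!f. f \<in> SF ==> N m (KT i ka (%s z. s * e s z) f) <= C * N m f"
  using KT_bound[OF i k ka] by blast
 have "EX C>=0. ALL f:SF. N m (KT i ka (k'' j) f) <= C * N m f" if "j \<in> vfs" for j by (rule KT_bound[OF i k''[OF that] ka])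
 then obtain D where D: "!!j. j \<in> vfs ==> D j >= 0"
  "!!j f. j \<in> vfs ==> f \<in> SF ==> N m (KT i ka (k'' j) f) <= D j * N m f" by metis
 have "N (Suc m) (KT i ka (%s z. s * e s z) f) <= (C + (SUM j:vfs. D j)) * N m f" if f: "f \<in> SF" for f
 proof -
  have "N m (vf j (KT i ka (%s z. s * e s z) f)) <= D j * N m f" if j: "j \<in> vfs" for j
   using N_cong[of "vf j (KT i ka (%s z. s * e s z) f)" "KT i ka (k'' j) f"] eq[OF j f] D(2)[OF j f] by simp
  hence "(SUM j:vfs. N m (vf j (KT i ka (%s z. s * e s z) f))) <= (SUM j:vfs. D j * N m f)" by (rule sum_mono)
  thus ?thesis using C(2)[OF f] by (simp add: N_Suc distrib_right sum_distrib_right)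
 qed
 moreover have "C + (SUM j:vfs. D j) >= 0" using C(1) D(1) by (simp add: sum_nonneg)
 ultimately show ?thesis by blast
qed

text \<open>Multiplying the argument by a fixed function is absorbed into the kernel, so correcting
  the parametrix by a factor does not leave the class.\<close>

lemma KT_mult:
 assumes i: "cell i" and "ksupp (cq i) k"
 shows "KT i ka k (%p. w p * f p) = KT i ka (%s z. k s z * shf (cF i w) s z) f"
proof -
 obtain c a r where cr: "i = (c, a, r)" by (cases i)
 note ci = i[unfolded cr]
 have "k s (x, y) * cF i (%p. w p * f p) (x + s *\<^sub>R y) = k s (x, y) * shf (cF i w) s (x, y) * cF i f (x + s *\<^sub>R y)" if "s \<in> {0<..1}" for s x y
 proof (cases "x + s *\<^sub>R y \<in> cq i")
  case True
  hence "norm (x + s *\<^sub>R y - a) <= 4 * r" using cell_ball(2)[OF ci] by (auto simp: cr cq_def dist_norm norm_minus_commute)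
  thus ?thesis by (simp add: shf_def cr cF_near[OF ci])
 next
  case False
  thus ?thesis using ksuppD[OF assms(2) that] by simp
 qed
 hence "kop ka k (cF i (%p. w p * f p)) = kop ka (%s z. k s z * shf (cF i w) s z) (cF i f)" by (intro ext kop_cong)
 thus ?thesis by (simp add: KT_def)
qed

end

lemma dd_vanish_fst:
 fixes h :: "(real ^ 'n::finite) \<times> (real ^ 'n) => real"
 assumes "closed Q" "!!x y. x \<notin> Q ==> h (x, y) = 0" "x \<notin> Q"
 shows "dd v h (x, y) = 0"
proof -
 have "dd v h (x, y) = dd v (%_. 0) (x, y)"
  by (rule dd_cong_open[of "(- Q) \<times> UNIV"]) (use assms in "auto intro: open_Times")
 thus ?thesis by simp
qed

context rmfd
begin

section \<open>Locality and linearity of the Laplacian; local and global parametrices\<close>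

lemma lap_cong:
 assumes "c \<in> A" "open T" "T \<subseteq> im c" "x \<in> T" "!!y. y \<in> T ==> v (ci c y) = w (ci c y)"
 shows "lap c v x = lap c w x"
proof -
 have "pd c j v y = pd c j w y" if "y \<in> T" for j y unfolding pd_def by (rule dd_cong_open[OF assms(2) that assms(5)])
 hence "dx i (%y. vd c y * (SU j. Am c y $ i $ j * pd c j v y)) x = dx i (%y. vd c y * (SU j. Am c y $ i $ j * pd c j w y)) x" for i
  by (intro dd_cong_open[OF assms(2,4)]) simp
 thus ?thesis by (simp add: lap_def)
qed

lemma lapM_cong:
 assumes "openin X W" "p \<in> W" "!!q. q \<in> W ==> v q = w q"
 shows "lapM v p = lapM w p"
proof -
 have "p \<in> M" using assms openin_subset by blast
 hence c: "chart_at A p \<in> A" "p \<in> chart_dom (chart_at A p)" using chart_at by auto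
 show ?thesis unfolding lapM_def by (rule lap_cong[OF c(1) open_vimage_inv[OF c(1) assms(1)]]) (use c assms in auto)
qed

lemma lapM_lin:
 assumes f: "f \<in> SF" and h: "h \<in> SF" and p: "p \<in> M"
 shows "lapM (%p. al * f p + \<beta> * h p) p = al * lapM f p + \<beta> * lapM h p"
proof -
 define c where "c = chart_at A p"
 define x where "x = chart_map c p"
 have c: "c \<in> A" and x: "x \<in> im c" using chart_at[OF p] by (auto simp: c_def x_def)
 let ?F = "%v i y. vd c y * (SU j. Am c y $ i $ j * pd c j v y)"
 have pl: "pd c j (%p. al * f p + \<beta> * h p) y = al * pd c j f y + \<beta> * pd c j h y" if "y \<in> im c" for j y
  unfolding pd_def using SF_diff[OF f c that] SF_diff[OF h c that] by (simp add: dd_add dd_cmult)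
 have "dx i (?F (%p. al * f p + \<beta> * h p) i) x = dx i (%y. al * ?F f i y + \<beta> * ?F h i y) x" for i
  by (rule dd_cong_open[OF open_im[OF c] x]) (simp add: pl distrib_left sum.distrib sum_distrib_left mult_ac)
 also have "... i = al * dx i (?F f i) x + \<beta> * dx i (?F h i) x" for i
  using smooth_diff[OF smooth_flux[OF c f] x, of i] smooth_diff[OF smooth_flux[OF c h] x, of i] by (simp add: dd_add dd_cmult)
 finally have "lap c (%p. al * f p + \<beta> * h p) x = al * lap c f x + \<beta> * lap c h x"
  by (simp add: lap_def distrib_left sum.distrib sum_distrib_left mult_ac)
 thus ?thesis by (simp add: lapM_def c_def x_def)
qed

lemma lapM_add: "f \<in> SF ==> h \<in> SF ==> p \<in> M ==> lapM (%p. f p + h p) p = lapM f p + lapM h p"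
 using lapM_lin[of f h p 1 1] by simp

lemma lapM_diff: "f \<in> SF ==> h \<in> SF ==> p \<in> M ==> lapM (%p. f p - h p) p = lapM f p - lapM h p"
 using lapM_lin[of f h p 1 "-1"] by simp

lemma lapM_const: "p \<in> M ==> lapM (%p. k) p = 0"
proof -
 assume p: "p \<in> M"
 have "lap c (%p. k) x = 0" for c x by (simp add: lap_def pd_def)
 thus ?thesis by (simp add: lapM_def)
qed

lemma lapM_sum: "finite I ==> (!!i. i \<in> I ==> f i \<in> SF) ==> p \<in> M ==> lapM (%p. SUM i:I. f i p) p = (SUM i:I. lapM (f i) p)"
proof (induction I rule: finite_induct)
 case empty
 thus ?case by (simp add: lapM_const)
next
 case (insert i I)
 thus ?case using lapM_add[of "f i" "%p. SUM i:I. f i p"] SF_sum[of I f] by simp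
qed

text \<open>The local construction reproduces \<open>f\<close> only up to the factor \<nu>, the
  cutoff times the Gaussian mass. Its positivity on the core is what allows division after summation
  over the cells.\<close>

lemma cell_parametrix:
 assumes i: "cell i"
 shows "EX e rh \<nu>. kern True e & kern True rh & ksupp (cq i) e & ksupp (cq i) rh & \<nu> \<in> SF & (ALL p. \<nu> p >= 0) & (ALL p:core i. \<nu> p > 0) &
  (ALL ka>=0. ALL f:SF. ALL p:M. ka * KT i ka (%s z. s * e s z) f p - lapM (KT i ka (%s z. s * e s z) f) p = \<nu> p * f p + KT i ka rh f p)"
proof -
 obtain c a r where cr: "i = (c, a, r)" by (cases i)
 note ci = i[unfolded cr]
 note c = cell_ball(1)[OF ci] and r = cell_ball(2)[OF ci]
 have K: "cball a (2 * r) \<subseteq> im c" using cell_ball(3)[OF ci, of "2 * r"] r by simp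
 interpret gc: gauss_cell a r "im c" "%i j x. Gm c x $ i $ j" "%i j x. Am c x $ i $ j" by (rule gauss_cell[OF ci])
 let ?\<psi> = "cutoff a r"
 define b where "b j x = gc.\<xi> x * Bm c j x" for j x
 have b: "csm (b j)" for j unfolding b_def[abs_def] by (rule gc.xi_csm[OF smooth_Bm[OF c]])
 have \<psi>: "csm ?\<psi>" by (rule csm_cutoff[OF r])
 \<comment> \<open>One factor s is split off, in the form used by \<open>KT_gain\<close>. The cutoff
   at the target point x + s y confines that point to the cell as well and amounts to applying the
   Euclidean parametrix to \<open>F\<close>, the cutoff times \<open>f\<close>.\<close>
 define e where "e s z = 2 * (1 - s) * gc.hk z * shf ?\<psi> s z" for s z
 define rh where "rh s z = rker gc.At b gc.hk s z * shf ?\<psi> s z" for s z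
 define \<nu> where "\<nu> = lift c (%x. ?\<psi> x * gc.Nk x)"
 have q: "cq i = cball a (2 * r)" by (simp add: cr cq_def)
 have hk0: "gc.hk (x, y) = 0" if "x \<notin> cball a (2 * r)" for x y
  using gc.chi_supp[of x] that by (auto simp: gc.hk_def dist_norm norm_minus_commute)
 have dh0: "dd v gc.hk (x, y) = 0" if "x \<notin> cball a (2 * r)" for x y v
  by (rule dd_vanish_fst[OF closed_cball[of a "2 * r"] _ that]) (rule hk0)
 have ddh0: "dd w (dd v gc.hk) (x, y) = 0" if "x \<notin> cball a (2 * r)" for x y v w
  by (rule dd_vanish_fst[OF closed_cball[of a "2 * r"] _ that]) (rule dh0)
 have shf0: "shf ?\<psi> s (x, y) = 0" if "x + s *\<^sub>R y \<notin> cball a (2 * r)" for s x y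
  using cutoff_supp[OF r that] by (simp add: shf_def)
 have "kern True (%s z. 2 * (1 - s) * gc.hk z)" by (intro kern_mult kern_diff kern_const kern_scale gc.kern_hk)
 hence ke: "kern True e" unfolding e_def[abs_def] by (rule kern_mult_shf[OF _ \<psi>])
 have kr: "kern True rh" unfolding rh_def[abs_def] by (rule kern_mult_shf[OF kern_rker[OF gc.kern_hk gc.csm_At b] \<psi>])
 have se: "ksupp (cq i) e" unfolding ksupp_def q e_def using hk0 shf0 by fastforce
 have "rker gc.At b gc.hk s (x, y) = 0" if "x \<notin> cball a (2 * r)" for s x y using that by (simp add: rker_def hk0 dh0 ddh0)
 hence sr: "ksupp (cq i) rh" unfolding ksupp_def q rh_def using shf0 by fastforce
 have \<nu>: "\<nu> \<in> SF" unfolding \<nu>_def by (rule lift_SF[OF c _ compact_cball K])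
   (use cutoff_supp[OF r, of _ a] in "auto intro!: smooth_on_mult smooth_on_cutoff open_im c smooth_on_subset[OF gc.smooth_Nk]")
 have "\<nu> p > 0" if pc: "p \<in> core i" for p
 proof -
  obtain x where x: "x \<in> ball a r" "p = ci c x" using pc by (auto simp: cr core_def)
  hence "x \<in> im c" "norm (x - a) <= r" using K r by (auto simp: subset_iff dist_norm norm_minus_commute)
  thus ?thesis using x gc.Nk_pos[of x] cutoff_eq_1[OF r, of x a] by (simp add: \<nu>_def)
 qed
 moreover have "\<nu> p >= 0" for p by (simp add: \<nu>_def lift_def cutoff_bounds gc.Nk_nonneg)
 moreover have "ka * KT i ka (%s z. s * e s z) f p - lapM (KT i ka (%s z. s * e s z) f) p = \<nu> p * f p + KT i ka rh f p"
  if ka: "ka >= 0" and f: "f \<in> SF" and p: "p \<in> M" for ka f p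
 proof -
  have k: "kern True (%s z. s * e s z)" "ksupp (cq i) (%s z. s * e s z)"
   using kern_mult[OF kern_scale ke] ksupp_mult1[OF se] by auto
  let ?T = "KT i ka (%s z. s * e s z) f"
  have T: "?T \<in> SF" by (rule KT_SF[OF i k f ka])
  consider "p \<in> ci c ` cball a (2 * r)" | "p \<notin> ci c ` cball a (2 * r)" by blast
  thus ?thesis
  proof cases
   case 1
   then obtain x where x: "x \<in> cball a (2 * r)" "p = ci c x" by blast
   hence xi: "x \<in> im c" and n: "norm (x - a) <= 4 * r" using K r by (auto simp: dist_norm norm_minus_commute)
   define F where "F x = ?\<psi> x * cF i f x" for x
   have F: "csm F" unfolding F_def[abs_def] by (rule csm_mult[OF csm_smooth[OF \<psi>] cF_csm[OF i f]])
   define u where "u = kop ka (%s z. 2 * s * (1 - s) * gc.hk z) F"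
   have Tu: "?T (ci c y) = u y" if "y \<in> im c" for y
    using that unfolding KT_def u_def by (simp add: cr) (rule kop_cong, simp add: e_def F_def shf_def cr)
   have dT: "dd v (%x. ?T (ci c x)) y = dd v u y" if "y \<in> im c" for v y by (rule dd_cong_open[OF open_im[OF c] that Tu])
   have ddT: "dd w (dd v (%x. ?T (ci c x))) x = dd w (dd v u) x" for v w by (rule dd_cong_open[OF open_im[OF c] xi dT])
   have L: "lapM ?T p = (SU i. SU j. gc.At i j x * dx i (dx j u) x) + (SU j. b j x * dx j u x)"
    unfolding x(2) lapM_chart[OF c xi T] lap_nondiv[OF c xi T] ddT pd_def dT[OF xi]
    by (simp add: gc.Gt_eq(2)[OF n] b_def gc.xi_1[OF n])
   have Pm: "ka * u x - (SU i. SU j. gc.At i j x * dx i (dx j u) x) - (SU i. b i x * dx i u x)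
     = F x * gc.Nk x + kop ka (rker gc.At b gc.hk) F x"
    unfolding u_def gc.Nk_def by (rule parametrix[OF gc.kern_hk F ka]) (rule gc.heat_hk)
   have Kp: "kop ka (rker gc.At b gc.hk) F x = KT i ka rh f p"
    using xi unfolding KT_def x(2) by (simp add: cr) (rule kop_cong, simp add: rh_def F_def shf_def cr)
   have Tp: "?T p = u x" using Tu[OF xi] by (simp add: x(2))
   have Fp: "F x = ?\<psi> x * f p" by (simp add: F_def cr cF_near[OF ci n] x(2))
   have np: "\<nu> p = ?\<psi> x * gc.Nk x" using xi by (simp add: \<nu>_def x(2))
   show ?thesis unfolding Tp L diff_diff_eq[symmetric] Pm unfolding Fp Kp np by (simp only: mult_ac)
  next
   case 2
   have "lapM ?T p = lapM (%_. 0) p" by (rule lapM_cong[of "M - ci c ` cball a (2 * r)"])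
     (use closedin_inv_image[OF c compact_cball K] 2 p KT_zero[OF k(2)[unfolded cr] ci] in "auto simp: closedin_def cr")
   moreover have "\<nu> p = 0"
   proof (cases "p \<in> chart_dom c")
    case True
    hence "chart_map c p \<notin> cball a (2 * r)" using 2 inv_chart[OF c True] by (metis image_eqI)
    from cutoff_supp[OF r this] show ?thesis by (simp add: \<nu>_def lift_def)
   qed (simp add: \<nu>_def lift_def)
   ultimately show ?thesis
    using lapM_const[OF p] KT_zero[OF k(2)[unfolded cr] ci 2] KT_zero[OF sr[unfolded cr] ci 2] by (simp add: cr)
  qed
 qed
 ultimately show ?thesis using ke kr se sr \<nu> by blast
qed

text \<open>Because the cores cover, the factors \<nu> sum to a positive function. Its inverse
  \<open>w\<close> is multiplied into the argument and then absorbed into the kernels.\<close>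

lemma parametrix_M:
 "EX e rh. (ALL i:cells. kern True (e i) & kern True (rh i) & ksupp (cq i) (e i) & ksupp (cq i) (rh i)) &
  (ALL ka>=0. ALL f:SF. ALL p:M. ka * (SUM i:cells. KT i ka (%s z. s * e i s z) f p) - lapM (%p. SUM i:cells. KT i ka (%s z. s * e i s z) f p) p
    = f p + (SUM i:cells. KT i ka (rh i) f p))"
proof -
 define P where "P i e rh \<nu> \<longleftrightarrow> kern True e & kern True rh & ksupp (cq i) e & ksupp (cq i) rh & \<nu> \<in> SF & (ALL p. \<nu> p >= 0) & (ALL p:core i. \<nu> p > 0) &
  (ALL ka>=0. ALL f:SF. ALL p:M. ka * KT i ka (%s z. s * e s z) f p - lapM (KT i ka (%s z. s * e s z) f) p = \<nu> p * f p + KT i ka rh f p)" for i e rh \<nu>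
 have "ALL i:cells. EX e rh \<nu>. P i e rh \<nu>" unfolding P_def using cell_parametrix[OF cells(2)] by blast
 then obtain e rh \<nu> where P: "!!i. i \<in> cells ==> P i (e i) (rh i) (\<nu> i)" by metis
 have k: "!!i. i \<in> cells ==> kern True (e i)" "!!i. i \<in> cells ==> kern True (rh i)"
  and s: "!!i. i \<in> cells ==> ksupp (cq i) (e i)" "!!i. i \<in> cells ==> ksupp (cq i) (rh i)"
  and \<nu>: "!!i. i \<in> cells ==> \<nu> i \<in> SF" "!!i p. i \<in> cells ==> \<nu> i p >= 0" "!!i p. i \<in> cells ==> p \<in> core i ==> \<nu> i p > 0"
  and eq: "!!i ka f p. i \<in> cells ==> ka >= 0 ==> f \<in> SF ==> p \<in> M ==>
    ka * KT i ka (%s z. s * e i s z) f p - lapM (KT i ka (%s z. s * e i s z) f) p = \<nu> i p * f p + KT i ka (rh i) f p"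
  using P unfolding P_def by blast+
 have pos: "(SUM i:cells. \<nu> i p) > 0" if "p \<in> M" for p
 proof -
  obtain i where i: "i \<in> cells" "p \<in> core i" using cells(3) \<open>p \<in> M\<close> by blast
  have "\<nu> i p <= (SUM i:cells. \<nu> i p)" by (rule member_le_sum) (use i cells(1) \<nu> in auto)
  thus ?thesis using \<nu>(3)[OF i] by simp
 qed
 define w where "w p = inverse (SUM i:cells. \<nu> i p)" for p
 have w: "w \<in> SF" unfolding w_def[abs_def] by (intro SF_inverse SF_sum \<nu>(1), assumption) (use pos in fastforce)
 define e' where "e' i s z = e i s z * shf (cF i w) s z" for i s z
 define rh' where "rh' i s z = rh i s z * shf (cF i w) s z" for i s z
 have "ka * (SUM i:cells. KT i ka (%s z. s * e' i s z) f p) - lapM (%p. SUM i:cells. KT i ka (%s z. s * e' i s z) f p) p = f p + (SUM i:cells. KT i ka (rh' i) f p)"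
  if ka: "ka >= 0" and f: "f \<in> SF" and p: "p \<in> M" for ka f p
 proof -
  let ?h = "%p. w p * f p"
  have h: "?h \<in> SF" by (rule SF_mult[OF w f])
  have k': "kern True (%s z. s * e i s z)" "ksupp (cq i) (%s z. s * e i s z)" if "i \<in> cells" for i
   using kern_mult[OF kern_scale k(1)[OF that]] ksupp_mult1[OF s(1)[OF that]] by auto
  have E: "KT i ka (%s z. s * e' i s z) f = KT i ka (%s z. s * e i s z) ?h" if "i \<in> cells" for i
   using KT_mult[OF cells(2)[OF that] k'(2)[OF that]] by (simp add: e'_def mult.assoc)
  have R: "KT i ka (rh' i) f = KT i ka (rh i) ?h" if "i \<in> cells" for i
   using KT_mult[OF cells(2)[OF that] s(2)[OF that]] by (simp add: rh'_def[abs_def])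
  have "ka * (SUM i:cells. KT i ka (%s z. s * e i s z) ?h p) - lapM (%p. SUM i:cells. KT i ka (%s z. s * e i s z) ?h p) p
    = (SUM i:cells. \<nu> i p * ?h p + KT i ka (rh i) ?h p)"
   using lapM_sum[OF cells(1) KT_SF[OF cells(2) k' h ka] p] eq[OF _ ka h p]
   by (simp add: sum_distrib_left sum_subtractf[symmetric])
  also have "... = (SUM i:cells. \<nu> i p) * w p * f p + (SUM i:cells. KT i ka (rh i) ?h p)"
   by (simp add: sum.distrib sum_distrib_right mult.assoc)
  finally show ?thesis using pos[OF p] by (simp add: E R w_def)
 qed
 moreover have "kern True (e' i)" "kern True (rh' i)" "ksupp (cq i) (e' i)" "ksupp (cq i) (rh' i)" if "i \<in> cells" for i
  unfolding e'_def[abs_def] rh'_def[abs_def] by (auto intro!: kern_mult_shf k s cF_csm cells(2) w ksupp_mult2 that)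
 ultimately show ?thesis by blast
qed

end

section \<open>Completeness and the resolvent of the Laplacian\<close>

lemma family_bound:
 assumes "!!i. i \<in> I ==> EX C>=(0::real). P i C"
 obtains C where "!!i. i \<in> I ==> C i >= 0" "!!i. i \<in> I ==> P i (C i)" using assms by metis

context mfd
begin

section \<open>Sequences that are Cauchy in every C^k norm\<close>

definition NC :: "(nat => 'a => real) => bool" where
 "NC f \<longleftrightarrow> (ALL n. f n \<in> SF) & (ALL m. ALL e>0. EX n0. ALL n>=n0. ALL k>=n0. dN m (f n) (f k) < e)"

definition nl :: "(nat => 'a => real) => 'a => real" where
 "nl f p = lim (%n. f n p)"

lemma NC_SF: "NC f ==> f n \<in> SF" by (simp add: NC_def)

lemma NC_vf:
 assumes f: "NC f" and j: "j \<in> vfs"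
 shows "NC (%n. vf j (f n))" unfolding NC_def
proof (intro conjI allI impI)
 show "vf j (f n) \<in> SF" for n by (rule vf_SF[OF j NC_SF[OF f]])
 fix m and e :: real assume "e > 0"
 then obtain n0 where n0: "!!n k. n >= n0 ==> k >= n0 ==> dN (Suc m) (f n) (f k) < e" using f unfolding NC_def by metis
 have "N m (%p. vf j (f n) p - vf j (f k) p) = N m (vf j (%p. f n p - f k p))" for n k
  by (rule N_cong) (simp add: vf_diff[OF j NC_SF[OF f] NC_SF[OF f]])
 also have "... n k <= dN (Suc m) (f n) (f k)" for n k by (intro N_vf SF_diff' NC_SF[OF f] j)
 finally show "EX n0. ALL n>=n0. ALL k>=n0. N m (%p. vf j (f n) p - vf j (f k) p) < e" using n0 le_less_trans by blast
qed

lemma NC_lim: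
 assumes f: "NC f" and p: "p \<in> M"
 shows "(%n. f n p) \<longlonglongrightarrow> nl f p"
proof -
 have "Cauchy (%n. f n p)"
 proof (rule CauchyI)
  fix e :: real assume "e > 0"
  then obtain n0 where "!!n k. n >= n0 ==> k >= n0 ==> dN 0 (f n) (f k) < e" using f unfolding NC_def by metis
  thus "EX n0. ALL n>=n0. ALL k>=n0. norm (f n p - f k p) < e"
   using N0_ge[OF SF_diff'[OF NC_SF[OF f] NC_SF[OF f]] p] by (metis le_less_trans real_norm_def)
 qed
 thus ?thesis unfolding nl_def using convergent_LIMSEQ_iff Cauchy_convergent by blast
qed

lemma NC_unif:
 assumes f: "NC f" and e: "e > 0"
 shows "EX n0. ALL n>=n0. ALL p:M. \<bar>f n p - nl f p\<bar> <= e"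
proof -
 obtain n0 where n0: "!!n k. n >= n0 ==> k >= n0 ==> dN 0 (f n) (f k) < e" using f e unfolding NC_def by metis
 have "\<bar>f n p - nl f p\<bar> <= e" if "n >= n0" "p \<in> M" for n p
 proof (rule Lim_bounded)
  show "(%k. \<bar>f n p - f k p\<bar>) \<longlonglongrightarrow> \<bar>f n p - nl f p\<bar>"
   by (intro tendsto_intros NC_lim[OF f that(2)])
  show "ALL k>=n0. \<bar>f n p - f k p\<bar> <= e"
   using n0[OF that(1)] N0_ge[OF SF_diff'[OF NC_SF[OF f] NC_SF[OF f]] that(2)] by (meson less_imp_le order_trans)
 qed
 thus ?thesis by blast
qed

text \<open>On the ball of radius 2 r the fields of the cell are exact partial derivatives, and they
  converge uniformly. The derivative of the limit is expressed by limits of sequences that are again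
  Cauchy in every norm, which is what an induction on the order needs.\<close>

lemma NC_deriv:
 assumes f: "NC f" and i: "(c, a, r) \<in> cells" and x: "x \<in> ball a (2 * r)"
 shows "((%x. nl f (ci c x)) has_derivative (%v. SU j. v $ j * nl (%n. vf ((c, a, r), j) (f n)) (ci c x))) (at x)"
proof -
 note ci = cells(2)[OF i]
 have j: "((c, a, r), j) \<in> vfs" for j using i by (simp add: vfs_def)
 have im: "ci c y \<in> M" "y \<in> im c" "y \<in> cball a (2 * r)" if "y \<in> ball a (2 * r)" for y
  using that cell_ball(3)[OF ci, of "2 * r"] cell_ball(1,2)[OF ci] by (auto intro!: chart_inv_M)
 let ?f = "%n x. f n (ci c x)"
 let ?f' = "%n x v. SU j. v $ j * vf ((c, a, r), j) (f n) (ci c x)"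
 let ?g' = "%x v. SU j. v $ j * nl (%n. vf ((c, a, r), j) (f n)) (ci c x)"
 have "EX g. ALL x:ball a (2 * r). (%n. ?f n x) \<longlonglongrightarrow> g x & (g has_derivative ?g' x) (at x within ball a (2 * r))"
 proof (rule has_derivative_sequence[where S = "ball a (2 * r)" and f = ?f and f' = ?f' and g' = ?g', OF convex_ball _ _ x NC_lim[OF f im(1)[OF x]]])
  fix n y assume y: "y \<in> ball a (2 * r)"
  have d: "?f n differentiable (at y)" by (rule SF_diff[OF NC_SF[OF f] cell_ball(1)[OF ci] im(2)[OF y]])
  have "dd v (?f n) y = ?f' n y v" for v unfolding dd_axis[OF d, of v] using vf_core[OF j NC_SF[OF f] im(3)[OF y]] by simp
  thus "(?f n has_derivative ?f' n y) (at y within ball a (2 * r))" using has_derivative_at_withinI[OF dd_works[OF d]] by simp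
 next
  fix e :: real assume "e > 0"
  hence e: "e / CARD('n) > 0" by simp
  have "EX n0. ALL n>=n0. ALL p:M. \<bar>vf ((c, a, r), j) (f n) p - nl (%n. vf ((c, a, r), j) (f n)) p\<bar> <= e / CARD('n)" for j
   by (rule NC_unif[OF NC_vf[OF f j] e])
  then obtain n0 where n0: "!!j n p. n >= n0 j ==> p \<in> M ==> \<bar>vf ((c, a, r), j) (f n) p - nl (%n. vf ((c, a, r), j) (f n)) p\<bar> <= e / CARD('n)"
   by metis
  have "norm (?f' n y h - ?g' y h) <= e * norm h" if n: "n >= Max (range n0)" and y: "y \<in> ball a (2 * r)" for n y h
  proof -
   have "\<bar>h $ j * vf ((c, a, r), j) (f n) (ci c y) - h $ j * nl (%n. vf ((c, a, r), j) (f n)) (ci c y)\<bar> <= norm h * (e / CARD('n))" for j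
   proof -
    have "n0 j <= n" using n Max_ge[of "range n0" "n0 j"] by simp
    from n0[OF this im(1)[OF y]] show ?thesis
     unfolding right_diff_distrib[symmetric] abs_mult by (intro mult_mono component_le_norm_cart) auto
   qed
   hence "norm (?f' n y h - ?g' y h) <= (SUM j:(UNIV :: 'n set). norm h * (e / CARD('n)))"
    unfolding sum_subtractf[symmetric] real_norm_def by (intro order_trans[OF sum_abs] sum_mono)
   thus ?thesis by (simp add: mult.commute)
  qed
  thus "\<forall>\<^sub>F n in sequentially. ALL y:ball a (2 * r). ALL h. norm (?f' n y h - ?g' y h) <= e * norm h"
   unfolding eventually_sequentially by blast
 qed
 then obtain g where g: "!!y. y \<in> ball a (2 * r) ==> (%n. ?f n y) \<longlonglongrightarrow> g y"
  "(g has_derivative ?g' x) (at x within ball a (2 * r))" using x by blast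
 have "g y = nl f (ci c y)" if "y \<in> ball a (2 * r)" for y
  by (rule LIMSEQ_unique[OF g(1)[OF that] NC_lim[OF f im(1)[OF that]]])
 thus ?thesis using has_derivative_transform[OF x _ g(2), of "%x. nl f (ci c x)"] at_within_open[OF x open_ball] by simp
qed

lemma NC_Ck: "NC f ==> (c, a, r) \<in> cells ==> Ck_on k (ball a (2 * r)) (%x. nl f (ci c x))"
proof (induction k arbitrary: f)
 case 0
 thus ?case using has_derivative_continuous[OF NC_deriv[OF 0]] by (auto intro!: continuous_at_imp_continuous_on)
next
 case (Suc k)
 have "Ck_on k (ball a (2 * r)) (%x. nl (%n. vf ((c, a, r), j) (f n)) (ci c x))" for j
  using Suc.prems by (intro Suc.IH NC_vf) (auto simp: vfs_def)
 thus ?case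
  by (intro Ck_on_SucI[OF open_ball NC_deriv[OF Suc.prems]] Ck_on_sum Ck_on_bounded_linear[OF bounded_linear_mult_right] open_ball)
qed

lemma nl_SF:
 assumes "NC f"
 shows "nl f \<in> SF"
proof (rule SF_local)
 fix p assume "p \<in> M"
 then obtain c a r where i: "(c, a, r) \<in> cells" "p \<in> core (c, a, r)" using cells(3) by auto
 note ci = cells(2)[OF i(1)]
 have b: "ball a (2 * r) \<subseteq> im c" using cell_ball(3)[OF ci, of "2 * r"] cell_ball(2)[OF ci] by auto
 obtain x where x: "x \<in> ball a r" "p = ci c x" using i(2) by (auto simp: core_def)
 have x2: "x \<in> ball a (2 * r)" using x(1) cell_ball(2)[OF ci] by simp
 show "EX c:A. EX S. open S & S \<subseteq> im c & p \<in> chart_dom c & chart_map c p \<in> S & smooth_on S (%x. nl f (ci c x))"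
  by (rule bexI[OF _ cell_ball(1)[OF ci]], rule exI[of _ "ball a (2 * r)"])
   (use b x2 NC_Ck[OF assms i(1)] in "auto simp: smooth_on_def x(2) subset_iff")
qed

lemma NC_vf_lim:
 assumes f: "NC f" and j: "j \<in> vfs" and p: "p \<in> M"
 shows "vf j (nl f) p = nl (%n. vf j (f n)) p"
proof -
 obtain c a r where i: "(c, a, r) \<in> cells" "p \<in> core (c, a, r)" using cells(3) p by auto
 note ci = cells(2)[OF i(1)]
 obtain x where x: "x \<in> ball a r" "p = ci c x" using i(2) by (auto simp: core_def)
 have x2: "x \<in> ball a (2 * r)" "x \<in> cball a (2 * r)" "x \<in> im c"
  using x(1) cell_ball(2)[OF ci] cell_ball(3)[OF ci, of "2 * r"] by auto
 have v: "((c, a, r), l) \<in> vfs" for l using i(1) by (simp add: vfs_def)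
 have "dx l (%x. nl f (ci c x)) x = nl (%n. vf ((c, a, r), l) (f n)) (ci c x)" for l
  unfolding dd_eqI[OF NC_deriv[OF f i(1) x2(1)]] by (simp add: axis_def if_distrib[of "%z. z * _"] cong: if_cong)
 hence "vf j (nl f) p = (SU l. vcoef j c l x * nl (%n. vf ((c, a, r), l) (f n)) (ci c x))"
  using vf_chart[OF j cell_ball(1)[OF ci] nl_SF[OF f] x2(3)] by (simp add: x(2))
 moreover have "vf j (f n) p = (SU l. vcoef j c l x * vf ((c, a, r), l) (f n) (ci c x))" for n
  using vf_chart[OF j cell_ball(1)[OF ci] NC_SF[OF f] x2(3)] vf_core[OF v NC_SF[OF f] x2(2)] by (simp add: x(2))
 moreover have "(%n. SU l. vcoef j c l x * vf ((c, a, r), l) (f n) (ci c x))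
   \<longlonglongrightarrow> (SU l. vcoef j c l x * nl (%n. vf ((c, a, r), l) (f n)) (ci c x))"
  using p by (intro tendsto_intros NC_lim NC_vf f v) (simp add: x(2))
 ultimately show ?thesis using LIMSEQ_unique[OF NC_lim[OF NC_vf[OF f j] p]] by simp
qed

lemma NC_conv: "NC f ==> (%n. dN m (f n) (nl f)) \<longlonglongrightarrow> 0"
proof (induction m arbitrary: f)
 case 0
 show ?case
 proof (rule LIMSEQ_I)
  fix e :: real assume e: "e > 0"
  then obtain n0 where n0: "!!n p. n >= n0 ==> p \<in> M ==> \<bar>f n p - nl f p\<bar> <= e / 2" using NC_unif[OF 0, of "e / 2"] by auto
  have "norm (dN 0 (f n) (nl f) - 0) < e" if "n >= n0" for n
   using N0_le[of "%p. f n p - nl f p" "e / 2"] n0[OF that] e N_nonneg[OF SF_diff'[OF NC_SF[OF 0] nl_SF[OF 0]], of 0 n] by simp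
  thus "EX n0. ALL n>=n0. norm (dN 0 (f n) (nl f) - 0) < e" by blast
 qed
next
 case (Suc m)
 have "N m (vf j (%p. f n p - nl f p)) = N m (%p. vf j (f n) p - nl (%n. vf j (f n)) p)" if "j \<in> vfs" for j n
  by (rule N_cong) (simp add: vf_diff[OF that NC_SF[OF Suc.prems] nl_SF[OF Suc.prems]] NC_vf_lim[OF Suc.prems that])
 moreover have "(%n. SUM j:vfs. N m (%p. vf j (f n) p - nl (%n. vf j (f n)) p)) \<longlonglongrightarrow> (SUM j:vfs. 0)"
  by (intro tendsto_sum Suc.IH NC_vf Suc.prems)
 ultimately show ?case using tendsto_add[OF Suc.IH[OF Suc.prems]] by (simp add: N_Suc)
qed

lemma NC_I:
 assumes f: "!!n. f n \<in> SF" and C: "!!m. EX C>=0. ALL n. dN m (f (Suc n)) (f n) <= C * (1 / 2) ^ n"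
 shows "NC f" unfolding NC_def
proof (intro conjI allI impI f)
 fix m and e :: real assume e: "e > 0"
 obtain C where C: "C >= 0" "!!n. dN m (f (Suc n)) (f n) <= C * (1 / 2) ^ n" using assms(2) by blast
 have d: "N m (%p. f (n + d) p - f n p) <= 2 * C * ((1 / 2) ^ n - (1 / 2) ^ (n + d))" for n d
 proof (induction d)
  case 0
  show ?case using N_cmult[OF SF_const[of 0], of m 0] by simp
 next
  case (Suc d)
  have "N m (%p. f (n + Suc d) p - f n p) <= N m (%p. f (Suc (n + d)) p - f (n + d) p) + N m (%p. f (n + d) p - f n p)"
   using N_add[OF SF_diff'[OF f f] SF_diff'[OF f f], of m "Suc (n + d)" "n + d" "n + d" n] by simp
  thus ?case using Suc C(2)[of "n + d"] by (simp add: algebra_simps)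
 qed
 have le: "dN m (f n) (f n0) <= 2 * C * (1 / 2) ^ n0" if "n >= n0" for n n0
 proof -
  have "2 * C * ((1 / 2) ^ n0 - (1 / 2) ^ n) <= 2 * C * (1 / 2) ^ n0" using C(1) by (intro mult_left_mono) auto
  thus ?thesis using d[of n0 "n - n0"] that by simp
 qed
 have "(%n. 2 * C * (1 / 2) ^ n) \<longlonglongrightarrow> 2 * C * 0" by (intro tendsto_intros LIMSEQ_realpow_zero) auto
 then obtain n0 where "\<bar>2 * C * (1 / 2) ^ n0\<bar> < e / 2" using e LIMSEQ_D[of _ 0 "e / 2"] by fastforce
 hence "dN m (f n) (f k) < e" if "n >= n0" "k >= n0" for n k
  using N_diff[OF SF_diff'[OF f f] SF_diff'[OF f f], of m n n0 k n0] le[OF that(1)] le[OF that(2)] by simp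
 thus "EX n0. ALL n>=n0. ALL k>=n0. dN m (f n) (f k) < e" by blast
qed

end

context rmfd
begin

text \<open>On the core of a cell the coordinate derivatives are fields of that cell, and the
  coefficients are bounded on a compact ball; finitely many cores suffice.\<close>

lemma lapM_le: "EX C>=0. ALL f:SF. ALL p:M. \<bar>lapM f p\<bar> <= C * N 2 f"
proof -
 have "EX C>=0. ALL f:SF. ALL p:core i. \<bar>lapM f p\<bar> <= C * N 2 f" if i: "i \<in> cells" for i
 proof -
  obtain c a r where cr: "i = (c, a, r)" by (cases i)
  note ci = cells(2)[OF i, unfolded cr]
  note c = cell_ball(1)[OF ci]
  have K: "cball a r \<subseteq> im c" using cell_ball(3)[OF ci, of r] cell_ball(2)[OF ci] by simp
  have v: "((c, a, r), l) \<in> vfs" for l using i by (simp add: vfs_def cr)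
  have bd: "EX B>=0. ALL x:cball a r. \<bar>h x\<bar> <= B" if "smooth_on (im c) h" for h :: "real ^ 'n => real"
   using compact_imp_bounded[OF compact_continuous_image[OF continuous_on_subset[OF smooth_cont[OF that] K] compact_cball]]
   unfolding bounded_pos by (metis image_eqI less_imp_le real_norm_def)
  obtain a1 where a1: "!!i j. a1 i j >= 0" "!!i j x. x \<in> cball a r ==> \<bar>Am c x $ i $ j\<bar> <= a1 i j" using bd[OF smooth_Am[OF c]] by metis
  obtain b1 where b1: "!!j. b1 j >= 0" "!!j x. x \<in> cball a r ==> \<bar>Bm c j x\<bar> <= b1 j" using bd[OF smooth_Bm[OF c]] by metis
  let ?C = "(SU i. SU j. a1 i j) + (SU j. b1 j)"
  have "\<bar>lapM f p\<bar> <= ?C * N 2 f" if f: "f \<in> SF" and p: "p \<in> core i" for f p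
  proof -
   obtain x where x: "x \<in> ball a r" "p = ci c x" using p by (auto simp: cr core_def)
   have xi: "x \<in> im c" "x \<in> cball a r" "x \<in> ball a (2 * r)" using x(1) K cell_ball(2)[OF ci] by auto
   have pM: "p \<in> M" using xi c x(2) by simp
   have 1: "dx j (%x. h (ci c x)) y = vf ((c, a, r), j) h (ci c y)" if "y \<in> ball a (2 * r)" "h \<in> SF" for j y h
    by (rule vf_core[OF v that(2), symmetric]) (use that(1) in auto)
   have 2: "dx k (dx j (%x. f (ci c x))) x = vf ((c, a, r), k) (vf ((c, a, r), j) f) p" for j k
    using dd_cong_open[OF open_ball xi(3) 1[OF _ f]] 1[OF xi(3) vf_SF[OF v f]] by (simp add: x(2))
   have n1: "\<bar>vf ((c, a, r), j) f p\<bar> <= N 2 f" for j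
    using N0_ge[OF vf_SF[OF v f] pM] N_vf[OF f v, of 0] N_mono[OF f, of 1] by (simp add: numeral_2_eq_2) (meson order_trans)
   have n2: "\<bar>vf ((c, a, r), k) (vf ((c, a, r), j) f) p\<bar> <= N 2 f" for j k
    using N0_ge[OF vf_SF[OF v vf_SF[OF v f]] pM] N_vf[OF vf_SF[OF v f] v, of 0] N_vf[OF f v, of 1] by (simp add: numeral_2_eq_2) (meson order_trans)
   have e: "lapM f p = (SU k. SU j. Am c x $ k $ j * vf ((c, a, r), k) (vf ((c, a, r), j) f) p) + (SU j. Bm c j x * vf ((c, a, r), j) f p)"
    using lapM_chart[OF c xi(1) f] lap_nondiv[OF c xi(1) f] 1[OF xi(3) f] by (simp add: 2 x(2) pd_def)
   have "\<bar>lapM f p\<bar> <= (SU k. SU j. a1 k j * N 2 f) + (SU j. b1 j * N 2 f)"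
    unfolding e by (intro order_trans[OF abs_triangle_ineq] add_mono order_trans[OF sum_abs] sum_mono)
     (auto simp: abs_mult intro!: mult_mono a1 b1 xi(2) n1 n2)
   thus ?thesis by (simp add: distrib_right sum_distrib_right)
  qed
  moreover have "?C >= 0" using a1(1) b1(1) by (simp add: sum_nonneg)
  ultimately show ?thesis by blast
 qed
 note fb = this
 obtain C where C1: "!!i. i \<in> cells ==> C i >= 0"
  and C2: "!!i. i \<in> cells ==> ALL f:SF. ALL p:core i. \<bar>lapM f p\<bar> <= C i * N 2 f" by (rule family_bound[where I = cells], erule fb, rule that)
 note C = C1 C2[rule_format]
 have "\<bar>lapM f p\<bar> <= (SUM i:cells. C i) * N 2 f" if f: "f \<in> SF" and p: "p \<in> M" for f p
 proof -
  obtain i where i: "i \<in> cells" "p \<in> core i" using cells(3) p by blast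
  have "C i <= (SUM i:cells. C i)" by (rule member_le_sum) (use i C cells(1) in auto)
  from order_trans[OF C(2)[OF i(1) f i(2)] mult_right_mono[OF this N_nonneg[OF f]]] show ?thesis .
 qed
 thus ?thesis using C(1) by (intro exI[of _ "sum C cells"]) (auto intro!: sum_nonneg)
qed

lemma NC_lapM:
 assumes f: "NC f" and p: "p \<in> M"
 shows "(%n. lapM (f n) p) \<longlonglongrightarrow> lapM (nl f) p"
proof -
 obtain C where C: "!!f p. f \<in> SF ==> p \<in> M ==> \<bar>lapM f p\<bar> <= C * N 2 f" using lapM_le by blast
 have "(%n. C * dN 2 (f n) (nl f)) \<longlonglongrightarrow> C * 0" by (intro tendsto_intros NC_conv f)
 hence "(%n. C * dN 2 (f n) (nl f)) \<longlonglongrightarrow> 0" by simp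
 hence "(%n. lapM (f n) p - lapM (nl f) p) \<longlonglongrightarrow> 0" by (rule Lim_null_comparison[rotated])
   (use C[OF SF_diff'[OF NC_SF[OF f] nl_SF[OF f]] p] lapM_diff[OF NC_SF[OF f] nl_SF[OF f] p] in auto)
 thus ?thesis by (rule LIM_zero_cancel)
qed

text \<open>With \<open>E\<close> the parametrix, ka - Laplacian maps E f to f - P f, and the
  resolvent is the sum of E applied to the powers of \<open>P\<close>. The threshold for
  \<open>ka\<close> is fixed by the sup norm alone, although the series has to converge in every
  norm.\<close>

lemma resolvent_exists:
 "EX ka0>0. ALL ka>=ka0. EX R. (ALL f:SF. R f \<in> SF & (ALL p:M. ka * R f p - lapM (R f) p = f p)) &
   (ALL m. EX C>=0. ALL f:SF. N (Suc m) (R f) <= C * N m f)"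
proof -
 from parametrix_M show ?thesis
 proof (elim exE conjE)
 fix e rh assume ks: "ALL i:cells. kern True (e i) & kern True (rh i) & ksupp (cq i) (e i) & ksupp (cq i) (rh i)"
  and eq: "ALL ka>=0. ALL f:SF. ALL p:M. ka * (SUM i:cells. KT i ka (%s z. s * e i s z) f p) - lapM (%p. SUM i:cells. KT i ka (%s z. s * e i s z) f p) p
    = f p + (SUM i:cells. KT i ka (rh i) f p)"
 have k: "!!i. i \<in> cells ==> kern True (e i)" "!!i. i \<in> cells ==> kern True (rh i)"
  and s: "!!i. i \<in> cells ==> ksupp (cq i) (e i)" "!!i. i \<in> cells ==> ksupp (cq i) (rh i)" using ks by auto
 have "EX C>=0. ALL ka>=0. ALL f:SF. N 0 (KT i ka (rh i) f) <= C * theta ka * N 0 f" if "i \<in> cells" for i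
  using KT_le[OF cells(2)[OF that] k(2)[OF that] s(2)[OF that]] by metis
 note fb = this
 obtain C where C1: "!!i. i \<in> cells ==> C i >= 0"
  and C2: "!!i. i \<in> cells ==> ALL ka>=0. ALL f:SF. N 0 (KT i ka (rh i) f) <= C i * theta ka * N 0 f" by (rule family_bound[where I = cells], erule fb, rule that)
 note C = C1 C2[rule_format]
 define Q where "Q = (SUM i:cells. C i)"
 have Q: "Q >= 0" using C(1) by (simp add: Q_def sum_nonneg)
 \<comment> \<open>Chosen so that Q times \<open>theta ka\<close> is at most 1/4; the added 1 keeps
   the denominator positive.\<close>
 obtain ka0 where ka0: "ka0 > 0" "!!ka. ka >= ka0 ==> theta ka <= 1 / (4 * (Q + 1))"
  using theta_small[of "1 / (4 * (Q + 1))"] Q by auto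
 have "EX R. (ALL f:SF. R f \<in> SF & (ALL p:M. ka * R f p - lapM (R f) p = f p)) & (ALL m. EX C>=0. ALL f:SF. N (Suc m) (R f) <= C * N m f)"
  if kak: "ka >= ka0" for ka
 proof -
  have ka: "ka >= 0" using kak ka0 by simp
  define E where "E f p = (SUM i:cells. KT i ka (%s z. s * e i s z) f p)" for f p
  define P where "P f p = -1 * (SUM i:cells. KT i ka (rh i) f p)" for f p
  have ke: "kern True (%s z. s * e i s z)" "ksupp (cq i) (%s z. s * e i s z)" if "i \<in> cells" for i
   using kern_mult[OF kern_scale k(1)[OF that]] ksupp_mult1[OF s(1)[OF that]] by auto
  have T1: "KT i ka (%s z. s * e i s z) f \<in> SF" and T2: "KT i ka (rh i) f \<in> SF" if "i \<in> cells" "f \<in> SF" for i f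
   using KT_SF[OF cells(2)[OF that(1)] _ _ that(2) ka] ke[OF that(1)] k(2)[OF that(1)] s(2)[OF that(1)] by auto
  have E: "E f \<in> SF" if "f \<in> SF" for f unfolding E_def[abs_def] by (rule SF_sum) (rule T1[OF _ that])
  have P: "P f \<in> SF" if "f \<in> SF" for f unfolding P_def[abs_def] by (rule SF_cmult, rule SF_sum) (rule T2[OF _ that])
  have Eeq: "ka * E f p - lapM (E f) p = f p - P f p" if "f \<in> SF" "p \<in> M" for f p
   using eq[rule_format, OF ka that] by (simp add: E_def[abs_def] P_def)
  have EN: "EX G>=0. ALL f:SF. N (Suc m) (E f) <= G * N m f" for m
  proof -
   have "EX C>=0. ALL f:SF. N (Suc m) (KT i ka (%s z. s * e i s z) f) <= C * N m f" if "i \<in> cells" for i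
    by (rule KT_gain[OF cells(2)[OF that] k(1)[OF that] s(1)[OF that] ka])
   note fb = this
   obtain G where G1: "!!i. i \<in> cells ==> G i >= 0"
  and G2: "!!i. i \<in> cells ==> ALL f:SF. N (Suc m) (KT i ka (%s z. s * e i s z) f) <= G i * N m f" by (rule family_bound[where I = cells], erule fb, rule that)
 note G = G1 G2[rule_format]
   have "N (Suc m) (E f) <= (SUM i:cells. G i) * N m f" if f: "f \<in> SF" for f unfolding E_def[abs_def] sum_distrib_right
    by (rule order_trans[OF N_sum[OF cells(1)] sum_mono]) (auto intro: T1 G(2) f)
   thus ?thesis using G(1) by (intro exI[of _ "sum G cells"]) (auto intro!: sum_nonneg)
  qed
  have PN: "N m (P f) <= (SUM i:cells. N m (KT i ka (rh i) f))" if "f \<in> SF" for m f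
  proof -
   have 1: "(%p. SUM i:cells. KT i ka (rh i) f p) \<in> SF" by (rule SF_sum) (rule T2[OF _ that])
   have 2: "N m (%p. SUM i:cells. KT i ka (rh i) f p) <= (SUM i:cells. N m (KT i ka (rh i) f))" by (rule N_sum[OF cells(1)]) (rule T2[OF _ that])
   show ?thesis using N_cmult[OF 1, of m "-1"] 2 by (simp add: P_def[abs_def])
  qed
  have q: "(SUM i:cells. C i * theta ka) <= 1 / 4"
  proof -
   have "Q * theta ka <= Q * (1 / (4 * (Q + 1)))" by (rule mult_left_mono[OF ka0(2)[OF kak] Q])
   also have "... <= 1 / 4" using Q by (simp add: field_simps)
   finally show ?thesis by (simp add: Q_def sum_distrib_right)
  qed
  have P0: "N 0 (P f) <= 1 / 4 * N 0 f" if f: "f \<in> SF" for f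
  proof -
   have "N 0 (P f) <= (SUM i:cells. C i * theta ka) * N 0 f" unfolding sum_distrib_right by (rule order_trans[OF PN[OF f] sum_mono]) (rule C(2)[OF _ ka f])
   from order_trans[OF this mult_right_mono[OF q N_nonneg[OF f, of 0]]] show ?thesis .
  qed
  have PS: "EX D>=0. ALL f:SF. N (Suc m) (P f) <= 1 / 4 * N (Suc m) f + D * N m f" for m
  proof -
   have "EX D>=0. ALL f:SF. N (Suc m) (KT i ka (rh i) f) <= C i * theta ka * N (Suc m) f + D * N m f" if "i \<in> cells" for i
    using KT_leading[OF cells(2)[OF that] ka k(2)[OF that] s(2)[OF that] C(2)[OF that ka], of "Suc m"] by simp
   note fb = this
   obtain D where D1: "!!i. i \<in> cells ==> D i >= 0"
  and D2: "!!i. i \<in> cells ==> ALL f:SF. N (Suc m) (KT i ka (rh i) f) <= C i * theta ka * N (Suc m) f + D i * N m f" by (rule family_bound[where I = cells], erule fb, rule that)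
 note D = D1 D2[rule_format]
   have "N (Suc m) (P f) <= 1 / 4 * N (Suc m) f + (SUM i:cells. D i) * N m f" if f: "f \<in> SF" for f
   proof -
    have "N (Suc m) (P f) <= (SUM i:cells. C i * theta ka * N (Suc m) f + D i * N m f)"
     by (rule order_trans[OF PN[OF f] sum_mono]) (rule D(2)[OF _ f])
    thus ?thesis using mult_right_mono[OF q N_nonneg[OF f, of "Suc m"]]
     unfolding sum.distrib sum_distrib_right[symmetric] by linarith
   qed
   thus ?thesis using D(1) by (intro exI[of _ "sum D cells"]) (auto intro!: sum_nonneg)
  qed
  have Pn: "(P ^^ n) f \<in> SF" if "f \<in> SF" for n f using that by (induction n) (auto intro: P)
  \<comment> \<open>By induction the lower-order term already decays like (1/2)^n. The leading
    factor 1/4 lies strictly below 1/2, and the constant 1 + 4 D B uses this room to absorb that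
    term.\<close>
  have PB: "EX B>=0. ALL n. ALL f:SF. N m ((P ^^ n) f) <= B * (1 / 2) ^ n * N m f" for m
  proof (induction m)
   case 0
   have "N 0 ((P ^^ n) f) <= 1 * (1 / 2) ^ n * N 0 f" if f: "f \<in> SF" for n f
   proof (induction n)
    case (Suc n)
    thus ?case using P0[OF Pn[OF f], of n] N_nonneg[OF Pn[OF f], of 0 n] by simp
   qed simp
   thus ?case by (intro exI[of _ 1]) simp
  next
   case (Suc m)
   then obtain B where B: "B >= 0" "!!n f. f \<in> SF ==> N m ((P ^^ n) f) <= B * (1 / 2) ^ n * N m f" by blast
   obtain D where D: "D >= 0" "!!f. f \<in> SF ==> N (Suc m) (P f) <= 1 / 4 * N (Suc m) f + D * N m f" using PS by blast
   have "N (Suc m) ((P ^^ n) f) <= (1 + 4 * (D * B)) * (1 / 2) ^ n * N (Suc m) f" if f: "f \<in> SF" for n f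
   proof (induction n)
    case 0
    show ?case using mult_right_mono[of 1 "1 + 4 * (D * B)" "N (Suc m) f"] N_nonneg[OF f, of "Suc m"] B(1) D(1) by simp
   next
    case (Suc n)
    let ?X = "(1 / 2) ^ n * N (Suc m) f"
    have X: "?X >= 0" using N_nonneg[OF f, of "Suc m"] by simp
    have "N m ((P ^^ n) f) <= B * ?X"
     using B(2)[OF f, of n] mult_left_mono[OF N_mono[OF f, of m], of "B * (1 / 2) ^ n"] B(1) by (simp add: mult.assoc)
    hence "D * N m ((P ^^ n) f) <= D * B * ?X" using D(1) by (simp add: mult_left_mono mult.assoc)
    moreover have "N (Suc m) ((P ^^ Suc n) f) <= 1 / 4 * N (Suc m) ((P ^^ n) f) + D * N m ((P ^^ n) f)"
     using D(2)[OF Pn[OF f, of n]] by simp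
    ultimately have "N (Suc m) ((P ^^ Suc n) f) <= 1 / 4 * ((1 + 4 * (D * B)) * ?X) + D * B * ?X" using Suc by (simp add: mult.assoc)
    also have "... <= (1 + 4 * (D * B)) * (1 / 2 * ?X)" using X by (simp add: algebra_simps)
    finally show ?case by (simp add: mult.assoc)
   qed
   moreover have "1 + 4 * (D * B) >= 0" using B(1) D(1) by simp
   ultimately show ?case by blast
  qed
  define S where "S f n p = (\<Sum>j<n. E ((P ^^ j) f) p)" for f n p
  have S: "S f n \<in> SF" if "f \<in> SF" for f n unfolding S_def[abs_def] by (intro SF_sum E Pn that)
  have EB: "EX B>=0. ALL n. ALL f:SF. N (Suc m) (E ((P ^^ n) f)) <= B * N m f * (1 / 2) ^ n" for m
  proof -
   obtain G where G: "G >= 0" "!!f. f \<in> SF ==> N (Suc m) (E f) <= G * N m f" using EN by blast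
   obtain B where B: "B >= 0" "!!n f. f \<in> SF ==> N m ((P ^^ n) f) <= B * (1 / 2) ^ n * N m f" using PB by blast
   have "N (Suc m) (E ((P ^^ n) f)) <= (G * B) * N m f * (1 / 2) ^ n" if "f \<in> SF" for n f
    using G(2)[OF Pn[OF that, of n]] mult_left_mono[OF B(2)[OF that, of n] G(1)] by (simp add: mult_ac)
   thus ?thesis using G(1) B(1) by (intro exI[of _ "G * B"]) auto
  qed
  have NC: "NC (S f)" if f: "f \<in> SF" for f
  proof (rule NC_I[OF S[OF f]])
   fix m
   obtain B where B: "B >= 0" "!!n f. f \<in> SF ==> N (Suc m) (E ((P ^^ n) f)) <= B * N m f * (1 / 2) ^ n" using EB by blast
   have "N m (%p. S f (Suc n) p - S f n p) <= B * N m f * (1 / 2) ^ n" for n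
    using order_trans[OF N_mono[OF E[OF Pn[OF f]]] B(2)[OF f]] by (simp add: S_def)
   thus "EX C>=0. ALL n. N m (%p. S f (Suc n) p - S f n p) <= C * (1 / 2) ^ n"
    using B(1) N_nonneg[OF f, of m] by (intro exI[of _ "B * N m f"]) auto
  qed
  define R where "R f = nl (S f)" for f
  have eqR: "ka * R f p - lapM (R f) p = f p" if f: "f \<in> SF" and p: "p \<in> M" for f p
  proof -
   have "ka * S f n p - lapM (S f n) p = f p - (P ^^ n) f p" for n
   proof -
    have "lapM (S f n) p = (\<Sum>j<n. lapM (E ((P ^^ j) f)) p)"
     unfolding S_def[abs_def] by (rule lapM_sum) (auto intro: E Pn f p)
    hence "ka * S f n p - lapM (S f n) p = (\<Sum>j<n. (P ^^ j) f p - (P ^^ Suc j) f p)"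
     using Eeq[OF Pn[OF f] p] by (simp add: S_def sum_distrib_left sum_subtractf[symmetric])
    thus ?thesis using sum_lessThan_telescope'[of "%j. (P ^^ j) f p" n] by simp
   qed
   moreover have "(%n. (P ^^ n) f p) \<longlonglongrightarrow> 0"
   proof -
    obtain B where B: "!!n. N 0 ((P ^^ n) f) <= B * (1 / 2) ^ n * N 0 f" using PB f by blast
    have "(%n. B * (1 / 2) ^ n * N 0 f) \<longlonglongrightarrow> B * 0 * N 0 f" by (intro tendsto_intros LIMSEQ_realpow_zero) auto
    hence "(%n. B * (1 / 2) ^ n * N 0 f) \<longlonglongrightarrow> 0" by simp
    moreover have "norm ((P ^^ n) f p) <= B * (1 / 2) ^ n * N 0 f" for n using order_trans[OF N0_ge[OF Pn[OF f] p] B] by simp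
    ultimately show ?thesis by (metis (no_types, lifting) Lim_null_comparison always_eventually)
   qed
   hence "(%n. f p - (P ^^ n) f p) \<longlonglongrightarrow> f p - 0" by (intro tendsto_intros)
   moreover have "(%n. ka * S f n p - lapM (S f n) p) \<longlonglongrightarrow> ka * R f p - lapM (R f) p"
    unfolding R_def by (intro tendsto_intros NC_lim NC_lapM NC f p)
   ultimately have "ka * R f p - lapM (R f) p = f p - 0" by (intro LIMSEQ_unique[of "%n. ka * S f n p - lapM (S f n) p"]) simp_all
   thus ?thesis by simp
  qed
  have gainR: "EX C>=0. ALL f:SF. N (Suc m) (R f) <= C * N m f" for m
  proof -
   obtain B where B: "B >= 0" "!!n f. f \<in> SF ==> N (Suc m) (E ((P ^^ n) f)) <= B * N m f * (1 / 2) ^ n" using EB by blast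
   have "N (Suc m) (R f) <= 2 * B * N m f" if f: "f \<in> SF" for f
   proof -
    let ?b = "B * N m f"
    have b: "?b >= 0" using B(1) N_nonneg[OF f, of m] by simp
    have 1: "N (Suc m) (S f n) <= 2 * ?b" for n
    proof -
     have "N (Suc m) (S f n) <= (\<Sum>j<n. N (Suc m) (E ((P ^^ j) f)))"
      unfolding S_def[abs_def] by (rule N_sum) (auto intro: E Pn f)
     also have "... <= (\<Sum>j<n. ?b * (1 / 2) ^ j)" by (rule sum_mono) (rule B(2)[OF f])
     also have "... = ?b * (\<Sum>j<n. (1 / 2) ^ j)" by (rule sum_distrib_left[symmetric])
     also have "... <= ?b * 2" by (rule mult_left_mono[OF _ b]) (simp add: sum_gp_strict)
     finally show ?thesis by simp
    qed
    have le: "N (Suc m) (R f) <= 2 * ?b + N (Suc m) (%p. S f n p - R f p)" for n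
     using N_diff[OF S[OF f] SF_diff'[OF S[OF f] nl_SF[OF NC[OF f]]], of "Suc m" n n] 1[of n] by (simp add: R_def)
    have "(%n. 2 * ?b + N (Suc m) (%p. S f n p - R f p)) \<longlonglongrightarrow> 2 * ?b + 0"
     unfolding R_def by (intro tendsto_intros NC_conv NC f)
    hence "N (Suc m) (R f) <= 2 * ?b + 0" by (rule LIMSEQ_le_const) (rule exI[of _ 0], intro allI impI, rule le)
    thus ?thesis by simp
   qed
   thus ?thesis using B(1) by (intro exI[of _ "2 * B"]) auto
  qed
  have "R f \<in> SF" if "f \<in> SF" for f unfolding R_def by (rule nl_SF[OF NC[OF that]])
  thus ?thesis by (intro exI[of _ R] conjI ballI allI eqR gainR)
 qed
 with ka0(1) show ?thesis by (intro exI[of _ ka0] conjI allI impI)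
 qed
qed

end

section \<open>Maximum principles\<close>

lemma smooth_min:
 fixes v :: "real ^ 'n::finite => real"
 assumes S: "open S" "smooth_on S v" "x \<in> S" and m: "!!y. y \<in> S ==> v x <= v y"
 shows "dd w v x = 0" "dd w (dd w v) x >= 0"
proof -
 have d: "v differentiable (at y)" "dd w v differentiable (at y)" if "y \<in> S" for y
  using smooth_diff[OF S(2) that] smooth_diff[OF smooth_on_dd[OF S(2)] that] by auto
 have "(%w. dd w v x) = (%w. 0)" by (rule differential_zero_maxmin[OF S(3,1) dd_works[OF d(1)[OF S(3)]]]) (use m in auto)
 thus z: "dd w v x = 0" by metis
 show "dd w (dd w v) x >= 0"
 proof (rule ccontr)
  assume "\<not> ?thesis"
  hence "((%t. dd w v (x + t *\<^sub>R w)) has_real_derivative dd w (dd w v) x) (at 0)" "dd w (dd w v) x < 0"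
   using dd_DERIV_line[of "dd w v" x 0 w] d(2)[OF S(3)] by auto
  from DERIV_neg_dec_right[OF this] z obtain e where e: "e > 0" "!!h. 0 < h ==> h < e ==> dd w v (x + h *\<^sub>R w) < 0" by auto
  have "open ((%t. x + t *\<^sub>R w) -` S)" by (rule open_vimage[OF S(1)]) (intro continuous_intros)
  then obtain b where b0: "b > 0" "ball 0 b \<subseteq> (%t. x + t *\<^sub>R w) -` S" using openE[of "(%t. x + t *\<^sub>R w) -` S" 0] S(3) by auto
  hence b: "b > 0" "!!t. \<bar>t\<bar> < b ==> x + t *\<^sub>R w \<in> S" by (auto simp: subset_iff)
  define t where "t = min e b / 2"
  have t: "0 < t" "t < e" "t < b" using e b by (auto simp: t_def min_def)
  have "EX z. 0 < z & z < t & v (x + t *\<^sub>R w) - v (x + 0 *\<^sub>R w) = (t - 0) * dd w v (x + z *\<^sub>R w)"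
   by (rule MVT2[OF t(1)]) (rule dd_DERIV_line, rule d(1), rule b(2), use t in auto)
  then obtain z where z: "0 < z" "z < t" "v (x + t *\<^sub>R w) - v x = t * dd w v (x + z *\<^sub>R w)" by auto
  have "t * dd w v (x + z *\<^sub>R w) < 0" using e(2)[OF z(1)] z(2) t by (simp add: mult_pos_neg)
  thus False using z(3) m[OF b(2)[of t]] t by simp
 qed
qed

lemma dd_dd_axis:
 fixes v :: "real ^ 'n::finite => real"
 assumes S: "open S" "smooth_on S v" "x \<in> S"
 shows "dd y (dd y v) x = (SU i. SU j. dx i (dx j v) x * y $ i * y $ j)"
proof -
 have d: "dd w v differentiable (at x)" for w using smooth_diff[OF smooth_on_dd[OF S(2)] S(3)] .
 have "dx i (dd y v) x = dx i (%z. SU j. y $ j * dx j v z) x" for i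
  by (rule dd_cong_open[OF S(1,3)]) (use dd_axis[OF smooth_diff[OF S(2)], of _ y] in simp)
 also have "... i = (SU j. y $ j * dx i (dx j v) x)" for i by (simp add: dd_sum dd_cmult d)
 finally show ?thesis unfolding dd_axis[OF d, of y y] by (simp add: sum_distrib_left mult_ac)
qed

context rmfd
begin

text \<open>The Hessian at a minimum is positive semidefinite, and \<open>trace_le\<close> contracts
  its negative with the inverse metric. The radius e/8 fits a cell around the point into the
  chart.\<close>

lemma trace_min:
 assumes c: "c \<in> A" and S: "open S" "S \<subseteq> im c" "smooth_on S v" "x \<in> S" and m: "!!y. y \<in> S ==> v x <= v y"
 shows "(SU i. SU j. Am c x $ i $ j * dx i (dx j v) x) >= 0"
proof -
 obtain e where e: "e > 0" "cball x e \<subseteq> im c" using open_im[OF c] S(2,4) open_contains_cball by blast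
 have "cell (c, x, e / 8)" using c e by (simp add: cell_def)
 from gauss_cell.trace_le[OF gauss_cell[OF this], of x "%i j. - dx i (dx j v) x"]
 show ?thesis using dd_dd_axis[OF S(1,3,4)] smooth_min(2)[OF S(1,3,4) m] e by (simp add: sum_negf)
qed

lemma lapM_min:
 assumes u: "u \<in> SF" and p: "p \<in> M" and m: "!!q. q \<in> M ==> u p <= u q"
 shows "lapM u p >= 0"
proof -
 obtain c where c: "c \<in> A" "p \<in> chart_dom c" using cover[OF p] by blast
 let ?x = "chart_map c p"
 have x: "?x \<in> im c" using c by simp
 have m': "u (ci c ?x) <= u (ci c y)" if "y \<in> im c" for y using m c that by simp
 have "pd c j u ?x = 0" for j unfolding pd_def by (rule smooth_min(1)[OF open_im[OF c(1)] SF_smooth[OF u c(1)] x m'])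
 thus ?thesis
  using lapM_chart[OF c(1) x u] lap_nondiv[OF c(1) x u] trace_min[OF c(1) open_im[OF c(1)] order_refl SF_smooth[OF u c(1)] x m'] c by simp
qed

text \<open>At a minimum of \<open>u\<close> its Laplacian is nonnegative, so the bound holds there
  and hence everywhere. A general \<open>b\<close> makes this a quantitative comparison, which later
  keeps iterates strictly above a subsolution.\<close>

lemma max_principle:
 assumes u: "u \<in> SF" and k: "ka > 0" and le: "!!p. p \<in> M ==> ka * u p - lapM u p >= b" and p: "p \<in> M"
 shows "ka * u p >= b"
proof -
 obtain q where q: "q \<in> M" "!!p. p \<in> M ==> u q <= u p" using SF_attains_min[OF u] p by blast
 thus ?thesis using lapM_min[OF u q] le[OF q(1)] mult_left_mono[OF q(2)[OF p] less_imp_le[OF k]] by linarith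
qed

section \<open>The Hopf barrier and the strong maximum principle\<close>

lemma inverse_metric_pos:
 assumes c: "c \<in> A" and x: "x \<in> im c" and y: "y ~= 0"
 shows "0 < (SU i. SU j. Am c x $ i $ j * y $ i * y $ j)"
proof -
 define z where "z = Am c x *v y"
 have Gz: "Gm c x *v z = y" by (simp add: z_def matrix_vector_mul_assoc inverse_metric(2)[OF c x])
 hence "z ~= 0" using y by auto
 from metric_pos[OF c x this] have "0 < z \<bullet> (Gm c x *v z)"
  by (simp add: inner_vec_def matrix_vector_mult_def sum_distrib_left mult_ac)
 thus ?thesis unfolding Gz by (simp add: z_def inner_vec_def matrix_vector_mult_def sum_distrib_left sum_distrib_right mult_ac)
qed

text \<open>The Laplacian for functions of the coordinates, since barriers exist only inside one
  chart.\<close>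

definition Lc :: "('a, 'n) chart => (real ^ 'n => real) => real ^ 'n => real" where
 "Lc c v x = (SU i. SU j. Am c x $ i $ j * dx i (dx j v) x) + (SU j. Bm c j x * dx j v x)"

text \<open>On the Gaussian the operator yields a leading term 4 al^2 D, where D is the inverse
  metric evaluated at x - x1. It is bounded below on \<open>K\<close> because \<open>x1\<close> is
  not in \<open>K\<close>, and for large \<open>al\<close> it dominates everything of order
  \<open>al\<close>.\<close>

lemma barrier_exists:
 assumes c: "c \<in> A" and K: "compact K" "K \<subseteq> im c" "x1 \<notin> K" and k: "ka >= 0"
 shows "EX al>0. ALL x:K. Lc c (%x. exp (- al * ((x - x1) \<bullet> (x - x1))) - b) x > ka * exp (- al * ((x - x1) \<bullet> (x - x1)))"
proof (cases "K = {}")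
 case False
 define D where "D x = (SU i. SU j. Am c x $ i $ j * (x - x1) $ i * (x - x1) $ j)" for x
 define T where "T x = (SU i. Am c x $ i $ i) + (SU j. Bm c j x * (x - x1) $ j)" for x
 have cA: "continuous_on K (%x. Am c x $ i $ j)" "continuous_on K (Bm c j)" for i j
  using continuous_on_subset[OF smooth_cont[OF smooth_Am[OF c]] K(2)]
   continuous_on_subset[OF smooth_cont[OF smooth_Bm[OF c]] K(2)] by auto
 have cD: "continuous_on K D" "continuous_on K (%x. \<bar>T x\<bar>)" unfolding D_def T_def by (intro continuous_intros cA)+
 obtain x2 where x2: "x2 \<in> K" "!!x. x \<in> K ==> D x2 <= D x" using continuous_attains_inf[OF K(1) False cD(1)] by blast
 obtain x3 where x3: "x3 \<in> K" "!!x. x \<in> K ==> \<bar>T x\<bar> <= \<bar>T x3\<bar>" using continuous_attains_sup[OF K(1) False cD(2)] by blast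
 define l where "l = D x2"
 define t where "t = \<bar>T x3\<bar>"
 have "x2 - x1 ~= 0" using x2(1) K(3) by auto
 hence l: "l > 0" unfolding l_def D_def using inverse_metric_pos[OF c subsetD[OF K(2) x2(1)]] by blast
 have t: "t >= 0" by (simp add: t_def)
 \<comment> \<open>Gives al \<ge> 1 and al l \<ge> t + ka + 1, so that 4 al^2 D exceeds 2 al T +
   ka.\<close>
 define al where "al = 1 + (t + ka + 1) / l"
 have a: "al >= 1" "al * l >= t + ka + 1" using l t k by (auto simp: al_def field_simps)
 let ?E = "%x. exp (- al * ((x - x1) \<bullet> (x - x1)))"
 have d1: "dd v (%x. ?E x - b) x = - 2 * al * ((x - x1) \<bullet> v) * ?E x" for v x
  by (rule dd_eqI) (auto intro!: derivative_eq_intros simp: inner_commute algebra_simps)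
 have d2: "dd w (dd v (%x. ?E x - b)) x = ?E x * (4 * al\<^sup>2 * ((x - x1) \<bullet> w) * ((x - x1) \<bullet> v) - 2 * al * (w \<bullet> v))" for v w x
  unfolding d1[abs_def] by (rule dd_eqI) (auto intro!: derivative_eq_intros simp: inner_commute algebra_simps power2_eq_square)
 have L: "Lc c (%x. ?E x - b) x = ?E x * (4 * al\<^sup>2 * D x - 2 * al * T x)" for x
 proof -
  have 1: "Lc c (%x. ?E x - b) x = (SU i. SU j. Am c x $ i $ j * (e * (4 * al\<^sup>2 * y $ i * y $ j - 2 * al * (axis i 1 \<bullet> axis j (1::real)))))
    + (SU j. Bm c j x * (- 2 * al * y $ j * e))" if "y = x - x1" "e = ?E x" for y e
   unfolding Lc_def d1 d2 that by (simp add: inner_axis del: vector_minus_component)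
  have "(SU i. SU j. Am c x $ i $ j * (e * (4 * al\<^sup>2 * y $ i * y $ j - 2 * al * (axis i 1 \<bullet> axis j (1::real)))))
    + (SU j. Bm c j x * (- 2 * al * y $ j * e))
   = e * (4 * al\<^sup>2 * (SU i. SU j. Am c x $ i $ j * y $ i * y $ j) - 2 * al * ((SU i. Am c x $ i $ i) + (SU j. Bm c j x * y $ j)))" for y e
  proof -
   have "Am c x $ i $ j * (e * (2 * al * (axis i 1 \<bullet> axis j (1::real)))) = (if i = j then 2 * al * e * Am c x $ i $ i else 0)" for i j
    by (simp add: inner_axis_axis)
   thus ?thesis by (simp add: right_diff_distrib sum_subtractf sum_distrib_left sum_negf distrib_left mult_ac)
  qed
  note 2 = this
  show ?thesis unfolding D_def T_def by (rule trans[OF 1[OF refl refl] 2])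
 qed
 have "Lc c (%x. ?E x - b) x > ka * ?E x" if x: "x \<in> K" for x
 proof -
  have "al * (t + ka + 1) <= al * (al * D x)"
  proof (rule mult_left_mono)
   show "t + ka + 1 <= al * D x" using a mult_left_mono[OF x2(2)[OF x], of al] unfolding l_def by linarith
  qed (use a(1) in simp)
  moreover have "al * T x <= al * t" using a x3(2)[OF x] by (intro mult_left_mono) (auto simp: t_def)
  moreover have "ka <= al * ka" using mult_right_mono[OF a(1) k] by simp
  moreover have "al * t >= 0" using a t by simp
  ultimately have "ka < 4 * al\<^sup>2 * D x - 2 * al * T x" 
   using a k unfolding power2_eq_square distrib_left mult.assoc mult.left_commute[of 2 al] by linarith
  thus ?thesis unfolding L by (simp add: mult.commute)
 qed
 thus ?thesis using a(1) by (intro exI[of _ al]) auto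
qed (auto intro: exI[of _ 1])

text \<open>The touching-ball argument of Hopf: near a boundary point of the zero set, \<open>u\<close> dominates
 a multiple of the barrier and so has a nonzero gradient at its minimum.\<close>

lemma zero_set_open:
 assumes c: "c \<in> A" and u: "u \<in> SF" "!!p. p \<in> M ==> u p >= 0" "!!p. p \<in> M ==> lapM u p <= ka * u p" and k: "ka >= 0"
  and x0: "cball x0 (2 * e) \<subseteq> im c" "u (ci c x0) = 0" and x1: "x1 \<in> ball x0 e"
 shows "u (ci c x1) = 0"
proof (rule ccontr)
 assume ne: "u (ci c x1) ~= 0"
 define f where "f x = u (ci c x)" for x
 have fs: "smooth_on (im c) f" unfolding f_def[abs_def] by (rule SF_smooth[OF u(1) c])
 have f0: "f x >= 0" if "x \<in> im c" for x using u(2) c that by (simp add: f_def)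
 have Lf: "Lc c f x <= ka * f x" if "x \<in> im c" for x
  using u(3)[OF chart_inv_M[OF c that]] lapM_chart[OF c that u(1)] lap_nondiv[OF c that u(1)]
  by (simp add: Lc_def f_def[abs_def] pd_def)
 \<comment> \<open>The point \<open>x0\<close> lies on the boundary of this ball, so it contains a
   zero nearest to \<open>x1\<close>; it stays inside the chart because \<open>x1\<close> is closer
   than e to \<open>x0\<close>.\<close>
 define B where "B = cball x1 (dist x1 x0)"
 have d1: "dist x1 x0 < e" using x1 by (simp add: dist_commute)
 have "B \<subseteq> cball x0 (2 * e)"
 proof
  fix y assume "y \<in> B"
  hence "dist x1 y < e" using d1 by (simp add: B_def)
  thus "y \<in> cball x0 (2 * e)" using dist_triangle[of x0 y x1] d1 by (simp add: dist_commute)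
 qed
 hence Bi: "B \<subseteq> im c" using x0(1) by blast
 have fc: "continuous_on B f" using continuous_on_subset[OF smooth_cont[OF fs] Bi] .
 have "closed (B \<inter> f -` {0})" by (rule continuous_closed_preimage[OF fc]) (auto simp: B_def)
 hence "compact (B \<inter> (B \<inter> f -` {0}))" by (intro compact_Int_closed) (auto simp: B_def)
 hence "compact (B \<inter> f -` {0})" by (simp add: Int_left_absorb)
 moreover have "x0 \<in> B \<inter> f -` {0}" using x0(2) by (simp add: B_def f_def)
 ultimately obtain z where z: "z \<in> B" "f z = 0" "!!y. y \<in> B ==> f y = 0 ==> dist x1 z <= dist x1 y"
  using continuous_attains_inf[of "B \<inter> f -` {0}" "dist x1"] continuous_on_dist[OF continuous_on_const continuous_on_id] by blast
 define rh where "rh = dist x1 z"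
 have "x1 ~= z" using ne z(2) by (auto simp: f_def)
 hence rh: "rh > 0" by (simp add: rh_def)
 have sub: "cball x1 rh \<subseteq> B" using z(1) by (auto simp: rh_def B_def)
 have fpos: "f y > 0" if "dist x1 y < rh" for y
 proof -
  have "y \<in> B" using that sub by auto
  thus ?thesis using z(3)[of y] f0[of y] Bi that by (force simp: rh_def)
 qed
 \<comment> \<open>An annulus: the barrier has zero gradient at the centre, where the lower bound on
   D fails.\<close>
 define K where "K = cball x1 rh - ball x1 (rh / 2)"
 have K: "compact K" "K \<subseteq> im c" "x1 \<notin> K" using sub Bi rh by (auto simp: K_def intro: compact_diff)
 \<comment> \<open>Makes the barrier vanish on the sphere through the nearest zero.\<close>
 define b where "b al = exp (- al * rh\<^sup>2)" for al :: real
 have "EX al>0. ALL x:K. Lc c (%x. exp (- al * ((x - x1) \<bullet> (x - x1))) - b al) x > ka * exp (- al * ((x - x1) \<bullet> (x - x1)))"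
 proof -
  have "Lc c (%x. exp (- al * ((x - x1) \<bullet> (x - x1))) - b') x = Lc c (%x. exp (- al * ((x - x1) \<bullet> (x - x1))) - 0) x" for al b' x
  proof -
   have "dd v (%x. exp (- al * ((x - x1) \<bullet> (x - x1))) - b') = dd v (%x. exp (- al * ((x - x1) \<bullet> (x - x1))) - 0)" for v
    by (rule ext, subst (1 2) dd_diff) (auto intro!: differentiableI derivative_eq_intros)
   thus ?thesis by (simp add: Lc_def)
  qed
  thus ?thesis using barrier_exists[OF c K k, of 0] by simp
 qed
 then obtain al where al: "al > 0" "!!x. x \<in> K ==> Lc c (%x. exp (- al * ((x - x1) \<bullet> (x - x1))) - b al) x > ka * exp (- al * ((x - x1) \<bullet> (x - x1)))" by blast
 define w where "w x = exp (- al * ((x - x1) \<bullet> (x - x1))) - b al" for x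
 have ws: "smooth_on S w" if "open S" for S unfolding w_def[abs_def] inner_vec_def inner_real_def by (intro smooth_intros that)
 have nn: "(x - x1) \<bullet> (x - x1) = (dist x1 x)\<^sup>2" for x by (simp add: dot_square_norm dist_norm norm_minus_commute)
 have Lw: "Lc c w x > ka * w x" if "x \<in> K" for x
 proof -
  have "ka * w x <= ka * exp (- al * ((x - x1) \<bullet> (x - x1)))" using k by (intro mult_left_mono) (auto simp: w_def b_def)
  thus ?thesis using al(2)[OF that] by (simp add: w_def[abs_def])
 qed
 let ?S = "sphere x1 (rh / 2)"
 have Sp: "?S \<subseteq> B" using sub rh by auto
 obtain y0 where "(y0 :: real ^ 'n) \<in> ?S" using rh by (metis ex_in_conv less_imp_le sphere_eq_empty not_less half_gt_zero)
 then obtain y1 where y1: "y1 \<in> ?S" "!!y. y \<in> ?S ==> f y1 <= f y"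
  using continuous_attains_inf[of ?S f] continuous_on_subset[OF fc Sp] by auto
 define m where "m = f y1"
 have m: "m > 0" unfolding m_def using fpos[of y1] y1(1) rh by simp
 \<comment> \<open>On the inner sphere f \<ge> m and w \<le> 1; on the outer one f \<ge> 0 and w =
   0. A negative minimum would therefore be interior and contradict the two differential
   inequalities.\<close>
 define h where "h x = f x - m * w x" for x
 have hs: "smooth_on S h" if "open S" "S \<subseteq> im c" for S
  unfolding h_def[abs_def] by (intro smooth_intros that ws smooth_on_subset[OF fs])
 have hK: "h x >= 0" if x: "x \<in> K" for x
 proof (rule ccontr)
  assume neg: "\<not> h x >= 0"
  have hc: "continuous_on K h" using continuous_on_subset[OF smooth_cont[OF hs[OF open_im[OF c] order_refl]] K(2)] .
  obtain y where y: "y \<in> K" "!!x. x \<in> K ==> h y <= h x" using continuous_attains_inf[OF K(1) _ hc] x by blast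
  have hy: "h y < 0" using y(2)[OF x] neg by simp
  have dy: "dist x1 y <= rh" "rh / 2 <= dist x1 y" using y(1) by (auto simp: K_def)
  have "dist x1 y ~= rh"
  proof
   assume "dist x1 y = rh"
   hence "w y = 0" unfolding w_def nn by (simp add: b_def)
   thus False using hy f0[of y] K(2) y(1) by (auto simp: h_def)
  qed
  moreover have "dist x1 y ~= rh / 2"
  proof
   assume "dist x1 y = rh / 2"
   hence "m <= f y" using y1(2) by (simp add: m_def)
   moreover have "exp (- al * (dist x1 y)\<^sup>2) <= 1" using al(1) by simp
   hence "w y <= 1" unfolding w_def nn b_def using exp_ge_zero[of "- al * rh\<^sup>2"] by linarith
   hence "m * w y <= m" using m by (simp add: mult_left_le)
   ultimately show False using hy by (simp add: h_def)
  qed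
  ultimately have yo: "y \<in> ball x1 rh - cball x1 (rh / 2)" using dy by auto
  let ?O = "ball x1 rh - cball x1 (rh / 2)"
  have O: "open ?O" "?O \<subseteq> K" by (auto simp: K_def)
  have Oi: "?O \<subseteq> im c" using O K by blast
  have mo: "h y <= h x" if "x \<in> ?O" for x using y(2) O that by blast
  have "dx j h y = 0" for j by (rule smooth_min(1)[OF O(1) hs[OF O(1) Oi] yo mo])
  hence "Lc c h y >= 0" using trace_min[OF c O(1) Oi hs[OF O(1) Oi] yo mo] by (simp add: Lc_def)
  moreover have "Lc c h y = Lc c f y - m * Lc c w y"
  proof -
   have df: "f differentiable (at x)" "w differentiable (at x)" "dd v f differentiable (at x)" "dd v w differentiable (at x)" if "x \<in> ?O" for x v
    using that smooth_diff[OF smooth_on_subset[OF fs Oi]] smooth_diff[OF ws[OF O(1)]]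
     smooth_diff[OF smooth_on_dd[OF smooth_on_subset[OF fs Oi]]] smooth_diff[OF smooth_on_dd[OF ws[OF O(1)]]] by auto
   have 1: "dd v h x = dd v f x - m * dd v w x" if "x \<in> ?O" for v x
    unfolding h_def[abs_def] by (simp add: dd_diff dd_cmult df[OF that])
   have 2: "dd v (dd z h) y = dd v (dd z f) y - m * dd v (dd z w) y" for v z
    proof -
     have "dd v (dd z h) y = dd v (%x. dd z f x - m * dd z w x) y" by (rule dd_cong_open[OF O(1) yo 1])
     thus ?thesis by (simp add: dd_diff dd_cmult df[OF yo])
    qed
   show ?thesis unfolding Lc_def 1[OF yo] 2 by (simp add: right_diff_distrib distrib_left sum_subtractf sum_distrib_left mult_ac)
  qed
  moreover have "m * (ka * w y) < m * Lc c w y" using Lw[OF y(1)] m by simp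
  moreover have "Lc c f y <= ka * f y" using Lf K(2) y(1) by blast
  moreover have "ka * h y <= 0" using k hy by (simp add: mult_nonneg_nonpos)
  ultimately show False by (simp add: h_def algebra_simps)
 qed
 \<comment> \<open>The inward direction at the touching point \<open>z\<close>. There
   \<open>f\<close> has a minimum, so its derivative is 0, while \<open>w\<close> increases
   strictly; hence \<open>h\<close> drops below 0 inside the annulus.\<close>
 define v where "v = x1 - z"
 have zi: "z \<in> im c" using z(1) Bi by blast
 have df: "dd v f z = 0" by (rule smooth_min(1)[OF open_im[OF c] fs zi]) (use f0 z(2) in auto)
 have dw: "dd v w z = 2 * al * rh\<^sup>2 * exp (- al * rh\<^sup>2)"
 proof -
  have "dd v w z = exp (- al * ((z - x1) \<bullet> (z - x1))) * (- al * (v \<bullet> (z - x1) + (z - x1) \<bullet> v))"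
   unfolding w_def[abs_def] by (rule dd_eqI) (auto intro!: derivative_eq_intros simp: algebra_simps)
  moreover have "v \<bullet> (z - x1) = - rh\<^sup>2" "(z - x1) \<bullet> v = - rh\<^sup>2"
   using nn[of z] by (auto simp: v_def rh_def inner_diff_left inner_diff_right algebra_simps inner_commute)
  ultimately show ?thesis unfolding nn by (simp add: rh_def)
 qed
 have hd: "h differentiable (at z)" using smooth_diff[OF hs[OF open_im[OF c] order_refl] zi] .
 have "dd v h z = dd v f z - m * dd v w z" unfolding h_def[abs_def]
  by (simp add: dd_diff dd_cmult smooth_diff[OF fs zi] smooth_diff[OF ws[OF open_UNIV]])
 hence hneg: "dd v h z < 0" using df dw m al(1) rh by simp
 have hD: "((%t. h (z + t *\<^sub>R v)) has_real_derivative dd v h z) (at 0)" using dd_DERIV_line[of h z 0 v] hd by simp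
 from DERIV_neg_dec_right[OF hD hneg] obtain d where d: "d > 0" "!!t. 0 < t ==> t < d ==> h (z + t *\<^sub>R v) < h z" by auto
 have "h z = 0" using z(2) nn[of z] by (simp add: h_def w_def b_def rh_def)
 \<comment> \<open>The bound 1/2 keeps the point outside the removed inner ball.\<close>
 define t where "t = min (d / 2) (1 / 2)"
 have t: "0 < t" "t < d" "t <= 1 / 2" using d(1) by (auto simp: t_def)
 have "dist x1 (z + t *\<^sub>R v) = norm ((1 - t) *\<^sub>R v)" by (simp add: dist_norm v_def algebra_simps)
 also have "... = (1 - t) * rh" using t by (simp add: v_def rh_def dist_norm)
 finally have dt: "dist x1 (z + t *\<^sub>R v) = (1 - t) * rh" .
 have "(1 - t) * rh <= rh" "(1 / 2) * rh <= (1 - t) * rh" using t rh by (auto intro: mult_right_mono simp: mult_le_cancel_right1)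
 hence "z + t *\<^sub>R v \<in> K" using dt by (simp add: K_def)
 thus False using hK d(2)[OF t(1,2)] \<open>h z = 0\<close> by fastforce
qed

text \<open>The zero set is closed by continuity and open by the touching-ball argument, so
  connectedness leaves only the empty set and \<open>M\<close>.\<close>

theorem strong_max_principle:
 assumes u: "u \<in> SF" "!!p. p \<in> M ==> u p >= 0" "!!p. p \<in> M ==> lapM u p <= ka * u p" and k: "ka >= 0"
  and p: "p \<in> M" "u p = 0" and q: "q \<in> M"
 shows "u q = 0"
proof -
 define Z where "Z = {p \<in> M. u p \<in> {0}}"
 have "closedin X Z" unfolding Z_def by (rule closedin_continuous_map_preimage[OF SF_continuous[OF u(1)]]) simp
 moreover have "openin X Z"
 proof (subst openin_subopen, intro ballI)
  fix p assume p: "p \<in> Z"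
  then obtain c where c: "c \<in> A" "p \<in> chart_dom c" using cover[of p] unfolding Z_def by blast
  let ?x = "chart_map c p"
  obtain d where d: "d > 0" "cball ?x d \<subseteq> im c" using open_im[OF c(1)] chart_im[OF c(2)] open_contains_cball by blast
  have b: "ball ?x (d / 2) \<subseteq> im c" using d by (auto simp: subset_iff)
  have "u (ci c y) = 0" if "y \<in> ball ?x (d / 2)" for y
   by (rule zero_set_open[OF c(1) u k _ _ that]) (use d p c in "auto simp: Z_def")
  hence "ci c ` ball ?x (d / 2) \<subseteq> Z" using b c(1) by (auto simp: Z_def)
  moreover have "p \<in> ci c ` ball ?x (d / 2)" using c d(1) by (auto intro!: image_eqI[of _ _ ?x])
  ultimately show "EX T. openin X T & p \<in> T & T \<subseteq> Z" using openin_inv_image[OF c(1) open_ball b] by blast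
 qed
 moreover have "connected_space X" using closed_mfd by (simp add: closed_manifold_def)
 ultimately have "Z = {} \<or> Z = M" by (simp add: connected_space_clopen_in)
 thus ?thesis using p q by (auto simp: Z_def)
qed

end

section \<open>Monotone iteration\<close>

lemma smooth_real_deriv:
 fixes h :: "real => real"
 assumes "smooth_on J h" "t \<in> J"
 shows "(h has_real_derivative dd 1 h t) (at t)" using dd_DERIV_line[of h 0 t 1] smooth_diff[OF assms] by simp

lemma smooth_lipschitz:
 fixes h :: "real => real"
 assumes h: "smooth_on J h" and ab: "{a..b} \<subseteq> J"
 obtains H where "H >= 0" "!!s t. s \<in> {a..b} ==> t \<in> {a..b} ==> \<bar>h s - h t\<bar> <= H * \<bar>s - t\<bar>"
proof -
 have "continuous_on {a..b} (dd 1 h)" using smooth_cont[OF smooth_on_dd[OF h]] ab continuous_on_subset by blast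
 hence "bounded (dd 1 h ` {a..b})" by (intro compact_imp_bounded compact_continuous_image) auto
 then obtain H where H: "H > 0" "!!t. t \<in> {a..b} ==> \<bar>dd 1 h t\<bar> <= H" unfolding bounded_pos by (metis image_eqI real_norm_def)
 have "norm (h s - h t) <= H * norm (s - t)" if "s \<in> {a..b}" "t \<in> {a..b}" for s t
 proof (rule field_differentiable_bound[of "{a..b}"])
  show "(h has_field_derivative dd 1 h x) (at x within {a..b})" if "x \<in> {a..b}" for x
   using smooth_real_deriv[OF h] that ab has_field_derivative_at_within by blast
 qed (use H that in auto)
 thus ?thesis using H(1) by (intro that[of H]) auto
qed

context mfd
begin

text \<open>A field turns h(u) - h(v) into h'(u) (du - dv) + (h'(u) - h'(v)) dv. The induction is
  general in \<open>h\<close> and so applies to h' as well; the bound \<open>B\<close> controls the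
  factors that are not differences.\<close>

lemma comp_lip:
 assumes J: "open J" "{a..b} \<subseteq> J"
 shows "smooth_on J h ==> EX L>=0. ALL u:SF. ALL v:SF. (ALL p:M. u p \<in> {a..b} & v p \<in> {a..b}) --> N m u <= B --> N m v <= B -->
  N m (%p. h (u p) - h (v p)) <= L * dN m u v"
proof (induction m arbitrary: h B)
 case 0
 obtain H where H: "H >= 0" "!!s t. s \<in> {a..b} ==> t \<in> {a..b} ==> \<bar>h s - h t\<bar> <= H * \<bar>s - t\<bar>"
  using smooth_lipschitz[OF 0 J(2)] by blast
 have "N 0 (%p. h (u p) - h (v p)) <= H * dN 0 u v" if u: "u \<in> SF" "v \<in> SF" "!!p. p \<in> M ==> u p \<in> {a..b} & v p \<in> {a..b}" for u v
 proof (rule N0_le)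
  fix p assume p: "p \<in> M"
  show "\<bar>h (u p) - h (v p)\<bar> <= H * dN 0 u v"
   using order_trans[OF H(2) mult_left_mono[OF N0_ge[OF SF_diff'[OF u(1,2)] p] H(1)]] u(3)[OF p] by blast
 qed (use H(1) N_nonneg[OF SF_diff'[OF u(1,2)], of 0] in simp)
 thus ?case using H(1) by blast
next
 case (Suc m)
 define h' where "h' = dd 1 h"
 have h': "smooth_on J h'" unfolding h'_def by (rule smooth_on_dd[OF Suc.prems])
 \<comment> \<open>The constant function is a reference point: the norm of h'(u) is bounded through
   its difference from h'(a).\<close>
 have aS: "(%p. a) \<in> SF" by (rule SF_const)
 define B' where "B' = \<bar>B\<bar> + N m (%p. a)"
 have B': "B <= B'" "N m (%p. a) <= B'" "B' >= 0" using N_nonneg[OF aS, of m] by (auto simp: B'_def)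
 obtain L where L: "L >= 0" "!!u v. u \<in> SF ==> v \<in> SF ==> (!!p. p \<in> M ==> u p \<in> {a..b} & v p \<in> {a..b}) ==> N m u <= B' ==> N m v <= B' ==>
   N m (%p. h (u p) - h (v p)) <= L * dN m u v" using Suc.IH[OF Suc.prems, of B'] by blast
 obtain L' where L': "L' >= 0" "!!u v. u \<in> SF ==> v \<in> SF ==> (!!p. p \<in> M ==> u p \<in> {a..b} & v p \<in> {a..b}) ==> N m u <= B' ==> N m v <= B' ==>
   N m (%p. h' (u p) - h' (v p)) <= L' * dN m u v" using Suc.IH[OF h', of B'] by blast
 obtain K where K: "K >= 0" "!!f g. f \<in> SF ==> g \<in> SF ==> N m (%p. f p * g p) <= K * N m f * N m g" using N_mult by blast
 define Z where "Z = L' * (B' + B') + N m (%p. h' a)"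
 have Z: "Z >= 0" using L'(1) B'(3) N_nonneg[OF SF_const, of m "h' a"] by (simp add: Z_def)
 define Y where "Y = K * Z + K * L' * B'"
 have Y: "Y >= 0" using K(1) Z L'(1) B'(3) by (simp add: Y_def)
 have "N (Suc m) (%p. h (u p) - h (v p)) <= (L + real (card vfs) * Y) * dN (Suc m) u v"
  if u: "u \<in> SF" and v: "v \<in> SF" and uv: "ALL p:M. u p \<in> {a..b} & v p \<in> {a..b}" and n: "N (Suc m) u <= B" "N (Suc m) v <= B" for u v
 proof -
  let ?D = "dN (Suc m) u v"
  note d = SF_diff'[OF u v]
  have D: "?D >= 0" by (rule N_nonneg[OF d])
  have nB: "N m u <= B'" "N m v <= B'" using N_mono[OF u, of m] N_mono[OF v, of m] n B'(1) by linarith+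
  have hS: "(%p. k (u p)) \<in> SF" "(%p. k (v p)) \<in> SF" if "smooth_on J k" for k
   by (rule SF_comp[OF u J(1) that], use uv J(2) in blast, rule SF_comp[OF v J(1) that], use uv J(2) in blast)
  have 0: "N m (%p. h (u p) - h (v p)) <= L * ?D"
   using L(2)[OF u v _ nB] uv mult_left_mono[OF N_mono[OF d] L(1)] by (meson order_trans)
  have "N m (vf j (%p. h (u p) - h (v p))) <= Y * ?D" if j: "j \<in> vfs" for j
  proof -
   note sj = vf_SF[OF j u] vf_SF[OF j v]
   have "vf j (%p. h (u p) - h (v p)) p = h' (u p) * (vf j u p - vf j v p) + (h' (u p) - h' (v p)) * vf j v p" if p: "p \<in> M" for p
   proof -
    have J': "u p \<in> J" "v p \<in> J" using uv J(2) p by auto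
    show ?thesis unfolding vf_diff[OF j hS[OF Suc.prems]] h'_def
     using vf_comp[OF j u p smooth_real_deriv[OF Suc.prems J'(1)]] vf_comp[OF j v p smooth_real_deriv[OF Suc.prems J'(2)]]
     by (simp add: algebra_simps)
   qed
   hence "N m (vf j (%p. h (u p) - h (v p))) = N m (%p. h' (u p) * (vf j u p - vf j v p) + (h' (u p) - h' (v p)) * vf j v p)"
    by (rule N_cong)
   also have "... <= N m (%p. h' (u p) * (vf j u p - vf j v p)) + N m (%p. (h' (u p) - h' (v p)) * vf j v p)"
    by (intro N_add SF_mult SF_diff' hS h' sj)
   also have "... <= K * Z * ?D + K * L' * B' * ?D"
   proof (rule add_mono)
    have "N m (%p. h' (u p)) <= N m (%p. h' (u p) - h' a) + N m (%p. h' a)"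
     using N_add[OF SF_diff'[OF hS(1)[OF h'] SF_const] SF_const, of m "h' a" "h' a"] by simp
    moreover have "N m (%p. h' (u p) - h' a) <= L' * N m (%p. u p - a)" by (rule L'(2)[OF u aS _ nB(1) B'(2)]) (use uv in force)
    moreover have "L' * N m (%p. u p - a) <= L' * (B' + B')"
     using N_diff[OF u aS, of m] nB(1) B'(2) L'(1) by (intro mult_left_mono) auto
    ultimately have hz: "N m (%p. h' (u p)) <= Z" by (simp add: Z_def)
    have "N m (%p. vf j u p - vf j v p) <= ?D"
     using N_vf[OF d j, of m] N_cong[of "vf j (%p. u p - v p)" "%p. vf j u p - vf j v p"] vf_diff[OF j u v] by simp
    with hz have "N m (%p. h' (u p)) * N m (%p. vf j u p - vf j v p) <= Z * ?D" by (intro mult_mono N_nonneg SF_diff' sj Z) auto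
    thus "N m (%p. h' (u p) * (vf j u p - vf j v p)) <= K * Z * ?D"
     using order_trans[OF K(2)[OF hS(1)[OF h'] SF_diff'[OF sj]] ] K(1) by (simp add: mult.assoc mult_left_mono)
    have "N m (%p. h' (u p) - h' (v p)) <= L' * ?D"
     using L'(2)[OF u v _ nB] uv mult_left_mono[OF N_mono[OF d] L'(1)] by (meson order_trans)
    moreover have "N m (vf j v) <= B'" using N_vf[OF v j, of m] n(2) B'(1) by simp
    ultimately have "N m (%p. h' (u p) - h' (v p)) * N m (vf j v) <= (L' * ?D) * B'"
     using L'(1) D by (intro mult_mono N_nonneg sj) auto
    from mult_left_mono[OF this K(1)] K(2)[OF SF_diff'[OF hS[OF h']] sj(2)]
    have "N m (%p. (h' (u p) - h' (v p)) * vf j v p) <= K * ((L' * ?D) * B')" by (simp only: mult.assoc)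
    thus "N m (%p. (h' (u p) - h' (v p)) * vf j v p) <= K * L' * B' * ?D" by (simp only: mult_ac)
   qed
   finally show ?thesis by (simp add: Y_def distrib_right)
  qed
  hence "(SUM j:vfs. N m (vf j (%p. h (u p) - h (v p)))) <= (SUM j:vfs. Y * ?D)" by (rule sum_mono)
  with 0 show ?thesis by (simp add: N_Suc[of m "%p. h (u p) - h (v p)"] algebra_simps)
 qed
 moreover have "L + real (card vfs) * Y >= 0" using L(1) Y by simp
 ultimately show ?case by blast
qed

lemma SF_lipschitz:
 assumes i: "(c, a, r) \<in> cells" and f: "f \<in> SF" and xy: "x \<in> ball a (2 * r)" "y \<in> ball a (2 * r)"
 shows "\<bar>f (ci c x) - f (ci c y)\<bar> <= real CARD('n) * N 1 f * norm (x - y)"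
proof -
 note ci = cells(2)[OF i]
 have v: "((c, a, r), l) \<in> vfs" for l using i by (simp add: vfs_def)
 have d: "((%x. f (ci c x)) has_derivative (%w. SU j. w $ j * vf ((c, a, r), j) f (ci c z))) (at z within ball a (2 * r))"
  and M: "ci c z \<in> M" if z: "z \<in> ball a (2 * r)" for z
 proof -
  have zi: "z \<in> im c" "z \<in> cball a (2 * r)" using z cell_ball(3)[OF ci, of "2 * r"] cell_ball(2)[OF ci] by auto
  show "ci c z \<in> M" using zi cell_ball(1)[OF ci] by simp
  have df: "(%x. f (ci c x)) differentiable (at z)" by (rule SF_diff[OF f cell_ball(1)[OF ci] zi(1)])
  have "dd w (%x. f (ci c x)) z = (SU j. w $ j * vf ((c, a, r), j) f (ci c z))" for w
   unfolding dd_axis[OF df, of w] using vf_core[OF v f zi(2)] by simp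
  thus "((%x. f (ci c x)) has_derivative (%w. SU j. w $ j * vf ((c, a, r), j) f (ci c z))) (at z within ball a (2 * r))"
   using has_derivative_at_withinI[OF dd_works[OF df]] by simp
 qed
 have "norm (f (ci c x) - f (ci c y)) <= real CARD('n) * N 1 f * norm (x - y)"
 proof (rule differentiable_bound[OF convex_ball d _ xy])
  fix z assume z: "z \<in> ball a (2 * r)"
  show "onorm (%w. SU j. w $ j * vf ((c, a, r), j) f (ci c z)) <= real CARD('n) * N 1 f"
  proof (rule onorm_le)
   fix w :: "real ^ 'n"
   have "\<bar>w $ j * vf ((c, a, r), j) f (ci c z)\<bar> <= norm w * N 1 f" for j
    using order_trans[OF N0_ge[OF vf_SF[OF v f] M[OF z]] N_vf[OF f v]] unfolding abs_mult
    by (intro mult_mono component_le_norm_cart) auto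
   hence "norm (SU j. w $ j * vf ((c, a, r), j) f (ci c z)) <= (SUM j:(UNIV :: 'n set). norm w * N 1 f)"
    unfolding real_norm_def by (intro order_trans[OF sum_abs] sum_mono)
   thus "norm (SU j. w $ j * vf ((c, a, r), j) f (ci c z)) <= real CARD('n) * N 1 f * norm w" by (simp add: mult_ac)
  qed
 qed
 thus ?thesis by simp
qed

text \<open>Dini's argument: the first-order bound makes the sequence equi-Lipschitz in every cell,
  so closeness to the pointwise limit at one point spreads to a neighbourhood, and compactness
  finishes. Monotonicity makes the whole sequence converge, with no passage to subsequences.\<close>

lemma decreasing_Cauchy:
 assumes v: "!!n. v n \<in> SF" and dec: "!!n p. p \<in> M ==> v (Suc n) p <= v n p" and lb: "!!n p. p \<in> M ==> v n p >= b"
  and N1: "!!n. N 1 (v n) <= B" and e: "e > 0"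
 shows "EX n0. ALL n>=n0. ALL k>=n0. dN 0 (v n) (v k) < e"
proof -
 have ds: "v k p <= v n p" if "p \<in> M" "n <= k" for p n k using lift_Suc_antimono_le[of "%n. v n p"] dec that by blast
 have "EX W n0. openin X W & p \<in> W & (ALL q:W. ALL n>=n0. ALL k. v n q - v k q <= e / 2)" if p: "p \<in> M" for p
 proof -
  obtain c a r where i: "(c, a, r) \<in> cells" "p \<in> core (c, a, r)" using cells(3) p by auto
  note ci = cells(2)[OF i(1)]
  obtain x where x: "x \<in> ball a r" "p = ci c x" using i(2) by (auto simp: core_def)
  define K where "K = real CARD('n) * \<bar>B\<bar> + 1"
  have K: "K > 0" by (simp add: K_def add_nonneg_pos)
  \<comment> \<open>Two Lipschitz errors of e/8 and one pointwise error of e/8 stay below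
    e/2.\<close>
  define \<delta> where "\<delta> = min r (e / (8 * K))"
  have \<delta>: "\<delta> > 0" "\<delta> <= r" "K * \<delta> <= e / 8" using K e cell_ball(2)[OF ci] by (auto simp: \<delta>_def min_def field_simps)
  have bs: "ball x \<delta> \<subseteq> ball a (2 * r)"
  proof
   fix y assume "y \<in> ball x \<delta>"
   thus "y \<in> ball a (2 * r)" using x(1) \<delta>(2) dist_triangle[of a y x] by simp
  qed
  have bi: "ball x \<delta> \<subseteq> im c" using bs cell_ball(3)[OF ci, of "2 * r"] cell_ball(2)[OF ci] ball_subset_cball by fastforce
  have L: "\<bar>v n q - v n p\<bar> <= e / 8" if q: "q \<in> ci c ` ball x \<delta>" for n q
  proof -
   obtain y where y: "y \<in> ball x \<delta>" "q = ci c y" using q by blast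
   have xx: "x \<in> ball a (2 * r)" using bs \<delta>(1) by (meson centre_in_ball subsetD)
   have "\<bar>v n q - v n p\<bar> <= real CARD('n) * N 1 (v n) * norm (y - x)"
    unfolding y(2) x(2) by (rule SF_lipschitz[OF i(1) v subsetD[OF bs y(1)] xx])
   also have "... <= K * \<delta>"
   proof (rule mult_mono)
    have "real CARD('n) * N 1 (v n) <= real CARD('n) * \<bar>B\<bar>" using N1[of n] by (intro mult_left_mono) auto
    thus "real CARD('n) * N 1 (v n) <= K" unfolding K_def by linarith
   qed (use y(1) K in "auto simp: dist_norm norm_minus_commute")
   finally show ?thesis using \<delta>(3) by simp
  qed
  have bb: "bdd_below (range (%n. v n p))" by (rule bdd_belowI2[of _ b]) (rule lb[OF p])
  have "(%n. v n p) \<longlonglongrightarrow> (INF n. v n p)"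
   by (rule LIMSEQ_decseq_INF[OF bb]) (use ds[OF p] in "auto simp: decseq_def")
  from LIMSEQ_D[OF this, of "e / 8"] e obtain n0 where n0: "!!n. n >= n0 ==> norm (v n p - (INF n. v n p)) < e / 8" by auto
  have "v n q - v k q <= e / 2" if q: "q \<in> ci c ` ball x \<delta>" and n: "n >= n0" for q n k
  proof -
   have "(INF n. v n p) <= v k p" by (rule cINF_lower[OF bb]) simp
   thus ?thesis using L[OF q, of n] L[OF q, of k] n0[OF n] e unfolding real_norm_def by linarith
  qed
  moreover have "openin X (ci c ` ball x \<delta>)" by (rule openin_inv_image[OF cell_ball(1)[OF ci] open_ball bi])
  moreover have "p \<in> ci c ` ball x \<delta>" using \<delta>(1) by (simp add: x(2))
  ultimately show ?thesis by blast
 qed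
 then obtain W n0 where W: "!!p. p \<in> M ==> openin X (W p)" "!!p. p \<in> M ==> p \<in> W p"
  "!!p q n k. p \<in> M ==> q \<in> W p ==> n >= n0 p ==> v n q - v k q <= e / 2" by metis
 have cm: "compactin X M" using closed_mfd by (auto simp: closed_manifold_def compact_space_def)
 have "EX F. finite F & F \<subseteq> W ` M & M \<subseteq> \<Union> F"
  by (rule conjunct2[OF cm[unfolded compactin_def], rule_format]) (use W in auto)
 then obtain P where P: "finite P" "P \<subseteq> M" "M \<subseteq> \<Union> (W ` P)" by (metis finite_subset_image)
 define m where "m = (SUM p:P. n0 p)"
 have "v n q - v k q <= e / 2" if q: "q \<in> M" and n: "n >= m" for q n k
 proof -
  obtain p where p: "p \<in> P" "q \<in> W p" using P(3) q by blast
  have "n0 p <= m" unfolding m_def by (rule member_le_sum) (use p P(1) in auto)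
  thus ?thesis using W(3)[of p q n k] p P(2) n by auto
 qed
 note vv = this
 have "dN 0 (v n) (v k) < e" if "n >= m" "k >= m" for n k
 proof -
  have "dN 0 (v n) (v k) <= e / 2"
  proof (rule N0_le)
   show "\<bar>v n p - v k p\<bar> <= e / 2" if "p \<in> M" for p
    using vv[OF that \<open>n >= m\<close>, of k] vv[OF that \<open>k >= m\<close>, of n] by linarith
  qed (use e in simp)
  thus ?thesis using e by simp
 qed
 thus ?thesis by blast
qed

end

context rmfd
begin

text \<open>Besides the solution the conclusion exports the iterates: they are supersolutions
  strictly above \<open>w\<close> even where the limit may touch \<open>w\<close>. With w = 0 this
  provides the positive functions for Picone's inequality while the limit might still
  vanish.\<close>

lemma monotone_iteration:
 assumes J: "open J" "{m..C} \<subseteq> J" and h: "smooth_on J h" and V: "V \<in> SF"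
  and w: "w \<in> SF" "!!p. p \<in> M ==> m <= w p" "!!p. p \<in> M ==> w p + 1 <= C"
  and sub: "!!p. p \<in> M ==> - lapM w p + V p * w p + h (w p) <= 0"
  and super: "!!p. p \<in> M ==> V p * C + h C >= 0"
 shows "EX (v :: nat => 'a => real) u. u \<in> SF & (ALL p:M. w p <= u p & u p <= C & - lapM u p + V p * u p + h (u p) = 0) &
  (ALL n. v n \<in> SF & (ALL p:M. w p < v n p & v n p <= C & - lapM (v n) p + V p * v n p + h (v n p) >= 0)) &
  (ALL e>0. EX n. ALL p:M. \<bar>v n p - u p\<bar> <= e)"
proof (cases "M = {}")
 case True
 thus ?thesis using w(1) by auto
next
 case False
 then obtain p0 where "p0 \<in> M" by blast
 hence mC: "m <= C" using w(2,3)[of p0] by simp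
 obtain H where H: "H >= 0" "!!s t. s \<in> {m..C} ==> t \<in> {m..C} ==> \<bar>h s - h t\<bar> <= H * \<bar>s - t\<bar>"
  using smooth_lipschitz[OF h J(2)] by blast
 obtain W where W: "W > 0" "!!p. p \<in> M ==> \<bar>V p\<bar> <= W" by (rule SF_bounded[OF V], rule that)
 obtain ka0 where ka0: "ka0 > 0" "!!ka. ka >= ka0 ==> EX R. (ALL f:SF. R f \<in> SF & (ALL p:M. ka * R f p - lapM (R f) p = f p)) &
   (ALL m. EX C>=0. ALL f:SF. N (Suc m) (R f) <= C * N m f)" using resolvent_exists by auto
 \<comment> \<open>Large enough for the resolvent, and so large that the right-hand side
   \<open>F\<close> increases with slope at least 1; the extra 1 carries strict inequalities through
   the iteration.\<close>
 define ka where "ka = max ka0 (W + H + 1)"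
 have ka: "ka > 0" "ka >= ka0" "ka >= W + H + 1" using ka0(1) by (auto simp: ka_def)
 obtain R where R: "!!f. f \<in> SF ==> R f \<in> SF" "!!f p. f \<in> SF ==> p \<in> M ==> ka * R f p - lapM (R f) p = f p"
  "!!m. EX C>=0. ALL f:SF. N (Suc m) (R f) <= C * N m f" using ka0(2)[OF ka(2)] by auto
 define F where "F u p = ka * u p - V p * u p - h (u p)" for u p
 define ok where "ok u \<longleftrightarrow> u \<in> SF & (ALL p:M. u p \<in> {m..C})" for u
 have F: "F u \<in> SF" if "ok u" for u unfolding F_def[abs_def] using that J(2)
  by (intro SF_diff' SF_cmult SF_mult V SF_comp[OF _ J(1) h]) (auto simp: ok_def)
 have Fmono: "F s p - F t p >= s p - t p" if "ok s" "ok t" "p \<in> M" "t p <= s p" for s t p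
 proof -
  have "h (s p) - h (t p) <= H * (s p - t p)" using H(2)[of "s p" "t p"] that by (auto simp: ok_def)
  moreover have "V p * (s p - t p) <= W * (s p - t p)" using W(2)[OF that(3)] that(4) by (intro mult_right_mono) auto
  moreover have "(W + H + 1) * (s p - t p) <= ka * (s p - t p)" using ka(3) that(4) by (intro mult_right_mono) auto
  ultimately show ?thesis by (simp add: F_def algebra_simps)
 qed
 have cmp: "ka * (s p - t p) >= b"
  if "s \<in> SF" "t \<in> SF" "!!p. p \<in> M ==> (ka * s p - lapM s p) - (ka * t p - lapM t p) >= b" "p \<in> M" for s t b p
 proof (rule max_principle[OF SF_diff'[OF that(1,2)] ka(1) _ that(4)])
  fix p assume p: "p \<in> M"
  show "ka * (s p - t p) - lapM (%p. s p - t p) p >= b"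
   using that(3)[OF p] unfolding lapM_diff[OF that(1,2) p] right_diff_distrib by linarith
 qed
 have Cs: "(%p. C) \<in> SF" by (rule SF_const)
 have okw: "ok w" using w by (fastforce simp: ok_def)
 have okC: "ok (%p. C)" using mC Cs by (simp add: ok_def)
 define v where "v = rec_nat (%p. C) (%_ u. R (F u))"
 have v0: "v 0 = (%p. C)" and vS: "v (Suc n) = R (F (v n))" for n by (simp_all add: v_def)
 \<comment> \<open>A gap \<delta> above \<open>w\<close> becomes a gap \<delta> / ka after one step.
   It is not uniform in n, so only weak inequality survives in the limit.\<close>
 have inv: "v n \<in> SF & (\<exists>\<delta>>0. ALL p:M. w p + \<delta> <= v n p) & (ALL p:M. v n p <= C)" for n
 proof (induction n)
  case 0
  show ?case using Cs w(3) by (auto simp: v0 intro!: exI[of _ 1])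
 next
  case (Suc n)
  then obtain \<delta> where \<delta>: "\<delta> > 0" "!!p. p \<in> M ==> w p + \<delta> <= v n p" by blast
  have okn: "ok (v n)" using Suc w(2) \<delta> by (fastforce simp: ok_def)
  have S: "v (Suc n) \<in> SF" unfolding vS by (rule R(1)[OF F[OF okn]])
  have e: "ka * v (Suc n) p - lapM (v (Suc n)) p = F (v n) p" if "p \<in> M" for p unfolding vS by (rule R(2)[OF F[OF okn] that])
  have "ka * (v (Suc n) p - w p) >= \<delta>" if p: "p \<in> M" for p
  proof (rule cmp[OF S w(1) _ p])
   fix p assume p: "p \<in> M"
   have "F (v n) p - F w p >= v n p - w p" by (rule Fmono[OF okn okw p]) (use \<delta>(1) \<delta>(2)[OF p] in simp)
   moreover have "ka * w p - lapM w p <= F w p" using sub[OF p] by (simp add: F_def)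
   ultimately show "ka * v (Suc n) p - lapM (v (Suc n)) p - (ka * w p - lapM w p) >= \<delta>"
    using \<delta>(2)[OF p] e[OF p] by linarith
  qed
  hence "w p + \<delta> / ka <= v (Suc n) p" if "p \<in> M" for p using that ka(1) by (simp add: field_simps)
  moreover have "ka * (C - v (Suc n) p) >= 0" if p: "p \<in> M" for p
  proof (rule cmp[OF Cs S _ p])
   fix p assume p: "p \<in> M"
   have "F (%p. C) p - F (v n) p >= C - v n p" by (rule Fmono[OF okC okn p]) (use Suc p in simp)
   moreover have "F (%p. C) p <= ka * C" using super[OF p] by (simp add: F_def)
   ultimately show "ka * C - lapM (%p. C) p - (ka * v (Suc n) p - lapM (v (Suc n)) p) >= 0"
    using e[OF p] lapM_const[OF p, of C] Suc p by fastforce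
  qed
  hence "v (Suc n) p <= C" if "p \<in> M" for p using that ka(1) by (simp add: zero_le_mult_iff)
  ultimately show ?case using S \<delta>(1) ka(1) by (meson divide_pos_pos)
 qed
 have vSF: "v n \<in> SF" and vw: "p \<in> M ==> w p < v n p" and vC: "p \<in> M ==> v n p <= C" for n p
  using inv[of n] by fastforce+
 have okn: "ok (v n)" for n
 proof -
  have "m <= v n p" if "p \<in> M" for p using w(2)[OF that] vw[OF that, of n] by linarith
  thus ?thesis using vSF vC by (auto simp: ok_def)
 qed
 have e: "ka * v (Suc n) p - lapM (v (Suc n)) p = F (v n) p" if "p \<in> M" for p n unfolding vS by (rule R(2)[OF F[OF okn] that])
 have dec: "p \<in> M ==> v (Suc n) p <= v n p" for n p
 proof (induction n arbitrary: p)
  case 0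
  thus ?case using vC[of p 1] by (simp add: v0)
 next
  case (Suc n)
  have "ka * (v (Suc n) p - v (Suc (Suc n)) p) >= 0"
  proof (rule cmp[OF vSF vSF _ Suc.prems])
   fix p assume p: "p \<in> M"
   show "ka * v (Suc n) p - lapM (v (Suc n)) p - (ka * v (Suc (Suc n)) p - lapM (v (Suc (Suc n))) p) >= 0"
    using Fmono[OF okn okn p Suc.IH[OF p]] Suc.IH[OF p] by (simp add: e[OF p])
  qed
  thus ?case using ka(1) by (simp add: zero_le_mult_iff)
 qed
 have sup: "- lapM (v n) p + V p * v n p + h (v n p) >= 0" if p: "p \<in> M" for n p
 proof (cases n)
  case 0
  thus ?thesis using super[OF p] lapM_const[OF p, of C] by (simp add: v0)
 next
  case (Suc k)
  have "F (v k) p - F (v (Suc k)) p >= 0" using Fmono[OF okn[of k] okn[of "Suc k"] p dec[OF p]] dec[OF p, of k] by linarith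
  thus ?thesis using e[OF p, of k] by (simp add: Suc F_def)
 qed
 have lip: "EX L>=0. ALL n k. N m' (v n) <= B --> N m' (v k) <= B --> N m' (%p. F (v n) p - F (v k) p) <= L * dN m' (v n) (v k)" for m' B
 proof -
  from comp_lip[OF J h, of m' B] obtain L where L1: "L >= 0" and L2: "ALL u:SF. ALL v:SF. (ALL p:M. u p \<in> {m..C} & v p \<in> {m..C}) --> N m' u <= B --> N m' v <= B -->
   N m' (%p. h (u p) - h (v p)) <= L * dN m' u v" by (elim exE conjE) (rule that)
  have kV: "(%p. ka - V p) \<in> SF" by (intro SF_diff' SF_const V)
  obtain K where K: "K >= 0" "!!f. f \<in> SF ==> N m' (%p. (ka - V p) * f p) <= K * N m' f" using N_mult_left[OF kV] by blast
  have in_J: "ALL p:M. v n p \<in> {m..C} & v k p \<in> {m..C}" for n k using okn[of n] okn[of k] unfolding ok_def by blast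
  have "N m' (%p. F (v n) p - F (v k) p) <= (K + L) * dN m' (v n) (v k)" if "N m' (v n) <= B" "N m' (v k) <= B" for n k
  proof -
   note d = SF_diff'[OF vSF[of n] vSF[of k]]
   have hS: "(%p. h (v n p)) \<in> SF" for n by (rule SF_comp[OF vSF J(1) h]) (use okn J(2) in "auto simp: ok_def")
   have "N m' (%p. F (v n) p - F (v k) p) = N m' (%p. (ka - V p) * (v n p - v k p) - (h (v n p) - h (v k p)))"
    by (rule N_cong) (simp add: F_def algebra_simps)
   also have "... <= N m' (%p. (ka - V p) * (v n p - v k p)) + N m' (%p. h (v n p) - h (v k p))"
    by (intro N_diff SF_mult[OF kV d] SF_diff' hS)
   also have "... <= K * dN m' (v n) (v k) + L * dN m' (v n) (v k)"
    by (rule add_mono[OF K(2)[OF d] L2[rule_format, OF vSF vSF in_J[rule_format] that]])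
   finally show ?thesis by (simp add: distrib_right)
  qed
  thus ?thesis using K(1) L1 by (intro exI[of _ "K + L"]) auto
 qed
 \<comment> \<open>Linearity of \<open>R\<close> is not part of its specification; the comparison
   principle gives uniqueness, which identifies the difference of two iterates with \<open>R\<close>
   of the difference of their right-hand sides.\<close>
 have Rd: "dN m' (v (Suc n)) (v (Suc k)) = N m' (R (%p. F (v n) p - F (v k) p))" for m' n k
 proof (rule N_cong)
  fix p assume p: "p \<in> M"
  let ?f = "%p. F (v n) p - F (v k) p" and ?d = "%p. v (Suc n) p - v (Suc k) p"
  have f: "?f \<in> SF" and d: "?d \<in> SF" by (intro SF_diff' F okn vSF)+
  have "ka * ?d p - lapM ?d p = ?f p" if "p \<in> M" for p
   using e[OF that, of n] e[OF that, of k] lapM_diff[OF vSF vSF that] by (simp add: algebra_simps)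
  hence "ka * (?d p - R ?f p) >= 0" "ka * (R ?f p - ?d p) >= 0"
   by (intro cmp[OF d R(1)[OF f] _ p] cmp[OF R(1)[OF f] d _ p]; simp add: R(2)[OF f])+
  thus "?d p = R ?f p" using ka(1) by (simp add: zero_le_mult_iff)
 qed
 have bd: "EX B. ALL n. N m' (v n) <= B" if c: "ALL e>0. EX n0. ALL n>=n0. ALL k>=n0. dN m' (v n) (v k) < e" for m'
 proof -
  obtain n0 where n0: "!!n. n >= n0 ==> dN m' (v n) (v n0) < 1" using c zero_less_one by blast
  define B where "B = (\<Sum>n\<le>n0. N m' (v n)) + 1"
  have s: "N m' (v n) <= (\<Sum>n\<le>n0. N m' (v n))" if "n <= n0" for n
   by (rule member_le_sum) (use that N_nonneg[OF vSF] in auto)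
  have "N m' (v n) <= B" for n
  proof (cases "n <= n0")
   case False
   thus ?thesis using n0[of n] s[of n0] N_add[OF SF_diff'[OF vSF vSF] vSF, of m' n n0 n0] by (simp add: B_def)
  qed (use s in "simp add: B_def add_increasing2")
  thus ?thesis by blast
 qed
 \<comment> \<open>Order 0 follows from monotonicity and the first-order bound that the resolvent
   gains from the sup norm. Each further order is gained from the previous one, since
   \<open>F\<close> is Lipschitz along sequences bounded in that norm.\<close>
 have ca: "ALL e>0. EX n0. ALL n>=n0. ALL k>=n0. dN m' (v n) (v k) < e" for m'
  proof (induction m')
   case 0
   define B where "B = \<bar>m\<bar> + \<bar>C\<bar>"
   have B: "N 0 (v n) <= B" for n by (rule N0_le) (use okn[of n] in "auto simp: ok_def B_def abs_le_iff")
   obtain L where L: "L >= 0" "!!n k. N 0 (%p. F (v n) p - F (v k) p) <= L * dN 0 (v n) (v k)" using lip[of 0 B] B by blast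
   obtain G where G: "G >= 0" "!!f. f \<in> SF ==> N 1 (R f) <= G * N 0 f" using R(3)[of 0] by auto
   define D where "D = N 1 (v 0) + N 1 (v (Suc 0)) + G * (L * (B + B))"
   have "N 1 (v n) <= D" for n
   proof (cases n)
    case 0
    thus ?thesis using N_nonneg[OF vSF, of 1 "Suc 0"] G(1) L(1) by (simp add: D_def B_def)
   next
    case (Suc k)
    have "dN 1 (v (Suc k)) (v (Suc 0)) <= G * (L * (B + B))"
    proof -
     have "N 0 (%p. F (v k) p - F (v 0) p) <= L * (B + B)"
      by (rule order_trans[OF L(2) mult_left_mono[OF order_trans[OF N_diff[OF vSF vSF] add_mono[OF B B]] L(1)]])
     from order_trans[OF G(2)[OF SF_diff'[OF F[OF okn] F[OF okn]]] mult_left_mono[OF this G(1)]] show ?thesis unfolding Rd .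
    qed
    thus ?thesis using N_add[OF SF_diff'[OF vSF vSF] vSF, of 1 "Suc k" "Suc 0" "Suc 0"] N_nonneg[OF vSF, of 1 0] by (simp add: D_def Suc)
   qed
   thus ?case using decreasing_Cauchy[where v = v, OF vSF dec, of m D] okn by (auto simp: ok_def)
  next
   case (Suc m')
   obtain B where B: "!!n. N m' (v n) <= B" using bd[OF Suc] by blast
   obtain L where L: "L >= 0" "!!n k. N m' (%p. F (v n) p - F (v k) p) <= L * dN m' (v n) (v k)" using lip[of m' B] B by blast
   obtain G where G: "G >= 0" "!!f. f \<in> SF ==> N (Suc m') (R f) <= G * N m' f" using R(3)[of m'] by auto
   have le: "dN (Suc m') (v (Suc n)) (v (Suc k)) <= (G * L + 1) * dN m' (v n) (v k)" for n k
    unfolding Rd using order_trans[OF G(2)[OF SF_diff'[OF F[OF okn] F[OF okn]]] mult_left_mono[OF L(2) G(1)]] N_nonneg[OF SF_diff'[OF vSF[of n] vSF[of k]], of m']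
    by (simp add: algebra_simps) (meson add_increasing)
   show ?case
   proof (intro allI impI)
    fix e :: real assume e0: "e > 0"
    have GL: "G * L + 1 > 0" using G(1) L(1) by (simp add: add_nonneg_pos)
    obtain n0 where n0: "!!n k. n >= n0 ==> k >= n0 ==> dN m' (v n) (v k) < e / (G * L + 1)"
     using Suc e0 GL by (metis divide_pos_pos)
    have "dN (Suc m') (v n) (v k) < e" if nk: "n >= Suc n0" "k >= Suc n0" for n k
    proof -
     obtain n' k' where n': "n = Suc n'" "k = Suc k'" using nk by (metis Suc_le_D)
     hence "dN m' (v n') (v k') < e / (G * L + 1)" using n0 nk by simp
     thus ?thesis using le[of n' k'] GL by (simp add: n' pos_less_divide_eq mult.commute)
    qed
    thus "EX n0. ALL n>=n0. ALL k>=n0. dN (Suc m') (v n) (v k) < e" by blast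
   qed
  qed
 have NCv: "NC v" unfolding NC_def using vSF ca by blast
 define u where "u = nl v"
 have u: "u \<in> SF" unfolding u_def by (rule nl_SF[OF NCv])
 have lim: "(%n. v n p) \<longlonglongrightarrow> u p" if "p \<in> M" for p unfolding u_def by (rule NC_lim[OF NCv that])
 have uw: "w p <= u p" "u p <= C" if p: "p \<in> M" for p
  using LIMSEQ_le_const[OF lim[OF p], of "w p"] LIMSEQ_le_const2[OF lim[OF p], of C] vw[OF p] vC[OF p] by (auto intro: less_imp_le)
 have ueq: "- lapM u p + V p * u p + h (u p) = 0" if p: "p \<in> M" for p
 proof -
  have "u p \<in> {m..C}" using uw[OF p] w(2)[OF p] by simp
  hence "isCont h (u p)" using J smooth_cont[OF h] continuous_on_eq_continuous_at by blast
  hence "(%n. F (v n) p) \<longlonglongrightarrow> F u p"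
   unfolding F_def by (intro tendsto_intros lim p isCont_tendsto_compose[of _ h])
  moreover have "(%n. ka * v (Suc n) p - lapM (v (Suc n)) p) \<longlonglongrightarrow> ka * u p - lapM u p"
   using LIMSEQ_Suc[OF lim[OF p]] LIMSEQ_Suc[OF NC_lapM[OF NCv p]] unfolding u_def[symmetric] by (intro tendsto_intros)
  ultimately have "ka * u p - lapM u p = F u p" unfolding e[OF p] using LIMSEQ_unique by blast
  thus ?thesis by (simp add: F_def)
 qed
 have un: "EX n. ALL p:M. \<bar>v n p - u p\<bar> <= e" if "e > 0" for e using NC_unif[OF NCv that] unfolding u_def by blast
 show ?thesis by (rule exI[of _ v], rule exI[of _ u]) (intro conjI ballI allI impI u uw ueq vSF vw vC sup un)
qed

end

section \<open>Existence of a positive solution\<close>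

text \<open>Expand the nonnegative form at f - t w. If \<open>f\<close> and \<open>w\<close> are the
  gradients of functions \<phi> and v, and t = \<phi> / v, then 2 t f - t^2 w is the gradient of
  \<phi>^2 / v.\<close>

lemma picone_algebra:
 fixes f w :: "'n::finite => real"
 assumes s: "!!i j. a i j = a j i" and pos: "!!y :: real ^ 'n. (SU i. SU j. a i j * y $ i * y $ j) >= 0"
 shows "(SU i. SU j. a i j * (2 * t * f i - t\<^sup>2 * w i) * w j) <= (SU i. SU j. a i j * f i * f j)"
proof -
 have sw: "(SU i. SU j. a i j * w i * f j) = (SU i. SU j. a i j * f i * w j)" by (subst sum.swap) (simp add: s mult_ac)
 have "0 <= (SU i. SU j. a i j * (f i - t * w i) * (f j - t * w j))" using pos[of "\<chi> i. f i - t * w i"] by simp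
 also have "... = (SU i. SU j. a i j * f i * f j) - t * (SU i. SU j. a i j * f i * w j)
   - t * (SU i. SU j. a i j * w i * f j) + t\<^sup>2 * (SU i. SU j. a i j * w i * w j)"
  unfolding sum_distrib_left sum_subtractf[symmetric] sum.distrib[symmetric]
  by (intro sum.cong refl) (simp add: algebra_simps power2_eq_square)
 also have "... = (SU i. SU j. a i j * f i * f j) - (SU i. SU j. a i j * (2 * t * f i - t\<^sup>2 * w i) * w j)"
  unfolding sw by (simp add: right_diff_distrib left_diff_distrib sum_subtractf sum_distrib_left sum_negf mult_ac)
 finally show ?thesis by simp
qed

context rmfd
begin

lemma picone:
 assumes f: "f \<in> SF" and v: "v \<in> SF" "!!p. p \<in> M ==> v p > 0" and p: "p \<in> M"
 shows "gM (%p. f p * f p * inverse (v p)) v p <= gM f f p"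
proof -
 define c where "c = chart_at A p"
 define x where "x = chart_map c p"
 have c: "c \<in> A" and x: "x \<in> im c" "ci c x = p" using chart_at[OF p] by (auto simp: c_def x_def)
 note d = SF_diff[OF f c x(1)] SF_diff[OF v(1) c x(1)]
 have v0: "v (ci c x) ~= 0" using v(2)[OF p] x(2) by simp
 have di: "(%x. inverse (v (ci c x))) differentiable (at x)" using d(2) v0 by (rule differentiable_inverse)
 define t where "t = f p * inverse (v p)"
 have "pd c i (%p. f p * f p * inverse (v p)) x = 2 * t * pd c i f x - t\<^sup>2 * pd c i v x" for i
 proof -
  have "dd u (%x. inverse (v (ci c x))) x = - (inverse (v p) * inverse (v p)) * dd u (%x. v (ci c x)) x" for u
   using dd_real_compose[OF d(2) DERIV_inverse'[OF DERIV_ident v0]] x(2) by simp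
  thus ?thesis unfolding pd_def by (simp add: dd_mult d di differentiable_mult x(2) t_def power2_eq_square algebra_simps)
 qed
 moreover have "(SU i. SU j. Am c x $ i $ j * y $ i * y $ j) >= 0" for y :: "real ^ 'n"
  using inverse_metric_pos[OF c x(1), of y] by (cases "y = 0") auto
 ultimately show ?thesis
  using picone_algebra[of "%i j. Am c x $ i $ j" t "%i. pd c i f x" "%i. pd c i v x"] inverse_metric_sym[OF c x(1)]
  by (simp add: gM_def gq_def c_def[symmetric] x_def[symmetric])
qed

text \<open>The supersolution inequality is tested with f^2 / v, integrated by parts and compared by
  Picone's inequality. A positive supersolution thus excludes negative energy for the potential
  \<open>W\<close>.\<close>

lemma supersolution_energy:
 assumes f: "f \<in> SF" and v: "v \<in> SF" "!!p. p \<in> M ==> v p > 0" and W: "W \<in> SF" "!!p. p \<in> M ==> - lapM v p + W p * v p >= 0"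
 shows "(LINT p|vol. gM f f p) >= (LINT p|vol. - (W p * (f p)\<^sup>2))"
proof -
 let ?u = "%p. f p * f p * inverse (v p)"
 have u: "?u \<in> SF" by (intro SF_mult f SF_inverse v(1)) (use v(2) in force)
 have "(LINT p|vol. - (W p * (f p)\<^sup>2)) <= (LINT p|vol. - (?u p * lapM v p))"
 proof (rule integral_mono)
  show "integrable vol (%p. - (W p * (f p)\<^sup>2))" "integrable vol (%p. - (?u p * lapM v p))"
   using integrable_vol[OF SF_mult[OF W(1) SF_mult[OF f f]]] integrable_vol[OF SF_mult[OF u lapM_SF[OF v(1)]]]
   by (simp_all add: power2_eq_square)
  fix p assume "p \<in> space vol"
  hence p: "p \<in> M" by simp
  have "?u p >= 0" using v(2)[OF p] by simp
  from mult_nonneg_nonneg[OF this W(2)[OF p]] have "?u p * (- lapM v p + W p * v p) >= 0" .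
  thus "- (W p * (f p)\<^sup>2) <= - (?u p * lapM v p)" using v(2)[OF p] by (simp add: field_simps power2_eq_square)
 qed
 also have "... = (LINT p|vol. gM ?u v p)" using integration_by_parts[OF u v(1)] by simp
 also have "... <= (LINT p|vol. gM f f p)"
  by (rule integral_mono) (use integrable_vol[OF gM_SF[OF u v(1)]] integrable_vol[OF gM_SF[OF f f]] picone[OF f v] in auto)
 finally show ?thesis .
qed

lemma semilinear_solution:
 assumes V: "V \<in> SF" and q: "q > 0" and \<mu>: "\<mu> > 0"
  and f: "f \<in> SF" "(LINT p|vol. (f p)\<^sup>2) > 0"
  and neg: "(LINT p|vol. gM f f p + V p * (f p)\<^sup>2) <= - 2 * \<mu> * (LINT p|vol. (f p)\<^sup>2)"
 shows "EX u:SF. ALL p:M. u p > 0 & - lapM u p + V p * u p + \<mu> * (u p * u p powr q) = 0"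
proof (cases "M = {}")
 case True
 thus ?thesis using V by blast
next
 case False
 obtain W where W: "W > 0" "!!p. p \<in> M ==> \<bar>V p\<bar> <= W" by (rule SF_bounded[OF V], rule that)
 \<comment> \<open>Beyond this value the nonlinear coefficient dominates the potential
   \<open>V\<close>, so constants above it are supersolutions.\<close>
 define C where "C = max 1 ((W / \<mu>) powr (1 / q))"
 have C: "C >= 1" by (simp add: C_def)
 have Cq: "\<mu> * t powr q >= W" if "t >= C" for t
 proof -
  have "W / \<mu> = ((W / \<mu>) powr (1 / q)) powr q" using W(1) \<mu> q by (simp add: powr_powr)
  also have "... <= t powr q" using that q by (intro powr_mono2) (auto simp: C_def)
  finally show ?thesis using \<mu> by (simp add: field_simps)
 qed
 have up: "V p * t + \<mu> * (t * s powr q) >= 0" if "p \<in> M" "t >= 0" "s >= C" for p s t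
 proof -
  have "t * (V p + \<mu> * s powr q) >= 0" using W(2)[OF that(1)] Cq[OF that(3)] that(2) by (intro mult_nonneg_nonneg) auto
  thus ?thesis by (simp add: algebra_simps)
 qed
 define h where "h t = \<mu> * (t * (1 + t) powr q)" for t
 have h: "smooth_on {-1<..} h" unfolding h_def[abs_def] by (intro smooth_intros) auto
 have h0: "(%p. 0 :: real) \<in> SF" by (rule SF_const)
 have "EX (v :: nat => 'a => real) u. u \<in> SF & (ALL p:M. 0 <= u p & u p <= C & - lapM u p + V p * u p + h (u p) = 0) &
  (ALL n. v n \<in> SF & (ALL p:M. 0 < v n p & v n p <= C & - lapM (v n) p + V p * v n p + h (v n p) >= 0)) &
  (ALL e>0. EX n. ALL p:M. \<bar>v n p - u p\<bar> <= e)" by (rule monotone_iteration[of "{-1<..}" 0 C h V "%p. 0"])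
   (use C h V h0 up[of _ C "1 + C"] in "auto simp: lapM_const h_def")
 then obtain v :: "nat => 'a => real" and u where u: "u \<in> SF" "ALL p:M. 0 <= u p & u p <= C & - lapM u p + V p * u p + h (u p) = 0"
  and v: "ALL n. v n \<in> SF & (ALL p:M. 0 < v n p & v n p <= C & - lapM (v n) p + V p * v n p + h (v n p) >= 0)"
  and lim: "ALL e>0. EX n. ALL p:M. \<bar>v n p - u p\<bar> <= e" by (elim exE conjE) (rule that)
 have nz: "EX p:M. u p ~= 0"
 proof (rule ccontr)
  assume "\<not> ?thesis"
  hence z: "u p = 0" if "p \<in> M" for p using that by blast
  \<comment> \<open>Where v n \<le> e the factor (1 + v n) powr q is at most 3/2. The iterate is
    then a positive supersolution for the potential V + 3/2 \<mu>, against the bound with 2 \<mu> in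
    \<open>neg\<close>.\<close>
  define e where "e = (3 / 2) powr (1 / q) - (1 :: real)"
  have e: "e > 0" "(1 + e) powr q = 3 / 2" using q gr_one_powr[of "3 / 2" "1 / q"] by (auto simp: e_def powr_powr)
  obtain n where n: "!!p. p \<in> M ==> \<bar>v n p - u p\<bar> <= e" using lim e(1) by blast
  have vn: "v n \<in> SF" "!!p. p \<in> M ==> v n p > 0" using v by auto
  have VW: "(%p. V p + 3 / 2 * \<mu>) \<in> SF" by (intro SF_add V SF_const)
  have "- lapM (v n) p + (V p + 3 / 2 * \<mu>) * v n p >= 0" if p: "p \<in> M" for p
  proof -
   have "(1 + v n p) powr q <= 3 / 2" unfolding e(2)[symmetric] using n[OF p] z[OF p] vn(2)[OF p] q by (intro powr_mono2) auto
   hence "h (v n p) <= \<mu> * (v n p * (3 / 2))" unfolding h_def using \<mu> vn(2)[OF p] by (intro mult_left_mono) auto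
   moreover have "- lapM (v n) p + V p * v n p + h (v n p) >= 0" using v p by blast
   ultimately show ?thesis by (simp add: algebra_simps)
  qed
  from supersolution_energy[OF f(1) vn VW this]
  have 1: "(LINT p|vol. gM f f p) >= (LINT p|vol. - ((V p + 3 / 2 * \<mu>) * (f p)\<^sup>2))" .
  have f2: "(%p. (f p)\<^sup>2) \<in> SF" using SF_mult[OF f(1) f(1)] by (simp add: power2_eq_square)
  note int = integrable_vol[OF gM_SF[OF f(1) f(1)]] integrable_vol[OF f2] integrable_vol[OF SF_mult[OF V f2]]
  have "(LINT p|vol. - ((V p + 3 / 2 * \<mu>) * (f p)\<^sup>2)) = - (LINT p|vol. V p * (f p)\<^sup>2) - 3 / 2 * \<mu> * (LINT p|vol. (f p)\<^sup>2)"
   using int by (simp add: distrib_right)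
  moreover have "(LINT p|vol. gM f f p + V p * (f p)\<^sup>2) = (LINT p|vol. gM f f p) + (LINT p|vol. V p * (f p)\<^sup>2)"
   using int by simp
  ultimately have "2 * (\<mu> * (LINT p|vol. (f p)\<^sup>2)) <= 3 / 2 * (\<mu> * (LINT p|vol. (f p)\<^sup>2))" using 1 neg by simp
  moreover have "\<mu> * (LINT p|vol. (f p)\<^sup>2) > 0" using \<mu> f(2) by simp
  ultimately show False by simp
 qed
 have upos: "u p > 0" if p: "p \<in> M" for p
 proof (rule ccontr)
  assume "\<not> u p > 0"
  hence up0: "u p = 0" using u(2) p by force
  \<comment> \<open>Bounds the coefficient V + \<mu> (1 + u) powr q, which puts the equation into
    the linear form of the strong maximum principle.\<close>
  let ?k = "W + \<mu> * (1 + C) powr q"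
  have k: "?k >= 0" using W(1) \<mu> by simp
  have "lapM u x <= ?k * u x" if x: "x \<in> M" for x
  proof -
   have ux: "0 <= u x" "u x <= C" "lapM u x = V x * u x + h (u x)" using u(2) x by auto
   have "V x * u x <= W * u x" using W(2)[OF x] ux(1) by (intro mult_right_mono) auto
   moreover have "h (u x) <= \<mu> * (u x * (1 + C) powr q)" unfolding h_def
    using ux \<mu> q by (intro mult_left_mono powr_mono2) auto
   ultimately show ?thesis unfolding ux(3) by (simp add: algebra_simps)
  qed
  hence "u x = 0" if "x \<in> M" for x using strong_max_principle[OF u(1) _ _ k p up0 that] u(2) by blast
  thus False using nz by blast
 qed
 \<comment> \<open>The positive minimum of \<open>u\<close> bounds the second iteration away from 0,
   where t powr q need not be smooth.\<close>
 obtain p0 where p0: "p0 \<in> M" "!!p. p \<in> M ==> u p0 <= u p" using SF_attains_min[OF u(1) False] by blast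
 define h2 where "h2 t = \<mu> * (t * t powr q)" for t
 have h2: "smooth_on {0<..} h2" unfolding h2_def[abs_def] by (intro smooth_intros) auto
 have "EX (v :: nat => 'a => real) y. y \<in> SF & (ALL p:M. u p <= y p & y p <= C + 1 & - lapM y p + V p * y p + h2 (y p) = 0) &
  (ALL n. v n \<in> SF & (ALL p:M. u p < v n p & v n p <= C + 1 & - lapM (v n) p + V p * v n p + h2 (v n p) >= 0)) &
  (ALL e>0. EX n. ALL p:M. \<bar>v n p - y p\<bar> <= e)"
 \<comment> \<open>The upper constant is C + 1 because a gap of 1 above \<open>u\<close> is
   required.\<close>
 proof (rule monotone_iteration[of "{0<..}" "u p0" "C + 1" h2 V u])
  fix p assume p: "p \<in> M"
  have "h2 (u p) <= h (u p)" unfolding h_def h2_def using upos[OF p] \<mu> q by (intro mult_left_mono powr_mono2) auto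
  thus "- lapM u p + V p * u p + h2 (u p) <= 0" using u(2) p by fastforce
  show "V p * (C + 1) + h2 (C + 1) >= 0" unfolding h2_def by (rule up[OF p]) (use C in auto)
 qed (use h2 V u p0 upos[OF p0(1)] in "auto intro: less_le_trans")
 then obtain y where "y \<in> SF" "ALL p:M. u p <= y p & y p <= C + 1 & - lapM y p + V p * y p + h2 (y p) = 0" by (elim exE conjE) (rule that)
 thus ?thesis using upos unfolding h2_def by (intro bexI[of _ y] ballI conjI) (auto intro: less_le_trans)
qed

end

section \<open>Reduction of the geometric equation to the semilinear one\<close>

theorem theorem4p3:
  fixes X :: "'a topology"
    and A :: "('a, 'n::finite) chart set"
    and g :: "'a metric_tensor"
  assumes "closed_manifold X A"
    and "riemannian_metric X A g"
    and "CARD('n) \<ge> 3"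
    and "\<exists>p\<in>topspace X. scalar_curvature A g p < 0"
    and "conformal_eigenvalue X A g < 0"
  shows "\<exists>lam<0. \<forall>\<beta>\<le>0. \<exists>u\<in>smooth_functions A.
           (\<forall>p\<in>topspace X. u p > 0) \<and>
           (\<forall>p\<in>topspace X.
              - yamabe_a CARD('n) * laplace_beltrami A g u p + (scalar_curvature A g p + \<beta>) * u p
              = lam * u p powr (yamabe_p CARD('n) - 1))"
proof -
 interpret rmfd X A g using assms(1,2) by unfold_locales
 let ?S = "scalar_curvature A g"
 define a where "a = yamabe_a CARD('n)"
 \<comment> \<open>This exponent writes the power p - 1 of \<open>u\<close> as u times u powr q,
   with q = 4 / (n - 2) > 0.\<close>
 define q where "q = yamabe_p CARD('n) - 2"
 have a: "a > 0" using assms(3) by (simp add: a_def yamabe_a_def)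
 have q: "q > 0" using assms(3) by (simp add: q_def yamabe_p_def field_simps)
 let ?I = "%f. \<integral>p. a * grad_norm_sq A g f p + ?S p * (f p)\<^sup>2 \<partial>vol" and ?D = "%f. \<integral>p. (f p)\<^sup>2 \<partial>vol"
 let ?T = "{f \<in> SF. EX p:M. f p ~= 0}"
 have "(%p. 1) \<in> ?T" using assms(4) SF_const by auto
 hence ne: "?T ~= {}" by blast
 have "EX f:?T. ?I f / ?D f < 0"
 proof (rule ccontr)
  assume "\<not> ?thesis"
  hence "0 <= (INF f\<in>?T. ?I f / ?D f)" by (intro cINF_greatest[OF ne]) force
  thus False using assms(5) by (simp add: conformal_eigenvalue_def a_def)
 qed
 then obtain f where f: "f \<in> SF" "?I f / ?D f < 0" by blast
 have "?D f >= 0" by (intro Bochner_Integration.integral_nonneg) simp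
 \<comment> \<open>Division by 0 gives 0, so a negative quotient already excludes a zero
   denominator.\<close>
 moreover have "?D f ~= 0" using f(2) by auto
 ultimately have D: "?D f > 0" by linarith
 define \<mu> where "\<mu> = - (?I f / ?D f) / 2"
 have \<mu>: "\<mu> > 0" using f(2) by (simp add: \<mu>_def)
 have I: "?I f = - 2 * \<mu> * ?D f" using D by (simp add: \<mu>_def)
 have f2: "(%p. (f p)\<^sup>2) \<in> SF" using SF_mult[OF f(1) f(1)] by (simp add: power2_eq_square)
 have "EX u:SF. (ALL p:M. u p > 0) & (ALL p:M. - a * laplace_beltrami A g u p + (?S p + \<beta>) * u p = - \<mu> * u p powr (yamabe_p CARD('n) - 1))"
  if \<beta>: "\<beta> <= 0" for \<beta>
 proof -
  \<comment> \<open>The equation is divided by \<open>a\<close>, so the constant becomes \<mu> / a.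
    The parameter \<beta> sits in the potential only, and the same \<open>f\<close> serves every
    \<beta> \<le> 0.\<close>
  define V where "V p = (1 / a) * (?S p + \<beta>)" for p
  have V: "V \<in> SF" unfolding V_def[abs_def] by (intro SF_cmult SF_add scalar_curvature_SF SF_const)
  have "(LINT p|vol. gM f f p + V p * (f p)\<^sup>2) <= (LINT p|vol. (1 / a) * (a * grad_norm_sq A g f p + ?S p * (f p)\<^sup>2))"
  proof (rule integral_mono)
   have "integrable vol (%p. (1 / a) * (a * gM f f p + ?S p * (f p)\<^sup>2))"
    by (intro integrable_vol SF_cmult SF_add SF_mult gM_SF f(1) scalar_curvature_SF f2)
   thus "integrable vol (%p. (1 / a) * (a * grad_norm_sq A g f p + ?S p * (f p)\<^sup>2))"
    by (rule iffD1[OF Bochner_Integration.integrable_cong[OF refl], rotated]) (simp add: grad_norm_sq_eq[OF f(1)])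
   show "integrable vol (%p. gM f f p + V p * (f p)\<^sup>2)" by (intro integrable_vol SF_add SF_mult gM_SF f(1) V f2)
   fix p assume "p \<in> space vol"
   hence p: "p \<in> M" by simp
   have "(1 / a) * (\<beta> * (f p)\<^sup>2) <= 0" using \<beta> a by (intro mult_nonneg_nonpos mult_nonpos_nonneg[of \<beta>]) auto
   moreover have "gM f f p + V p * (f p)\<^sup>2 = (1 / a) * (a * gM f f p + ?S p * (f p)\<^sup>2) + (1 / a) * (\<beta> * (f p)\<^sup>2)"
    using a by (simp add: V_def field_simps)
   ultimately show "gM f f p + V p * (f p)\<^sup>2 <= (1 / a) * (a * grad_norm_sq A g f p + ?S p * (f p)\<^sup>2)"
    unfolding grad_norm_sq_eq[OF f(1) p] by linarith
  qed
  also have "... = - 2 * (\<mu> / a) * ?D f" using I by simp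
  finally obtain u where u: "u \<in> SF" "ALL p:M. u p > 0 & - lapM u p + V p * u p + \<mu> / a * (u p * u p powr q) = 0"
   using semilinear_solution[OF V q _ f(1) D, of "\<mu> / a"] \<mu> a by auto
  have "- a * laplace_beltrami A g u p + (?S p + \<beta>) * u p = - \<mu> * u p powr (yamabe_p CARD('n) - 1)" if p: "p \<in> M" for p
  proof -
   have up: "u p > 0" and eq: "- lapM u p + V p * u p + \<mu> / a * (u p * u p powr q) = 0" using u(2) p by auto
   have "yamabe_p CARD('n) - 1 = 1 + q" by (simp add: q_def)
   hence pw: "u p powr (yamabe_p CARD('n) - 1) = u p * u p powr q" using up by (simp add: powr_add)
   have "a * (- lapM u p + V p * u p + \<mu> / a * (u p * u p powr q)) = 0" using eq by simp
   thus ?thesis unfolding laplace_beltrami_eq[OF u(1) p] pw using a by (simp add: V_def algebra_simps)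
  qed
  thus ?thesis using u by blast
 qed
 thus ?thesis using \<mu> by (intro exI[of _ "- \<mu>"]) (auto simp: a_def)
qed

end
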